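(* There is a natural, $\mathrm{Aut}(\mathbb P)$-covariant field on $\mathbb P$, assigning to each $z\in\mathbb P$ and each meromorphic map $\nu:\mathbb P\to\mathbf g$ regular at $z$ a linear map $$j^{\nu(z)}(z):\mathcal V^z\to\mathcal V\otimes K_z$$ which, for every choice of point $P\ne z$, restricts on $\mathcal V^z_P$ to $\epsilon^{\nu(z)}(z)+\iota^{\nu(z)}(z)$ (defined using $P$). For $v_1,v_2\in\mathbf g$ it satisfies, as $z_2\to z_1$, $$\begin{aligned} j^{v_2}(z_2)j^{v_1}(z_1)&-\frac{(v_1,v_2)\,du_{z_1}du_{z_2}}{(u(z_1)-u(z_2))^2}-\frac{1}{u(z_2)-u(z_1)}\,du_{z_2}\,j^{[v_2,v_1]}(z_1)\\ &\longrightarrow\ \iota^{v_2}(z_1)\iota^{v_1}(z_1)+\epsilon^{v_2}(z_1)\epsilon^{v_1}(z_1)+\epsilon^{v_2}(z_1)\iota^{v_1}(z_1)+\epsilon^{v_1}(z_1)\iota^{v_2}(z_1)+\frac{d\hat\iota^{[v_2,v_1]}}{du}(z_1)\,du_{z_1}^2 ,\end{aligned}$$ where the limit can be calculated with respect to any choice of point at infinity $P\ne z_1$ and coordinate $u$ with pole at $P$, and is independent of this choice of $P$.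
   Context: $\mathbb P$ is a complex projective line with canonical bundle $K$; a coordinate is a meromorphic function with exactly one pole, which is simple. $\mathbf g$ is a complex Lie algebra with a nondegenerate invariant symmetric bilinear form $(\cdot,\cdot)$. $\mathfrak g$ is the Lie algebra of all meromorphic maps $\mathbb P\to\mathbf g$, $\mathfrak g^z$ the subalgebra of maps regular at $z$, $\mathfrak g_P$ of maps regular at $P$, $\mathfrak g_P^z=\mathfrak g_P\cap\mathfrak g^z$; $\mathbf g\subset\mathfrak g$ as constant maps. $\mathcal V=U\mathfrak g\otimes_{U\mathbf g}\mathbb C$, $\mathcal V^z=U\mathfrak g^z\otimes_{U\mathbf g}\mathbb C$, $\mathcal V_P=U\mathfrak g_P\otimes_{U\mathbf g}\mathbb C$, $\mathcal V_P^z=U\mathfrak g_P^z\otimes_{U\mathbf g}\mathbb C$ ($\mathbb C$ the trivial representation; $\mathbf 1$ the class of $1$). If $\mathfrak g_{P,-}\subset\mathfrak g_P$ is the ideal of maps vanishing at $P$, then $U\mathfrak g_{P,-}\cong\mathcal V_P$ and $U\mathfrak g_{P,-}^z\cong\mathcal V^z_P$. Every vector of $\mathcal V^z$ lies in $\mathcal V_P^z$ for all but finitely many $P$. For $P$ chosen, $u$ a coordinate with pole at $P$, $a\in\mathbf g$ and $z\ne P$: $\epsilon^a(z):U\mathfrak g_{P,-}\to U\mathfrak g_{P,-}\otimes K_z$ is left multiplication by $\frac{a}{u-u(z)}\otimes du_z$; $\iota^a(z):U\mathfrak g_{P,-}^z\to U\mathfrak g_{P,-}^z\otimes K_z$ is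 defined (simultaneously for all $a$) by $\iota^a(z)\mathbf 1=0$ and, for $\alpha\in\mathfrak g_{P,-}^z$ acting by left multiplication, $$\iota^a(z)\circ\alpha-\alpha\circ\iota^a(z)=-[\epsilon^a(z),\alpha]-(a,d\alpha(z))+\iota^{[a,\alpha(z)]}(z)+\epsilon^{[a,\alpha(z)]}(z).$$ One writes $\iota^a(z)=\hat\iota^a(z)du_z$. $j^v$ denotes $j^\nu$ for the constant map $\nu=v$. The factors $du_{z_1},du_{z_2}$ commute without signs. Covariance means: for $g\in\mathrm{Aut}(\mathbb P)$, the maps induced by transport by $g$ on $\mathcal V$ and on $K$ carry $j^a(z)$ to $j^a(g(z))$. Limits: the expression is applied to a vector of $\mathcal V^{z_1}_P\cong U\mathfrak g_{P,-}^{z_1}$ and is defined for $z_2\ne z_1$ near $z_1$; it is the image in $U\mathfrak g_{P,-}$ of a finite sum of $\mathbf g^{\otimes m}$-valued rational functions of $m$ auxiliary points and of $u(z_2)$; the limit statement means such a representative can be chosen without pole along $z_2=z_1$, its value at $z_2=z_1$ giving the right side.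
   Formalization: Independence of P is stated with u in the subtracted terms fixed: computing that limit via any other Q and coordinate w gives the same vector. If u changes with P, the limit changes by a multiple of j^{[v2,v1]}(z1), nonzero on the vacuum vector when [v1,v2] is nonzero. *)

theory Defs
  imports
    "HOL-Complex_Analysis.Complex_Analysis"
    "HOL-Library.Set_Algebras"
    "HOL-Library.Poly_Mapping"
begin

section \<open>Complex Lie algebras\<close>

class complex_lie_algebra = ab_group_add +
  fixes cscale :: "complex \<Rightarrow> 'a \<Rightarrow> 'a"  (infixr \<open>*\<^sub>C\<close> 75)
    and lie :: "'a \<Rightarrow> 'a \<Rightarrow> 'a"
  assumes cscale_add_right: "c *\<^sub>C (x + y) = c *\<^sub>C x + c *\<^sub>C y"
    and cscale_add_left: "(c + d) *\<^sub>C x = c *\<^sub>C x + d *\<^sub>C x"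
    and cscale_cscale: "c *\<^sub>C d *\<^sub>C x = (c * d) *\<^sub>C x"
    and cscale_one: "1 *\<^sub>C x = x"
    and lie_add_left: "lie (x + y) z = lie x z + lie y z"
    and lie_add_right: "lie x (y + z) = lie x y + lie x z"
    and lie_cscale_left: "lie (c *\<^sub>C x) y = c *\<^sub>C lie x y"
    and lie_cscale_right: "lie x (c *\<^sub>C y) = c *\<^sub>C lie x y"
    and lie_self: "lie x x = 0"
    and jacobi: "lie x (lie y z) + lie y (lie z x) + lie z (lie x y) = 0"

interpretation cvs: vector_space "cscale :: complex \<Rightarrow> 'a \<Rightarrow> 'a::complex_lie_algebra"
  by standard (simp_all add: cscale_add_right cscale_add_left cscale_cscale cscale_one)

definition invariant_form :: "('g::complex_lie_algebra \<Rightarrow> 'g \<Rightarrow> complex) \<Rightarrow> bool" where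
  "invariant_form form \<longleftrightarrow>
     (\<forall>x. Vector_Spaces.linear (*\<^sub>C) (*) (form x)) \<and>
     (\<forall>x y. form x y = form y x) \<and>
     (\<forall>x. (\<forall>y. form x y = 0) \<longrightarrow> x = 0) \<and>
     (\<forall>x y z. form (lie x y) z = form x (lie y z))"


section \<open>The complex projective line\<close>

datatype proj_line = Fin complex | Infty

text \<open>\<open>chart p\<close> is a holomorphic parametrisation of a neighbourhood of \<open>p\<close> with \<open>chart p 0 = p\<close>,
  and \<open>coord p\<close> is the inverse local coordinate; the value \<open>0\<close> of \<open>coord p\<close> at the one
  point where that coordinate is infinite is a dummy.\<close>

fun chart :: "proj_line \<Rightarrow> complex \<Rightarrow> proj_line" where
  "chart (Fin a) h = Fin (a + h)"
| "chart Infty h = (if h = 0 then Infty else Fin (inverse h))"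

fun coord :: "proj_line \<Rightarrow> proj_line \<Rightarrow> complex" where
  "coord (Fin a) (Fin b) = b - a"
| "coord (Fin a) Infty = 0"
| "coord Infty (Fin b) = inverse b"
| "coord Infty Infty = 0"

text \<open>A scalar meromorphic function is a function on all of the line whose value at a pole
  is irrelevant; \<open>meromorphic_fun\<close> also tolerates wrong values at finitely many
  regular points, \<open>holo_at\<close> does not.\<close>

definition meromorphic_fun :: "(proj_line \<Rightarrow> complex) \<Rightarrow> bool" where
  "meromorphic_fun f \<longleftrightarrow> (\<forall>p. (\<lambda>h. f (chart p h)) meromorphic_on {0})"

definition holo_at :: "(proj_line \<Rightarrow> complex) \<Rightarrow> proj_line \<Rightarrow> bool" where
  "holo_at f p \<longleftrightarrow> (\<lambda>h. f (chart p h)) analytic_on {0}"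

definition coordinate :: "proj_line \<Rightarrow> (proj_line \<Rightarrow> complex) \<Rightarrow> bool" where
  "coordinate P u \<longleftrightarrow> meromorphic_fun u \<and> (\<forall>p. p \<noteq> P \<longrightarrow> holo_at u p) \<and>
     is_pole (\<lambda>h. u (chart P h)) 0 \<and> zorder (\<lambda>h. u (chart P h)) 0 = -1"

text \<open>The fibre \<open>K\<^sub>z\<close> of the canonical bundle is one-dimensional with basis
  \<open>e\<^sub>z = d(coord z)\<close>. Throughout, \<open>K\<^sub>z\<close> is identified with the complex numbers, and \<open>V \<otimes> K\<^sub>z\<close>
  with \<open>V\<close>, by means of this basis; similarly \<open>V \<otimes> K\<^sub>z \<otimes> K\<^sub>w\<close> with \<open>V\<close> by means of
  \<open>e\<^sub>z \<otimes> e\<^sub>w\<close>. Thus \<open>diff f z\<close> is the covector \<open>df\<^sub>z\<close>.\<close>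

definition diff :: "(proj_line \<Rightarrow> complex) \<Rightarrow> proj_line \<Rightarrow> complex" where
  "diff f z = deriv (\<lambda>h. f (chart z h)) 0"

definition holo_map :: "(proj_line \<Rightarrow> proj_line) \<Rightarrow> bool" where
  "holo_map g \<longleftrightarrow> (\<forall>p. (\<lambda>h. coord (g p) (g (chart p h))) analytic_on {0})"

definition Aut :: "(proj_line \<Rightarrow> proj_line) set" where
  "Aut = {g. bij g \<and> holo_map g \<and> holo_map (inv g)}"

text \<open>Transport by \<open>g\<close> maps \<open>K\<^sub>z\<close> to the fibre at \<open>g z\<close> by pullback along \<open>inv g\<close>; it sends
  \<open>e\<^sub>z\<close> to \<open>K_transport g z\<close> times the basis vector at \<open>g z\<close>.\<close>

definition K_transport :: "(proj_line \<Rightarrow> proj_line) \<Rightarrow> proj_line \<Rightarrow> complex" where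
  "K_transport g z = diff (\<lambda>p. coord z (inv g p)) (g z)"


section \<open>The Lie algebra of meromorphic maps\<close>

text \<open>The Lie algebra \<open>'g\<close> may have infinite dimension and carries no topology: a meromorphic map
  is a finite combination of vectors with meromorphic coefficients. Maps that agree off a
  finite set are identified.\<close>

definition meromorphic_map :: "(proj_line \<Rightarrow> 'g::complex_lie_algebra) \<Rightarrow> bool" where
  "meromorphic_map \<nu> \<longleftrightarrow> (\<exists>(n::nat) f x. (\<forall>i<n. meromorphic_fun (f i)) \<and>
     finite {p. \<nu> p \<noteq> (\<Sum>i<n. f i p *\<^sub>C x i)})"

lemma meromorphic_mapE:
  assumes "meromorphic_map \<nu>"
  obtains n :: nat and f x where "\<And>i. i < n \<Longrightarrow> meromorphic_fun (f i)"
    "finite {p. \<nu> p \<noteq> (\<Sum>i<n. f i p *\<^sub>C x i)}"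
  using assms unfolding meromorphic_map_def by blast

lemma meromorphic_mapI:
  assumes "finite I" "\<And>i. i \<in> I \<Longrightarrow> meromorphic_fun (f i)"
    "finite {p. \<nu> p \<noteq> (\<Sum>i\<in>I. f i p *\<^sub>C x i)}"
  shows "meromorphic_map \<nu>"
proof -
  obtain e where e: "bij_betw e {..<card I} I"
    using ex_bij_betw_nat_finite[OF \<open>finite I\<close>] by (metis atLeast0LessThan)
  have "(\<Sum>i\<in>I. f i p *\<^sub>C x i) = (\<Sum>k<card I. f (e k) p *\<^sub>C x (e k))" for p
    by (rule sum.reindex_bij_betw[OF e, symmetric])
  moreover have "\<forall>k<card I. meromorphic_fun (f (e k))"
    using e assms(2) by (metis bij_betwE lessThan_iff)
  ultimately show ?thesis
    unfolding meromorphic_map_def using assms(3)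
    by (intro exI[of _ "card I"] exI[of _ "f \<circ> e"] exI[of _ "x \<circ> e"]) simp
qed

lemma meromorphic_map_zero: "meromorphic_map (\<lambda>p. 0)"
  by (rule meromorphic_mapI[of "{}"]) auto

lemma meromorphic_map_add:
  assumes "meromorphic_map \<nu>" "meromorphic_map \<mu>"
  shows "meromorphic_map (\<lambda>p. \<nu> p + \<mu> p)"
proof -
  obtain n :: nat and f x where 1: "\<And>i. i < n \<Longrightarrow> meromorphic_fun (f i)"
    "finite {p. \<nu> p \<noteq> (\<Sum>i<n. f i p *\<^sub>C x i)}"
    by (rule meromorphic_mapE[OF assms(1)]) blast
  obtain m :: nat and g y where 2: "\<And>i. i < m \<Longrightarrow> meromorphic_fun (g i)"
    "finite {p. \<mu> p \<noteq> (\<Sum>i<m. g i p *\<^sub>C y i)}"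
    by (rule meromorphic_mapE[OF assms(2)]) blast
  let ?F = "case_sum f g" and ?X = "case_sum x y"
  have *: "(\<Sum>i\<in>{..<n} <+> {..<m}. ?F i p *\<^sub>C ?X i) =
      (\<Sum>i<n. f i p *\<^sub>C x i) + (\<Sum>i<m. g i p *\<^sub>C y i)" for p
    by (simp add: sum.Plus)
  show ?thesis
    by (rule meromorphic_mapI[of "{..<n} <+> {..<m}" ?F _ ?X])
       (use 1 2 in \<open>auto simp: * intro: finite_subset[OF _ finite_UnI[OF 1(2) 2(2)]]\<close>)
qed

lemma meromorphic_fun_mult:
  "meromorphic_fun f \<Longrightarrow> meromorphic_fun g \<Longrightarrow> meromorphic_fun (\<lambda>p. f p * g p)"
  unfolding meromorphic_fun_def by (auto intro: meromorphic_on_mult)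

lemma meromorphic_map_scale:
  assumes "meromorphic_map \<nu>"
  shows "meromorphic_map (\<lambda>p. c *\<^sub>C \<nu> p)"
proof -
  obtain n :: nat and f x where 1: "\<And>i. i < n \<Longrightarrow> meromorphic_fun (f i)"
    "finite {p. \<nu> p \<noteq> (\<Sum>i<n. f i p *\<^sub>C x i)}"
    by (rule meromorphic_mapE[OF assms(1)]) blast
  have *: "(\<Sum>i<n. f i p *\<^sub>C (c *\<^sub>C x i)) = c *\<^sub>C (\<Sum>i<n. f i p *\<^sub>C x i)" for p
    by (simp add: cvs.scale_sum_right mult.commute)
  show ?thesis
  proof (rule meromorphic_mapI[of "{..<n}" f _ "\<lambda>i. c *\<^sub>C x i"])
    show "finite {p. c *\<^sub>C \<nu> p \<noteq> (\<Sum>i<n. f i p *\<^sub>C (c *\<^sub>C x i))}"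
      unfolding * by (rule finite_subset[OF _ 1(2)]) auto
  qed (use 1 in auto)
qed

lemma lie_zero_left: "lie 0 x = (0::'a::complex_lie_algebra)"
  using lie_cscale_left[of 0 0 x] by simp

lemma lie_zero_right: "lie x 0 = (0::'a::complex_lie_algebra)"
  using lie_cscale_right[of x 0 0] by simp

lemma lie_sum_left: "lie (\<Sum>i\<in>I. f i) y = (\<Sum>i\<in>I. lie (f i) (y::'a::complex_lie_algebra))"
  by (induction I rule: infinite_finite_induct) (auto simp: lie_zero_left lie_add_left)

lemma lie_sum_right: "lie y (\<Sum>i\<in>I. f i) = (\<Sum>i\<in>I. lie (y::'a::complex_lie_algebra) (f i))"
  by (induction I rule: infinite_finite_induct) (auto simp: lie_zero_right lie_add_right)

lemma meromorphic_map_lie: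
  assumes "meromorphic_map \<nu>" "meromorphic_map \<mu>"
  shows "meromorphic_map (\<lambda>p. lie (\<nu> p) (\<mu> p))"
proof -
  obtain n :: nat and f x where 1: "\<And>i. i < n \<Longrightarrow> meromorphic_fun (f i)"
    "finite {p. \<nu> p \<noteq> (\<Sum>i<n. f i p *\<^sub>C x i)}"
    by (rule meromorphic_mapE[OF assms(1)]) blast
  obtain m :: nat and g y where 2: "\<And>i. i < m \<Longrightarrow> meromorphic_fun (g i)"
    "finite {p. \<mu> p \<noteq> (\<Sum>i<m. g i p *\<^sub>C y i)}"
    by (rule meromorphic_mapE[OF assms(2)]) blast
  let ?F = "\<lambda>(i,j) p. f i p * g j p" and ?X = "\<lambda>(i,j). lie (x i) (y j)"
  have *: "(\<Sum>k\<in>{..<n} \<times> {..<m}. ?F k p *\<^sub>C ?X k) =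
      lie (\<Sum>i<n. f i p *\<^sub>C x i) (\<Sum>i<m. g i p *\<^sub>C y i)" for p
  proof -
    have "(\<Sum>k\<in>{..<n} \<times> {..<m}. ?F k p *\<^sub>C ?X k) =
        (\<Sum>i<n. \<Sum>j<m. (f i p * g j p) *\<^sub>C lie (x i) (y j))"
      by (simp add: sum.cartesian_product case_prod_unfold)
    also have "\<dots> = (\<Sum>i<n. lie (f i p *\<^sub>C x i) (\<Sum>j<m. g j p *\<^sub>C y j))"
      by (simp add: lie_sum_right lie_cscale_left lie_cscale_right mult.commute)
    finally show ?thesis by (simp add: lie_sum_left)
  qed
  show ?thesis
  proof (rule meromorphic_mapI[of "{..<n} \<times> {..<m}" ?F _ ?X])
    show "finite {p. lie (\<nu> p) (\<mu> p) \<noteq> (\<Sum>k\<in>{..<n} \<times> {..<m}. ?F k p *\<^sub>C ?X k)}"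
      unfolding * by (rule finite_subset[OF _ finite_UnI[OF 1(2) 2(2)]]) auto
  qed (use 1 2 in \<open>auto intro: meromorphic_fun_mult\<close>)
qed

quotient_type (overloaded) 'g mero = "proj_line \<Rightarrow> 'g::complex_lie_algebra" / partial:
  "\<lambda>\<nu> \<mu>. meromorphic_map \<nu> \<and> meromorphic_map \<mu> \<and> finite {p. \<nu> p \<noteq> \<mu> p}"
proof (rule part_equivpI)
  show "\<exists>\<nu>::proj_line \<Rightarrow> 'g. meromorphic_map \<nu> \<and> meromorphic_map \<nu> \<and> finite {p. \<nu> p \<noteq> \<nu> p}"
    by (rule exI[of _ "\<lambda>p. 0"]) (simp add: meromorphic_map_zero)
  show "symp (\<lambda>\<nu> \<mu>::proj_line \<Rightarrow> 'g.
      meromorphic_map \<nu> \<and> meromorphic_map \<mu> \<and> finite {p. \<nu> p \<noteq> \<mu> p})"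
    by (auto simp: symp_def eq_commute)
  show "transp (\<lambda>\<nu> \<mu>::proj_line \<Rightarrow> 'g.
      meromorphic_map \<nu> \<and> meromorphic_map \<mu> \<and> finite {p. \<nu> p \<noteq> \<mu> p})"
  proof (rule transpI, intro conjI)
    fix \<nu> \<mu> \<kappa> :: "proj_line \<Rightarrow> 'g"
    assume "meromorphic_map \<nu> \<and> meromorphic_map \<mu> \<and> finite {p. \<nu> p \<noteq> \<mu> p}"
      and "meromorphic_map \<mu> \<and> meromorphic_map \<kappa> \<and> finite {p. \<mu> p \<noteq> \<kappa> p}"
    then show "finite {p. \<nu> p \<noteq> \<kappa> p}"
      by (auto intro: finite_subset[of _ "{p. \<nu> p \<noteq> \<mu> p} \<union> {p. \<mu> p \<noteq> \<kappa> p}"])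
  qed auto
qed

instantiation mero :: (complex_lie_algebra) complex_lie_algebra
begin

lift_definition zero_mero :: "'a mero" is "\<lambda>p. 0"
  by (simp add: meromorphic_map_zero)

lift_definition plus_mero :: "'a mero \<Rightarrow> 'a mero \<Rightarrow> 'a mero" is "\<lambda>\<nu> \<mu> p. \<nu> p + \<mu> p"
  subgoal for \<nu> \<nu>' \<mu> \<mu>'
    by (auto intro: meromorphic_map_add
        finite_subset[of _ "{p. \<nu> p \<noteq> \<nu>' p} \<union> {p. \<mu> p \<noteq> \<mu>' p}"])
  done

lift_definition cscale_mero :: "complex \<Rightarrow> 'a mero \<Rightarrow> 'a mero" is "\<lambda>c \<nu> p. c *\<^sub>C \<nu> p"
  subgoal for c \<nu> \<nu>'
    by (auto intro: meromorphic_map_scale finite_subset[of _ "{p. \<nu> p \<noteq> \<nu>' p}"])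
  done

lift_definition lie_mero :: "'a mero \<Rightarrow> 'a mero \<Rightarrow> 'a mero" is "\<lambda>\<nu> \<mu> p. lie (\<nu> p) (\<mu> p)"
  subgoal for \<nu> \<nu>' \<mu> \<mu>'
    by (auto intro: meromorphic_map_lie
        finite_subset[of _ "{p. \<nu> p \<noteq> \<nu>' p} \<union> {p. \<mu> p \<noteq> \<mu>' p}"])
  done

lift_definition uminus_mero :: "'a mero \<Rightarrow> 'a mero" is "\<lambda>\<nu> p. - \<nu> p"
  subgoal for \<nu> \<nu>'
    using meromorphic_map_scale[of \<nu> "-1"] meromorphic_map_scale[of \<nu>' "-1"] by simp
  done

lift_definition minus_mero :: "'a mero \<Rightarrow> 'a mero \<Rightarrow> 'a mero" is "\<lambda>\<nu> \<mu> p. \<nu> p - \<mu> p"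
  subgoal for \<nu> \<nu>' \<mu> \<mu>'
    using meromorphic_map_add[OF _ meromorphic_map_scale[of \<mu> "-1"], of \<nu>]
      meromorphic_map_add[OF _ meromorphic_map_scale[of \<mu>' "-1"], of \<nu>']
    by (auto intro: finite_subset[of _ "{p. \<nu> p \<noteq> \<nu>' p} \<union> {p. \<mu> p \<noteq> \<mu>' p}"])
  done

instance
proof
  fix \<nu> \<mu> \<kappa> :: "'a mero" and c d :: complex
  have neg: "meromorphic_map (\<lambda>p. - f p)" if "meromorphic_map f" for f :: "proj_line \<Rightarrow> 'a"
    using meromorphic_map_scale[OF that, of "-1"] by simp
  have sub: "meromorphic_map (\<lambda>p. f p - g p)"
    if "meromorphic_map f" "meromorphic_map g" for f g :: "proj_line \<Rightarrow> 'a"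
    using meromorphic_map_add[OF that(1) neg[OF that(2)]] by simp
  note closed = meromorphic_map_add meromorphic_map_scale meromorphic_map_lie meromorphic_map_zero
    neg sub
  show "\<nu> + \<mu> + \<kappa> = \<nu> + (\<mu> + \<kappa>)" by transfer (simp add: closed add.assoc)
  show "\<nu> + \<mu> = \<mu> + \<nu>" by transfer (simp add: closed add.commute)
  show "0 + \<nu> = \<nu>" by transfer (simp add: closed)
  show "- \<nu> + \<nu> = 0" by transfer (simp add: closed)
  show "\<nu> - \<mu> = \<nu> + - \<mu>" by transfer (simp add: closed)
  show "c *\<^sub>C (\<nu> + \<mu>) = c *\<^sub>C \<nu> + c *\<^sub>C \<mu>" by transfer (simp add: closed cscale_add_right)
  show "(c + d) *\<^sub>C \<nu> = c *\<^sub>C \<nu> + d *\<^sub>C \<nu>" by transfer (simp add: closed cscale_add_left)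
  show "c *\<^sub>C d *\<^sub>C \<nu> = (c * d) *\<^sub>C \<nu>" by transfer (simp add: closed)
  show "1 *\<^sub>C \<nu> = \<nu>" by transfer simp
  show "lie (\<nu> + \<mu>) \<kappa> = lie \<nu> \<kappa> + lie \<mu> \<kappa>" by transfer (simp add: closed lie_add_left)
  show "lie \<nu> (\<mu> + \<kappa>) = lie \<nu> \<mu> + lie \<nu> \<kappa>" by transfer (simp add: closed lie_add_right)
  show "lie (c *\<^sub>C \<nu>) \<mu> = c *\<^sub>C lie \<nu> \<mu>" by transfer (simp add: closed lie_cscale_left)
  show "lie \<nu> (c *\<^sub>C \<mu>) = c *\<^sub>C lie \<nu> \<mu>" by transfer (simp add: closed lie_cscale_right)
  show "lie \<nu> \<nu> = 0" by transfer (simp add: closed lie_self)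
  show "lie \<nu> (lie \<mu> \<kappa>) + lie \<mu> (lie \<kappa> \<nu>) + lie \<kappa> (lie \<nu> \<mu>) = 0"
    by transfer (simp add: closed jacobi)
qed

end

text \<open>\<open>abs_mero \<nu>\<close> is the meromorphic map given by the function \<open>\<nu>\<close>.\<close>

definition const :: "'g \<Rightarrow> 'g::complex_lie_algebra mero" where
  "const a = abs_mero (\<lambda>p. a)"

definition expansion_at ::
  "proj_line \<Rightarrow> 'g::complex_lie_algebra mero \<Rightarrow> nat \<Rightarrow> (nat \<Rightarrow> proj_line \<Rightarrow> complex) \<Rightarrow> (nat \<Rightarrow> 'g) \<Rightarrow> bool"
  where "expansion_at z \<nu> n f x \<longleftrightarrow>
     (\<forall>i<n. meromorphic_fun (f i) \<and> holo_at (f i) z) \<and> \<nu> = abs_mero (\<lambda>p. \<Sum>i<n. f i p *\<^sub>C x i)"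

definition regular_at :: "proj_line \<Rightarrow> 'g::complex_lie_algebra mero \<Rightarrow> bool" where
  "regular_at z \<nu> \<longleftrightarrow> (\<exists>n f x. expansion_at z \<nu> n f x)"

text \<open>The value \<open>\<nu>(z)\<close> and the differential \<open>d\<nu>(z)\<close> (an element of \<open>'g \<otimes> K\<^sub>z\<close>).\<close>

definition ev :: "proj_line \<Rightarrow> 'g::complex_lie_algebra mero \<Rightarrow> 'g" where
  "ev z \<nu> = (THE v. \<exists>n f x. expansion_at z \<nu> n f x \<and> v = (\<Sum>i<n. f i z *\<^sub>C x i))"

definition dev :: "proj_line \<Rightarrow> 'g::complex_lie_algebra mero \<Rightarrow> 'g" where
  "dev z \<nu> = (THE v. \<exists>n f x. expansion_at z \<nu> n f x \<and> v = (\<Sum>i<n. diff (f i) z *\<^sub>C x i))"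

text \<open>In this order: \<open>\<g>\<^sup>z\<close>, \<open>\<g>\<^sub>P\<close> and \<open>\<g>\<^sub>P\<^sup>z\<close> are \<open>reg z\<close>, \<open>reg P\<close> and \<open>reg P \<inter> reg z\<close>; the
  subalgebras \<open>\<g>\<^sub>P\<^sub>,\<^sub>-\<close> and \<open>\<g>\<^sub>P\<^sub>,\<^sub>-\<^sup>z\<close> are \<open>van P\<close> and \<open>van P \<inter> reg z\<close>.\<close>

definition reg :: "proj_line \<Rightarrow> 'g::complex_lie_algebra mero set" where
  "reg z = {\<nu>. regular_at z \<nu>}"

definition van :: "proj_line \<Rightarrow> 'g::complex_lie_algebra mero set" where
  "van P = {\<nu> \<in> reg P. ev P \<nu> = 0}"

definition transport :: "(proj_line \<Rightarrow> proj_line) \<Rightarrow> 'g::complex_lie_algebra mero \<Rightarrow> 'g mero" where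
  "transport g \<nu> = abs_mero (\<lambda>p. rep_mero \<nu> (inv g p))"


section \<open>Universal enveloping algebras and vacuum modules\<close>

text \<open>The tensor algebra of \<open>'l\<close> is presented as the free algebra on the set \<open>'l\<close>, the linear
  relations between the generators being among the relators below.\<close>

datatype 'l word = Word (letters: "'l list")

instantiation word :: (type) monoid_add
begin

definition zero_word :: "'a word" where "0 = Word []"

definition plus_word :: "'a word \<Rightarrow> 'a word \<Rightarrow> 'a word" where
  "v + w = Word (letters v @ letters w)"

instance by standard (simp_all add: zero_word_def plus_word_def)

end

type_synonym 'l free_alg = "'l word \<Rightarrow>\<^sub>0 complex"

definition gen :: "'l \<Rightarrow> 'l free_alg" where
  "gen \<alpha> = Poly_Mapping.single (Word [\<alpha>]) 1"

definition scal :: "complex \<Rightarrow> 'l free_alg" where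
  "scal c = Poly_Mapping.single 0 c"

definition free_on :: "'l set \<Rightarrow> 'l free_alg set" where
  "free_on H = {t. \<forall>w\<in>Poly_Mapping.keys t. set (letters w) \<subseteq> H}"

text \<open>The two-sided ideal of \<open>free_on H\<close> defining the enveloping algebra of a subalgebra \<open>H\<close>.\<close>

inductive_set uea_ideal :: "'l::complex_lie_algebra set \<Rightarrow> 'l free_alg set"
  for H :: "'l set" where
  rel_add: "\<alpha> \<in> H \<Longrightarrow> \<beta> \<in> H \<Longrightarrow> gen (\<alpha> + \<beta>) - gen \<alpha> - gen \<beta> \<in> uea_ideal H"
| rel_scale: "\<alpha> \<in> H \<Longrightarrow> gen (c *\<^sub>C \<alpha>) - scal c * gen \<alpha> \<in> uea_ideal H"
| rel_lie: "\<alpha> \<in> H \<Longrightarrow> \<beta> \<in> H \<Longrightarrow> gen \<alpha> * gen \<beta> - gen \<beta> * gen \<alpha> - gen (lie \<alpha> \<beta>) \<in> uea_ideal H"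
| zero: "0 \<in> uea_ideal H"
| add: "s \<in> uea_ideal H \<Longrightarrow> t \<in> uea_ideal H \<Longrightarrow> s + t \<in> uea_ideal H"
| mult: "s \<in> free_on H \<Longrightarrow> r \<in> uea_ideal H \<Longrightarrow> t \<in> free_on H \<Longrightarrow> s * r * t \<in> uea_ideal H"

definition UEA :: "'l::complex_lie_algebra set \<Rightarrow> 'l free_alg set set" where
  "UEA H = {t +o uea_ideal H | t. t \<in> free_on H}"

text \<open>For a subalgebra \<open>H\<close> containing the constants, \<open>Vac H\<close> is \<open>U H \<otimes> \<complex>\<close>, the tensor product
  taken over the enveloping algebra of the constants. With \<open>U H \<otimes> \<complex>\<close> over \<open>\<complex>\<close>
  identified with \<open>U H\<close>, it is the quotient by the balancing relations \<open>t a \<otimes> 1 = t \<otimes> a 1\<close>,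
  where \<open>a\<close> acts on the trivial representation by its coefficient at the empty word.\<close>

inductive_set vac_ideal :: "'g::complex_lie_algebra mero set \<Rightarrow> 'g mero free_alg set"
  for H :: "'g mero set" where
  uea: "r \<in> uea_ideal H \<Longrightarrow> r \<in> vac_ideal H"
| balance: "t \<in> free_on H \<Longrightarrow> a \<in> free_on (range const) \<Longrightarrow>
     t * a - t * scal (Poly_Mapping.lookup a 0) \<in> vac_ideal H"
| add: "s \<in> vac_ideal H \<Longrightarrow> t \<in> vac_ideal H \<Longrightarrow> s + t \<in> vac_ideal H"

definition Vac :: "'g::complex_lie_algebra mero set \<Rightarrow> 'g mero free_alg set set" where
  "Vac H = {t +o vac_ideal H | t. t \<in> free_on H}"

text \<open>Elements of \<open>UEA H\<close> and \<open>Vac H\<close> are cosets, added elementwise by \<^const>\<open>plus\<close> on sets. For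
  \<open>N \<subseteq> N'\<close>, the natural map from cosets of \<open>N\<close> to cosets of \<open>N'\<close> is \<open>X \<mapsto> X + N'\<close>. In particular
  \<open>X + uea_ideal H'\<close>, for \<open>H \<subseteq> H'\<close>, is the image of \<open>X \<in> UEA H\<close> in \<open>UEA H'\<close>, and
  \<open>X + vac_ideal H'\<close> is its image in \<open>Vac H'\<close>. The action of \<open>a\<close> by left multiplication on
  cosets of \<open>N\<close>, scalar multiplication included, is \<open>lmul N a\<close>.\<close>

definition lmul :: "'l free_alg set \<Rightarrow> 'l free_alg \<Rightarrow> 'l free_alg set \<Rightarrow> 'l free_alg set" where
  "lmul N a X = a *o X + N"

definition coset_diff :: "'l free_alg set \<Rightarrow> 'l free_alg set \<Rightarrow> 'l free_alg set"
    (infixl \<open>\<ominus>\<close> 65) where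
  "X \<ominus> Y = X + (-1) *o Y"

definition quot_linear :: "'l free_alg set \<Rightarrow> 'l free_alg set set \<Rightarrow>
    'l free_alg set \<Rightarrow> 'l free_alg set set \<Rightarrow> ('l free_alg set \<Rightarrow> 'l free_alg set) \<Rightarrow> bool" where
  "quot_linear N Q N' Q' F \<longleftrightarrow>
     (\<forall>X\<in>Q. F X \<in> Q') \<and>
     (\<forall>X\<in>Q. \<forall>Y\<in>Q. F (X + Y) = F X + F Y) \<and>
     (\<forall>X\<in>Q. \<forall>c. F (lmul N (scal c) X) = lmul N' (scal c) (F X))"

definition free_map :: "('l \<Rightarrow> 'm) \<Rightarrow> 'l free_alg \<Rightarrow> 'm free_alg" where
  "free_map \<phi> t = (\<Sum>w\<in>Poly_Mapping.keys t.
     Poly_Mapping.single (Word (map \<phi> (letters w))) (Poly_Mapping.lookup t w))"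

text \<open>The map induced by transport by \<open>g\<close> on elements of the vacuum modules.\<close>

definition vac_transport ::
  "(proj_line \<Rightarrow> proj_line) \<Rightarrow> 'g::complex_lie_algebra mero free_alg set \<Rightarrow> 'g mero free_alg set" where
  "vac_transport g X = free_map (transport g) ` X"


section \<open>The operators \<open>\<epsilon>\<close> and \<open>\<iota>\<close>\<close>

definition eps_elt ::
  "(proj_line \<Rightarrow> complex) \<Rightarrow> proj_line \<Rightarrow> 'g::complex_lie_algebra \<Rightarrow> 'g mero" where
  "eps_elt u z a = abs_mero (\<lambda>p. (diff u z / (u p - u z)) *\<^sub>C a)"

definition eps :: "proj_line \<Rightarrow> (proj_line \<Rightarrow> complex) \<Rightarrow> proj_line \<Rightarrow> 'g \<Rightarrow>
    'g::complex_lie_algebra mero free_alg set \<Rightarrow> 'g mero free_alg set" where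
  "eps P u z a X = lmul (uea_ideal (van P)) (gen (eps_elt u z a)) X"

text \<open>The terms \<open>\<epsilon>\<close> in the commutation relation are operators on the enveloping algebra of
  \<open>van P\<close> only, but their combination \<open>- [\<epsilon>\<^sup>a(z), \<alpha>] + \<epsilon>\<^sup>b(z)\<close> with \<open>b = [a, \<alpha>(z)]\<close> is left
  multiplication by the element \<open>- [eps_elt u z a, \<alpha>] + eps_elt u z b\<close>, which is regular at \<open>z\<close>
  and thus acts on the enveloping algebra of \<open>van P \<inter> reg z\<close>.\<close>

definition is_iota :: "('g \<Rightarrow> 'g \<Rightarrow> complex) \<Rightarrow> proj_line \<Rightarrow> (proj_line \<Rightarrow> complex) \<Rightarrow> proj_line \<Rightarrow>
    ('g \<Rightarrow> 'g::complex_lie_algebra mero free_alg set \<Rightarrow> 'g mero free_alg set) \<Rightarrow> bool" where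
  "is_iota form P u z I \<longleftrightarrow> (let H = van P \<inter> reg z; J = uea_ideal H in
     (\<forall>a. quot_linear J (UEA H) J (UEA H) (I a)) \<and>
     (\<forall>a. I a (1 +o J) = 0 +o J) \<and>
     (\<forall>a. \<forall>\<alpha>\<in>H. \<forall>X\<in>UEA H.
        I a (lmul J (gen \<alpha>) X) \<ominus> lmul J (gen \<alpha>) (I a X) =
          lmul J (gen (- lie (eps_elt u z a) \<alpha> + eps_elt u z (lie a (ev z \<alpha>)))) X
          \<ominus> lmul J (scal (form a (dev z \<alpha>))) X
          + I (lie a (ev z \<alpha>)) X))"

definition iota :: "('g \<Rightarrow> 'g \<Rightarrow> complex) \<Rightarrow> proj_line \<Rightarrow> (proj_line \<Rightarrow> complex) \<Rightarrow> proj_line \<Rightarrow>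
    'g \<Rightarrow> 'g::complex_lie_algebra mero free_alg set \<Rightarrow> 'g mero free_alg set" where
  "iota form P u z = (SOME I. is_iota form P u z I)"


section \<open>Limits\<close>

text \<open>Rational functions of an auxiliary point and of a parameter, with coordinates \<open>t\<close> and \<open>s\<close>, are
  quotients of polynomials \<open>p\<close>, \<open>q\<close> in \<open>s\<close> with coefficients in \<open>\<complex>[t]\<close>. A letter \<open>(p, q, x)\<close> stands
  for \<open>p(t,s) / q(t,s) x\<close>. The function of \<open>m\<close> auxiliary points and \<open>s\<close> which is the product of
  \<open>m\<close> letters, letter \<open>i\<close> being taken at the \<open>i\<close>-th point, and of a rational function \<open>c / d\<close>
  of \<open>s\<close>, is written \<open>(c, d, [letters])\<close>; as it separates the auxiliary points, it has
  an image in the enveloping algebra. A list of such data stands for their sum.\<close>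

type_synonym 'g letter_family = "complex poly poly \<times> complex poly poly \<times> 'g"
type_synonym 'g rational_family = "(complex poly \<times> complex poly \<times> 'g letter_family list) list"

fun letter_at :: "(proj_line \<Rightarrow> complex) \<Rightarrow> complex \<Rightarrow> 'g letter_family \<Rightarrow>
    'g::complex_lie_algebra mero" where
  "letter_at u s (p, q, x) =
     abs_mero (\<lambda>t. (poly (poly p [:s:]) (u t) / poly (poly q [:s:]) (u t)) *\<^sub>C x)"

definition family_at :: "(proj_line \<Rightarrow> complex) \<Rightarrow> complex \<Rightarrow> 'g rational_family \<Rightarrow>
    'g::complex_lie_algebra mero free_alg" where
  "family_at u s R = (\<Sum>(c, d, ls)\<leftarrow>R.
     scal (poly c s / poly d s) * prod_list (map (\<lambda>l. gen (letter_at u s l)) ls))"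

definition no_pole_at :: "complex \<Rightarrow> 'g rational_family \<Rightarrow> bool" where
  "no_pole_at s R \<longleftrightarrow> (\<forall>(c, d, ls)\<in>set R. poly d s \<noteq> 0 \<and> (\<forall>(p, q, x)\<in>set ls. poly q [:s:] \<noteq> 0))"

text \<open>\<open>tends_to P u z\<^sub>1 E L\<close>: the expression described by \<open>E\<close>, which holds of \<open>z\<close> and \<open>Y\<close> if \<open>Y\<close>
  in the enveloping algebra of \<open>van P\<close> is the value of the expression at \<open>z\<close>, has the limit \<open>L\<close> as
  \<open>z\<close> tends to \<open>z\<^sub>1\<close>.\<close>

definition tends_to :: "proj_line \<Rightarrow> (proj_line \<Rightarrow> complex) \<Rightarrow> proj_line \<Rightarrow>
    (proj_line \<Rightarrow> 'g::complex_lie_algebra mero free_alg set \<Rightarrow> bool) \<Rightarrow>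
    'g mero free_alg set \<Rightarrow> bool" where
  "tends_to P u z\<^sub>1 E L \<longleftrightarrow> (let H = van P; J = uea_ideal H in
     (\<exists>R. no_pole_at (u z\<^sub>1) R \<and>
       family_at u (u z\<^sub>1) R \<in> free_on H \<and> L = family_at u (u z\<^sub>1) R +o J \<and>
       (\<exists>\<delta>>0. \<forall>z. z \<noteq> P \<and> z \<noteq> z\<^sub>1 \<and> dist (u z) (u z\<^sub>1) < \<delta> \<longrightarrow>
          family_at u (u z) R \<in> free_on H \<and> E z (family_at u (u z) R +o J))))"

text \<open>\<open>D\<close> is the value on \<open>X\<close> of the derivative at \<open>z\<^sub>1\<close>, with respect to \<open>u(z)\<close>, of the operator
  \<open>\<iota>\<^sup>a(z) / du\<^sub>z\<close>. For \<open>z\<close> near \<open>z\<^sub>1\<close> the vector \<open>X\<close>, viewed in the enveloping algebra of \<open>van P\<close>, comes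
  from that of \<open>van P \<inter> reg z\<close>, and \<open>X'\<close> is this preimage.\<close>

definition iota_deriv :: "('g \<Rightarrow> 'g \<Rightarrow> complex) \<Rightarrow> proj_line \<Rightarrow> (proj_line \<Rightarrow> complex) \<Rightarrow> proj_line \<Rightarrow>
    'g \<Rightarrow> 'g::complex_lie_algebra mero free_alg set \<Rightarrow> 'g mero free_alg set \<Rightarrow> bool" where
  "iota_deriv form P u z\<^sub>1 a X D \<longleftrightarrow> (let J = uea_ideal (van P) in
     tends_to P u z\<^sub>1
       (\<lambda>z Y. \<exists>X' \<in> UEA (van P \<inter> reg z). X' + J = X + J \<and>
          Y = lmul J (scal (1 / (u z - u z\<^sub>1)))
                (lmul J (scal (1 / diff u z)) (iota form P u z a X')
                 \<ominus> lmul J (scal (1 / diff u z\<^sub>1)) (iota form P u z\<^sub>1 a X)))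
       D)"


section \<open>The current field\<close>

type_synonym 'g current = "'g \<Rightarrow> proj_line \<Rightarrow> 'g mero free_alg set \<Rightarrow> 'g mero free_alg set"

definition current_field ::
  "('g \<Rightarrow> 'g \<Rightarrow> complex) \<Rightarrow> 'g::complex_lie_algebra current \<Rightarrow> bool" where
  "current_field form j \<longleftrightarrow> (\<forall>z. \<forall>\<nu>\<in>reg z.
     quot_linear (vac_ideal (reg z)) (Vac (reg z)) (vac_ideal UNIV) (Vac UNIV) (j (ev z \<nu>) z) \<and>
     (\<forall>P u. P \<noteq> z \<and> coordinate P u \<longrightarrow> (\<forall>X \<in> UEA (van P \<inter> reg z).
        j (ev z \<nu>) z (X + vac_ideal (reg z)) =
          eps P u z (ev z \<nu>) (X + uea_ideal (van P)) + iota form P u z (ev z \<nu>) X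
          + vac_ideal UNIV)))"

definition covariant :: "'g::complex_lie_algebra current \<Rightarrow> bool" where
  "covariant j \<longleftrightarrow> (\<forall>g\<in>Aut. \<forall>z a. \<forall>X\<in>Vac (reg z).
     j a (g z) (vac_transport g X) =
       lmul (vac_ideal UNIV) (scal (K_transport g z)) (vac_transport g (j a z X)))"

text \<open>The value \<open>e\<close>, in \<open>Vac UNIV\<close> tensored with the fibres of \<open>K\<close> at \<open>z\<^sub>1\<close> and \<open>z\<^sub>2\<close>, of the expression
  whose limit is taken, applied to the vector \<open>X\<close> of \<open>Vac (reg z\<^sub>1)\<close>. The product of the two
  currents is defined if the first one maps \<open>X\<close> into \<open>Vac (reg z\<^sub>2)\<close>, where \<open>W\<close> is its image.\<close>

definition current_product :: "('g \<Rightarrow> 'g \<Rightarrow> complex) \<Rightarrow> 'g::complex_lie_algebra current \<Rightarrow>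
    (proj_line \<Rightarrow> complex) \<Rightarrow> 'g \<Rightarrow> 'g \<Rightarrow> proj_line \<Rightarrow> 'g mero free_alg set \<Rightarrow>
    proj_line \<Rightarrow> 'g mero free_alg set \<Rightarrow> bool" where
  "current_product form j u v\<^sub>2 v\<^sub>1 z\<^sub>1 X z\<^sub>2 e \<longleftrightarrow> (let N = vac_ideal UNIV in
     \<exists>W \<in> Vac (reg z\<^sub>2). W + N = j v\<^sub>1 z\<^sub>1 X \<and>
       e = j v\<^sub>2 z\<^sub>2 W
           \<ominus> lmul N (scal (form v\<^sub>1 v\<^sub>2 * diff u z\<^sub>1 * diff u z\<^sub>2 / (u z\<^sub>1 - u z\<^sub>2)\<^sup>2)) X
           \<ominus> lmul N (scal (1 / (u z\<^sub>2 - u z\<^sub>1) * diff u z\<^sub>2)) (j (lie v\<^sub>2 v\<^sub>1) z\<^sub>1 X))"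

text \<open>The limit of this expression, calculated with the point at infinity \<open>Q\<close> and the coordinate \<open>w\<close>
  with pole at \<open>Q\<close>, is \<open>L dw\<^sup>2\<close> at \<open>z\<^sub>1\<close>: the expression at \<open>z\<^sub>2\<close> is
  \<open>Y dw dw\<close>, the differentials taken at \<open>z\<^sub>1\<close> and \<open>z\<^sub>2\<close>, and \<open>Y\<close> tends to \<open>L\<close>.
  The coordinate \<open>u\<close> in the subtracted terms is kept separate from \<open>w\<close>, as these terms depend on
  the pole of \<open>u\<close>: replacing \<open>u\<close> by \<open>1 / u\<close> changes \<open>du / (u(z\<^sub>2) - u(z\<^sub>1))\<close>, in the limit, by
  \<open>- du / u\<close>. Only for a fixed expression is the limit independent of the point at infinity used to
  calculate it.\<close>

definition current_product_limit :: "('g \<Rightarrow> 'g \<Rightarrow> complex) \<Rightarrow> 'g::complex_lie_algebra current \<Rightarrow>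
    (proj_line \<Rightarrow> complex) \<Rightarrow> 'g \<Rightarrow> 'g \<Rightarrow> proj_line \<Rightarrow> 'g mero free_alg set \<Rightarrow>
    proj_line \<Rightarrow> (proj_line \<Rightarrow> complex) \<Rightarrow> 'g mero free_alg set \<Rightarrow> bool" where
  "current_product_limit form j u v\<^sub>2 v\<^sub>1 z\<^sub>1 X Q w L \<longleftrightarrow>
     tends_to Q w z\<^sub>1
       (\<lambda>z\<^sub>2 Y. current_product form j u v\<^sub>2 v\<^sub>1 z\<^sub>1 X z\<^sub>2
          (lmul (vac_ideal UNIV) (scal (diff w z\<^sub>1 * diff w z\<^sub>2)) (Y + vac_ideal UNIV)))
       L"

definition limit_formula :: "('g \<Rightarrow> 'g \<Rightarrow> complex) \<Rightarrow> proj_line \<Rightarrow> (proj_line \<Rightarrow> complex) \<Rightarrow>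
    'g \<Rightarrow> 'g \<Rightarrow> proj_line \<Rightarrow> 'g::complex_lie_algebra mero free_alg set \<Rightarrow>
    'g mero free_alg set \<Rightarrow> 'g mero free_alg set" where
  "limit_formula form P u v\<^sub>2 v\<^sub>1 z\<^sub>1 X D = (
     let J = uea_ideal (van P); \<iota> = iota form P u z\<^sub>1; \<epsilon> = eps P u z\<^sub>1 in
       \<iota> v\<^sub>2 (\<iota> v\<^sub>1 X) + \<epsilon> v\<^sub>2 (\<epsilon> v\<^sub>1 (X + J)) + \<epsilon> v\<^sub>2 (\<iota> v\<^sub>1 X + J) + \<epsilon> v\<^sub>1 (\<iota> v\<^sub>2 X + J)
       + lmul J (scal ((diff u z\<^sub>1)\<^sup>2)) D)"

end

theory Submission
  imports Defs
begin

text \<open>For a meromorphic map \<open>\<beta>\<close> let \<open>A\<^sub>z(\<beta>)\<close> be the operator on \<open>Vac UNIV\<close> with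
  \<open>A\<^sub>z(\<beta>) \<alpha> - \<alpha> A\<^sub>z(\<beta>) = A\<^sub>z([\<beta>, \<alpha>]) - Res\<^sub>z (\<beta>, d\<alpha>)\<close> that takes the vacuum vector to the
  principal part of \<open>\<beta>\<close> at \<open>z\<close>. The cocycle property of the residue makes it well defined, and on
  vectors regular at \<open>z\<close> it depends on the principal part of \<open>\<beta>\<close> only. The current is \<open>A\<^sub>z(\<beta>)\<close> for
  \<open>\<beta>\<close> with principal part \<open>a / coord z\<close>. This involves neither \<open>P\<close> nor \<open>u\<close>, whence covariance, and
  it is \<open>\<epsilon> + \<iota>\<close> because both obey the same commutation relations.

  The enveloping algebra of \<open>van P \<inter> reg z\<close> is spanned by words in simple fractions
  \<open>x / (u - \<sigma>)\<^sup>k\<close>, on which \<open>\<iota>\<^sup>a(z) / du\<close> is explicitly rational in \<open>s = u(z)\<close>. So is the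
  difference of the product of currents and its singular part, and its value at \<open>z\<^sub>1\<close> can be read
  off. In \<open>Vac UNIV\<close> this value is the image of \<open>Y\<close> under \<open>A(\<beta>)\<close>, where \<open>Y\<close> is the value on \<open>X\<close> of
  the current of \<open>v\<^sub>1\<close> at \<open>z\<^sub>1\<close>, and \<open>\<beta> = v\<^sub>2 du / (u - u(z\<^sub>1))\<close>. Another coordinate \<open>w\<close> changes
  \<open>\<beta>\<close> by a constant map \<open>\<kappa> v\<^sub>2\<close>, and \<open>A(v\<^sub>2)\<close> takes \<open>Y\<close> to the value on \<open>X\<close> of the current of
  \<open>[v\<^sub>2, v\<^sub>1]\<close>. In the limit \<open>du / (u - u(z\<^sub>1))\<close> differs from its analogue for \<open>w\<close> by \<open>\<kappa>\<close> as
  well, so that the two changes cancel.\<close>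

section \<open>Free algebras and cosets\<close>

text \<open>A limit is tested on representatives in the free algebra. The regular part of the
  product of currents therefore has to be one rational expression there, and only its comparison
  with the currents takes place in a quotient; hence the use of exact divided differences instead of
  congruences. The derivative in the limit has two sources that must agree. Moving the current of v2
  at z2 across the letter v1/(u - u(z1)) made by the first current yields the form with a double
  pole and, divided by u(z2) - u(z1), the \<epsilon> part of b = [v2, v1] at z1 and its \<iota> part
  at z2; subtracting the current of b at z1 leaves a difference quotient of \<iota>. In A(\<beta>)
  Y, on the other hand, the bracket of two simple poles at z1 is a double pole, and since 1/(u -
  s)^2 is the s-derivative of 1/(u - s), A of it is the derivative of the current. That A(\<beta>)
  descends to the vacuum module rests on constants having zero differential and on brackets with
  constants commuting with principal parts.\<close>

lemma scal_0 [simp]: "scal 0 = 0"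
  by (simp add: scal_def)

lemma scal_1 [simp]: "scal 1 = 1"
  by (simp add: scal_def)

lemma scal_add: "scal (a + b) = scal a + scal b"
  by (simp add: scal_def single_add)

lemma scal_diff: "scal (a - b) = scal a - scal b"
  by (simp add: scal_def single_diff)

lemma scal_minus: "scal (- a) = - scal a"
  by (simp add: scal_def single_uminus)

lemma scal_mult: "scal (a * b) = scal a * scal b"
  by (simp add: scal_def mult_single)

lemma scal_mult_left: "scal a * (scal b * t) = scal (a * b) * t"
  by (simp add: scal_mult mult.assoc)

lemma scal_sum: "scal (sum f I) = (\<Sum>i\<in>I. scal (f i))"
  by (induction I rule: infinite_finite_induct) (auto simp: scal_add)

abbreviation lk :: "'l free_alg \<Rightarrow> 'l word \<Rightarrow> complex" where
  "lk \<equiv> Poly_Mapping.lookup"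

definition gens :: "'l list \<Rightarrow> 'l free_alg" where
  "gens w = prod_list (map gen w)"

lemma gens_Nil [simp]: "gens [] = 1"
  and gens_Cons: "gens (\<alpha> # w) = gen \<alpha> * gens w"
  and gens_append: "gens (v @ w) = gens v * gens w"
  by (simp_all add: gens_def)

lemma gens_single: "gens w = Poly_Mapping.single (Word w) 1"
proof (induction w)
  case Nil
  show ?case by (metis gens_Nil single_one zero_word_def)
next
  case (Cons a w)
  then show ?case by (simp add: gens_Cons gen_def mult_single plus_word_def)
qed

lemma scal_gens: "scal c * gens w = Poly_Mapping.single (Word w) c"
  by (simp add: gens_single scal_def mult_single)

lemma free_alg_expand: "t = (\<Sum>w\<in>Poly_Mapping.keys t. scal (lk t w) * gens (letters w))"
proof (rule poly_mapping_eqI)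
  fix w
  show "lk t w = lk (\<Sum>w\<in>Poly_Mapping.keys t. scal (lk t w) * gens (letters w)) w"
    by (simp add: scal_gens lookup_sum lookup_single when_def in_keys_iff)
qed

lemma scal_central: "scal c * t = t * scal c"
proof -
  have "t * scal c = (\<Sum>w\<in>Poly_Mapping.keys t. (scal (lk t w) * gens (letters w)) * scal c)"
    by (subst free_alg_expand[of t]) (simp add: sum_distrib_right)
  also have "\<dots> = (\<Sum>w\<in>Poly_Mapping.keys t. scal c * (scal (lk t w) * gens (letters w)))"
    by (simp add: gens_single scal_def mult_single mult.commute)
  also have "\<dots> = scal c * t"
    by (subst (3) free_alg_expand[of t]) (simp add: sum_distrib_left)
  finally show ?thesis by simp
qed

lemma mult_scal_left: "t * (scal c * s) = scal c * (t * s)"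
  by (metis mult.assoc scal_central)

lemma free_on_0 [simp]: "0 \<in> free_on H"
  and free_on_1 [simp]: "1 \<in> free_on H"
  and free_on_scal [simp]: "scal c \<in> free_on H"
  and free_on_gen: "\<alpha> \<in> H \<Longrightarrow> gen \<alpha> \<in> free_on H"
  and free_on_add: "s \<in> free_on H \<Longrightarrow> t \<in> free_on H \<Longrightarrow> s + t \<in> free_on H"
  and free_on_minus: "s \<in> free_on H \<Longrightarrow> - s \<in> free_on H"
  unfolding free_on_def using keys_add[of s t]
  by (auto simp: scal_def gen_def zero_word_def)

lemma free_on_diff: "s \<in> free_on H \<Longrightarrow> t \<in> free_on H \<Longrightarrow> s - t \<in> free_on H"
  by (metis free_on_add free_on_minus uminus_add_conv_diff add.commute)

lemma free_on_mult:
  assumes "s \<in> free_on H" "t \<in> free_on H" shows "s * t \<in> free_on H"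
proof -
  have "set (letters w) \<subseteq> H" if "w \<in> Poly_Mapping.keys (s * t)" for w
  proof -
    obtain a b where "w = a + b" "a \<in> Poly_Mapping.keys s" "b \<in> Poly_Mapping.keys t"
      using keys_mult[of s t] \<open>w \<in> _\<close> by blast
    then show ?thesis using assms by (auto simp: free_on_def plus_word_def)
  qed
  then show ?thesis by (simp add: free_on_def)
qed

lemma free_on_gens: "set w \<subseteq> H \<Longrightarrow> gens w \<in> free_on H"
  by (induction w) (auto simp: gens_Cons intro: free_on_mult free_on_gen)

lemma free_on_mono: "H \<subseteq> H' \<Longrightarrow> t \<in> free_on H \<Longrightarrow> t \<in> free_on H'"
  by (auto simp: free_on_def)

lemma free_on_UNIV [simp]: "t \<in> free_on UNIV"
  by (simp add: free_on_def)

lemma free_on_induct [consumes 1, case_names add word]: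
  assumes "t \<in> free_on H"
    and add: "\<And>s t. P s \<Longrightarrow> P t \<Longrightarrow> P (s + t)"
    and word: "\<And>c w. set w \<subseteq> H \<Longrightarrow> P (scal c * gens w)"
  shows "P t"
proof -
  have zero: "P 0" using word[of "[]" 0] by simp
  have "P (\<Sum>w\<in>K. scal (lk t w) * gens (letters w))"
    if "finite K" "K \<subseteq> Poly_Mapping.keys t" for K
    using that
  proof (induction K rule: finite_induct)
    case (insert w K)
    have "set (letters w) \<subseteq> H"
      using insert.prems assms(1) by (auto simp: free_on_def)
    with insert show ?case by (auto intro!: add word)
  qed (use zero in auto)
  from this[of "Poly_Mapping.keys t"] show ?thesis
    by (simp add: free_alg_expand[symmetric])
qed

section \<open>Subspaces, congruence modulo a subspace, cosets\<close>

definition subsp :: "'l free_alg set \<Rightarrow> bool" where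
  "subsp J \<longleftrightarrow> 0 \<in> J \<and> (\<forall>s\<in>J. \<forall>t\<in>J. s + t \<in> J) \<and> (\<forall>c. \<forall>t\<in>J. scal c * t \<in> J)"

lemma subsp_0: "subsp J \<Longrightarrow> 0 \<in> J"
  and subsp_add: "subsp J \<Longrightarrow> s \<in> J \<Longrightarrow> t \<in> J \<Longrightarrow> s + t \<in> J"
  and subsp_scal: "subsp J \<Longrightarrow> t \<in> J \<Longrightarrow> scal c * t \<in> J"
  by (auto simp: subsp_def)

lemma subsp_minus: "subsp J \<Longrightarrow> t \<in> J \<Longrightarrow> - t \<in> J"
  using subsp_scal[of J t "-1"] by (simp add: scal_minus)

lemma subsp_diff: "subsp J \<Longrightarrow> s \<in> J \<Longrightarrow> t \<in> J \<Longrightarrow> s - t \<in> J"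
  by (metis subsp_add subsp_minus uminus_add_conv_diff add.commute)

definition eqm :: "'l free_alg set \<Rightarrow> 'l free_alg \<Rightarrow> 'l free_alg \<Rightarrow> bool" where
  "eqm J s t \<longleftrightarrow> s - t \<in> J"

lemma eqm_refl: "subsp J \<Longrightarrow> eqm J t t"
  by (simp add: eqm_def subsp_0)

lemma eqm_sym: "subsp J \<Longrightarrow> eqm J s t \<Longrightarrow> eqm J t s"
  using subsp_minus[of J "s - t"] by (simp add: eqm_def)

lemma eqm_trans: "subsp J \<Longrightarrow> eqm J s t \<Longrightarrow> eqm J t r \<Longrightarrow> eqm J s r"
  using subsp_add[of J "s - t" "t - r"] by (simp add: eqm_def)

lemma eqm_add: "subsp J \<Longrightarrow> eqm J s t \<Longrightarrow> eqm J s' t' \<Longrightarrow> eqm J (s + s') (t + t')"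
  using subsp_add[of J "s - t" "s' - t'"] by (simp add: eqm_def add_diff_add)

lemma eqm_minus: "subsp J \<Longrightarrow> eqm J s t \<Longrightarrow> eqm J (- s) (- t)"
  using subsp_minus[of J "s - t"] by (simp add: eqm_def)

lemma eqm_diff: "subsp J \<Longrightarrow> eqm J s t \<Longrightarrow> eqm J s' t' \<Longrightarrow> eqm J (s - s') (t - t')"
  using eqm_add[of J s t "- s'" "- t'"] eqm_minus[of J s' t'] by simp

lemma eqm_scal: "subsp J \<Longrightarrow> eqm J s t \<Longrightarrow> eqm J (scal c * s) (scal c * t)"
  using subsp_scal[of J "s - t" c] by (simp add: eqm_def algebra_simps)

lemma eqm_mono: "J \<subseteq> J' \<Longrightarrow> eqm J s t \<Longrightarrow> eqm J' s t"
  by (auto simp: eqm_def)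

lemma coset_eq_iff:
  assumes "subsp J" shows "s +o J = t +o J \<longleftrightarrow> eqm J s t"
proof
  assume "s +o J = t +o J"
  then have "s + 0 \<in> t +o J" using subsp_0[OF assms] by blast
  then show "eqm J s t" by (simp add: eqm_def set_minus_plus)
next
  have sub: "s +o J \<subseteq> t +o J" if "eqm J s t" for s t
  proof
    fix r assume "r \<in> s +o J"
    then have "r - s \<in> J" by (simp add: set_minus_plus)
    then have "r - t \<in> J" using subsp_add[OF assms, of "r - s" "s - t"] that by (simp add: eqm_def)
    then show "r \<in> t +o J" by (simp add: set_minus_plus)
  qed
  assume "eqm J s t"
  then show "s +o J = t +o J"
    using sub[of s t] sub[of t s] eqm_sym[OF assms] by blast
qed

lemma coset_eqI: "subsp J \<Longrightarrow> eqm J s t \<Longrightarrow> s +o J = t +o J"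
  by (simp add: coset_eq_iff)

lemma subsp_plus_absorb:
  assumes "subsp J" "0 \<in> M" "M \<subseteq> J" shows "M + J = J" "J + M = J"
proof -
  show "M + J = J"
  proof
    show "M + J \<subseteq> J"
      using assms(3) subsp_add[OF assms(1)] by (auto elim!: set_plus_elim)
    show "J \<subseteq> M + J"
      using set_plus_intro[OF assms(2)] by fastforce
  qed
  then show "J + M = J" by (simp add: add.commute)
qed

text \<open>Because \<open>M + J = J\<close>, cosets of different subspaces add on representatives.
  The third equation is the natural map from cosets of \<open>M\<close> to cosets of
  \<open>J\<close>, by which vectors of one module are viewed in a larger one.\<close>

lemma coset_plus:
  assumes "subsp J" "0 \<in> M" "M \<subseteq> J"
  shows "(s +o M) + (t +o J) = (s + t) +o J" "(s +o J) + (t +o M) = (s + t) +o J"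
    "(s +o M) + J = s +o J"
  unfolding set_plus_rearrange unfolding set_plus_rearrange3 subsp_plus_absorb[OF assms] by simp_all

lemma coset_plus_same: "subsp J \<Longrightarrow> (s +o J) + (t +o J) = (s + t) +o J"
  by (simp add: coset_plus subsp_0)

text \<open>\<open>M\<close> may be smaller than \<open>J\<close>; what matters is that
  \<open>a\<close> carries it into \<open>J\<close>. This covers terms in which a scalar acts on a
  coset of \<open>vac_ideal (reg z)\<close> while the result is meant modulo
  \<open>vac_ideal UNIV\<close>.\<close>

lemma lmul_coset:
  assumes "subsp J" "0 \<in> M" "\<And>r. r \<in> M \<Longrightarrow> a * r \<in> J"
  shows "lmul J a (t +o M) = (a * t) +o J"
proof -
  have "a *o M + J = J"
    by (rule subsp_plus_absorb) (use assms in \<open>auto simp: elt_set_times_def intro: bexI[of _ 0]\<close>)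
  then show ?thesis
    by (simp add: lmul_def set_times_plus_distrib set_plus_rearrange3)
qed

lemma coset_diff_coset:
  assumes "subsp J" shows "(s +o J) \<ominus> (t +o J) = (s - t) +o J"
proof -
  have "(-1) *o J = J"
    using subsp_minus[OF assms] by (auto simp: elt_set_times_def) (metis minus_minus)
  then show ?thesis
    by (simp add: coset_diff_def set_times_plus_distrib set_plus_rearrange subsp_plus_absorb
        assms subsp_0)
qed

lemma lmul_scal_coset:
  "subsp J \<Longrightarrow> subsp M \<Longrightarrow> M \<subseteq> J \<Longrightarrow> lmul J (scal c) (t +o M) = (scal c * t) +o J"
  by (rule lmul_coset) (auto simp: subsp_0 intro: subsp_scal)

text \<open>The image of a coset of \<open>M\<close> under an additive map is in general only part
  of a coset of \<open>J\<close>, and adding \<open>J\<close> completes it. Operators on cosets are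
  therefore written as an image plus \<open>J\<close>.\<close>

lemma image_coset_plus:
  fixes f :: "'l free_alg \<Rightarrow> 'm free_alg"
  assumes "subsp J" "0 \<in> M" "\<And>r. r \<in> M \<Longrightarrow> f r \<in> J" "\<And>r s. f (r + s) = f r + f s"
  shows "f ` (t +o M) + J = f t +o J"
proof -
  have f0: "f 0 = 0" using assms(4)[of 0 0] add_left_cancel[of "f 0" "f 0" 0] by simp
  have "f ` (t +o M) = f t +o f ` M"
    by (force simp: elt_set_plus_def assms(4))
  moreover have "f ` M + J = J"
    by (rule subsp_plus_absorb) (use assms f0 in \<open>auto simp: image_iff\<close>)
  ultimately show ?thesis by (simp add: set_plus_rearrange3)
qed


section \<open>The ideals\<close>

text \<open>The property that \<open>uea_ideal\<close> and \<open>vac_ideal\<close> share: the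
  second is in general only a left ideal, since a constant kills the vacuum but need not kill other
  vectors.\<close>

definition left_stable :: "'l set \<Rightarrow> 'l free_alg set \<Rightarrow> bool" where
  "left_stable H J \<longleftrightarrow> (\<forall>s\<in>free_on H. \<forall>t\<in>J. s * t \<in> J)"

lemma left_stableD: "left_stable H J \<Longrightarrow> s \<in> free_on H \<Longrightarrow> t \<in> J \<Longrightarrow> s * t \<in> J"
  by (simp add: left_stable_def)

lemma eqm_lmult:
  "left_stable H J \<Longrightarrow> a \<in> free_on H \<Longrightarrow> eqm J s t \<Longrightarrow> eqm J (a * s) (a * t)"
  using left_stableD[of H J a "s - t"] by (simp add: eqm_def right_diff_distrib)

lemma uea_lmult: "s \<in> free_on H \<Longrightarrow> r \<in> uea_ideal H \<Longrightarrow> s * r \<in> uea_ideal H"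
  using uea_ideal.mult[of s H r 1] by simp

lemma uea_rmult: "r \<in> uea_ideal H \<Longrightarrow> t \<in> free_on H \<Longrightarrow> r * t \<in> uea_ideal H"
  using uea_ideal.mult[of 1 H r t] by simp

lemma subsp_uea [simp]: "subsp (uea_ideal H)"
  by (auto simp: subsp_def intro: uea_ideal.zero uea_ideal.add uea_lmult)

lemma left_stable_uea [simp]: "left_stable H (uea_ideal H)"
  by (auto simp: left_stable_def intro: uea_lmult)

lemma eqm_rmult_uea: "eqm (uea_ideal H) s s' \<Longrightarrow> t \<in> free_on H \<Longrightarrow> eqm (uea_ideal H) (s * t) (s' * t)"
  using uea_rmult[of "s - s'" H t] by (simp add: eqm_def left_diff_distrib)

lemma subsp_vac [simp]: "subsp (vac_ideal H)"
proof -
  have "scal c * r \<in> vac_ideal H" if "r \<in> vac_ideal H" for c r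
    using that
  proof (induction rule: vac_ideal.induct)
    case (uea r)
    then show ?case by (simp add: vac_ideal.uea[OF uea_lmult[OF free_on_scal]])
  next
    case (balance t a)
    then have "(scal c * t) * a - (scal c * t) * scal (lk a 0) \<in> vac_ideal H"
      by (intro vac_ideal.balance free_on_mult) auto
    then show ?case by (simp add: right_diff_distrib mult.assoc)
  qed (auto simp: distrib_left intro: vac_ideal.add)
  then show ?thesis
    by (auto simp: subsp_def intro: vac_ideal.add vac_ideal.uea uea_ideal.zero)
qed

lemma left_stable_vac [simp]: "left_stable H (vac_ideal H)"
proof -
  have "s * r \<in> vac_ideal H" if "r \<in> vac_ideal H" "s \<in> free_on H" for s r
    using that
  proof (induction rule: vac_ideal.induct)
    case (uea r)
    then show ?case by (auto intro: vac_ideal.uea uea_lmult)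
  next
    case (balance t a)
    then have "(s * t) * a - (s * t) * scal (lk a 0) \<in> vac_ideal H"
      by (intro vac_ideal.balance free_on_mult) auto
    then show ?case by (simp add: right_diff_distrib mult.assoc)
  qed (auto simp: distrib_left intro: vac_ideal.add)
  then show ?thesis by (simp add: left_stable_def)
qed

lemma uea_mono: assumes "H \<subseteq> H'" shows "uea_ideal H \<subseteq> uea_ideal H'"
proof
  fix r assume "r \<in> uea_ideal H"
  then show "r \<in> uea_ideal H'"
    by induction (use assms in \<open>auto intro: uea_ideal.intros dest: free_on_mono[OF assms]\<close>)
qed

lemma vac_mono: assumes "H \<subseteq> H'" shows "vac_ideal H \<subseteq> vac_ideal H'"
proof
  fix r assume "r \<in> vac_ideal H"
  then show "r \<in> vac_ideal H'"
    by induction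
      (use assms uea_mono[OF assms] in \<open>auto intro: vac_ideal.intros dest: free_on_mono[OF assms]\<close>)
qed

lemma uea_vac: "H \<subseteq> H' \<Longrightarrow> uea_ideal H \<subseteq> vac_ideal H'"
  using uea_mono by (blast intro: vac_ideal.uea)

text \<open>The balancing relation with \<open>t = 1\<close>: a word of one letter has coefficient
  zero at the empty word, so constants kill the vacuum.\<close>

lemma gen_const_vac: "gen (const b) \<in> vac_ideal H"
proof -
  have "lk (gen (const b)) 0 = 0" by (simp add: gen_def zero_word_def lookup_single)
  then show ?thesis
    using vac_ideal.balance[of 1 H "gen (const b)"] by (simp add: free_on_gen)
qed

section \<open>Operators given by commutation relations\<close>

text \<open>Linear extension from the basis of words. It lives on the free algebra, where it is
  additive without side conditions; passing to a quotient is a separate step.\<close>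

definition wext :: "('l list \<Rightarrow> 'm free_alg) \<Rightarrow> 'l free_alg \<Rightarrow> 'm free_alg" where
  "wext f t = (\<Sum>w\<in>Poly_Mapping.keys t. scal (lk t w) * f (letters w))"

lemma wext_superset:
  assumes "finite K" "Poly_Mapping.keys t \<subseteq> K"
  shows "wext f t = (\<Sum>w\<in>K. scal (lk t w) * f (letters w))"
  unfolding wext_def by (rule sum.mono_neutral_left) (use assms in \<open>auto simp: in_keys_iff\<close>)

lemma wext_add: "wext f (s + t) = wext f s + wext f t"
proof -
  let ?K = "Poly_Mapping.keys s \<union> Poly_Mapping.keys t"
  have "wext f (s + t) = (\<Sum>w\<in>?K. scal (lk (s + t) w) * f (letters w))"
    by (rule wext_superset) (auto simp: keys_add)
  also have "\<dots> = (\<Sum>w\<in>?K. scal (lk s w) * f (letters w)) + (\<Sum>w\<in>?K. scal (lk t w) * f (letters w))"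
    by (simp add: lookup_add scal_add distrib_right sum.distrib)
  also have "\<dots> = wext f s + wext f t"
    by (simp add: wext_superset[of ?K])
  finally show ?thesis .
qed

lemma wext_word: "wext f (scal c * gens w) = scal c * f w"
  by (simp add: wext_def scal_gens)

lemma wext_gens: "wext f (gens w) = f w"
  using wext_word[of f 1 w] by simp

lemma wext_0 [simp]: "wext f 0 = 0"
  by (simp add: wext_def)

lemma wext_scal: "wext f (scal c * t) = scal c * wext f t"
proof -
  have "t \<in> free_on UNIV" by simp
  then show ?thesis
    by (induction rule: free_on_induct)
      (simp_all add: distrib_left wext_add scal_mult_left wext_word)
qed

lemma wext_minus: "wext f (- t) = - wext f t"
  using wext_scal[of f "-1" t] by (simp add: scal_minus)

lemma wext_diff: "wext f (s - t) = wext f s - wext f t"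
  by (metis wext_add wext_minus uminus_add_conv_diff add.commute)

lemma wext_free_on:
  assumes "t \<in> free_on H" "\<And>w. set w \<subseteq> H \<Longrightarrow> f w \<in> free_on H'"
  shows "wext f t \<in> free_on H'"
  using assms(1)
  by (induction rule: free_on_induct) (auto simp: wext_add wext_word assms(2) intro: free_on_add free_on_mult)

lemma free_map_wext: "free_map \<phi> = wext (\<lambda>w. gens (map \<phi> w))"
  by (rule ext) (simp add: free_map_def wext_def scal_gens)

lemma free_map_mult: "free_map \<phi> (s * t) = free_map \<phi> s * free_map \<phi> t"
proof -
  have *: "free_map \<phi> (gens v * t) = free_map \<phi> (gens v) * free_map \<phi> t" for v
  proof -
    have "t \<in> free_on UNIV" by simp
    then show ?thesis
    proof (induction rule: free_on_induct)
      case (word c w)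
      have "gens v * (scal c * gens w) = scal c * gens (v @ w)"
        by (simp add: mult_scal_left gens_append)
      then show ?case
        unfolding \<open>gens v * (scal c * gens w) = _\<close> free_map_wext wext_word wext_gens
        by (simp add: gens_append mult_scal_left)
    qed (simp_all add: distrib_left free_map_wext wext_add)
  qed
  have "s \<in> free_on UNIV" by simp
  then show ?thesis
  proof (induction rule: free_on_induct)
    case (word c w)
    have "free_map \<phi> (scal c * gens w * t) = scal c * free_map \<phi> (gens w * t)"
      by (simp add: mult.assoc free_map_wext wext_scal)
    then show ?case
      by (simp add: * mult.assoc) (simp add: free_map_wext wext_word wext_gens mult.assoc)
  qed (simp_all add: distrib_right free_map_wext wext_add)
qed

lemma free_map_gen: "free_map \<phi> (gen \<alpha>) = gen (\<phi> \<alpha>)"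
  using wext_gens[of "\<lambda>w. gens (map \<phi> w)" "[\<alpha>]"] by (simp add: free_map_wext gens_Cons)

lemma free_map_scal: "free_map \<phi> (scal c) = scal c"
  using wext_word[of "\<lambda>w. gens (map \<phi> w)" c "[]"] by (simp add: free_map_wext)

lemma free_map_add: "free_map \<phi> (s + t) = free_map \<phi> s + free_map \<phi> t"
  and free_map_diff: "free_map \<phi> (s - t) = free_map \<phi> s - free_map \<phi> t"
  and free_map_0: "free_map \<phi> 0 = 0"
  by (simp_all add: free_map_wext wext_add wext_diff)

text \<open>The rule O_k \<alpha> = \<alpha> O_k + e(k, \<alpha>) + O_(act k \<alpha>) with O_k 1 =
  v(k), solved letter by letter. Both A(\<beta>), indexed by meromorphic maps, and \<iota>, indexed
  by the Lie algebra of values, have this form. A whole family is treated at once because the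
  commutator brings in other members of it.\<close>

primrec op_word :: "('k \<Rightarrow> 'l \<Rightarrow> 'k) \<Rightarrow> ('k \<Rightarrow> 'l \<Rightarrow> 'l free_alg) \<Rightarrow> ('k \<Rightarrow> 'l free_alg) \<Rightarrow>
    'l list \<Rightarrow> 'k \<Rightarrow> 'l free_alg" where
  "op_word act e v [] k = v k"
| "op_word act e v (\<alpha> # w) k =
     gen \<alpha> * op_word act e v w k + e k \<alpha> * gens w + op_word act e v w (act k \<alpha>)"

definition op_ext :: "('k \<Rightarrow> 'l \<Rightarrow> 'k) \<Rightarrow> ('k \<Rightarrow> 'l \<Rightarrow> 'l free_alg) \<Rightarrow> ('k \<Rightarrow> 'l free_alg) \<Rightarrow>
    'k \<Rightarrow> 'l free_alg \<Rightarrow> 'l free_alg" where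
  "op_ext act e v k = wext (\<lambda>w. op_word act e v w k)"

lemma op_ext_1: "op_ext act e v k 1 = v k"
  using wext_gens[of "\<lambda>w. op_word act e v w k" "[]"] by (simp add: op_ext_def)

lemma op_ext_add: "op_ext act e v k (s + t) = op_ext act e v k s + op_ext act e v k t"
  and op_ext_diff: "op_ext act e v k (s - t) = op_ext act e v k s - op_ext act e v k t"
  and op_ext_scal: "op_ext act e v k (scal c * t) = scal c * op_ext act e v k t"
  and op_ext_0: "op_ext act e v k 0 = 0"
  by (simp_all add: op_ext_def wext_add wext_diff wext_scal)

lemma op_ext_gen: "op_ext act e v k (gen \<alpha> * t) =
    gen \<alpha> * op_ext act e v k t + e k \<alpha> * t + op_ext act e v (act k \<alpha>) t"
proof -
  have "t \<in> free_on UNIV" by simp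
  then show ?thesis
  proof (induction rule: free_on_induct)
    case (add s t)
    then show ?case by (simp add: distrib_left op_ext_add)
  next
    case (word c w)
    have "gen \<alpha> * (scal c * gens w) = scal c * gens (\<alpha> # w)"
      by (simp add: gens_Cons mult_scal_left)
    then show ?case
      by (simp add: op_ext_def wext_word distrib_left mult_scal_left)
  qed
qed

text \<open>\<open>act_lie\<close> says that \<open>act\<close> is a right action and
  \<open>e_lie\<close> is the cocycle condition for \<open>e\<close>; together they make the family
  respect the relator of a bracket. The laws for \<open>e\<close> are required modulo the two-sided
  ideal, since \<open>e k \<alpha>\<close> has further letters on its right, those for
  \<open>v\<close> only modulo \<open>N\<close>, which may be a left ideal.\<close>

locale operators =
  fixes H :: "'l::complex_lie_algebra set" and N :: "'l free_alg set"
    and act :: "'k::complex_lie_algebra \<Rightarrow> 'l \<Rightarrow> 'k" and e :: "'k \<Rightarrow> 'l \<Rightarrow> 'l free_alg"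
    and v :: "'k \<Rightarrow> 'l free_alg"
  assumes N: "subsp N" "left_stable H N" "uea_ideal H \<subseteq> N"
    and H_add: "\<alpha> \<in> H \<Longrightarrow> \<beta> \<in> H \<Longrightarrow> \<alpha> + \<beta> \<in> H"
    and H_scale: "\<alpha> \<in> H \<Longrightarrow> c *\<^sub>C \<alpha> \<in> H"
    and H_lie: "\<alpha> \<in> H \<Longrightarrow> \<beta> \<in> H \<Longrightarrow> lie \<alpha> \<beta> \<in> H"
    and v_free: "v k \<in> free_on H"
    and e_free: "\<alpha> \<in> H \<Longrightarrow> e k \<alpha> \<in> free_on H"
    and v_add: "eqm N (v (k + k')) (v k + v k')"
    and v_scale: "eqm N (v (c *\<^sub>C k)) (scal c * v k)"
    and e_add: "\<alpha> \<in> H \<Longrightarrow> eqm (uea_ideal H) (e (k + k') \<alpha>) (e k \<alpha> + e k' \<alpha>)"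
    and e_scale: "\<alpha> \<in> H \<Longrightarrow> eqm (uea_ideal H) (e (c *\<^sub>C k) \<alpha>) (scal c * e k \<alpha>)"
    and e_add_right: "\<alpha> \<in> H \<Longrightarrow> \<beta> \<in> H \<Longrightarrow> eqm (uea_ideal H) (e k (\<alpha> + \<beta>)) (e k \<alpha> + e k \<beta>)"
    and e_scale_right: "\<alpha> \<in> H \<Longrightarrow> eqm (uea_ideal H) (e k (c *\<^sub>C \<alpha>)) (scal c * e k \<alpha>)"
    and act_add: "\<alpha> \<in> H \<Longrightarrow> act (k + k') \<alpha> = act k \<alpha> + act k' \<alpha>"
    and act_scale: "\<alpha> \<in> H \<Longrightarrow> act (c *\<^sub>C k) \<alpha> = c *\<^sub>C act k \<alpha>"
    and act_add_right: "\<alpha> \<in> H \<Longrightarrow> \<beta> \<in> H \<Longrightarrow> act k (\<alpha> + \<beta>) = act k \<alpha> + act k \<beta>"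
    and act_scale_right: "\<alpha> \<in> H \<Longrightarrow> act k (c *\<^sub>C \<alpha>) = c *\<^sub>C act k \<alpha>"
    and act_lie: "\<alpha> \<in> H \<Longrightarrow> \<beta> \<in> H \<Longrightarrow> act k (lie \<alpha> \<beta>) + act (act k \<beta>) \<alpha> = act (act k \<alpha>) \<beta>"
    and e_lie: "\<alpha> \<in> H \<Longrightarrow> \<beta> \<in> H \<Longrightarrow> eqm (uea_ideal H) (e k (lie \<alpha> \<beta>))
        (gen \<alpha> * e k \<beta> - e k \<beta> * gen \<alpha> - (gen \<beta> * e k \<alpha> - e k \<alpha> * gen \<beta>)
         + e (act k \<alpha>) \<beta> - e (act k \<beta>) \<alpha>)"
begin

abbreviation "Op \<equiv> op_ext act e v"

lemma op_word_free: "set w \<subseteq> H \<Longrightarrow> op_word act e v w k \<in> free_on H"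
  by (induction w arbitrary: k)
    (auto intro!: free_on_add free_on_mult free_on_gen free_on_gens v_free e_free)

lemma Op_free: "t \<in> free_on H \<Longrightarrow> Op k t \<in> free_on H"
  unfolding op_ext_def by (rule wext_free_on) (auto intro: op_word_free)

lemma eqm_uea_mult: "eqm (uea_ideal H) s s' \<Longrightarrow> t \<in> free_on H \<Longrightarrow> eqm N (s * t) (s' * t)"
  using eqm_rmult_uea eqm_mono[OF N(3)] by blast

lemma op_word_add:
  "set w \<subseteq> H \<Longrightarrow> eqm N (op_word act e v w (k + k')) (op_word act e v w k + op_word act e v w k')"
proof (induction w arbitrary: k k')
  case (Cons \<alpha> w)
  have 1: "eqm N (gen \<alpha> * op_word act e v w (k + k'))
      (gen \<alpha> * (op_word act e v w k + op_word act e v w k'))"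
    by (rule eqm_lmult[OF N(2)]) (use Cons in \<open>auto intro: free_on_gen\<close>)
  have 2: "eqm N (e (k + k') \<alpha> * gens w) ((e k \<alpha> + e k' \<alpha>) * gens w)"
    by (rule eqm_uea_mult) (use Cons in \<open>auto intro: e_add free_on_gens\<close>)
  have 3: "eqm N (op_word act e v w (act (k + k') \<alpha>))
      (op_word act e v w (act k \<alpha>) + op_word act e v w (act k' \<alpha>))"
    using Cons by (simp add: act_add)
  show ?case
    using eqm_add[OF N(1) eqm_add[OF N(1) 1 2] 3] by (simp add: algebra_simps)
qed (simp add: v_add)

lemma op_word_scale:
  "set w \<subseteq> H \<Longrightarrow> eqm N (op_word act e v w (c *\<^sub>C k)) (scal c * op_word act e v w k)"
proof (induction w arbitrary: k)
  case (Cons \<alpha> w)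
  have 1: "eqm N (gen \<alpha> * op_word act e v w (c *\<^sub>C k)) (gen \<alpha> * (scal c * op_word act e v w k))"
    by (rule eqm_lmult[OF N(2)]) (use Cons in \<open>auto intro: free_on_gen\<close>)
  have 2: "eqm N (e (c *\<^sub>C k) \<alpha> * gens w) ((scal c * e k \<alpha>) * gens w)"
    by (rule eqm_uea_mult) (use Cons in \<open>auto intro: e_scale free_on_gens\<close>)
  have 3: "eqm N (op_word act e v w (act (c *\<^sub>C k) \<alpha>)) (scal c * op_word act e v w (act k \<alpha>))"
    using Cons by (simp add: act_scale)
  show ?case
    using eqm_add[OF N(1) eqm_add[OF N(1) 1 2] 3]
    by (simp add: distrib_left mult_scal_left mult.assoc)
qed (simp add: v_scale)

lemma Op_add:
  assumes "t \<in> free_on H" shows "eqm N (Op (k + k') t) (Op k t + Op k' t)"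
  using assms
proof (induction rule: free_on_induct)
  case (add s t)
  show ?case using eqm_add[OF N(1) add] by (simp add: op_ext_add algebra_simps)
next
  case (word c w)
  show ?case using eqm_scal[OF N(1) op_word_add[OF word], of c k k']
    by (simp add: op_ext_def wext_word distrib_left)
qed

lemma Op_scale:
  assumes "t \<in> free_on H" shows "eqm N (Op (c *\<^sub>C k) t) (scal c * Op k t)"
  using assms
proof (induction rule: free_on_induct)
  case (add s t)
  show ?case using eqm_add[OF N(1) add] by (simp add: op_ext_add distrib_left)
next
  case (word d w)
  show ?case using eqm_scal[OF N(1) op_word_scale[OF word], of d c k]
    by (simp add: op_ext_def wext_word scal_mult_left mult.commute)
qed

text \<open>A relator stands in the middle of a product: the factor \<open>t\<close> on its right is
  carried along, whereas letters on its left are peeled off by the commutation rule.\<close>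

lemma Op_ideal_aux:
  assumes "r \<in> uea_ideal H" "t \<in> free_on H"
  shows "Op k (r * t) \<in> N"
proof -
  \<comment> \<open>Membership in \<open>uea_ideal H\<close> is part of \<open>M\<close> because
    passing a letter \<alpha> also produces \<open>e k \<alpha> * r\<close>; all indices
    \<open>k\<close> are taken together because \<open>act\<close> changes them.\<close>
  define M where "M = {r \<in> uea_ideal H. \<forall>k. Op k r \<in> N}"
  have M_add: "s + t \<in> M" if "s \<in> M" "t \<in> M" for s t
    using that by (auto simp: M_def op_ext_add intro: uea_ideal.add subsp_add[OF N(1)])
  have M_gen: "gen \<alpha> * r \<in> M" if "\<alpha> \<in> H" "r \<in> M" for \<alpha> r
  proof -
    have "gen \<alpha> * Op k r + e k \<alpha> * r + Op (act k \<alpha>) r \<in> N" for k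
      using that N(3)
      by (intro subsp_add[OF N(1)] left_stableD[OF N(2)]) (auto simp: M_def intro: free_on_gen e_free)
    then show ?thesis
      using that by (auto simp: M_def op_ext_gen intro: uea_lmult free_on_gen)
  qed
  have M_scal: "scal c * r \<in> M" if "r \<in> M" for c r
    using that by (auto simp: M_def op_ext_scal intro: uea_lmult subsp_scal[OF N(1)])
  have M_gens: "gens w * r \<in> M" if "set w \<subseteq> H" "r \<in> M" for w r
    using that by (induction w) (auto simp: gens_Cons mult.assoc intro: M_gen)
  have M_mult: "s * r \<in> M" if "s \<in> free_on H" "r \<in> M" for s r
    using that(1)
    by (induction rule: free_on_induct)
      (auto simp: distrib_right mult.assoc intro: M_add M_scal M_gens that(2))
  have "\<forall>t\<in>free_on H. r * t \<in> M"
    using assms(1)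
  proof (induction rule: uea_ideal.induct)
    case (rel_add \<alpha> \<beta>)
    show ?case
    proof
      fix t assume t: "t \<in> free_on H"
      have "Op k ((gen (\<alpha> + \<beta>) - gen \<alpha> - gen \<beta>) * t) \<in> N" for k
      proof -
        have *: "gen (\<alpha> + \<beta>) - gen \<alpha> - gen \<beta> \<in> uea_ideal H"
          using rel_add by (rule uea_ideal.rel_add)
        have "Op k ((gen (\<alpha> + \<beta>) - gen \<alpha> - gen \<beta>) * t) =
            (gen (\<alpha> + \<beta>) - gen \<alpha> - gen \<beta>) * Op k t + (e k (\<alpha> + \<beta>) * t - (e k \<alpha> + e k \<beta>) * t)
            + (Op (act k \<alpha> + act k \<beta>) t - (Op (act k \<alpha>) t + Op (act k \<beta>) t))"
          using rel_add
          by (simp add: left_diff_distrib op_ext_diff op_ext_gen act_add_right)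
            (simp add: algebra_simps)
        also have "\<dots> \<in> N"
          using uea_rmult[OF * Op_free[OF t]] N(3) eqm_uea_mult[OF e_add_right[OF rel_add] t]
            Op_add[OF t, of "act k \<alpha>" "act k \<beta>"]
          by (intro subsp_add[OF N(1)]) (auto simp: eqm_def)
        finally show ?thesis .
      qed
      then show "(gen (\<alpha> + \<beta>) - gen \<alpha> - gen \<beta>) * t \<in> M"
        unfolding M_def using uea_rmult[OF uea_ideal.rel_add[OF rel_add] t] by simp
    qed
  next
    case (rel_scale \<alpha> c)
    show ?case
    proof
      fix t assume t: "t \<in> free_on H"
      have "Op k ((gen (c *\<^sub>C \<alpha>) - scal c * gen \<alpha>) * t) \<in> N" for k
      proof -
        have *: "gen (c *\<^sub>C \<alpha>) - scal c * gen \<alpha> \<in> uea_ideal H"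
          using rel_scale by (rule uea_ideal.rel_scale)
        have "Op k ((gen (c *\<^sub>C \<alpha>) - scal c * gen \<alpha>) * t) =
            (gen (c *\<^sub>C \<alpha>) - scal c * gen \<alpha>) * Op k t + (e k (c *\<^sub>C \<alpha>) * t - (scal c * e k \<alpha>) * t)
            + (Op (c *\<^sub>C act k \<alpha>) t - scal c * Op (act k \<alpha>) t)"
          using rel_scale
          by (simp add: left_diff_distrib op_ext_diff op_ext_gen op_ext_scal act_scale_right mult.assoc)
            (simp add: algebra_simps)
        also have "\<dots> \<in> N"
          using uea_rmult[OF * Op_free[OF t]] N(3) eqm_uea_mult[OF e_scale_right[OF rel_scale] t]
            Op_scale[OF t, of c "act k \<alpha>"]
          by (intro subsp_add[OF N(1)]) (auto simp: eqm_def)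
        finally show ?thesis .
      qed
      then show "(gen (c *\<^sub>C \<alpha>) - scal c * gen \<alpha>) * t \<in> M"
        unfolding M_def using uea_rmult[OF uea_ideal.rel_scale[OF rel_scale] t] by simp
    qed
  next
    case (rel_lie \<alpha> \<beta>)
    show ?case
    proof
      fix t assume t: "t \<in> free_on H"
      let ?r = "gen \<alpha> * gen \<beta> - gen \<beta> * gen \<alpha> - gen (lie \<alpha> \<beta>)"
      have *: "?r \<in> uea_ideal H"
        using rel_lie by (rule uea_ideal.rel_lie)
      have "Op k (?r * t) \<in> N" for k
      proof -
        let ?E = "gen \<alpha> * e k \<beta> - e k \<beta> * gen \<alpha> - (gen \<beta> * e k \<alpha> - e k \<alpha> * gen \<beta>)
         + e (act k \<alpha>) \<beta> - e (act k \<beta>) \<alpha>"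
        have "Op k (?r * t) = Op k (gen \<alpha> * (gen \<beta> * t)) - Op k (gen \<beta> * (gen \<alpha> * t))
            - Op k (gen (lie \<alpha> \<beta>) * t)"
          by (simp add: left_diff_distrib op_ext_diff mult.assoc)
        \<comment> \<open>The mixed terms, \<alpha> times the operator of
          \<open>act k \<beta>\<close> and \<beta> times that of \<open>act k \<alpha>\<close>,
          cancel between the two orders. What is left is settled by \<open>e_lie\<close> and
          \<open>act_lie\<close>.\<close>
        also have "\<dots> = ?r * Op k t - (e k (lie \<alpha> \<beta>) * t - ?E * t)
            + (Op (act (act k \<alpha>) \<beta>) t - (Op (act k (lie \<alpha> \<beta>)) t + Op (act (act k \<beta>) \<alpha>) t))"
          by (simp add: op_ext_gen algebra_simps)
        also have "\<dots> \<in> N"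
        proof (rule subsp_add[OF N(1) subsp_diff[OF N(1)]])
          show "?r * Op k t \<in> N" using uea_rmult[OF * Op_free[OF t]] N(3) by blast
          show "e k (lie \<alpha> \<beta>) * t - ?E * t \<in> N"
            using eqm_uea_mult[OF e_lie[OF rel_lie] t] by (simp add: eqm_def)
          show "Op (act (act k \<alpha>) \<beta>) t - (Op (act k (lie \<alpha> \<beta>)) t + Op (act (act k \<beta>) \<alpha>) t) \<in> N"
            using Op_add[OF t, of "act k (lie \<alpha> \<beta>)" "act (act k \<beta>) \<alpha>"] act_lie[OF rel_lie, of k]
            by (simp add: eqm_def)
        qed
        finally show ?thesis .
      qed
      then show "?r * t \<in> M"
        unfolding M_def using uea_rmult[OF * t] by simp
    qed
  next
    case zero
    show ?case by (simp add: M_def uea_ideal.zero op_ext_0 subsp_0[OF N(1)])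
  next
    case (add s t)
    then show ?case by (simp add: distrib_right M_add)
  next
    case (mult s r t)
    then show ?case by (simp add: mult.assoc M_mult free_on_mult)
  qed
  with assms(2) show ?thesis by (simp add: M_def)
qed

lemma Op_ideal: "r \<in> uea_ideal H \<Longrightarrow> Op k r \<in> N"
  using Op_ideal_aux[of r 1 k] by simp

end

unbundle fps_syntax

section \<open>Meromorphic functions on the projective line\<close>

lemma chart_0 [simp]: "chart z 0 = z"
  by (cases z) auto

lemma inj_chart: "inj (chart z)"
  by (cases z) (auto simp: inj_def split: if_splits)

lemma eventually_chart_notin: "finite S \<Longrightarrow> eventually (\<lambda>h. chart z h \<notin> S) (at 0)"
  using islimpt_finite[OF finite_vimageI[OF _ inj_chart, of S z], of 0]
  by (auto simp: islimpt_conv_frequently_at frequently_def vimage_def)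

text \<open>The expansion in the local coordinate \<open>coord z\<close>. It is insensitive to
  values at finitely many points, which is all the information lost in passing to
  \<open>mero\<close>.\<close>

definition LE :: "proj_line \<Rightarrow> (proj_line \<Rightarrow> complex) \<Rightarrow> complex fls" where
  "LE z f = laurent_expansion (\<lambda>h. f (chart z h)) 0"

lemma LE_expansion: "meromorphic_fun f \<Longrightarrow> (\<lambda>h. f (chart z h)) has_laurent_expansion LE z f"
  using meromorphic_on_imp_has_laurent_expansion[of "\<lambda>h. f (chart z h)" "{0}" 0]
  by (simp add: meromorphic_fun_def LE_def)

lemma LE_eqI: "(\<lambda>h. f (chart z h)) has_laurent_expansion F \<Longrightarrow> LE z f = F"
  unfolding LE_def by (rule laurent_expansion_0_eqI)

lemma LE_cong: "finite {p. f p \<noteq> g p} \<Longrightarrow> LE z f = LE z g"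
  unfolding LE_def
  by (rule laurent_expansion_cong) (use eventually_chart_notin[of "{p. f p \<noteq> g p}" z] in auto)

lemma LE_const: "LE z (\<lambda>p. c) = fls_const c"
  by (rule LE_eqI) simp

lemma LE_diff: "meromorphic_fun f \<Longrightarrow> meromorphic_fun g \<Longrightarrow> LE z (\<lambda>p. f p - g p) = LE z f - LE z g"
  by (intro LE_eqI has_laurent_expansion_diff LE_expansion)

lemma LE_mult: "meromorphic_fun f \<Longrightarrow> meromorphic_fun g \<Longrightarrow> LE z (\<lambda>p. f p * g p) = LE z f * LE z g"
  by (intro LE_eqI has_laurent_expansion_mult LE_expansion)

lemma LE_cmult: "meromorphic_fun f \<Longrightarrow> LE z (\<lambda>p. c * f p) = fls_const c * LE z f"
  by (intro LE_eqI has_laurent_expansion_cmult_left LE_expansion)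

lemma LE_power: "meromorphic_fun f \<Longrightarrow> LE z (\<lambda>p. f p ^ n) = LE z f ^ n"
  by (intro LE_eqI has_laurent_expansion_power LE_expansion)

lemma LE_sum: "(\<And>i. i \<in> I \<Longrightarrow> meromorphic_fun (f i)) \<Longrightarrow>
    LE z (\<lambda>p. \<Sum>i\<in>I. f i p) = (\<Sum>i\<in>I. LE z (f i))"
  by (intro LE_eqI has_laurent_expansion_sum LE_expansion)

lemma meromorphic_fun_const [simp]: "meromorphic_fun (\<lambda>p. c)"
  by (simp add: meromorphic_fun_def meromorphic_on_const)

lemma meromorphic_fun_add: "meromorphic_fun f \<Longrightarrow> meromorphic_fun g \<Longrightarrow> meromorphic_fun (\<lambda>p. f p + g p)"
  and meromorphic_fun_diff: "meromorphic_fun f \<Longrightarrow> meromorphic_fun g \<Longrightarrow> meromorphic_fun (\<lambda>p. f p - g p)"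
  and meromorphic_fun_inverse: "meromorphic_fun f \<Longrightarrow> meromorphic_fun (\<lambda>p. inverse (f p))"
  and meromorphic_fun_divide: "meromorphic_fun f \<Longrightarrow> meromorphic_fun g \<Longrightarrow> meromorphic_fun (\<lambda>p. f p / g p)"
  and meromorphic_fun_power: "meromorphic_fun f \<Longrightarrow> meromorphic_fun (\<lambda>p. f p ^ n)"
  by (auto simp: meromorphic_fun_def intro!: meromorphic_intros)

lemma meromorphic_fun_sum: "(\<And>i. i \<in> I \<Longrightarrow> meromorphic_fun (f i)) \<Longrightarrow> meromorphic_fun (\<lambda>p. \<Sum>i\<in>I. f i p)"
  by (auto simp: meromorphic_fun_def intro!: meromorphic_on_sum)

lemma holo_at_LE:
  assumes "holo_at f z"
  shows "n < 0 \<Longrightarrow> LE z f $$ n = 0" "LE z f $$ 0 = f z" "LE z f $$ 1 = diff f z"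
proof -
  let ?g = "\<lambda>h. f (chart z h)"
  have "?g has_fps_expansion fps_expansion ?g 0"
    using assms by (intro analytic_at_imp_has_fps_expansion_0) (simp add: holo_at_def)
  then have "LE z f = fps_to_fls (fps_expansion ?g 0)" and 0: "?g 0 = fps_nth (fps_expansion ?g 0) 0"
    unfolding has_fps_expansion_to_laurent by (auto intro: LE_eqI)
  then show "n < 0 \<Longrightarrow> LE z f $$ n = 0" "LE z f $$ 0 = f z" "LE z f $$ 1 = diff f z"
    by (simp_all add: diff_def fps_expansion_def)
qed

lemma meromorphic_fun_Fin:
  assumes "meromorphic_fun f" shows "(\<lambda>a. f (Fin a)) meromorphic_on UNIV"
proof -
  have "(\<lambda>a. f (Fin a)) meromorphic_on {b}" for b
  proof -
    have "(\<lambda>h. f (Fin (b + h))) meromorphic_on {0}"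
      using assms[unfolded meromorphic_fun_def, rule_format, of "Fin b"] by simp
    then have "(\<lambda>a. f (Fin (b + (a - b)))) meromorphic_on {b}"
      by (rule meromorphic_on_compose) (simp_all add: analytic_on_diff)
    then show ?thesis by simp
  qed
  then show ?thesis by (subst meromorphic_on_meromorphic_at) simp
qed

text \<open>The singularities are sparse in the plane, and meromorphy at \<open>Infty\<close>
  confines them to a disc; compactness of the disc makes them finite in number.\<close>

lemma finite_singularities:
  assumes "meromorphic_fun f" shows "finite {a. \<not> (\<lambda>a. f (Fin a)) analytic_on {a}}"
proof -
  let ?D = "{a. \<not> (\<lambda>a. f (Fin a)) analytic_on {a}}"
  have sparse: "?D sparse_in UNIV"
    using meromorphic_on_imp_sparse_singularities[OF meromorphic_fun_Fin[OF assms]] by simp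
  have "isolated_singularity_at (\<lambda>h. f (chart Infty h)) 0"
    using assms[unfolded meromorphic_fun_def, rule_format, of Infty]
    by (simp only: meromorphic_at_iff)
  then obtain r where r: "r > 0" "(\<lambda>h. f (chart Infty h)) analytic_on ball 0 r - {0}"
    unfolding isolated_singularity_at_def by blast
  have "?D \<subseteq> cball 0 (inverse r)"
  proof
    fix a assume a: "a \<in> ?D"
    show "a \<in> cball 0 (inverse r)"
    proof (rule ccontr)
      assume "a \<notin> cball 0 (inverse r)"
      then have na: "inverse r < norm a" by simp
      then have "a \<noteq> 0" using r by auto
      have "norm (inverse a) < r"
        using less_imp_inverse_less[OF na] r by (simp add: norm_inverse)
      then have "(\<lambda>h. f (chart Infty h)) analytic_on {inverse a}"
        using r \<open>a \<noteq> 0\<close> by (auto intro: analytic_on_subset)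
      then have "((\<lambda>h. f (chart Infty h)) \<circ> inverse) analytic_on {a}"
        by (intro analytic_on_compose) (use \<open>a \<noteq> 0\<close> in \<open>auto intro!: analytic_intros\<close>)
      also have "?this \<longleftrightarrow> (\<lambda>a. f (Fin a)) analytic_on {a}"
      proof (rule analytic_at_cong)
        have "eventually (\<lambda>x. x \<in> - {0}) (nhds a)"
          using \<open>a \<noteq> 0\<close> by (intro eventually_nhds_in_open) auto
        then show "\<forall>\<^sub>F x in nhds a. ((\<lambda>h. f (chart Infty h)) \<circ> inverse) x = f (Fin x)"
          by eventually_elim auto
      qed simp
      finally show False using a by simp
    qed
  qed
  then have "?D = cball 0 (inverse r) \<inter> ?D" by blast
  moreover have "finite (cball 0 (inverse r) \<inter> ?D)"
    using sparse_in_compact_finite[of ?D "cball 0 (inverse r)"] sparse_in_subset[OF sparse, of "cball 0 (inverse r)"]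
    by simp
  ultimately show ?thesis by simp
qed

lemma finite_poles:
  assumes "meromorphic_fun f" shows "finite {z. \<exists>n<0. LE z f $$ n \<noteq> 0}"
proof (rule finite_subset)
  let ?D = "{a. \<not> (\<lambda>a. f (Fin a)) analytic_on {a}}"
  show "{z. \<exists>n<0. LE z f $$ n \<noteq> 0} \<subseteq> insert Infty (Fin ` ?D)"
  proof
    fix z assume "z \<in> {z. \<exists>n<0. LE z f $$ n \<noteq> 0}"
    then have nh: "\<not> holo_at f z" using holo_at_LE(1) by blast
    show "z \<in> insert Infty (Fin ` ?D)"
    proof (cases z)
      case (Fin a)
      have "a \<in> ?D"
      proof (rule ccontr)
        assume "a \<notin> ?D"
        then have "(\<lambda>a. f (Fin a)) analytic_on {a + 0}" by simp
        then have "((\<lambda>a. f (Fin a)) \<circ> (\<lambda>h. a + h)) analytic_on {0}"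
          by (intro analytic_on_compose) (auto intro!: analytic_intros)
        then have "holo_at f (Fin a)" by (simp add: holo_at_def o_def)
        then show False using nh Fin by simp
      qed
      then show ?thesis using Fin by simp
    qed simp
  qed
  show "finite (insert Infty (Fin ` ?D))"
    using finite_singularities[OF assms] by simp
qed

text \<open>Liouville's theorem. As \<open>f\<close> may have wrong values at finitely many points,
  it is applied to \<open>remove_sings\<close> of the restriction to the plane; the expansion at
  \<open>Infty\<close> supplies a limit at infinity, which is the constant.\<close>

lemma regular_imp_constant:
  assumes f: "meromorphic_fun f" and reg: "\<And>z n. n < 0 \<Longrightarrow> LE z f $$ n = 0"
  obtains c where "finite {p. f p \<noteq> c}"
proof -
  let ?F = "\<lambda>a. f (Fin a)" and ?D = "{a. \<not> (\<lambda>a. f (Fin a)) analytic_on {a}}"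
  have lim: "((\<lambda>h. f (chart z h)) \<longlongrightarrow> LE z f $$ 0) (at 0)" for z
  proof (rule has_laurent_expansion_imp_tendsto_0[OF LE_expansion[OF f]])
    show "fls_subdegree (LE z f) \<ge> 0"
      using reg by (cases "LE z f = 0") (auto intro: fls_subdegree_geI)
  qed
  have merF: "?F meromorphic_on UNIV" by (rule meromorphic_fun_Fin[OF f])
  have "remove_sings ?F analytic_on {a}" for a
  proof (rule remove_sings_analytic_at)
    show "isolated_singularity_at ?F a"
      using meromorphic_on_subset[OF merF, of "{a}"] by (simp add: meromorphic_at_iff)
    have "((\<lambda>h. ?F (a + h)) \<longlongrightarrow> LE (Fin a) f $$ 0) (at 0)" using lim[of "Fin a"] by simp
    then show "?F \<midarrow>a\<rightarrow> LE (Fin a) f $$ 0" by (simp add: LIM_offset_zero_iff)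
  qed
  then have hol: "remove_sings ?F holomorphic_on UNIV"
    using analytic_on_analytic_at analytic_imp_holomorphic by blast
  have ev: "eventually (\<lambda>a. a \<notin> ?D) at_infinity"
  proof -
    obtain B where "\<And>a. a \<in> ?D \<Longrightarrow> norm a \<le> B"
      using finite_imp_bounded[OF finite_singularities[OF f]] unfolding bounded_iff by blast
    then have "norm a \<ge> B + 1 \<Longrightarrow> a \<notin> ?D" for a by fastforce
    then show ?thesis unfolding eventually_at_infinity by blast
  qed
  have "((\<lambda>h. f (chart Infty h)) \<longlongrightarrow> LE Infty f $$ 0) (at 0)" by (rule lim)
  then have "((\<lambda>h. ?F (inverse h)) \<longlongrightarrow> LE Infty f $$ 0) (at 0)"
    by (rule Lim_transform_eventually) (auto simp: eventually_at_filter)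
  then have "(?F \<longlongrightarrow> LE Infty f $$ 0) at_infinity"
    by (simp add: lim_at_infinity_0 o_def)
  then have "(remove_sings ?F \<longlongrightarrow> LE Infty f $$ 0) at_infinity"
    by (rule Lim_transform_eventually) (use ev in \<open>auto elim!: eventually_mono\<close>)
  then have eq: "remove_sings ?F a = LE Infty f $$ 0" for a
    using Liouville_weak[OF hol] by blast
  have "{p. f p \<noteq> LE Infty f $$ 0} \<subseteq> insert Infty (Fin ` ?D)"
  proof
    fix p assume p: "p \<in> {p. f p \<noteq> LE Infty f $$ 0}"
    show "p \<in> insert Infty (Fin ` ?D)"
    proof (cases p)
      case (Fin a)
      then show ?thesis using p eq[of a] remove_sings_at_analytic[of ?F a] by auto
    qed simp
  qed
  then have "finite {p. f p \<noteq> LE Infty f $$ 0}"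
    using finite_singularities[OF f] by (auto intro: finite_subset)
  then show ?thesis by (rule that)
qed


subsection \<open>Partial fractions\<close>

text \<open>\<open>pol y\<close> has its only pole, a simple one, at \<open>y\<close>; it is \<open>1 / coord y\<close>, up to dummy values.\<close>

fun pol :: "proj_line \<Rightarrow> proj_line \<Rightarrow> complex" where
  "pol (Fin b) (Fin a) = inverse (a - b)"
| "pol (Fin b) Infty = 0"
| "pol Infty (Fin a) = a"
| "pol Infty Infty = 0"

lemma pol_chart: "pol y (chart y h) = inverse h"
  by (cases y) auto

lemma holo_at_pol: "p \<noteq> y \<Longrightarrow> holo_at (pol y) p"
proof (cases y; cases p)
  fix b q assume *: "y = Fin b" "p = Fin q" "p \<noteq> y"
  then have "(\<lambda>h. inverse (q + h - b)) analytic_on {0}" by (auto intro!: analytic_intros)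
  then show ?thesis using * by (simp add: holo_at_def)
next
  fix b assume *: "y = Fin b" "p = Infty"
  have "(\<lambda>h. h / (1 - b * h)) analytic_on {0}" by (auto intro!: analytic_intros)
  moreover have "pol (Fin b) (chart Infty h) = h / (1 - b * h)" for h
    by (cases "1 - b * h = 0") (auto simp: field_simps)
  ultimately show ?thesis using * by (simp add: holo_at_def)
next
  fix q assume *: "y = Infty" "p = Fin q"
  have "(\<lambda>h. q + h) analytic_on {0}" by (auto intro!: analytic_intros)
  then show ?thesis using * by (simp add: holo_at_def)
qed auto

lemma meromorphic_fun_pol [simp]: "meromorphic_fun (pol y)"
  unfolding meromorphic_fun_def
proof
  fix p
  show "(\<lambda>h. pol y (chart p h)) meromorphic_on {0}"
  proof (cases "p = y")
    case True
    then show ?thesis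
      using meromorphic_on_inverse[OF meromorphic_on_id'[of "{0}"]] by (simp add: pol_chart id_def)
  next
    case False
    then show ?thesis using holo_at_pol[OF False] by (simp add: holo_at_def analytic_on_imp_meromorphic_on)
  qed
qed

lemma LE_pol_same: "LE y (pol y) = fls_X_inv"
  by (rule LE_eqI) (simp add: pol_chart has_laurent_expansion_fls_X_inv)

lemma LE_pol_power_same: "LE y (\<lambda>p. pol y p ^ k) $$ n = (if n = - int k then 1 else 0)"
  by (simp add: LE_power LE_pol_same)

lemma holo_at_const [simp]: "holo_at (\<lambda>p. c) z"
  and holo_at_add: "holo_at f z \<Longrightarrow> holo_at g z \<Longrightarrow> holo_at (\<lambda>p. f p + g p) z"
  and holo_at_diff: "holo_at f z \<Longrightarrow> holo_at g z \<Longrightarrow> holo_at (\<lambda>p. f p - g p) z"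
  and holo_at_mult: "holo_at f z \<Longrightarrow> holo_at g z \<Longrightarrow> holo_at (\<lambda>p. f p * g p) z"
  and holo_at_power: "holo_at f z \<Longrightarrow> holo_at (\<lambda>p. f p ^ k) z"
  by (auto simp: holo_at_def intro!: analytic_intros)

lemma holo_at_divide: "holo_at f z \<Longrightarrow> holo_at g z \<Longrightarrow> g z \<noteq> 0 \<Longrightarrow> holo_at (\<lambda>p. f p / g p) z"
  by (auto simp: holo_at_def intro!: analytic_intros)

lemma LE_pol_power_other: "z \<noteq> y \<Longrightarrow> n < 0 \<Longrightarrow> LE z (\<lambda>p. pol y p ^ k) $$ n = 0"
  by (intro holo_at_LE(1) holo_at_power holo_at_pol) auto

text \<open>Subtracting all principal parts leaves a function without poles, which is constant.
  \<open>S\<close> and \<open>M\<close> are only upper bounds for the poles and their orders, so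
  that several functions can be expanded over one index set.\<close>

lemma partial_fractions:
  assumes f: "meromorphic_fun f" and S: "finite S" "\<And>y n. y \<notin> S \<Longrightarrow> n < 0 \<Longrightarrow> LE y f $$ n = 0"
    and M: "\<And>y n. n < - int M \<Longrightarrow> LE y f $$ n = 0"
  obtains c where "finite {p. f p \<noteq> c + (\<Sum>y\<in>S. \<Sum>k=1..M. LE y f $$ (- int k) * pol y p ^ k)}"
proof -
  let ?h = "\<lambda>p. \<Sum>y\<in>S. \<Sum>k=1..M. LE y f $$ (- int k) * pol y p ^ k"
  have mer: "meromorphic_fun (\<lambda>p. LE y f $$ (- int k) * pol y p ^ k)" for y k
    by (intro meromorphic_fun_mult meromorphic_fun_power) auto
  have h: "meromorphic_fun ?h" by (intro meromorphic_fun_sum mer)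
  have LEh: "LE z ?h $$ n = (\<Sum>y\<in>S. \<Sum>k=1..M. LE y f $$ (- int k) * LE z (\<lambda>p. pol y p ^ k) $$ n)" for z n
  proof -
    have "LE z ?h = (\<Sum>y\<in>S. \<Sum>k=1..M. LE z (\<lambda>p. LE y f $$ (- int k) * pol y p ^ k))"
      by (simp add: LE_sum mer meromorphic_fun_sum)
    also have "\<dots> = (\<Sum>y\<in>S. \<Sum>k=1..M. fls_const (LE y f $$ (- int k)) * LE z (\<lambda>p. pol y p ^ k))"
      by (simp add: LE_cmult meromorphic_fun_power)
    finally show ?thesis by (simp add: fls_nth_sum)
  qed
  have "LE z (\<lambda>p. f p - ?h p) $$ n = 0" if n: "n < 0" for z n
  proof -
    have "LE z ?h $$ n = (\<Sum>y\<in>S. if y = z then \<Sum>k=1..M. LE z f $$ (- int k) * (if n = - int k then 1 else 0) else 0)"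
      unfolding LEh
    proof (rule sum.cong)
      fix y
      show "(\<Sum>k=1..M. LE y f $$ (- int k) * LE z (\<lambda>p. pol y p ^ k) $$ n) =
          (if y = z then \<Sum>k=1..M. LE z f $$ (- int k) * (if n = - int k then 1 else 0) else 0)"
      proof (cases "y = z")
        case True
        then show ?thesis by (simp only: LE_pol_power_same if_True refl)
      next
        case False
        then have "z \<noteq> y" by simp
        then show ?thesis using False n by (simp add: LE_pol_power_other)
      qed
    qed simp
    also have "\<dots> = (if z \<in> S then \<Sum>k=1..M. if k = nat (- n) then LE z f $$ n else 0 else 0)"
    proof -
      have "LE z f $$ (- int k) * (if n = - int k then 1 else 0) = (if k = nat (- n) then LE z f $$ n else 0)" for k
        using n by auto
      then show ?thesis using S(1) by simp
    qed
    also have "\<dots> = LE z f $$ n"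
      using n S(2)[of z n] M[of n z] by (cases "n < - int M") auto
    finally show ?thesis unfolding LE_diff[OF f h] by simp
  qed
  then obtain c where "finite {p. f p - ?h p \<noteq> c}"
    using regular_imp_constant[OF meromorphic_fun_diff[OF f h]] by blast
  then have "finite {p. f p \<noteq> c + ?h p}" by (simp add: diff_eq_eq add.commute)
  then show ?thesis by (rule that)
qed

section \<open>Laurent coefficients of meromorphic maps\<close>

lemma cscale_zero_left [simp]: "0 *\<^sub>C x = (0::'a::complex_lie_algebra)"
  and cscale_zero_right [simp]: "c *\<^sub>C 0 = (0::'a::complex_lie_algebra)"
  and cscale_minus_left: "(- c) *\<^sub>C x = - (c *\<^sub>C (x::'a::complex_lie_algebra))"
  and cscale_diff_right: "c *\<^sub>C (x - y) = c *\<^sub>C x - c *\<^sub>C (y::'a::complex_lie_algebra)"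
  and cscale_sum_left: "(\<Sum>i\<in>I. h i) *\<^sub>C x = (\<Sum>i\<in>I. h i *\<^sub>C (x::'a::complex_lie_algebra))"
  by (simp_all add: cvs.scale_minus_left cvs.scale_left_diff_distrib cvs.scale_right_diff_distrib
      cvs.scale_sum_left cvs.scale_sum_right)

lemma lie_minus_right: "lie x (- y) = - lie x (y::'a::complex_lie_algebra)"
  using lie_cscale_right[of x "-1" y] by (simp add: cscale_minus_left cscale_one)

lemma lie_skew: "lie y x = - lie x (y::'a::complex_lie_algebra)"
proof -
  have "0 = lie (x + y) (x + y)" by (simp add: lie_self)
  also have "\<dots> = lie y x + lie x y"
    by (simp add: lie_add_left lie_add_right lie_self[of x] lie_self[of y])
  finally show ?thesis by (simp add: eq_neg_iff_add_eq_0)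
qed

lemma lie_jacobi': "lie k (lie a b) = lie (lie k a) b - lie (lie k b) (a::'a::complex_lie_algebra)"
proof -
  have "lie k (lie a b) + lie a (lie b k) + lie b (lie k a) = 0" by (rule jacobi)
  then show ?thesis
    using lie_skew[of "lie k a" b] lie_skew[of "lie k b" a] lie_skew[of k b]
    by (simp add: lie_minus_right add_eq_0_iff2 algebra_simps)
qed

section \<open>Laurent coefficients tested by linear functionals\<close>

definition functional :: "('g::complex_lie_algebra \<Rightarrow> complex) \<Rightarrow> bool" where
  "functional l \<longleftrightarrow> (\<forall>x y. l (x + y) = l x + l y) \<and> (\<forall>c x. l (c *\<^sub>C x) = c * l x)"

lemma functional_0: "functional l \<Longrightarrow> l 0 = 0"
  unfolding functional_def by (metis cscale_zero_left mult_zero_left)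

lemma functional_sum: "functional l \<Longrightarrow> l (\<Sum>i\<in>I. c i *\<^sub>C x i) = (\<Sum>i\<in>I. c i * l (x i))"
  by (induction I rule: infinite_finite_induct) (auto simp: functional_0, auto simp: functional_def)

text \<open>The difference of two distinct vectors extends to a basis, and the coordinate along it
  tells them apart. In a space of arbitrary dimension without topology, functionals reduce questions
  about vector-valued maps to scalar functions.\<close>

lemma functional_separates:
  fixes x y :: "'g::complex_lie_algebra"
  assumes "\<And>l. functional l \<Longrightarrow> l x = l y" shows "x = y"
proof (rule ccontr)
  assume "x \<noteq> y"
  define v where "v = x - y"
  have v: "v \<noteq> 0" using \<open>x \<noteq> y\<close> by (simp add: v_def)
  then have ind: "cvs.independent {v}" by simp
  define B where "B = cvs.extend_basis {v}"
  have B: "cvs.independent B" "cvs.span B = UNIV" "v \<in> B"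
    using cvs.independent_extend_basis[OF ind] cvs.span_extend_basis[OF ind]
      cvs.extend_basis_superset[OF ind] by (auto simp: B_def)
  define l where "l w = cvs.representation B w v" for w
  have "functional l"
    using B by (simp add: functional_def l_def cvs.representation_add cvs.representation_scale)
  then have "l x = l y" by (rule assms)
  moreover have "l x = l (v + y)" by (simp add: v_def)
  ultimately have "l v = 0" using \<open>functional l\<close> by (simp add: functional_def)
  then show False using B by (simp add: l_def cvs.representation_basis)
qed

lemma abs_mero_eqI:
  "meromorphic_map \<nu> \<Longrightarrow> meromorphic_map \<mu> \<Longrightarrow> finite {p. \<nu> p \<noteq> \<mu> p} \<Longrightarrow> abs_mero \<nu> = abs_mero \<mu>"
  using Quotient3_rel[OF Quotient3_mero, of \<nu> \<mu>] by simp

lemma rep_abs_mero: "meromorphic_map \<nu> \<Longrightarrow> finite {p. rep_mero (abs_mero \<nu>) p \<noteq> \<nu> p}"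
  using Quotient3_rel[OF Quotient3_mero, of "rep_mero (abs_mero \<nu>)" \<nu>]
    Quotient3_rep_reflp[OF Quotient3_mero, of "abs_mero \<nu>"] Quotient3_abs_rep[OF Quotient3_mero, of "abs_mero \<nu>"]
  by simp

lemma abs_mero_add: "meromorphic_map \<nu> \<Longrightarrow> meromorphic_map \<mu> \<Longrightarrow>
    abs_mero (\<lambda>p. \<nu> p + \<mu> p) = abs_mero \<nu> + abs_mero \<mu>"
  by (simp add: plus_mero.abs_eq)

lemma meromorphic_map_sum: "(\<And>i. i \<in> I \<Longrightarrow> meromorphic_map (\<nu> i)) \<Longrightarrow> meromorphic_map (\<lambda>p. \<Sum>i\<in>I. \<nu> i p)"
  by (induction I rule: infinite_finite_induct) (auto simp: meromorphic_map_zero intro: meromorphic_map_add)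

lemma abs_mero_sum: "(\<And>i. i \<in> I \<Longrightarrow> meromorphic_map (\<nu> i)) \<Longrightarrow>
    abs_mero (\<lambda>p. \<Sum>i\<in>I. \<nu> i p) = (\<Sum>i\<in>I. abs_mero (\<nu> i))"
  by (induction I rule: infinite_finite_induct)
    (simp_all add: zero_mero_def[symmetric] abs_mero_add meromorphic_map_sum)

definition elem :: "(proj_line \<Rightarrow> complex) \<Rightarrow> 'g \<Rightarrow> 'g::complex_lie_algebra mero" where
  "elem f a = abs_mero (\<lambda>p. f p *\<^sub>C a)"

lemma meromorphic_map_elem: "meromorphic_fun f \<Longrightarrow> meromorphic_map (\<lambda>p. f p *\<^sub>C a)"
  by (rule meromorphic_mapI[of "{0::nat}" "\<lambda>_. f" _ "\<lambda>_. a"]) auto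

lemma elem_cong:
  assumes "meromorphic_fun f" "meromorphic_fun g" "finite {p. f p \<noteq> g p}" shows "elem f a = elem g a"
  unfolding elem_def using assms(1,2)
  by (intro abs_mero_eqI meromorphic_map_elem finite_subset[OF _ assms(3)]) auto

lemma elem_add_left: "meromorphic_fun f \<Longrightarrow> meromorphic_fun g \<Longrightarrow> elem (\<lambda>p. f p + g p) a = elem f a + elem g a"
  by (simp add: elem_def cscale_add_left abs_mero_add meromorphic_map_elem)

lemma elem_add_right: "meromorphic_fun f \<Longrightarrow> elem f (a + b) = elem f a + elem f b"
  by (simp add: elem_def cscale_add_right abs_mero_add meromorphic_map_elem)

lemma elem_scale: "meromorphic_fun f \<Longrightarrow> c *\<^sub>C elem f a = elem f (c *\<^sub>C a)"
  by (simp add: elem_def cscale_mero.abs_eq meromorphic_map_elem cscale_cscale mult.commute)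

lemma elem_scale_left: "elem (\<lambda>p. c * f p) a = elem f (c *\<^sub>C a)"
  by (simp add: elem_def cscale_cscale mult.commute)

lemma elem_zero [simp]: "elem f 0 = 0"
  by (simp add: elem_def zero_mero_def)

lemma elem_zero_left [simp]: "elem (\<lambda>p. 0) a = 0"
  by (simp add: elem_def zero_mero_def)

lemma elem_minus: "meromorphic_fun f \<Longrightarrow> elem f (- a) = - elem f a"
  using elem_add_right[of f a "- a"] by (simp add: eq_neg_iff_add_eq_0 add.commute)

lemma elem_minus_left: "meromorphic_fun f \<Longrightarrow> elem (\<lambda>p. - f p) a = - elem f a"
  using elem_scale_left[of "-1" f a] by (simp add: cscale_minus_left cscale_one elem_minus)

lemma elem_diff_left: "meromorphic_fun f \<Longrightarrow> meromorphic_fun g \<Longrightarrow> elem (\<lambda>p. f p - g p) a = elem f a - elem g a"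
  using elem_add_left[of f "\<lambda>p. - g p" a] meromorphic_fun_mult[of "\<lambda>p. -1" g]
  by (simp add: elem_minus_left)

lemma elem_lie: "meromorphic_fun f \<Longrightarrow> meromorphic_fun g \<Longrightarrow>
    lie (elem f a) (elem g b) = elem (\<lambda>p. f p * g p) (lie a b)"
  by (simp add: elem_def lie_mero.abs_eq meromorphic_map_elem lie_cscale_left lie_cscale_right cscale_cscale mult.commute)

lemma elem_sum_left: "(\<And>i. i \<in> I \<Longrightarrow> meromorphic_fun (f i)) \<Longrightarrow>
    elem (\<lambda>p. \<Sum>i\<in>I. f i p) a = (\<Sum>i\<in>I. elem (f i) a)"
  by (simp add: elem_def cscale_sum_left abs_mero_sum meromorphic_map_elem)

lemma const_elem: "const a = elem (\<lambda>p. 1) a"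
  by (simp add: const_def elem_def cscale_one)

lemma abs_mero_elems: "(\<And>i. i \<in> I \<Longrightarrow> meromorphic_fun (f i)) \<Longrightarrow>
    abs_mero (\<lambda>p. \<Sum>i\<in>I. f i p *\<^sub>C x i) = (\<Sum>i\<in>I. elem (f i) (x i))"
  by (simp add: elem_def abs_mero_sum meromorphic_map_elem)

lemma mero_expand:
  obtains n :: nat and f x where "\<And>i. i < n \<Longrightarrow> meromorphic_fun (f i)" "\<nu> = (\<Sum>i<n. elem (f i) (x i))"
proof -
  obtain y where y: "meromorphic_map y" "\<nu> = abs_mero y"
    by (rule mero.abs_induct[of "\<lambda>\<nu>. \<exists>y. meromorphic_map y \<and> \<nu> = abs_mero y", THEN exE]) auto
  obtain n :: nat and f x where fx: "\<And>i. i < n \<Longrightarrow> meromorphic_fun (f i)"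
      "finite {p. y p \<noteq> (\<Sum>i<n. f i p *\<^sub>C x i)}"
    by (rule meromorphic_mapE[OF y(1)]) blast
  have "\<nu> = abs_mero (\<lambda>p. \<Sum>i<n. f i p *\<^sub>C x i)"
    unfolding y(2) using fx by (intro abs_mero_eqI y meromorphic_map_sum meromorphic_map_elem) auto
  also have "\<dots> = (\<Sum>i<n. elem (f i) (x i))" by (rule abs_mero_elems) (simp add: fx)
  finally show ?thesis using fx(1) by (rule that[rotated])
qed

lemma mero_induct [case_names ele add]:
  assumes "\<And>f a. meromorphic_fun f \<Longrightarrow> P (elem f a)" "\<And>\<nu> \<mu>. P \<nu> \<Longrightarrow> P \<mu> \<Longrightarrow> P (\<nu> + \<mu>)"
  shows "P \<nu>"
proof -
  obtain n :: nat and f x where fx: "\<And>i. i < n \<Longrightarrow> meromorphic_fun (f i)" "\<nu> = (\<Sum>i<n. elem (f i) (x i))"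
    by (rule mero_expand[of \<nu>]) blast
  have "P (\<Sum>i<m. elem (f i) (x i))" if "m \<le> n" for m
    using that
  proof (induction m)
    case 0
    show ?case using assms(1)[of "\<lambda>p. 0" 0] by simp
  next
    case (Suc m)
    then show ?case using assms(2)[of "\<Sum>i<m. elem (f i) (x i)" "elem (f m) (x m)"] assms(1)[OF fx(1)[of m]]
      by simp
  qed
  then show ?thesis using fx(2) by simp
qed

text \<open>The coefficient is pinned down by its scalar shadows, so no choice of an expansion
  enters. Existence comes with \<open>lc_sum\<close>, uniqueness from
  \<open>functional_separates\<close>.\<close>

definition lc :: "proj_line \<Rightarrow> int \<Rightarrow> 'g::complex_lie_algebra mero \<Rightarrow> 'g" where
  "lc z n \<nu> = (THE v. \<forall>l. functional l \<longrightarrow> l v = LE z (\<lambda>p. l (rep_mero \<nu> p)) $$ n)"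

lemma lc_sum:
  assumes f: "\<And>i. i \<in> I \<Longrightarrow> meromorphic_fun (f i)"
  shows "lc z n (\<Sum>i\<in>I. elem (f i) (x i)) = (\<Sum>i\<in>I. (LE z (f i) $$ n) *\<^sub>C x i)"
proof -
  let ?\<nu> = "\<Sum>i\<in>I. elem (f i) (x i)"
  have *: "l (\<Sum>i\<in>I. (LE z (f i) $$ n) *\<^sub>C x i) = LE z (\<lambda>p. l (rep_mero ?\<nu> p)) $$ n"
    if l: "functional l" for l
  proof -
    have "?\<nu> = abs_mero (\<lambda>p. \<Sum>i\<in>I. f i p *\<^sub>C x i)" using f by (simp add: abs_mero_elems)
    then have "finite {p. rep_mero ?\<nu> p \<noteq> (\<Sum>i\<in>I. f i p *\<^sub>C x i)}"
      using f by (simp add: rep_abs_mero meromorphic_map_sum meromorphic_map_elem)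
    then have "LE z (\<lambda>p. l (rep_mero ?\<nu> p)) = LE z (\<lambda>p. l (\<Sum>i\<in>I. f i p *\<^sub>C x i))"
      by (intro LE_cong) (auto elim: rev_finite_subset)
    also have "\<dots> = LE z (\<lambda>p. \<Sum>i\<in>I. l (x i) * f i p)"
      by (simp add: functional_sum[OF l] mult.commute)
    also have "\<dots> = (\<Sum>i\<in>I. fls_const (l (x i)) * LE z (f i))"
      using f by (simp add: LE_sum LE_cmult meromorphic_fun_mult)
    finally show ?thesis by (simp add: functional_sum[OF l] fls_nth_sum mult.commute)
  qed
  show ?thesis
    unfolding lc_def
  proof (rule the_equality)
    fix v assume "\<forall>l. functional l \<longrightarrow> l v = LE z (\<lambda>p. l (rep_mero ?\<nu> p)) $$ n"
    then show "v = (\<Sum>i\<in>I. (LE z (f i) $$ n) *\<^sub>C x i)"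
      by (intro functional_separates) (simp add: *)
  qed (use * in simp)
qed

lemma lc_elem: "meromorphic_fun f \<Longrightarrow> lc z n (elem f a) = (LE z f $$ n) *\<^sub>C a"
  using lc_sum[of "{0::nat}" "\<lambda>_. f" z n "\<lambda>_. a"] by simp

lemma lc_add: "lc z n (\<nu> + \<mu>) = lc z n \<nu> + lc z n \<mu>"
proof -
  obtain k :: nat and f x where 1: "\<And>i. i < k \<Longrightarrow> meromorphic_fun (f i)" "\<nu> = (\<Sum>i<k. elem (f i) (x i))"
    by (rule mero_expand[of \<nu>]) blast
  obtain m :: nat and g y where 2: "\<And>i. i < m \<Longrightarrow> meromorphic_fun (g i)" "\<mu> = (\<Sum>i<m. elem (g i) (y i))"
    by (rule mero_expand[of \<mu>]) blast
  have "\<nu> + \<mu> = (\<Sum>i\<in>{..<k} <+> {..<m}. elem (case_sum f g i) (case_sum x y i))"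
    by (simp add: sum.Plus 1(2) 2(2))
  also have "lc z n \<dots> = (\<Sum>i\<in>{..<k} <+> {..<m}. (LE z (case_sum f g i) $$ n) *\<^sub>C case_sum x y i)"
    by (rule lc_sum) (use 1 2 in auto)
  also have "\<dots> = lc z n \<nu> + lc z n \<mu>"
    unfolding 1(2) 2(2) using 1(1) 2(1) by (subst (1 2) lc_sum) (auto simp: sum.Plus)
  finally show ?thesis .
qed

lemma lc_scale: "lc z n (c *\<^sub>C \<nu>) = c *\<^sub>C lc z n \<nu>"
proof (induction \<nu> rule: mero_induct)
  case (ele f a)
  then show ?case by (simp add: elem_scale lc_elem cscale_cscale mult.commute)
qed (simp add: cscale_add_right lc_add)

lemma lc_zero [simp]: "lc z n 0 = 0"
  using lc_scale[of z n 0 0] by simp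

lemma lc_lie_const: "lc z n (lie \<nu> (const b)) = lie (lc z n \<nu>) b"
proof (induction \<nu> rule: mero_induct)
  case (ele f a)
  then show ?case by (simp add: const_elem elem_lie lc_elem lie_cscale_left)
qed (simp add: lie_add_left lc_add)

lemma pole_bound_fun:
  assumes "meromorphic_fun f" obtains M :: nat where "\<And>z n. n < - int M \<Longrightarrow> LE z f $$ n = 0"
proof -
  define S where "S = {z. \<exists>n<0. LE z f $$ n \<noteq> 0}"
  have S: "finite S" unfolding S_def by (rule finite_poles[OF assms])
  have "LE z f $$ n = 0" if "n < - int (\<Sum>y\<in>S. nat (- fls_subdegree (LE y f)))" for z n
  proof (cases "z \<in> S")
    case True
    then have "nat (- fls_subdegree (LE z f)) \<le> (\<Sum>y\<in>S. nat (- fls_subdegree (LE y f)))"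
      by (intro member_le_sum S) auto
    then have "n < fls_subdegree (LE z f)" using that by linarith
    then show ?thesis by simp
  next
    case False
    moreover have "n < 0" using that by linarith
    ultimately show ?thesis by (auto simp: S_def)
  qed
  then show ?thesis by (rule that)
qed

lemma pole_bound: obtains M :: nat where "\<And>z n. n < - int M \<Longrightarrow> lc z n \<nu> = 0"
proof -
  have "\<exists>M::nat. \<forall>z n. n < - int M \<longrightarrow> lc z n \<nu> = 0"
  proof (induction \<nu> rule: mero_induct)
    case (ele f a)
    obtain M :: nat where "\<And>z n. n < - int M \<Longrightarrow> LE z f $$ n = 0"
      by (rule pole_bound_fun[OF ele]) blast
    then show ?case using ele by (intro exI[of _ M]) (simp add: lc_elem)
  next
    case (add \<nu> \<mu>)
    then obtain M M' :: nat where "\<forall>z n. n < - int M \<longrightarrow> lc z n \<nu> = 0" "\<forall>z n. n < - int M' \<longrightarrow> lc z n \<mu> = 0"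
      by blast
    then show ?case by (intro exI[of _ "max M M'"]) (simp add: lc_add)
  qed
  then show ?thesis using that by blast
qed

abbreviation polk :: "proj_line \<Rightarrow> nat \<Rightarrow> proj_line \<Rightarrow> complex" where
  "polk y k \<equiv> \<lambda>p. pol y p ^ k"

lemma meromorphic_fun_polk [simp]: "meromorphic_fun (polk y k)"
  by (simp add: meromorphic_fun_power)

definition partial_fraction :: "'g::complex_lie_algebra mero \<Rightarrow> proj_line set \<Rightarrow> nat \<Rightarrow> bool" where
  "partial_fraction \<nu> S M \<longleftrightarrow>
     (\<exists>c. \<nu> = const c + (\<Sum>y\<in>S. \<Sum>k=1..M. elem (polk y k) (lc y (- int k) \<nu>)))"

lemma partial_fraction_add:
  assumes "partial_fraction \<nu> S M" "partial_fraction \<mu> S M" shows "partial_fraction (\<nu> + \<mu>) S M"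
proof -
  obtain c where c: "\<nu> = const c + (\<Sum>y\<in>S. \<Sum>k=1..M. elem (polk y k) (lc y (- int k) \<nu>))"
    using assms(1) unfolding partial_fraction_def by (elim exE)
  obtain d where d: "\<mu> = const d + (\<Sum>y\<in>S. \<Sum>k=1..M. elem (polk y k) (lc y (- int k) \<mu>))"
    using assms(2) unfolding partial_fraction_def by (elim exE)
  have "\<nu> + \<mu> = (const c + (\<Sum>y\<in>S. \<Sum>k=1..M. elem (polk y k) (lc y (- int k) \<nu>)))
      + (const d + (\<Sum>y\<in>S. \<Sum>k=1..M. elem (polk y k) (lc y (- int k) \<mu>)))"
    by (rule arg_cong2[OF c d])
  also have "\<dots> = (const c + const d) + (\<Sum>y\<in>S. \<Sum>k=1..M.
      elem (polk y k) (lc y (- int k) \<nu>) + elem (polk y k) (lc y (- int k) \<mu>))"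
    by (simp only: sum.distrib add.assoc add.left_commute)
  also have "\<dots> = const (c + d) + (\<Sum>y\<in>S. \<Sum>k=1..M. elem (polk y k) (lc y (- int k) (\<nu> + \<mu>)))"
    by (simp add: const_elem elem_add_right lc_add)
  finally show ?thesis unfolding partial_fraction_def by (rule exI)
qed

lemma partial_fraction_exists:
  "\<exists>S0 M0. finite S0 \<and> (\<forall>S M. S0 \<subseteq> S \<longrightarrow> finite S \<longrightarrow> M0 \<le> M \<longrightarrow> partial_fraction \<nu> S M)"
proof (induction \<nu> rule: mero_induct)
  case (ele f a)
  obtain M0 :: nat where M0: "\<And>z n. n < - int M0 \<Longrightarrow> LE z f $$ n = 0"
    by (rule pole_bound_fun[OF ele]) blast
  define S0 where "S0 = {z. \<exists>n<0. LE z f $$ n \<noteq> 0}"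
  have "finite S0" unfolding S0_def by (rule finite_poles[OF ele])
  have *: "partial_fraction (elem f a) S M"
    if S: "S0 \<subseteq> S" "finite S" and M: "M0 \<le> M" for S M
  proof -
    have h1: "\<And>y n. y \<notin> S \<Longrightarrow> n < 0 \<Longrightarrow> LE y f $$ n = 0" using S by (auto simp: S0_def)
    have h2: "\<And>y n. n < - int M \<Longrightarrow> LE y f $$ n = 0" using M0 M by simp
    have "\<exists>c. finite {p. f p \<noteq> c + (\<Sum>y\<in>S. \<Sum>k=1..M. LE y f $$ (- int k) * pol y p ^ k)}"
      by (rule partial_fractions[OF ele S(2), of M, OF h1 h2]) (assumption+, rule exI)
    then obtain c where c: "finite {p. f p \<noteq> c + (\<Sum>y\<in>S. \<Sum>k=1..M. LE y f $$ (- int k) * pol y p ^ k)}" ..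
    have mer: "meromorphic_fun (\<lambda>p. LE y f $$ (- int k) * pol y p ^ k)" for y k
      by (intro meromorphic_fun_mult meromorphic_fun_power) auto
    have "elem f a = elem (\<lambda>p. c + (\<Sum>y\<in>S. \<Sum>k=1..M. LE y f $$ (- int k) * pol y p ^ k)) a"
      by (rule elem_cong[OF ele _ c]) (intro meromorphic_fun_add meromorphic_fun_sum mer meromorphic_fun_const)
    also have "\<dots> = elem (\<lambda>p. c * 1) a + (\<Sum>y\<in>S. \<Sum>k=1..M. elem (\<lambda>p. LE y f $$ (- int k) * pol y p ^ k) a)"
    proof -
      have "elem (\<lambda>p. c + (\<Sum>y\<in>S. \<Sum>k=1..M. LE y f $$ (- int k) * pol y p ^ k)) a =
          elem (\<lambda>p. c) a + elem (\<lambda>p. \<Sum>y\<in>S. \<Sum>k=1..M. LE y f $$ (- int k) * pol y p ^ k) a"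
        by (intro elem_add_left meromorphic_fun_sum mer meromorphic_fun_const)
      also have "elem (\<lambda>p. \<Sum>y\<in>S. \<Sum>k=1..M. LE y f $$ (- int k) * pol y p ^ k) a =
          (\<Sum>y\<in>S. elem (\<lambda>p. \<Sum>k=1..M. LE y f $$ (- int k) * pol y p ^ k) a)"
        by (intro elem_sum_left meromorphic_fun_sum mer)
      also have "\<dots> = (\<Sum>y\<in>S. \<Sum>k=1..M. elem (\<lambda>p. LE y f $$ (- int k) * pol y p ^ k) a)"
        by (intro sum.cong refl elem_sum_left mer)
      finally show ?thesis by simp
    qed
    also have "\<dots> = const (c *\<^sub>C a) + (\<Sum>y\<in>S. \<Sum>k=1..M. elem (polk y k) (lc y (- int k) (elem f a)))"
      by (simp only: elem_scale_left const_elem lc_elem[OF ele])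
    finally show ?thesis unfolding partial_fraction_def by (rule exI)
  qed
  show ?case
    by (rule exI[of _ S0], rule exI[of _ M0]) (intro conjI allI impI \<open>finite S0\<close> *)
next
  case (add \<nu> \<mu>)
  obtain S1 M1 where "finite S1"
    and 1: "\<forall>S M. S1 \<subseteq> S \<longrightarrow> finite S \<longrightarrow> M1 \<le> M \<longrightarrow> partial_fraction \<nu> S M"
    using add(1) by (elim exE conjE)
  obtain S2 M2 where "finite S2"
    and 2: "\<forall>S M. S2 \<subseteq> S \<longrightarrow> finite S \<longrightarrow> M2 \<le> M \<longrightarrow> partial_fraction \<mu> S M"
    using add(2) by (elim exE conjE)
  show ?case using \<open>finite S1\<close> \<open>finite S2\<close> 1 2
    by (intro exI[of _ "S1 \<union> S2"] exI[of _ "max M1 M2"]) (simp add: partial_fraction_add)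
qed

lemma mero_partial_fractions:
  obtains c S M where "finite S" "\<nu> = const c + (\<Sum>y\<in>S. \<Sum>k=1..M. elem (polk y k) (lc y (- int k) \<nu>))"
proof -
  obtain S M where "finite S" "partial_fraction \<nu> S M"
    using partial_fraction_exists[of \<nu>] by blast
  then show ?thesis using that unfolding partial_fraction_def by (elim exE)
qed

subsection \<open>Regular maps\<close>

lemma expansion_at_alt:
  "expansion_at z \<nu> n f x \<longleftrightarrow>
    (\<forall>i<n. meromorphic_fun (f i) \<and> holo_at (f i) z) \<and> \<nu> = (\<Sum>i<n. elem (f i) (x i))"
  unfolding expansion_at_def by (rule conj_cong[OF refl], subst abs_mero_elems) auto

lemma reg_sumI:
  assumes "finite I" "\<And>i. i \<in> I \<Longrightarrow> meromorphic_fun (f i)" "\<And>i. i \<in> I \<Longrightarrow> holo_at (f i) z"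
  shows "(\<Sum>i\<in>I. elem (f i) (x i)) \<in> reg z"
proof -
  obtain e where e: "bij_betw e {..<card I} I"
    using ex_bij_betw_nat_finite[OF \<open>finite I\<close>] by (metis atLeast0LessThan)
  have "(\<Sum>i\<in>I. elem (f i) (x i)) = (\<Sum>k<card I. elem (f (e k)) (x (e k)))"
    by (rule sum.reindex_bij_betw[OF e, symmetric])
  moreover have "k < card I \<Longrightarrow> e k \<in> I" for k
    using e by (auto dest: bij_betwE)
  ultimately have "expansion_at z (\<Sum>i\<in>I. elem (f i) (x i)) (card I) (\<lambda>k. f (e k)) (\<lambda>k. x (e k))"
    using assms by (simp add: expansion_at_alt)
  then show ?thesis by (auto simp: reg_def regular_at_def)
qed

lemma regE:
  assumes "\<nu> \<in> reg z"
  obtains n :: nat and f x where "\<And>i. i < n \<Longrightarrow> meromorphic_fun (f i)" "\<And>i. i < n \<Longrightarrow> holo_at (f i) z"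
    "\<nu> = (\<Sum>i<n. elem (f i) (x i))"
  using assms by (auto simp: reg_def regular_at_def expansion_at_alt)

lemma elem_reg: "meromorphic_fun f \<Longrightarrow> holo_at f z \<Longrightarrow> elem f a \<in> reg z"
  using reg_sumI[of "{0::nat}" "\<lambda>_. f" z "\<lambda>_. a"] by simp

lemma reg_zero [simp]: "0 \<in> reg z"
  using reg_sumI[of "{}::nat set"] by simp

lemma const_reg [simp]: "const a \<in> reg z"
  by (simp add: const_elem elem_reg)

lemma reg_add:
  assumes "\<nu> \<in> reg z" "\<mu> \<in> reg z" shows "\<nu> + \<mu> \<in> reg z"
proof -
  obtain n :: nat and f x where 1: "\<And>i. i < n \<Longrightarrow> meromorphic_fun (f i)" "\<And>i. i < n \<Longrightarrow> holo_at (f i) z"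
    "\<nu> = (\<Sum>i<n. elem (f i) (x i))" by (rule regE[OF assms(1)]) blast
  obtain m :: nat and g y where 2: "\<And>i. i < m \<Longrightarrow> meromorphic_fun (g i)" "\<And>i. i < m \<Longrightarrow> holo_at (g i) z"
    "\<mu> = (\<Sum>i<m. elem (g i) (y i))" by (rule regE[OF assms(2)]) blast
  have "\<nu> + \<mu> = (\<Sum>i\<in>{..<n} <+> {..<m}. elem (case_sum f g i) (case_sum x y i))"
    by (simp add: sum.Plus 1(3) 2(3))
  also have "\<dots> \<in> reg z" by (rule reg_sumI) (use 1 2 in auto)
  finally show ?thesis .
qed

lemma reg_induct [consumes 1, case_names ele add]:
  assumes "\<nu> \<in> reg z" "\<And>f a. meromorphic_fun f \<Longrightarrow> holo_at f z \<Longrightarrow> P (elem f a)"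
    "\<And>\<nu> \<mu>. \<nu> \<in> reg z \<Longrightarrow> \<mu> \<in> reg z \<Longrightarrow> P \<nu> \<Longrightarrow> P \<mu> \<Longrightarrow> P (\<nu> + \<mu>)"
  shows "P \<nu>"
proof -
  obtain n :: nat and f x where fx: "\<And>i. i < n \<Longrightarrow> meromorphic_fun (f i)" "\<And>i. i < n \<Longrightarrow> holo_at (f i) z"
    "\<nu> = (\<Sum>i<n. elem (f i) (x i))" by (rule regE[OF assms(1)]) blast
  have "(\<Sum>i<m. elem (f i) (x i)) \<in> reg z \<and> P (\<Sum>i<m. elem (f i) (x i))" if "m \<le> n" for m
    using that
  proof (induction m)
    case 0
    show ?case using assms(2)[of "\<lambda>p. 0" 0] by simp
  next
    case (Suc m)
    then have "meromorphic_fun (f m)" "holo_at (f m) z" using fx by auto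
    then show ?case using Suc
      by (simp add: assms(2) elem_reg assms(3) reg_add)
  qed
  then show ?thesis using fx(3) by simp
qed

lemma reg_scale: assumes "\<nu> \<in> reg z" shows "c *\<^sub>C \<nu> \<in> reg z"
  using assms by (induction rule: reg_induct) (simp_all add: elem_scale elem_reg cscale_add_right reg_add)

lemma reg_minus: "\<nu> \<in> reg z \<Longrightarrow> - \<nu> \<in> reg z"
  using reg_scale[of \<nu> z "-1"] by (simp add: cscale_minus_left cscale_one)

lemma reg_diff: "\<nu> \<in> reg z \<Longrightarrow> \<mu> \<in> reg z \<Longrightarrow> \<nu> - \<mu> \<in> reg z"
  using reg_add[of \<nu> z "- \<mu>"] reg_minus[of \<mu> z] by simp

lemma reg_sum: "(\<And>i. i \<in> I \<Longrightarrow> \<nu> i \<in> reg z) \<Longrightarrow> sum \<nu> I \<in> reg z"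
  by (induction I rule: infinite_finite_induct) (auto intro: reg_add)

lemma reg_lie: assumes "\<nu> \<in> reg z" "\<mu> \<in> reg z" shows "lie \<nu> \<mu> \<in> reg z"
  using assms(1)
proof (induction rule: reg_induct)
  case (ele f a)
  show ?case
    using assms(2)
  proof (induction rule: reg_induct)
    case (ele g b)
    then show ?case using \<open>meromorphic_fun f\<close> \<open>holo_at f z\<close>
      by (simp add: elem_lie elem_reg meromorphic_fun_mult holo_at_mult)
  qed (simp add: lie_add_right reg_add)
qed (simp add: lie_add_left reg_add)

lemma lc_reg: assumes "\<nu> \<in> reg z" "n < 0" shows "lc z n \<nu> = 0"
  using assms(1) by (induction rule: reg_induct) (simp_all add: lc_elem holo_at_LE(1) assms(2) lc_add)

lemma expansion_at_lc:
  assumes "expansion_at z \<nu> n f x"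
  shows "lc z 0 \<nu> = (\<Sum>i<n. f i z *\<^sub>C x i)" "lc z 1 \<nu> = (\<Sum>i<n. diff (f i) z *\<^sub>C x i)"
proof -
  have *: "\<nu> = (\<Sum>i<n. elem (f i) (x i))" "i < n \<Longrightarrow> meromorphic_fun (f i)" "i < n \<Longrightarrow> holo_at (f i) z" for i
    using assms by (auto simp: expansion_at_alt)
  have "lc z k \<nu> = (\<Sum>i<n. (LE z (f i) $$ k) *\<^sub>C x i)" for k
    unfolding *(1) by (rule lc_sum) (simp add: *)
  then show "lc z 0 \<nu> = (\<Sum>i<n. f i z *\<^sub>C x i)" "lc z 1 \<nu> = (\<Sum>i<n. diff (f i) z *\<^sub>C x i)"
    by (simp_all add: holo_at_LE *)
qed

text \<open>The definite description in \<open>ev\<close> is legitimate because every expansion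
  computes the same Laurent coefficient.\<close>

lemma ev_eq: assumes "\<nu> \<in> reg z" shows "ev z \<nu> = lc z 0 \<nu>"
proof -
  obtain n f x where *: "expansion_at z \<nu> n f x" using assms by (auto simp: reg_def regular_at_def)
  show ?thesis
    unfolding ev_def by (rule the_equality) (use * expansion_at_lc(1) in \<open>blast, metis\<close>)
qed

lemma dev_eq: assumes "\<nu> \<in> reg z" shows "dev z \<nu> = lc z 1 \<nu>"
proof -
  obtain n f x where *: "expansion_at z \<nu> n f x" using assms by (auto simp: reg_def regular_at_def)
  show ?thesis
    unfolding dev_def by (rule the_equality) (use * expansion_at_lc(2) in \<open>blast, metis\<close>)
qed

lemma ev_elem: "meromorphic_fun f \<Longrightarrow> holo_at f z \<Longrightarrow> ev z (elem f a) = f z *\<^sub>C a"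
  by (simp add: ev_eq elem_reg lc_elem holo_at_LE)

lemma dev_elem: "meromorphic_fun f \<Longrightarrow> holo_at f z \<Longrightarrow> dev z (elem f a) = diff f z *\<^sub>C a"
  by (simp add: dev_eq elem_reg lc_elem holo_at_LE)

lemma ev_const [simp]: "ev z (const a) = a"
  by (simp add: const_elem ev_elem cscale_one)

lemma ev_zero [simp]: "ev z 0 = 0"
  by (simp add: ev_eq)

lemma ev_add: "\<nu> \<in> reg z \<Longrightarrow> \<mu> \<in> reg z \<Longrightarrow> ev z (\<nu> + \<mu>) = ev z \<nu> + ev z \<mu>"
  and dev_add: "\<nu> \<in> reg z \<Longrightarrow> \<mu> \<in> reg z \<Longrightarrow> dev z (\<nu> + \<mu>) = dev z \<nu> + dev z \<mu>"
  and ev_scale: "\<nu> \<in> reg z \<Longrightarrow> ev z (c *\<^sub>C \<nu>) = c *\<^sub>C ev z \<nu>"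
  and dev_scale: "\<nu> \<in> reg z \<Longrightarrow> dev z (c *\<^sub>C \<nu>) = c *\<^sub>C dev z \<nu>"
  by (simp_all add: ev_eq dev_eq reg_add reg_scale lc_add lc_scale)

lemma ev_minus: "\<nu> \<in> reg z \<Longrightarrow> ev z (- \<nu>) = - ev z \<nu>"
  using ev_scale[of \<nu> z "-1"] by (simp add: cscale_minus_left cscale_one)

lemma ev_lie: assumes "\<nu> \<in> reg z" "\<mu> \<in> reg z" shows "ev z (lie \<nu> \<mu>) = lie (ev z \<nu>) (ev z \<mu>)"
  using assms(1)
proof (induction rule: reg_induct)
  case (ele f a)
  show ?case
    using assms(2)
  proof (induction rule: reg_induct)
    case (ele g b)
    then show ?case using \<open>meromorphic_fun f\<close> \<open>holo_at f z\<close>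
      by (simp add: elem_lie meromorphic_fun_mult holo_at_mult ev_elem lie_cscale_left lie_cscale_right
          cscale_cscale mult.commute)
  next
    case (add \<nu> \<mu>)
    then show ?case using ele by (simp add: lie_add_right ev_add reg_lie elem_reg)
  qed
next
  case (add \<nu>1 \<nu>2)
  then show ?case using assms(2) by (simp add: lie_add_left ev_add reg_lie)
qed

lemma diff_mult: "holo_at f z \<Longrightarrow> holo_at g z \<Longrightarrow> diff (\<lambda>p. f p * g p) z = f z * diff g z + diff f z * g z"
  unfolding diff_def holo_at_def by (subst deriv_mult) (auto dest: analytic_on_imp_differentiable_at)

lemma dev_lie: assumes "\<nu> \<in> reg z" "\<mu> \<in> reg z"
  shows "dev z (lie \<nu> \<mu>) = lie (ev z \<nu>) (dev z \<mu>) + lie (dev z \<nu>) (ev z \<mu>)"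
  using assms(1)
proof (induction rule: reg_induct)
  case (ele f a)
  show ?case
    using assms(2)
  proof (induction rule: reg_induct)
    case (ele g b)
    then show ?case using \<open>meromorphic_fun f\<close> \<open>holo_at f z\<close>
      by (simp add: elem_lie meromorphic_fun_mult holo_at_mult ev_elem dev_elem diff_mult lie_cscale_left lie_cscale_right
          cscale_cscale cscale_add_left mult.commute)
  next
    case (add \<nu> \<mu>)
    then show ?case using ele by (simp add: lie_add_right ev_add dev_add reg_lie elem_reg algebra_simps)
  qed
next
  case (add \<nu>1 \<nu>2)
  then show ?case using assms(2) by (simp add: lie_add_left ev_add dev_add reg_lie algebra_simps)
qed

lemma van_reg: "\<nu> \<in> van P \<Longrightarrow> \<nu> \<in> reg P"
  and van_ev: "\<nu> \<in> van P \<Longrightarrow> ev P \<nu> = 0"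
  by (simp_all add: van_def)

lemma van_zero [simp]: "0 \<in> van P"
  and van_add: "\<nu> \<in> van P \<Longrightarrow> \<mu> \<in> van P \<Longrightarrow> \<nu> + \<mu> \<in> van P"
  and van_scale: "\<nu> \<in> van P \<Longrightarrow> c *\<^sub>C \<nu> \<in> van P"
  and van_minus: "\<nu> \<in> van P \<Longrightarrow> - \<nu> \<in> van P"
  and van_lie: "\<nu> \<in> van P \<Longrightarrow> \<mu> \<in> van P \<Longrightarrow> lie \<nu> \<mu> \<in> van P"
  by (simp_all add: van_def reg_add ev_add reg_scale ev_scale reg_minus ev_minus reg_lie ev_lie lie_zero_left)

lemma elem_van: "meromorphic_fun f \<Longrightarrow> holo_at f P \<Longrightarrow> f P = 0 \<Longrightarrow> elem f a \<in> van P"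
  by (simp add: van_def elem_reg ev_elem)


subsection \<open>Residues and principal parts\<close>

context
  fixes form :: "'g::complex_lie_algebra \<Rightarrow> 'g \<Rightarrow> complex"
  assumes form: "invariant_form form"
begin

lemma form_add_right: "form x (y + z) = form x y + form x z"
  and form_scale_right: "form x (c *\<^sub>C y) = c * form x y"
  and form_sym: "form x y = form y x"
  and form_inv: "form (lie x y) z = form x (lie y z)"
proof -
  have lin: "Vector_Spaces.linear (*\<^sub>C) (*) (form x)" for x
    using form by (simp add: invariant_form_def)
  interpret Vector_Spaces.linear "(*\<^sub>C) :: complex \<Rightarrow> 'g \<Rightarrow> 'g" "(*)" "form x"
    by (rule lin)
  show "form x (y + z) = form x y + form x z" "form x (c *\<^sub>C y) = c * form x y"
    by (rule add, rule scale)
  show "form x y = form y x" "form (lie x y) z = form x (lie y z)"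
    using form unfolding invariant_form_def by blast+
qed

lemma form_add_left: "form (x + y) z = form x z + form y z"
  using form_add_right[of z x y] form_sym[of z] by simp

lemma form_scale_left: "form (c *\<^sub>C x) y = c * form x y"
  using form_scale_right[of y c x] form_sym[of y] by simp

lemma form_zero [simp]: "form x 0 = 0" "form 0 x = 0"
  using form_scale_right[of x 0 0] form_scale_left[of 0 0 x] by simp_all

lemma form_minus_right: "form x (- y) = - form x y"
  using form_scale_right[of x "-1" y] by (simp add: cscale_minus_left cscale_one)

text \<open>\<open>om z \<beta> \<alpha>\<close> is \<open>Res\<^sub>z (\<beta>, d\<alpha>)\<close>.\<close>

definition om :: "proj_line \<Rightarrow> 'g mero \<Rightarrow> 'g mero \<Rightarrow> complex" where
  "om z \<beta> \<alpha> = Sum_any (\<lambda>n::int. of_int n * form (lc z (- n) \<beta>) (lc z n \<alpha>))"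

lemma finite_om: "finite {n::int. of_int n * form (lc z (- n) \<beta>) (lc z n \<alpha>) \<noteq> 0}"
proof -
  obtain M :: nat where M: "\<And>z n. n < - int M \<Longrightarrow> lc z n \<beta> = 0" by (rule pole_bound[of \<beta>]) blast
  obtain K :: nat where K: "\<And>z n. n < - int K \<Longrightarrow> lc z n \<alpha> = 0" by (rule pole_bound[of \<alpha>]) blast
  have "{n::int. of_int n * form (lc z (- n) \<beta>) (lc z n \<alpha>) \<noteq> 0} \<subseteq> {- int K..int M}"
  proof
    fix n :: int assume "n \<in> {n. of_int n * form (lc z (- n) \<beta>) (lc z n \<alpha>) \<noteq> 0}"
    then have "lc z (- n) \<beta> \<noteq> 0" "lc z n \<alpha> \<noteq> 0" by auto
    then have "\<not> - n < - int M" "\<not> n < - int K" using M K by auto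
    then show "n \<in> {- int K..int M}" by simp
  qed
  then show ?thesis by (rule finite_subset) simp
qed

lemma om_add_left: "om z (\<beta> + \<beta>') \<alpha> = om z \<beta> \<alpha> + om z \<beta>' \<alpha>"
  unfolding om_def lc_add form_add_left distrib_left by (rule Sum_any.distrib[OF finite_om finite_om])

lemma om_add_right: "om z \<beta> (\<alpha> + \<alpha>') = om z \<beta> \<alpha> + om z \<beta> \<alpha>'"
  unfolding om_def lc_add form_add_right distrib_left by (rule Sum_any.distrib[OF finite_om finite_om])

lemma om_scale_left: "om z (c *\<^sub>C \<beta>) \<alpha> = c * om z \<beta> \<alpha>"
  unfolding om_def lc_scale form_scale_left mult.left_commute[of _ c]
  by (rule Sum_any_right_distrib[OF finite_om, symmetric])

lemma om_scale_right: "om z \<beta> (c *\<^sub>C \<alpha>) = c * om z \<beta> \<alpha>"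
  unfolding om_def lc_scale form_scale_right mult.left_commute[of _ c]
  by (rule Sum_any_right_distrib[OF finite_om, symmetric])

text \<open>The sum over Laurent coefficients is the coefficient of order -1 of a product of series,
  that is, the residue of f dg. In this form the product rule for derivatives is available.\<close>

lemma om_elem:
  assumes "meromorphic_fun f" "meromorphic_fun g"
  shows "om z (elem f a) (elem g b) = form a b * (LE z f * fls_deriv (LE z g)) $$ (-1)"
proof -
  define F where "F = LE z f"
  define G where "G = LE z g"
  have "(F * fls_deriv G) $$ (-1) = Sum_any (\<lambda>n::int. of_int n * F $$ (- n) * G $$ n)"
  proof -
    let ?h = "\<lambda>n::int. of_int n * F $$ (- n) * G $$ n"
    define d where "d = fls_subdegree F"
    define e where "e = fls_subdegree (fls_deriv G)"
    have "(F * fls_deriv G) $$ (-1) = (\<Sum>i=d..-1-e. F $$ i * fls_deriv G $$ (-1 - i))"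
      unfolding d_def e_def by (rule fls_times_nth(2))
    also have "\<dots> = (\<Sum>i=d..-1-e. ?h (- i))" by (rule sum.cong) auto
    also have "\<dots> = (\<Sum>n\<in>uminus ` {d..-1-e}. ?h n)"
      by (subst sum.reindex) (auto simp: inj_on_def)
    also have "\<dots> = Sum_any ?h"
    proof (rule Sum_any.expand_superset[symmetric])
      show "{n. ?h n \<noteq> 0} \<subseteq> uminus ` {d..-1-e}"
      proof
        fix n assume n: "n \<in> {n. ?h n \<noteq> 0}"
        then have "F $$ (- n) \<noteq> 0" by auto
        then have 1: "\<not> - n < d" unfolding d_def using fls_eq0_below_subdegree by blast
        have "fls_deriv G $$ (n - 1) \<noteq> 0" using n by simp
        then have 2: "\<not> n - 1 < e" unfolding e_def using fls_eq0_below_subdegree by blast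
        have "n = - (- n)" "- n \<in> {d..-1-e}" using 1 2 by auto
        then show "n \<in> uminus ` {d..-1-e}" by blast
      qed
    qed simp
    finally show ?thesis .
  qed
  moreover have "om z (elem f a) (elem g b) = Sum_any (\<lambda>n::int. form a b * (of_int n * F $$ (- n) * G $$ n))"
    unfolding om_def
    by (simp add: lc_elem assms form_scale_left form_scale_right F_def G_def algebra_simps)
  moreover have "finite {n::int. of_int n * F $$ (- n) * G $$ n \<noteq> 0}"
  proof (rule finite_subset)
    show "{n::int. of_int n * F $$ (- n) * G $$ n \<noteq> 0} \<subseteq> {fls_subdegree G..- fls_subdegree F}"
    proof
      fix n :: int assume "n \<in> {n. of_int n * F $$ (- n) * G $$ n \<noteq> 0}"
      then have "F $$ (- n) \<noteq> 0" "G $$ n \<noteq> 0" by auto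
      then have "\<not> - n < fls_subdegree F" "\<not> n < fls_subdegree G" using fls_eq0_below_subdegree by blast+
      then show "n \<in> {fls_subdegree G..- fls_subdegree F}" by simp
    qed
  qed simp
  ultimately show ?thesis by (simp add: Sum_any_right_distrib F_def G_def)
qed

text \<open>On pure terms this is Leibniz's rule f d(gh) = fg dh + fh dg combined with invariance of
  the form; the sign comes from ([a,c],b) = -(a,[b,c]).\<close>

lemma om_cocycle: "om z \<beta> (lie \<alpha> \<gamma>) = om z (lie \<beta> \<alpha>) \<gamma> - om z (lie \<beta> \<gamma>) \<alpha>"
proof (induction \<beta> rule: mero_induct)
  case (ele f a)
  show ?case
  proof (induction \<alpha> rule: mero_induct)
    case (ele g b)
    show ?case
    proof (induction \<gamma> rule: mero_induct)
      case (ele h c)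
      have "form (lie a c) b = - form a (lie b c)"
        by (simp add: form_inv lie_skew[of b c] form_minus_right)
      then show ?case
        using \<open>meromorphic_fun f\<close> \<open>meromorphic_fun g\<close> ele
        by (simp add: elem_lie om_elem meromorphic_fun_mult LE_mult form_inv[of a b c] algebra_simps)
    qed (simp add: lie_add_right om_add_right om_add_left)
  qed (simp add: lie_add_left lie_add_right om_add_right om_add_left)
qed (simp add: lie_add_left om_add_left)

end

text \<open>The sum runs over all orders with the constant term \<open>k = 0\<close> switched off.
  Powers of \<open>pol z\<close> have no pole away from \<open>z\<close>, so the principal part is
  itself a global meromorphic map and can serve as a letter.\<close>

definition pp :: "proj_line \<Rightarrow> 'g::complex_lie_algebra mero \<Rightarrow> 'g mero" where
  "pp z \<beta> = Sum_any (\<lambda>k::nat. elem (polk z k) (if k = 0 then 0 else lc z (- int k) \<beta>))"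

lemma finite_pp: "finite {k::nat. elem (polk z k) (if k = 0 then 0 else lc z (- int k) \<beta>) \<noteq> 0}"
proof -
  obtain M :: nat where M: "\<And>z n. n < - int M \<Longrightarrow> lc z n \<beta> = 0" by (rule pole_bound[of \<beta>]) blast
  have "{k::nat. elem (polk z k) (if k = 0 then 0 else lc z (- int k) \<beta>) \<noteq> 0} \<subseteq> {..M}"
  proof
    fix k assume "k \<in> {k::nat. elem (polk z k) (if k = 0 then 0 else lc z (- int k) \<beta>) \<noteq> 0}"
    then have "lc z (- int k) \<beta> \<noteq> 0" by (auto split: if_splits)
    then have "\<not> - int k < - int M" using M by blast
    then show "k \<in> {..M}" by simp
  qed
  then show ?thesis by (rule finite_subset) simp
qed

lemma pp_add: "pp z (\<beta> + \<gamma>) = pp z \<beta> + pp z \<gamma>"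
proof -
  have "elem (polk z k) (if k = 0 then 0 else lc z (- int k) (\<beta> + \<gamma>)) =
      elem (polk z k) (if k = 0 then 0 else lc z (- int k) \<beta>)
      + elem (polk z k) (if k = 0 then 0 else lc z (- int k) \<gamma>)" for k
    by (simp add: lc_add elem_add_right)
  then show ?thesis unfolding pp_def by (simp only: Sum_any.distrib finite_pp)
qed

text \<open>One finite range covers the poles of both maps, and \<open>L\<close> can be moved inside
  the sum. The two uses are scalar multiplication and the bracket with a constant.\<close>

lemma pp_linear:
  fixes \<beta> \<gamma> :: "'g::complex_lie_algebra mero"
  assumes "\<And>x y. L (x + y) = L x + L y" "\<And>k x. L (elem (polk z k) x) = elem (polk z k) (l x)"
    "l 0 = 0" "\<And>n. lc z n \<gamma> = l (lc z n \<beta>)"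
  shows "pp z \<gamma> = L (pp z \<beta>)"
proof -
  obtain M :: nat where M: "\<And>z n. n < - int M \<Longrightarrow> lc z n \<beta> = 0" by (rule pole_bound[of \<beta>]) blast
  have *: "{k::nat. elem (polk z k) (if k = 0 then 0 else lc z (- int k) \<beta>') \<noteq> 0} \<subseteq> {..M}"
    if "\<And>n. n < - int M \<Longrightarrow> lc z n \<beta>' = 0" for \<beta>' :: "'g mero"
  proof
    fix k assume "k \<in> {k::nat. elem (polk z k) (if k = 0 then 0 else lc z (- int k) \<beta>') \<noteq> 0}"
    then have "lc z (- int k) \<beta>' \<noteq> 0" by (auto split: if_splits)
    then have "\<not> - int k < - int M" using that by blast
    then show "k \<in> {..M}" by simp
  qed
  have L0: "L 0 = 0" using assms(1)[of 0 0] by simp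
  have Lsum: "L (sum h I) = (\<Sum>i\<in>I. L (h i))" for h :: "nat \<Rightarrow> 'g mero" and I
    by (induction I rule: infinite_finite_induct) (auto simp: assms(1) L0)
  have "pp z \<gamma> = (\<Sum>k\<le>M. elem (polk z k) (if k = 0 then 0 else lc z (- int k) \<gamma>))"
    unfolding pp_def
    by (rule Sum_any.expand_superset[OF finite_atMost], rule *) (simp add: assms M)
  also have "\<dots> = L (\<Sum>k\<le>M. elem (polk z k) (if k = 0 then 0 else lc z (- int k) \<beta>))"
    unfolding Lsum by (rule sum.cong) (auto simp: assms(2-4) L0)
  also have "(\<Sum>k\<le>M. elem (polk z k) (if k = 0 then 0 else lc z (- int k) \<beta>)) = pp z \<beta>"
    unfolding pp_def
    by (rule Sum_any.expand_superset[OF finite_atMost, symmetric], rule *) (simp add: M)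
  finally show ?thesis .
qed

lemma pp_scale: "pp z (c *\<^sub>C \<beta>) = c *\<^sub>C pp z \<beta>"
  by (rule pp_linear[where L = "\<lambda>x. c *\<^sub>C x" and l = "\<lambda>x. c *\<^sub>C x"])
    (simp_all add: cscale_add_right elem_scale lc_scale)

lemma pp_lie_const: "pp z (lie \<beta> (const b)) = lie (pp z \<beta>) (const b)"
  by (rule pp_linear[where L = "\<lambda>x. lie x (const b)" and l = "\<lambda>x. lie x b"])
    (simp_all add: lie_add_left const_elem elem_lie lie_zero_left lc_lie_const[unfolded const_elem])

lemma pp_reg: assumes "\<beta> \<in> reg z" shows "pp z \<beta> = 0"
proof -
  have "(if k = 0 then 0 else lc z (- int k) \<beta>) = 0" for k
    using lc_reg[OF assms, of "- int k"] by simp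
  then show ?thesis by (simp add: pp_def)
qed

lemma pp_polk: "k > 0 \<Longrightarrow> pp z (elem (polk z k) a) = elem (polk z k) a"
proof -
  assume k: "k > 0"
  have "pp z (elem (polk z k) a) = Sum_any (\<lambda>j. if j = k then elem (polk z k) a else 0)"
    unfolding pp_def using k by (intro Sum_any.cong) (auto simp: lc_elem LE_pol_power_same cscale_one)
  also have "\<dots> = (\<Sum>j\<in>{k}. if j = k then elem (polk z k) a else 0)"
    by (rule Sum_any.expand_superset) auto
  finally show ?thesis by simp
qed

text \<open>\<open>reg\<close> asks for a whole expansion with regular coefficients. Partial
  fractions provide one: the terms with pole at \<open>z\<close> have coefficient zero, the others
  are regular there.\<close>

lemma reg_iff_lc: "\<nu> \<in> reg z \<longleftrightarrow> (\<forall>n<0. lc z n \<nu> = 0)"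
proof
  assume *: "\<forall>n<0. lc z n \<nu> = 0"
  obtain c S M where S: "finite S" and \<nu>: "\<nu> = const c + (\<Sum>y\<in>S. \<Sum>k=1..M. elem (polk y k) (lc y (- int k) \<nu>))"
    by (rule mero_partial_fractions[of \<nu>])
  have "elem (polk y k) (lc y (- int k) \<nu>) \<in> reg z" if "k \<in> {1..M}" for y k
  proof (cases "y = z")
    case True
    then have "lc y (- int k) \<nu> = 0" using * that by simp
    then show ?thesis by simp
  next
    case False
    then show ?thesis by (intro elem_reg holo_at_power holo_at_pol) auto
  qed
  then have "const c + (\<Sum>y\<in>S. \<Sum>k=1..M. elem (polk y k) (lc y (- int k) \<nu>)) \<in> reg z"
    by (intro reg_add reg_sum const_reg)
  then show "\<nu> \<in> reg z" using \<nu> by simp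
qed (simp add: lc_reg)

lemma lc_lie_pol: "lc z n (lie (elem (pol z) a) \<alpha>) = lie a (lc z (n + 1) \<alpha>)"
proof (induction \<alpha> rule: mero_induct)
  case (ele f b)
  then show ?case
    by (simp add: elem_lie lc_elem meromorphic_fun_mult LE_mult LE_pol_same fls_X_inv_times_conv_shift
        lie_cscale_right)
qed (simp add: lie_add_right lc_add)

lemma lc_pol: "lc z n (elem (pol z) a) = (if n = -1 then a else 0)"
  by (simp add: lc_elem LE_pol_same cscale_one)

text \<open>A simple pole times \<alpha> has only the value \<alpha>(z) in its principal part. Up to
  regular maps, the bracket with a simple pole thus sees nothing of \<alpha> but this value.\<close>

lemma lie_pol_reg: "\<alpha> \<in> reg z \<Longrightarrow> lie (elem (pol z) a) \<alpha> - elem (pol z) (lie a (ev z \<alpha>)) \<in> reg z"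
  unfolding reg_iff_lc[of "lie (elem (pol z) a) \<alpha> - elem (pol z) (lie a (ev z \<alpha>))"]
proof (intro allI impI)
  fix n :: int assume "\<alpha> \<in> reg z" "n < 0"
  have "lc z n (\<mu> - \<kappa>) = lc z n \<mu> - lc z n \<kappa>" for \<mu> \<kappa> :: "'a mero"
    using lc_add[of z n "\<mu> - \<kappa>" \<kappa>] by simp
  then show "lc z n (lie (elem (pol z) a) \<alpha> - elem (pol z) (lie a (ev z \<alpha>))) = 0"
    using \<open>\<alpha> \<in> reg z\<close> \<open>n < 0\<close> lc_reg[of \<alpha> z "n + 1"]
    by (auto simp: lc_lie_pol lc_pol ev_eq lie_zero_right)
qed


section \<open>Coordinates\<close>

lemma holo_at_unique:
  assumes "holo_at f z" "holo_at g z" "finite {p. f p \<noteq> g p}" shows "f z = g z"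
proof -
  have "LE z f = LE z g" by (rule LE_cong) fact
  then show ?thesis using holo_at_LE(2)[OF assms(1)] holo_at_LE(2)[OF assms(2)] by simp
qed

text \<open>Subtracting from \<open>u\<close> the multiple of \<open>pol P\<close> with the same
  pole leaves a constant, up to finitely many points. Away from \<open>P\<close> both sides are
  holomorphic and hence agree at every point.\<close>

lemma coordinateE:
  assumes "coordinate P u"
  obtains c b where "c \<noteq> 0" "\<And>p. p \<noteq> P \<Longrightarrow> u p = c * pol P p + b"
proof -
  have u: "meromorphic_fun u" "\<And>p. p \<noteq> P \<Longrightarrow> holo_at u p" "is_pole (\<lambda>h. u (chart P h)) 0"
    "zorder (\<lambda>h. u (chart P h)) 0 = -1"
    using assms by (auto simp: coordinate_def)
  have LEu: "(\<lambda>h. u (chart P h)) has_laurent_expansion LE P u" by (rule LE_expansion[OF u(1)])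
  have nz: "LE P u \<noteq> 0"
    using has_laurent_expansion_imp_is_pole_iff[of "\<lambda>h. u (chart P h)" 0 "LE P u"] LEu u(3) by auto
  have sd: "fls_subdegree (LE P u) = -1"
    using has_laurent_expansion_zorder_0[OF LEu nz] u(4) by simp
  define c where "c = LE P u $$ (-1)"
  have c: "c \<noteq> 0" using nz sd nth_fls_subdegree_nonzero[OF nz] by (simp add: c_def)
  have mer: "meromorphic_fun (\<lambda>p. c * pol P p)" by (intro meromorphic_fun_mult) auto
  have "LE z (\<lambda>p. u p - c * pol P p) $$ n = 0" if "n < 0" for z n
  proof (cases "z = P")
    case True
    have "n < -1 \<Longrightarrow> LE P u $$ n = 0" using sd by simp
    then show ?thesis unfolding LE_diff[OF u(1) mer] using True that
      by (cases "n = -1") (auto simp: LE_cmult LE_pol_same c_def)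
  next
    case False
    then show ?thesis using that
      by (intro holo_at_LE(1) holo_at_diff holo_at_mult) (auto simp: u holo_at_pol)
  qed
  then obtain b where b: "finite {p. u p - c * pol P p \<noteq> b}"
    by (rule regular_imp_constant[OF meromorphic_fun_diff[OF u(1) mer]])
  have "u p = c * pol P p + b" if "p \<noteq> P" for p
    by (rule holo_at_unique)
      (use that b in \<open>auto simp: u holo_at_pol diff_eq_eq add.commute intro!: holo_at_add holo_at_mult\<close>)
  then show ?thesis using c that by blast
qed

lemma pol_inj: "p \<noteq> P \<Longrightarrow> q \<noteq> P \<Longrightarrow> pol P p = pol P q \<Longrightarrow> p = q"
  by (cases P; cases p; cases q) auto

lemma pol_surj: obtains p where "p \<noteq> P" "pol P p = s"
proof (cases P)
  case (Fin q)
  show ?thesis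
  proof (cases "s = 0")
    case True
    then show ?thesis using that[of Infty] Fin by simp
  next
    case False
    then show ?thesis using that[of "Fin (q + inverse s)"] Fin by simp
  qed
next
  case Infty
  then show ?thesis using that[of "Fin s"] by simp
qed

lemma coordinate_inj:
  assumes "coordinate P u" "p \<noteq> P" "q \<noteq> P" "u p = u q" shows "p = q"
proof -
  obtain c b where "c \<noteq> 0" "\<And>p. p \<noteq> P \<Longrightarrow> u p = c * pol P p + b" by (rule coordinateE[OF assms(1)]) blast
  then show ?thesis using pol_inj[of p P q] assms by simp
qed

lemma coordinate_meromorphic: "coordinate P u \<Longrightarrow> meromorphic_fun u"
  and coordinate_holo: "coordinate P u \<Longrightarrow> p \<noteq> P \<Longrightarrow> holo_at u p"
  by (auto simp: coordinate_def)

lemma diff_pol: "diff (pol Infty) (Fin b) = 1" "b \<noteq> q \<Longrightarrow> diff (pol (Fin q)) (Fin b) = - inverse ((b - q)^2)"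
  "diff (pol (Fin q)) Infty = 1"
proof -
  show "diff (pol Infty) (Fin b) = 1" by (simp add: diff_def)
  show "diff (pol (Fin q)) (Fin b) = - inverse ((b - q)^2)" if "b \<noteq> q"
  proof -
    have "((\<lambda>h. inverse (b + h - q)) has_field_derivative - inverse ((b - q)^2)) (at 0)"
      by (rule derivative_eq_intros refl | use that in \<open>simp add: power2_eq_square\<close>)+
    then show ?thesis by (simp add: diff_def DERIV_imp_deriv)
  qed
  have "pol (Fin q) (chart Infty h) = h / (1 - q * h)" for h
    by (cases "1 - q * h = 0") (auto simp: field_simps)
  moreover have "((\<lambda>h. h / (1 - q * h)) has_field_derivative 1) (at 0)"
    by (rule derivative_eq_intros refl | simp)+
  ultimately show "diff (pol (Fin q)) Infty = 1" by (simp add: diff_def DERIV_imp_deriv)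
qed

lemma diff_pol_nonzero: "z \<noteq> P \<Longrightarrow> diff (pol P) z \<noteq> 0"
  by (cases P; cases z) (auto simp: diff_pol)

text \<open>As functions of \<open>p\<close>, both sides have a simple pole at \<open>z\<close> with
  leading coefficient 1 in \<open>coord z\<close>, and both vanish at \<open>P\<close>. The case
  distinction only unfolds the finite and infinite points.\<close>

lemma pol_identity:
  assumes "z \<noteq> P" "p \<noteq> z" "p \<noteq> P"
  shows "diff (pol P) z / (pol P p - pol P z) = pol z p - pol z P"
proof (cases P; cases z; cases p)
  fix q b x assume *: "P = Fin q" "z = Fin b" "p = Fin x"
  then have "b \<noteq> q" "x \<noteq> b" "x \<noteq> q" using assms by auto
  then show ?thesis using *
    by (simp add: diff_pol divide_simps power2_eq_square) (simp add: algebra_simps)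
next
  fix q b assume *: "P = Fin q" "z = Fin b" "p = Infty"
  then have "b \<noteq> q" using assms by auto
  then show ?thesis using *
    by (simp add: diff_pol divide_simps power2_eq_square)
qed (use assms in \<open>auto simp: diff_pol divide_simps\<close>)

lemma diff_affine: "holo_at f z \<Longrightarrow> diff (\<lambda>p. c * f p + b) z = c * diff f z"
  unfolding diff_def holo_at_def
  by (subst deriv_add) (auto simp: deriv_cmult dest: analytic_on_imp_differentiable_at intro!: derivative_intros)

lemma diff_cong:
  assumes "\<And>q. q \<noteq> P \<Longrightarrow> f q = g q" "z \<noteq> P" shows "diff f z = diff g z"
proof -
  have "eventually (\<lambda>h. chart z h \<notin> {P}) (at 0)" by (rule eventually_chart_notin) simp
  then have "eventually (\<lambda>h. chart z h \<noteq> P) (nhds 0)"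
    using assms(2) by (auto simp: eventually_at_filter elim!: eventually_mono)
  then have "eventually (\<lambda>h. f (chart z h) = g (chart z h)) (nhds 0)"
    by eventually_elim (simp add: assms)
  then show ?thesis unfolding diff_def by (intro deriv_cong_ev) auto
qed

lemma coordinate_diff:
  assumes "\<And>p. p \<noteq> P \<Longrightarrow> u p = c * pol P p + b" "z \<noteq> P" shows "diff u z = c * diff (pol P) z"
proof -
  have "diff u z = diff (\<lambda>p. c * pol P p + b) z" by (rule diff_cong[OF _ assms(2)]) (rule assms)
  then show ?thesis using assms(2) by (simp add: diff_affine holo_at_pol)
qed

lemma coordinate_diff_nonzero: assumes "coordinate P u" "z \<noteq> P" shows "diff u z \<noteq> 0"
proof -
  obtain c b where "c \<noteq> 0" "\<And>p. p \<noteq> P \<Longrightarrow> u p = c * pol P p + b" by (rule coordinateE[OF assms(1)]) blast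
  then show ?thesis
    using coordinate_diff[of P u c b z] assms(2) by (simp add: diff_pol_nonzero)
qed

text \<open>A coordinate with pole at \<open>P\<close> is affine in \<open>pol P\<close>, and the
  quotient is invariant under affine changes. Hence \<epsilon> depends on \<open>P\<close> but not
  on the choice of \<open>u\<close>.\<close>

lemma coordinate_eps:
  assumes "coordinate P u" "z \<noteq> P" "p \<noteq> z" "p \<noteq> P"
  shows "diff u z / (u p - u z) = pol z p - pol z P"
proof -
  obtain c b where *: "c \<noteq> 0" "\<And>p. p \<noteq> P \<Longrightarrow> u p = c * pol P p + b" by (rule coordinateE[OF assms(1)]) blast
  have "diff u z / (u p - u z) = (c * diff (pol P) z) / (c * (pol P p - pol P z))"
    using assms by (simp add: coordinate_diff[OF *(2)] *(2) right_diff_distrib)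
  then show ?thesis using pol_identity[OF assms(2-4)] *(1) by simp
qed

lemma eps_elt_pol:
  assumes "coordinate P u" "z \<noteq> P"
  shows "eps_elt u z a = elem (\<lambda>p. pol z p - pol z P) a"
proof -
  have "eps_elt u z a = elem (\<lambda>p. diff u z / (u p - u z)) a" by (simp add: eps_elt_def elem_def)
  also have "\<dots> = elem (\<lambda>p. pol z p - pol z P) a"
  proof (rule elem_cong)
    show "finite {p. diff u z / (u p - u z) \<noteq> pol z p - pol z P}"
      by (rule finite_subset[of _ "{z, P}"]) (use coordinate_eps[OF assms] in auto)
  qed (use assms coordinate_meromorphic in \<open>auto intro!: meromorphic_fun_divide meromorphic_fun_diff\<close>)
  finally show ?thesis .
qed

lemma elem_pol_shift: "elem (\<lambda>p. pol z p - c) a = elem (pol z) a + const (- c *\<^sub>C a)"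
proof -
  have "elem (\<lambda>p. pol z p + (- c) * 1) a = elem (pol z) a + elem (\<lambda>p. (- c) * 1) a"
    by (rule elem_add_left) (auto intro: meromorphic_fun_mult)
  then show ?thesis unfolding elem_scale_left by (simp add: const_elem)
qed

text \<open>All dependence on \<open>P\<close> sits in a constant map. A constant is regular at
  \<open>z\<close>, which is how an operator free of \<open>P\<close> can restrict to \<epsilon> +
  \<iota> for every \<open>P\<close>.\<close>

lemma eps_elt_const: "coordinate P u \<Longrightarrow> z \<noteq> P \<Longrightarrow>
    eps_elt u z a = elem (pol z) a + const (- pol z P *\<^sub>C a)"
  by (simp add: eps_elt_pol elem_pol_shift)

lemma eps_elt_van: "coordinate P u \<Longrightarrow> z \<noteq> P \<Longrightarrow> eps_elt u z a \<in> van P"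
  by (simp add: eps_elt_pol elem_van meromorphic_fun_diff holo_at_diff holo_at_pol)

lemma eps_elt_add: "coordinate P u \<Longrightarrow> z \<noteq> P \<Longrightarrow> eps_elt u z (a + b) = eps_elt u z a + eps_elt u z b"
  and eps_elt_scale: "coordinate P u \<Longrightarrow> z \<noteq> P \<Longrightarrow> eps_elt u z (c *\<^sub>C a) = c *\<^sub>C eps_elt u z a"
  by (simp_all add: eps_elt_pol elem_add_right elem_scale meromorphic_fun_diff)

lemma lie_eps_reg:
  assumes "coordinate P u" "z \<noteq> P" "\<alpha> \<in> reg z"
  shows "- lie (eps_elt u z a) \<alpha> + eps_elt u z (lie a (ev z \<alpha>)) \<in> reg z"
proof -
  have "- lie (eps_elt u z a) \<alpha> + eps_elt u z (lie a (ev z \<alpha>)) =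
      - (lie (elem (pol z) a) \<alpha> - elem (pol z) (lie a (ev z \<alpha>)))
      + (const (- pol z P *\<^sub>C lie a (ev z \<alpha>)) - lie (const (- pol z P *\<^sub>C a)) \<alpha>)"
    using assms by (simp add: eps_elt_const lie_add_left)
  also have "\<dots> \<in> reg z"
    by (intro reg_add reg_minus reg_diff[of _ _ "lie _ _"] lie_pol_reg reg_lie const_reg assms(3))
  finally show ?thesis .
qed

lemma lie_eps_van:
  assumes "coordinate P u" "z \<noteq> P" "\<alpha> \<in> van P"
  shows "- lie (eps_elt u z a) \<alpha> + eps_elt u z (lie a b) \<in> van P"
  using assms by (intro van_add van_minus van_lie eps_elt_van)

section \<open>Residue operators on the vacuum module\<close>

lemma lie_diff_right: "lie x (y - z) = lie x y - lie x (z::'a::complex_lie_algebra)"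
  using lie_add_right[of x y "- z"] by (simp add: lie_minus_right)

lemma gen_add: "\<alpha> \<in> H \<Longrightarrow> \<beta> \<in> H \<Longrightarrow> eqm (uea_ideal H) (gen (\<alpha> + \<beta>)) (gen \<alpha> + gen \<beta>)"
  using uea_ideal.rel_add[of \<alpha> H \<beta>] by (simp add: eqm_def diff_diff_eq)

lemma gen_scale: "\<alpha> \<in> H \<Longrightarrow> eqm (uea_ideal H) (gen (c *\<^sub>C \<alpha>)) (scal c * gen \<alpha>)"
  using uea_ideal.rel_scale[of \<alpha> H c] by (simp add: eqm_def)

lemma gen_lie: "\<alpha> \<in> H \<Longrightarrow> \<beta> \<in> H \<Longrightarrow>
    eqm (uea_ideal H) (gen \<alpha> * gen \<beta> - gen \<beta> * gen \<alpha>) (gen (lie \<alpha> \<beta>))"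
  using uea_ideal.rel_lie[of \<alpha> H \<beta>] by (simp add: eqm_def)

lemma gen_zero: "0 \<in> H \<Longrightarrow> gen 0 \<in> uea_ideal H"
  using gen_scale[of 0 H 0] by (simp add: eqm_def)

lemma gen_minus: "\<alpha> \<in> H \<Longrightarrow> eqm (uea_ideal H) (gen (- \<alpha>)) (- gen \<alpha>)"
  using gen_scale[of \<alpha> H "-1"] by (simp add: cscale_minus_left cscale_one scal_minus)

lemma gen_diff: "\<alpha> \<in> H \<Longrightarrow> - \<beta> \<in> H \<Longrightarrow> \<beta> \<in> H \<Longrightarrow> eqm (uea_ideal H) (gen (\<alpha> - \<beta>)) (gen \<alpha> - gen \<beta>)"
  using eqm_trans[OF subsp_uea gen_add[of \<alpha> H "- \<beta>"]
      eqm_add[OF subsp_uea eqm_refl[OF subsp_uea, of _ "gen \<alpha>"] gen_minus[of \<beta> H]]] by simp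

lemma uea_sub_vac: "uea_ideal H \<subseteq> vac_ideal UNIV"
  by (rule uea_vac) simp

lemma eqm_vacI: "eqm (uea_ideal H) s t \<Longrightarrow> eqm (vac_ideal UNIV) s t"
  by (rule eqm_mono[OF uea_sub_vac])

text \<open>\<open>resop form z \<beta>\<close> is \<open>A\<^sub>z(\<beta>)\<close>.\<close>

definition resop :: "('g \<Rightarrow> 'g \<Rightarrow> complex) \<Rightarrow> proj_line \<Rightarrow> 'g::complex_lie_algebra mero \<Rightarrow>
    'g mero free_alg \<Rightarrow> 'g mero free_alg" where
  "resop form z = op_ext lie (\<lambda>\<beta> \<alpha>. - scal (om form z \<beta> \<alpha>)) (\<lambda>\<beta>. gen (pp z \<beta>))"

lemma resop_1: "resop form z \<beta> 1 = gen (pp z \<beta>)"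
  and resop_0: "resop form z \<beta> 0 = 0"
  and resop_sum: "resop form z \<beta> (s + t) = resop form z \<beta> s + resop form z \<beta> t"
  and resop_minus: "resop form z \<beta> (s - t) = resop form z \<beta> s - resop form z \<beta> t"
  and resop_scal: "resop form z \<beta> (scal c * t) = scal c * resop form z \<beta> t"
  and resop_gen: "resop form z \<beta> (gen \<alpha> * t) =
      gen \<alpha> * resop form z \<beta> t - scal (om form z \<beta> \<alpha>) * t + resop form z (lie \<beta> \<alpha>) t"
  by (simp_all add: resop_def op_ext_1 op_ext_0 op_ext_add op_ext_diff op_ext_scal op_ext_gen)

lemma om_reg:
  assumes form: "invariant_form form" and "\<beta> \<in> reg z" "\<alpha> \<in> reg z" shows "om form z \<beta> \<alpha> = 0"
proof -
  have "of_int n * form (lc z (- n) \<beta>) (lc z n \<alpha>) = 0" for n :: int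
    using lc_reg[OF assms(2), of "- n"] lc_reg[OF assms(3), of n]
    by (cases "n = 0"; cases "n < 0") (auto simp: form_zero[OF form])
  then show ?thesis unfolding om_def[OF form] by (simp only: Sum_any.neutral)
qed

text \<open>\<open>pol z\<close> has the single Laurent coefficient of order -1, so that only n = 1
  survives. This is where the term (a, d\<alpha>(z)) of the defining relation of \<iota> arises as a
  residue.\<close>

lemma om_pol:
  assumes form: "invariant_form form" and "\<alpha> \<in> reg z" shows "om form z (elem (pol z) a) \<alpha> = form a (dev z \<alpha>)"
proof -
  have "om form z (elem (pol z) a) \<alpha> = Sum_any (\<lambda>n::int. if n = 1 then form a (lc z 1 \<alpha>) else 0)"
    unfolding om_def[OF form] by (rule Sum_any.cong) (auto simp: lc_pol form_zero[OF form])
  also have "\<dots> = (\<Sum>n\<in>{1::int}. if n = 1 then form a (lc z 1 \<alpha>) else 0)"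
    by (rule Sum_any.expand_superset) auto
  finally show ?thesis by (simp add: dev_eq assms(2))
qed

context
  fixes form :: "'g::complex_lie_algebra \<Rightarrow> 'g \<Rightarrow> complex"
  assumes form: "invariant_form form"
begin

text \<open>The action on indices is the bracket, an action by the Jacobi identity. The commutator
  term is a scalar, hence central, and the condition on it reduces to the cocycle identity of the
  residue.\<close>

lemma operators_resop: "operators UNIV (vac_ideal UNIV :: 'g mero free_alg set) lie
    (\<lambda>\<beta> \<alpha>. - scal (om form z \<beta> \<alpha>)) (\<lambda>\<beta>. gen (pp z \<beta>))"
proof
  fix k k' :: "'g mero" and c
  show "eqm (vac_ideal UNIV) (gen (pp z (k + k'))) (gen (pp z k) + gen (pp z k'))"
    unfolding pp_add by (rule eqm_vacI[OF gen_add[of _ UNIV]]) auto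
  show "eqm (vac_ideal UNIV) (gen (pp z (c *\<^sub>C k))) (scal c * gen (pp z k))"
    unfolding pp_scale by (rule eqm_vacI[OF gen_scale[of _ UNIV]]) auto
next
  fix k \<alpha> \<beta> :: "'g mero"
  show "eqm (uea_ideal UNIV) (- scal (om form z k (lie \<alpha> \<beta>)))
     (gen \<alpha> * - scal (om form z k \<beta>) - - scal (om form z k \<beta>) * gen \<alpha> -
      (gen \<beta> * - scal (om form z k \<alpha>) - - scal (om form z k \<alpha>) * gen \<beta>) +
      - scal (om form z (lie k \<alpha>) \<beta>) - - scal (om form z (lie k \<beta>) \<alpha>))"
    unfolding om_cocycle[OF form, of z k \<alpha> \<beta>]
    by (simp add: scal_central[of _ "gen \<alpha>"] scal_central[of _ "gen \<beta>"] scal_diff eqm_refl)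
next
  fix k \<alpha> \<beta> :: "'g mero"
  show "lie k (lie \<alpha> \<beta>) + lie (lie k \<beta>) \<alpha> = lie (lie k \<alpha>) \<beta>"
    by (simp add: lie_jacobi'[of k \<alpha> \<beta>])
qed (auto simp: uea_sub_vac free_on_minus lie_add_left lie_add_right lie_cscale_left lie_cscale_right
    om_add_left[OF form] om_add_right[OF form] om_scale_left[OF form] om_scale_right[OF form]
    scal_add scal_mult eqm_refl)

lemma resop_add: "eqm (vac_ideal UNIV) (resop form z (\<beta> + \<gamma>) t) (resop form z \<beta> t + resop form z \<gamma> t)"
  unfolding resop_def by (rule operators.Op_add[OF operators_resop]) simp

lemma resop_scale: "eqm (vac_ideal UNIV) (resop form z (c *\<^sub>C \<beta>) t) (scal c * resop form z \<beta> t)"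
  unfolding resop_def by (rule operators.Op_scale[OF operators_resop]) simp

lemma vac_lmult: "r \<in> vac_ideal UNIV \<Longrightarrow> s * r \<in> vac_ideal UNIV"
  by (rule left_stableD[OF left_stable_vac]) auto

text \<open>The residue pairing of \<beta> with the differential of a constant b is zero, and the
  principal part of [\<beta>, b] is [pp \<beta>, b]. So A(\<beta>) takes b to b pp(\<beta>) +
  [pp(\<beta>), b] = pp(\<beta>) b, which is zero in the vacuum module; left factors are then passed
  by induction.\<close>

lemma resop_const_right: "resop form z \<beta> (s * gen (const b)) \<in> vac_ideal UNIV"
proof -
  have base: "resop form z \<beta> (gen (const b)) \<in> vac_ideal UNIV" for \<beta>
  proof -
    have "lc z n (const b) = 0" if "n \<noteq> 0" for n
      using that by (simp add: const_elem lc_elem LE_const)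
    then have "of_int n * form (lc z (- n) \<beta>) (lc z n (const b)) = 0" for n :: int
      by (cases "n = 0") (auto simp: form_zero[OF form])
    then have 0: "om form z \<beta> (const b) = 0"
      unfolding om_def[OF form] by (simp only: Sum_any.neutral)
    have "resop form z \<beta> (gen (const b)) = gen (const b) * gen (pp z \<beta>) + gen (lie (pp z \<beta>) (const b))"
      using resop_gen[of form z \<beta> "const b" 1] by (simp add: 0 resop_1 pp_lie_const)
    also have "\<dots> = gen (pp z \<beta>) * gen (const b)
        - (gen (pp z \<beta>) * gen (const b) - gen (const b) * gen (pp z \<beta>) - gen (lie (pp z \<beta>) (const b)))"
      by simp
    also have "\<dots> \<in> vac_ideal UNIV"
    proof (rule subsp_diff[OF subsp_vac vac_lmult[OF gen_const_vac]])
      show "gen (pp z \<beta>) * gen (const b) - gen (const b) * gen (pp z \<beta>) - gen (lie (pp z \<beta>) (const b))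
          \<in> vac_ideal UNIV"
        using gen_lie[of "pp z \<beta>" UNIV "const b"] uea_sub_vac by (auto simp: eqm_def)
    qed
    finally show ?thesis .
  qed
  have word: "resop form z \<beta> (gens w * gen (const b)) \<in> vac_ideal UNIV" for w \<beta>
  proof (induction w arbitrary: \<beta>)
    case (Cons \<alpha> w)
    have "gen \<alpha> * resop form z \<beta> (gens w * gen (const b)) \<in> vac_ideal UNIV"
      by (rule vac_lmult[OF Cons])
    moreover have "scal (om form z \<beta> \<alpha>) * (gens w * gen (const b)) \<in> vac_ideal UNIV"
      by (intro vac_lmult gen_const_vac)
    moreover have "resop form z (lie \<beta> \<alpha>) (gens w * gen (const b)) \<in> vac_ideal UNIV" by (rule Cons)
    ultimately show ?case
      by (simp add: gens_Cons mult.assoc resop_gen subsp_add subsp_diff)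
  qed (simp add: base)
  have "s \<in> free_on UNIV" by simp
  then show ?thesis
    by (induction rule: free_on_induct)
      (auto simp: distrib_right resop_sum mult.assoc resop_scal word intro: subsp_add vac_lmult)
qed

lemma resop_vac: assumes "r \<in> vac_ideal UNIV" shows "resop form z \<beta> r \<in> vac_ideal UNIV"
  using assms
proof (induction rule: vac_ideal.induct)
  case (uea r)
  then show ?case unfolding resop_def by (rule operators.Op_ideal[OF operators_resop])
next
  case (balance t a)
  from balance(2) show ?case
  proof (induction rule: free_on_induct)
    case (add a a')
    have "t * (a + a') - t * scal (lk (a + a') 0) = (t * a - t * scal (lk a 0)) + (t * a' - t * scal (lk a' 0))"
      by (simp add: lookup_add scal_add distrib_left)
    then show ?case using add by (simp add: resop_sum subsp_add)
  next
    case (word c w)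
    show ?case
    \<comment> \<open>A nonempty word in constants has coefficient zero at the empty word and ends
      in a constant, so \<open>resop_const_right\<close> applies; for the empty word the relation is
      trivial.\<close>
    proof (cases w rule: rev_cases)
      case Nil
      then show ?thesis by (simp add: scal_def zero_word_def lookup_single resop_0 subsp_0)
    next
      case (snoc v x)
      then obtain b where b: "x = const b" using word by auto
      have "lk (scal c * gens w) 0 = 0"
        by (simp add: scal_gens snoc zero_word_def lookup_single)
      moreover have "t * (scal c * gens w) = (t * scal c * gens v) * gen (const b)"
        by (simp add: snoc b gens_append gens_Cons mult.assoc)
      ultimately show ?thesis using resop_const_right by simp
    qed
  qed
next
  case (add s t)
  then show ?case by (simp add: resop_sum subsp_add)
qed

lemma resop_eqm: "eqm (vac_ideal UNIV) s t \<Longrightarrow> eqm (vac_ideal UNIV) (resop form z \<beta> s) (resop form z \<beta> t)"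
  using resop_vac[of "s - t"] by (simp add: eqm_def resop_minus)

text \<open>With \<beta> and all letters regular at \<open>z\<close>, residues and principal parts
  vanish, and brackets remain regular. This permits replacing \<beta> by any map with the same
  principal part, as long as the vector is regular at \<open>z\<close>.\<close>

lemma resop_reg:
  assumes "\<beta> \<in> reg z" "t \<in> free_on (reg z)" shows "resop form z \<beta> t \<in> vac_ideal UNIV"
proof -
  have word: "resop form z \<beta> (gens w) \<in> vac_ideal UNIV" if "set w \<subseteq> reg z" "\<beta> \<in> reg z" for w \<beta>
    using that
  proof (induction w arbitrary: \<beta>)
    case Nil
    then show ?case using gen_zero[of UNIV] uea_sub_vac by (auto simp: resop_1 pp_reg)
  next
    case (Cons \<alpha> w)
    then have "resop form z \<beta> (gens (\<alpha> # w)) = gen \<alpha> * resop form z \<beta> (gens w) + resop form z (lie \<beta> \<alpha>) (gens w)"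
      by (simp add: gens_Cons resop_gen om_reg[OF form])
    then show ?case using Cons by (simp add: subsp_add vac_lmult reg_lie)
  qed
  show ?thesis using assms(2)
    by (induction rule: free_on_induct)
      (auto simp: resop_sum resop_scal word[OF _ assms(1)] intro: subsp_add vac_lmult)
qed

end


section \<open>The operators \<open>\<iota>\<close>\<close>

definition celt :: "(proj_line \<Rightarrow> complex) \<Rightarrow> proj_line \<Rightarrow> 'g \<Rightarrow> 'g mero \<Rightarrow> 'g::complex_lie_algebra mero" where
  "celt u z a \<alpha> = - lie (eps_elt u z a) \<alpha> + eps_elt u z (lie a (ev z \<alpha>))"

definition iop :: "('g \<Rightarrow> 'g \<Rightarrow> complex) \<Rightarrow> (proj_line \<Rightarrow> complex) \<Rightarrow> proj_line \<Rightarrow> 'g::complex_lie_algebra \<Rightarrow>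
    'g mero free_alg \<Rightarrow> 'g mero free_alg" where
  "iop form u z = op_ext (\<lambda>a \<alpha>. lie a (ev z \<alpha>))
     (\<lambda>a \<alpha>. gen (celt u z a \<alpha>) - scal (form a (dev z \<alpha>))) (\<lambda>a. 0)"

lemma iop_1: "iop form u z a 1 = 0"
  and iop_0: "iop form u z a 0 = 0"
  and iop_add: "iop form u z a (s + t) = iop form u z a s + iop form u z a t"
  and iop_minus: "iop form u z a (s - t) = iop form u z a s - iop form u z a t"
  and iop_scal: "iop form u z a (scal c * t) = scal c * iop form u z a t"
  and iop_gen: "iop form u z a (gen \<alpha> * t) = gen \<alpha> * iop form u z a t
      + (gen (celt u z a \<alpha>) - scal (form a (dev z \<alpha>))) * t + iop form u z (lie a (ev z \<alpha>)) t"
  by (simp_all add: iop_def op_ext_1 op_ext_0 op_ext_add op_ext_diff op_ext_scal op_ext_gen)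

lemma free_reg: "t \<in> free_on (van P \<inter> reg z) \<Longrightarrow> t \<in> free_on (reg z)"
  by (erule free_on_mono[rotated]) simp

locale iota_setup =
  fixes form :: "'g::complex_lie_algebra \<Rightarrow> 'g \<Rightarrow> complex" and P z :: proj_line and u
  assumes form: "invariant_form form" and u: "coordinate P u" and zP: "z \<noteq> P"
begin

abbreviation "Hz \<equiv> van P \<inter> reg z :: 'g mero set"
abbreviation "Jz \<equiv> uea_ideal Hz"

lemma celt_Hz: "\<alpha> \<in> Hz \<Longrightarrow> celt u z a \<alpha> \<in> Hz"
  unfolding celt_def using lie_eps_reg[OF u zP] lie_eps_van[OF u zP] by blast

lemma celt_linear:
  "celt u z (a + b) \<alpha> = celt u z a \<alpha> + celt u z b \<alpha>"
  "celt u z (c *\<^sub>C a) \<alpha> = c *\<^sub>C celt u z a \<alpha>"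
  "\<alpha> \<in> Hz \<Longrightarrow> \<beta> \<in> Hz \<Longrightarrow> celt u z a (\<alpha> + \<beta>) = celt u z a \<alpha> + celt u z a \<beta>"
  "\<alpha> \<in> Hz \<Longrightarrow> celt u z a (c *\<^sub>C \<alpha>) = c *\<^sub>C celt u z a \<alpha>"
  by (simp_all add: celt_def eps_elt_add[OF u zP] eps_elt_scale[OF u zP] lie_add_left lie_add_right
      lie_cscale_left lie_cscale_right ev_add ev_scale cscale_add_right cscale_diff_right)

lemma eps_minus: "eps_elt u z (- a) = - eps_elt u z a"
  using eps_elt_scale[OF u zP, of "-1" a] by (simp add: cscale_minus_left cscale_one)

lemma eps_diff: "eps_elt u z (a - b) = eps_elt u z a - eps_elt u z b"
  using eps_elt_add[OF u zP, of a "- b"] by (simp add: eps_minus)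

text \<open>The Jacobi identity for the bracket with the \<epsilon> element, and evaluation at
  \<open>z\<close> being a homomorphism. The brackets of \<alpha> and \<beta> with evaluated
  \<epsilon> elements, which arise in the first two terms, cancel against the last two.\<close>

lemma celt_lie:
  assumes "\<alpha> \<in> Hz" "\<beta> \<in> Hz"
  shows "celt u z a (lie \<alpha> \<beta>) = lie \<alpha> (celt u z a \<beta>) - lie \<beta> (celt u z a \<alpha>)
    + celt u z (lie a (ev z \<alpha>)) \<beta> - celt u z (lie a (ev z \<beta>)) \<alpha>"
proof -
  let ?E = "eps_elt u z"
  have 1: "lie (?E a) (lie \<alpha> \<beta>) = lie \<alpha> (lie (?E a) \<beta>) - lie \<beta> (lie (?E a) \<alpha>)"
    using lie_jacobi'[of "?E a" \<alpha> \<beta>] lie_skew[of "lie (?E a) \<beta>" \<alpha>] lie_skew[of "lie (?E a) \<alpha>" \<beta>]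
    by simp
  have 2: "?E (lie a (lie (ev z \<alpha>) (ev z \<beta>))) =
      ?E (lie (lie a (ev z \<alpha>)) (ev z \<beta>)) - ?E (lie (lie a (ev z \<beta>)) (ev z \<alpha>))"
    by (simp add: lie_jacobi'[of a] eps_diff)
  have 3: "lie \<alpha> (?E b) = - lie (?E b) \<alpha>" "lie \<beta> (?E b) = - lie (?E b) \<beta>" for b
    by (rule lie_skew)+
  show ?thesis
    using assms unfolding celt_def
    by (simp add: 1 2 3 ev_lie lie_diff_right)
qed

lemma operators_iop: "operators Hz Jz (\<lambda>a \<alpha>. lie a (ev z \<alpha>))
     (\<lambda>a \<alpha>. gen (celt u z a \<alpha>) - scal (form a (dev z \<alpha>))) (\<lambda>a. 0)"
proof
  fix a b :: 'g and c and \<alpha> \<beta> :: "'g mero"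
  assume \<alpha>: "\<alpha> \<in> Hz"
  let ?e = "\<lambda>a \<alpha>. gen (celt u z a \<alpha>) - scal (form a (dev z \<alpha>))"
  note gd = eqm_diff[OF subsp_uea _ eqm_refl[OF subsp_uea]]
  show "c *\<^sub>C \<alpha> \<in> Hz" using \<alpha> by (simp add: van_scale reg_scale)
  show "?e a \<alpha> \<in> free_on Hz" by (intro free_on_diff free_on_gen celt_Hz \<alpha> free_on_scal)
  show "eqm Jz (?e (a + b) \<alpha>) (?e a \<alpha> + ?e b \<alpha>)"
    using gd[OF gen_add[OF celt_Hz[OF \<alpha>] celt_Hz[OF \<alpha>]], of a b "scal (form (a + b) (dev z \<alpha>))"]
    by (simp add: celt_linear form_add_left[OF form] scal_add algebra_simps)
  show "eqm Jz (?e (c *\<^sub>C a) \<alpha>) (scal c * ?e a \<alpha>)"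
    using gd[OF gen_scale[OF celt_Hz[OF \<alpha>]], of c a "scal (form (c *\<^sub>C a) (dev z \<alpha>))"]
    by (simp add: celt_linear form_scale_left[OF form] scal_mult algebra_simps)
  show "eqm Jz (?e a (c *\<^sub>C \<alpha>)) (scal c * ?e a \<alpha>)"
    using gd[OF gen_scale[OF celt_Hz[OF \<alpha>]], of c a "scal (form a (dev z (c *\<^sub>C \<alpha>)))"] \<alpha>
    by (simp add: celt_linear dev_scale form_scale_right[OF form] scal_mult algebra_simps)
  show "lie (a + b) (ev z \<alpha>) = lie a (ev z \<alpha>) + lie b (ev z \<alpha>)"
    "lie (c *\<^sub>C a) (ev z \<alpha>) = c *\<^sub>C lie a (ev z \<alpha>)"
    "lie a (ev z (c *\<^sub>C \<alpha>)) = c *\<^sub>C lie a (ev z \<alpha>)"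
    using \<alpha> by (simp_all add: lie_add_left lie_cscale_left lie_cscale_right ev_scale)
  assume \<beta>: "\<beta> \<in> Hz"
  show "\<alpha> + \<beta> \<in> Hz" "lie \<alpha> \<beta> \<in> Hz"
    using \<alpha> \<beta> by (simp_all add: van_add reg_add van_lie reg_lie)
  show "eqm Jz (?e a (\<alpha> + \<beta>)) (?e a \<alpha> + ?e a \<beta>)"
    using gd[OF gen_add[OF celt_Hz[OF \<alpha>] celt_Hz[OF \<beta>]], of a a "scal (form a (dev z (\<alpha> + \<beta>)))"] \<alpha> \<beta>
    by (simp add: celt_linear dev_add form_add_right[OF form] scal_add algebra_simps)
  show "lie a (ev z (\<alpha> + \<beta>)) = lie a (ev z \<alpha>) + lie a (ev z \<beta>)"
    "lie a (ev z (lie \<alpha> \<beta>)) + lie (lie a (ev z \<beta>)) (ev z \<alpha>) = lie (lie a (ev z \<alpha>)) (ev z \<beta>)"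
    using \<alpha> \<beta> by (simp_all add: ev_add lie_add_right ev_lie lie_jacobi'[of a])
  show "eqm Jz (?e a (lie \<alpha> \<beta>)) (gen \<alpha> * ?e a \<beta> - ?e a \<beta> * gen \<alpha> - (gen \<beta> * ?e a \<alpha> - ?e a \<alpha> * gen \<beta>)
      + ?e (lie a (ev z \<alpha>)) \<beta> - ?e (lie a (ev z \<beta>)) \<alpha>)"
  proof -
    let ?ab = "celt u z (lie a (ev z \<alpha>)) \<beta>" and ?ba = "celt u z (lie a (ev z \<beta>)) \<alpha>"
    let ?x = "lie \<alpha> (celt u z a \<beta>)" and ?y = "lie \<beta> (celt u z a \<alpha>)"
    have H: "?ab \<in> Hz" "?ba \<in> Hz" "celt u z a \<alpha> \<in> Hz" "celt u z a \<beta> \<in> Hz"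
      using celt_Hz \<alpha> \<beta> by blast+
    then have H': "?x \<in> Hz" "?y \<in> Hz" using \<alpha> \<beta> by (simp_all add: van_lie reg_lie)
    have neg: "\<And>x. x \<in> Hz \<Longrightarrow> - x \<in> Hz" "\<And>x y. x \<in> Hz \<Longrightarrow> y \<in> Hz \<Longrightarrow> x + y \<in> Hz"
      by (simp_all add: van_minus reg_minus van_add reg_add)
    have xy: "?x - ?y \<in> Hz" using neg(2)[OF H'(1) neg(1)[OF H'(2)]] by simp
    have 1: "eqm Jz (gen (?x - ?y + ?ab - ?ba)) (gen (?x - ?y + ?ab) - gen ?ba)"
      by (intro gen_diff neg xy H)
    have 2: "eqm Jz (gen (?x - ?y + ?ab) - gen ?ba) ((gen (?x - ?y) + gen ?ab) - gen ?ba)"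
      by (intro eqm_diff[OF subsp_uea] gen_add xy H eqm_refl[OF subsp_uea])
    have 3: "eqm Jz ((gen (?x - ?y) + gen ?ab) - gen ?ba) (((gen ?x - gen ?y) + gen ?ab) - gen ?ba)"
      by (intro eqm_diff[OF subsp_uea] eqm_add[OF subsp_uea] gen_diff neg H' eqm_refl[OF subsp_uea])
    have 4: "eqm Jz (((gen ?x - gen ?y) + gen ?ab) - gen ?ba)
        ((((gen \<alpha> * gen (celt u z a \<beta>) - gen (celt u z a \<beta>) * gen \<alpha>)
          - (gen \<beta> * gen (celt u z a \<alpha>) - gen (celt u z a \<alpha>) * gen \<beta>)) + gen ?ab) - gen ?ba)"
      by (intro eqm_diff[OF subsp_uea] eqm_add[OF subsp_uea] eqm_refl[OF subsp_uea]
          eqm_sym[OF subsp_uea gen_lie] \<alpha> \<beta> H)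
    \<comment> \<open>Leibniz's rule at \<open>z\<close> and invariance of the form convert (a,
      d[\<alpha>,\<beta>]) into the terms with the indices [a, \<alpha>(z)] and [a, \<beta>(z)] that
      the cocycle condition asks for.\<close>
    have 5: "form a (dev z (lie \<alpha> \<beta>)) =
        form (lie a (ev z \<alpha>)) (dev z \<beta>) - form (lie a (ev z \<beta>)) (dev z \<alpha>)"
      using \<alpha> \<beta> lie_skew[of "dev z \<alpha>" "ev z \<beta>"]
        form_add_right[OF form, of a "lie (ev z \<alpha>) (dev z \<beta>)" "- lie (ev z \<beta>) (dev z \<alpha>)"]
      by (simp add: dev_lie form_minus_right[OF form] form_inv[OF form])
    note eqm_diff[OF subsp_uea eqm_trans[OF subsp_uea 1 eqm_trans[OF subsp_uea 2 eqm_trans[OF subsp_uea 3 4]]]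
        eqm_refl[OF subsp_uea, of Hz "scal (form a (dev z (lie \<alpha> \<beta>)))"]]
    then show ?thesis
      unfolding celt_lie[OF \<alpha> \<beta>] 5
      by (simp add: left_diff_distrib right_diff_distrib scal_central[of _ "gen \<alpha>"]
          scal_central[of _ "gen \<beta>"] scal_diff algebra_simps)
  qed
qed (auto simp: eqm_refl)

end

lemma UEA_iff: "X \<in> UEA H \<longleftrightarrow> (\<exists>t\<in>free_on H. X = t +o uea_ideal H)"
  by (auto simp: UEA_def)

lemma Vac_iff: "X \<in> Vac H \<longleftrightarrow> (\<exists>t\<in>free_on H. X = t +o vac_ideal H)"
  by (auto simp: Vac_def)

lemma eqm_add_ideal: "subsp J \<Longrightarrow> eqm J s (t + r) \<Longrightarrow> r \<in> J \<Longrightarrow> eqm J s t"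
  using subsp_add[of J "s - (t + r)" r] by (simp add: eqm_def diff_diff_eq2)

lemma uea_lmul: "a \<in> free_on H \<Longrightarrow> lmul (uea_ideal H) a (t +o uea_ideal H) = (a * t) +o uea_ideal H"
  by (rule lmul_coset) (auto intro: uea_lmult subsp_0)

context iota_setup
begin

lemma iop_ideal: "r \<in> Jz \<Longrightarrow> iop form u z a r \<in> Jz"
  unfolding iop_def by (rule operators.Op_ideal[OF operators_iop])

lemma iop_free: "t \<in> free_on Hz \<Longrightarrow> iop form u z a t \<in> free_on Hz"
  unfolding iop_def by (rule operators.Op_free[OF operators_iop])

lemma iop_scale_left: "t \<in> free_on Hz \<Longrightarrow> eqm Jz (iop form u z (c *\<^sub>C a) t) (scal c * iop form u z a t)"
  unfolding iop_def by (rule operators.Op_scale[OF operators_iop])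

lemma iop_eqm: "eqm Jz s t \<Longrightarrow> eqm Jz (iop form u z a s) (iop form u z a t)"
  using iop_ideal[of "s - t" a] by (simp add: eqm_def iop_minus)

lemma is_iota_iop: "is_iota form P u z (\<lambda>a X. iop form u z a ` X + Jz)"
proof -
  let ?I = "\<lambda>a X. iop form u z a ` X + Jz"
  have I: "?I a (t +o Jz) = iop form u z a t +o Jz" for a t
    by (rule image_coset_plus) (auto simp: subsp_0 iop_ideal iop_add)
  have "quot_linear Jz (UEA Hz) Jz (UEA Hz) (?I a)" for a
    unfolding quot_linear_def
  proof (intro conjI ballI allI)
    fix X assume "X \<in> UEA Hz"
    then obtain t where t: "t \<in> free_on Hz" "X = t +o Jz" unfolding UEA_iff by blast
    then show "?I a X \<in> UEA Hz" unfolding UEA_iff using I iop_free by blast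
    show "?I a (lmul Jz (scal c) X) = lmul Jz (scal c) (?I a X)" for c
      unfolding t(2) I uea_lmul[OF free_on_scal] iop_scal by simp
    fix Y assume "Y \<in> UEA Hz"
    then obtain s where s: "s \<in> free_on Hz" "Y = s +o Jz" unfolding UEA_iff by blast
    show "?I a (X + Y) = ?I a X + ?I a Y"
      unfolding t(2) s(2) coset_plus_same[OF subsp_uea] I iop_add by simp
  qed
  moreover have "?I a (1 +o Jz) = 0 +o Jz" for a
    unfolding I iop_1 by simp
  moreover have "?I a (lmul Jz (gen \<alpha>) X) \<ominus> lmul Jz (gen \<alpha>) (?I a X) =
          lmul Jz (gen (- lie (eps_elt u z a) \<alpha> + eps_elt u z (lie a (ev z \<alpha>)))) X
          \<ominus> lmul Jz (scal (form a (dev z \<alpha>))) X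
          + ?I (lie a (ev z \<alpha>)) X"
    if \<alpha>: "\<alpha> \<in> Hz" and X: "X \<in> UEA Hz" for a \<alpha> X
  proof -
    obtain t where t: "t \<in> free_on Hz" "X = t +o Jz" using X unfolding UEA_iff by blast
    note lm = uea_lmul[OF free_on_gen[OF \<alpha>]] uea_lmul[OF free_on_gen[OF celt_Hz[OF \<alpha>]]]
      uea_lmul[OF free_on_scal]
    show ?thesis
      unfolding t(2) celt_def[symmetric] lm I coset_diff_coset[OF subsp_uea] coset_plus_same[OF subsp_uea]
      by (simp add: iop_gen left_diff_distrib)
  qed
  ultimately show ?thesis unfolding is_iota_def Let_def by blast
qed

text \<open>The value on the vacuum and the commutation rule determine the operators on every word.
  As \<open>iota\<close> is an arbitrary choice among solutions, this is what makes it
  computable.\<close>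

lemma is_iota_unique:
  assumes "is_iota form P u z I" "t \<in> free_on Hz"
  shows "I a (t +o Jz) = iop form u z a t +o Jz"
proof -
  have lin: "quot_linear Jz (UEA Hz) Jz (UEA Hz) (I a)" and one: "I a (1 +o Jz) = 0 +o Jz"
    and com: "\<And>\<alpha> X. \<alpha> \<in> Hz \<Longrightarrow> X \<in> UEA Hz \<Longrightarrow> I a (lmul Jz (gen \<alpha>) X) \<ominus> lmul Jz (gen \<alpha>) (I a X) =
          lmul Jz (gen (celt u z a \<alpha>)) X \<ominus> lmul Jz (scal (form a (dev z \<alpha>))) X + I (lie a (ev z \<alpha>)) X" for a
    using assms(1) unfolding is_iota_def Let_def celt_def by blast+
  have mem: "s +o Jz \<in> UEA Hz" if "s \<in> free_on Hz" for s
    using that unfolding UEA_iff by blast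
  have wd: "I a (gens w +o Jz) = iop form u z a (gens w) +o Jz" if "set w \<subseteq> Hz" for w a
    using that
  proof (induction w arbitrary: a)
    case Nil
    show ?case by (simp add: one iop_1)
  next
    case (Cons \<alpha> w)
    then have \<alpha>: "\<alpha> \<in> Hz" and w: "gens w \<in> free_on Hz" and
      IH: "\<And>a. I a (gens w +o Jz) = iop form u z a (gens w) +o Jz" by (auto intro: free_on_gens)
    note lm = uea_lmul[OF free_on_gen[OF \<alpha>]] uea_lmul[OF free_on_gen[OF celt_Hz[OF \<alpha>]]]
      uea_lmul[OF free_on_scal]
    have "gens (\<alpha> # w) +o Jz \<in> UEA Hz" by (intro mem free_on_gens Cons)
    then have "I a (gens (\<alpha> # w) +o Jz) \<in> UEA Hz" using lin unfolding quot_linear_def by blast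
    then obtain r where r: "I a (gens (\<alpha> # w) +o Jz) = r +o Jz" unfolding UEA_iff by blast
    have "(r - gen \<alpha> * iop form u z a (gens w)) +o Jz =
        (gen (celt u z a \<alpha>) * gens w - scal (form a (dev z \<alpha>)) * gens w + iop form u z (lie a (ev z \<alpha>)) (gens w)) +o Jz"
      using com[OF \<alpha> mem[OF w], of a]
      unfolding lm gens_Cons[symmetric] r IH coset_diff_coset[OF subsp_uea] coset_plus_same[OF subsp_uea] .
    then have "eqm Jz (r - gen \<alpha> * iop form u z a (gens w))
        (gen (celt u z a \<alpha>) * gens w - scal (form a (dev z \<alpha>)) * gens w + iop form u z (lie a (ev z \<alpha>)) (gens w))"
      by (simp add: coset_eq_iff)
    then have "eqm Jz r (iop form u z a (gens (\<alpha> # w)))"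
      by (simp add: eqm_def gens_Cons iop_gen left_diff_distrib algebra_simps)
    then show ?case unfolding r by (intro coset_eqI subsp_uea)
  qed
  have "t \<in> free_on Hz \<and> I a (t +o Jz) = iop form u z a t +o Jz"
    using assms(2)
  proof (induction rule: free_on_induct)
    case (add s t)
    then have "I a ((s +o Jz) + (t +o Jz)) = I a (s +o Jz) + I a (t +o Jz)"
      using lin mem unfolding quot_linear_def by blast
    then show ?case using add by (simp add: coset_plus_same iop_add free_on_add)
  next
    case (word c w)
    have "I a (lmul Jz (scal c) (gens w +o Jz)) = lmul Jz (scal c) (I a (gens w +o Jz))"
      using lin mem[OF free_on_gens[OF word]] unfolding quot_linear_def by blast
    then show ?case using wd[OF word] word
      by (simp add: uea_lmul[OF free_on_scal] iop_scal free_on_mult free_on_gens)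
  qed
  then show ?thesis ..
qed

lemma iota_coset: "t \<in> free_on Hz \<Longrightarrow> iota form P u z a (t +o Jz) = iop form u z a t +o Jz"
  by (rule is_iota_unique) (auto simp: iota_def intro: someI[of "is_iota form P u z"] is_iota_iop)

lemma eqm_N_mult: "eqm (uea_ideal UNIV) s t \<Longrightarrow> eqm (vac_ideal UNIV) (s * r) (t * r)"
  by (rule eqm_vacI[OF eqm_rmult_uea]) auto

lemma resop_eps_word:
  assumes "set w \<subseteq> Hz"
  shows "eqm (vac_ideal UNIV) (resop form z (eps_elt u z a) (gens w))
    (gen (eps_elt u z a) * gens w + iop form u z a (gens w))"
  using assms
proof (induction w arbitrary: a)
  case Nil
  have "pp z (eps_elt u z a) = elem (pol z) a"
    using pp_polk[of 1 z a] by (simp add: eps_elt_const[OF u zP] pp_add pp_reg)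
  moreover have "eqm (vac_ideal UNIV) (gen (eps_elt u z a)) (gen (elem (pol z) a))"
  proof -
    have "eqm (vac_ideal UNIV) (gen (eps_elt u z a)) (gen (elem (pol z) a) + gen (const (- pol z P *\<^sub>C a)))"
      unfolding eps_elt_const[OF u zP] by (rule eqm_vacI[OF gen_add[of _ UNIV]]) auto
    then show ?thesis by (rule eqm_add_ideal[OF subsp_vac _ gen_const_vac])
  qed
  ultimately show ?case by (simp add: resop_1 iop_1 eqm_sym)
next
  case (Cons \<alpha> w)
  let ?N = "vac_ideal UNIV :: 'g mero free_alg set"
  let ?b = "lie a (ev z \<alpha>)" and ?E = "eps_elt u z" and ?c = "celt u z a \<alpha>"
  have \<alpha>: "\<alpha> \<in> Hz" and w: "set w \<subseteq> Hz" using Cons by auto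
  note IH = Cons.IH[OF w]
  note add = eqm_add[OF subsp_vac] and diff = eqm_diff[OF subsp_vac] and refl = eqm_refl[OF subsp_vac]
  \<comment> \<open>The bracket is the \<epsilon> element for [a, \<alpha>(z)] up to a map regular
    at \<open>z\<close>, whose residue operator kills regular words.\<close>
  have split: "lie (?E a) \<alpha> = ?E ?b + - ?c" by (simp add: celt_def)
  have c: "- ?c \<in> reg z" using celt_Hz[OF \<alpha>] by (simp add: reg_minus)
  have wreg: "gens w \<in> free_on (reg z)" using w by (intro free_on_gens) auto
  have om: "om form z (?E a) \<alpha> = form a (dev z \<alpha>)"
    using \<alpha> by (simp add: eps_elt_const[OF u zP] om_add_left[OF form] om_pol[OF form] om_reg[OF form])
  have r: "eqm ?N (resop form z (lie (?E a) \<alpha>) (gens w)) (gen (?E ?b) * gens w + iop form u z ?b (gens w))"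
  proof -
    have r1: "eqm ?N (resop form z (lie (?E a) \<alpha>) (gens w))
        (resop form z (?E ?b) (gens w) + resop form z (- ?c) (gens w))"
      unfolding split by (rule resop_add[OF form])
    have r2: "eqm ?N (resop form z (?E ?b) (gens w)) (gen (?E ?b) * gens w + iop form u z ?b (gens w))"
      by (rule IH)
    show ?thesis
      by (rule eqm_trans[OF subsp_vac eqm_add_ideal[OF subsp_vac r1 resop_reg[OF form c wreg]] r2])
  qed
  have lhs: "eqm ?N (resop form z (?E a) (gens (\<alpha> # w)))
      (gen \<alpha> * (gen (?E a) * gens w + iop form u z a (gens w)) - scal (form a (dev z \<alpha>)) * gens w
       + (gen (?E ?b) * gens w + iop form u z ?b (gens w)))"
    unfolding gens_Cons resop_gen om
    by (intro add diff refl r eqm_lmult[OF left_stable_vac, of _ UNIV] IH) simp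
  \<comment> \<open>Bringing the \<epsilon> element to the front of the word costs its bracket with
    \<alpha>; this accounts for both \<epsilon> terms in the commutation rule of \<iota>.\<close>
  have comm: "eqm ?N ((gen (?E a) * gen \<alpha> - gen \<alpha> * gen (?E a)) * gens w) ((gen (?E ?b) - gen ?c) * gens w)"
  proof (rule eqm_N_mult)
    have "eqm (uea_ideal UNIV) (gen (?E a) * gen \<alpha> - gen \<alpha> * gen (?E a)) (gen (lie (?E a) \<alpha>))"
      by (rule gen_lie) auto
    moreover have "eqm (uea_ideal UNIV) (gen (lie (?E a) \<alpha>)) (gen (?E ?b) - gen ?c)"
      using gen_diff[of "?E ?b" UNIV ?c] by (simp add: split)
    ultimately show "eqm (uea_ideal UNIV) (gen (?E a) * gen \<alpha> - gen \<alpha> * gen (?E a)) (gen (?E ?b) - gen ?c)"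
      by (rule eqm_trans[OF subsp_uea])
  qed
  have "gen \<alpha> * (gen (?E a) * gens w + iop form u z a (gens w)) - scal (form a (dev z \<alpha>)) * gens w
       + (gen (?E ?b) * gens w + iop form u z ?b (gens w))
       - (gen (?E a) * gens (\<alpha> # w) + iop form u z a (gens (\<alpha> # w))) =
       - ((gen (?E a) * gen \<alpha> - gen \<alpha> * gen (?E a)) * gens w - (gen (?E ?b) - gen ?c) * gens w)"
    by (simp add: gens_Cons iop_gen algebra_simps)
  also have "\<dots> \<in> ?N" using comm by (simp only: eqm_def subsp_minus[OF subsp_vac])
  finally show ?case using eqm_trans[OF subsp_vac lhs] by (simp only: eqm_def)
qed

lemma resop_eps:
  assumes "t \<in> free_on Hz"
  shows "eqm (vac_ideal UNIV) (resop form z (eps_elt u z a) t) (gen (eps_elt u z a) * t + iop form u z a t)"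
  using assms
proof (induction rule: free_on_induct)
  case (add s t)
  then show ?case
    using eqm_add[OF subsp_vac add] by (simp add: resop_sum iop_add algebra_simps)
next
  case (word c w)
  show ?case
    using eqm_scal[OF subsp_vac resop_eps_word[OF word], of c a]
    by (simp add: resop_scal iop_scal distrib_left mult_scal_left)
qed

lemma resop_pol_eps:
  assumes "t \<in> free_on (reg z)"
  shows "eqm (vac_ideal UNIV) (resop form z (elem (pol z) a) t) (resop form z (eps_elt u z a) t)"
proof -
  let ?N = "vac_ideal UNIV :: 'g mero free_alg set"
  have "eqm ?N (resop form z (eps_elt u z a) t)
      (resop form z (elem (pol z) a) t + resop form z (const (- pol z P *\<^sub>C a)) t)"
    unfolding eps_elt_const[OF u zP] by (rule resop_add[OF form])
  moreover have "resop form z (const (- pol z P *\<^sub>C a)) t \<in> ?N"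
    by (intro resop_reg[OF form] const_reg assms)
  ultimately have "eqm ?N (resop form z (eps_elt u z a) t) (resop form z (elem (pol z) a) t)"
    by (rule eqm_add_ideal[OF subsp_vac])
  then show ?thesis by (rule eqm_sym[OF subsp_vac])
qed

lemma resop_pol:
  assumes "t \<in> free_on Hz"
  shows "eqm (vac_ideal UNIV) (resop form z (elem (pol z) a) t) (gen (eps_elt u z a) * t + iop form u z a t)"
  by (rule eqm_trans[OF subsp_vac resop_pol_eps[OF free_reg[OF assms]] resop_eps[OF assms]])

end

section \<open>The current\<close>

definition jcur :: "('g \<Rightarrow> 'g \<Rightarrow> complex) \<Rightarrow> 'g::complex_lie_algebra current" where
  "jcur form a z X = resop form z (elem (pol z) a) ` X + vac_ideal UNIV"

lemma jcur_coset:
  assumes "invariant_form form"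
  shows "jcur form a z (t +o vac_ideal H) = resop form z (elem (pol z) a) t +o vac_ideal UNIV"
  unfolding jcur_def
  by (rule image_coset_plus) (use vac_mono[of H UNIV] in \<open>auto simp: subsp_0 resop_sum intro!: resop_vac[OF assms]\<close>)

lemma current_field_jcur:
  assumes form: "invariant_form form" shows "current_field form (jcur form)"
  unfolding current_field_def
proof (intro allI ballI conjI impI)
  fix z and \<nu> :: "'a mero"
  let ?a = "ev z \<nu>" and ?N = "vac_ideal UNIV :: 'a mero free_alg set"
  note lm = lmul_scal_coset[OF subsp_vac subsp_vac order.refl]
  show "quot_linear (vac_ideal (reg z)) (Vac (reg z)) ?N (Vac UNIV) (jcur form ?a z)"
    unfolding quot_linear_def
  proof (intro conjI ballI allI)
    fix X :: "'a mero free_alg set" assume "X \<in> Vac (reg z)"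
    then obtain t where t: "X = t +o vac_ideal (reg z)" unfolding Vac_iff by blast
    show "jcur form ?a z X \<in> Vac UNIV" unfolding t jcur_coset[OF form] Vac_iff
      by (rule bexI[of _ "resop form z (elem (pol z) ?a) t"]) simp_all
    show "jcur form ?a z (lmul (vac_ideal (reg z)) (scal c) X) = lmul ?N (scal c) (jcur form ?a z X)" for c
      unfolding t lm jcur_coset[OF form] by (simp add: resop_scal)
    fix Y :: "'a mero free_alg set" assume "Y \<in> Vac (reg z)"
    then obtain s where s: "Y = s +o vac_ideal (reg z)" unfolding Vac_iff by blast
    show "jcur form ?a z (X + Y) = jcur form ?a z X + jcur form ?a z Y"
      unfolding t s coset_plus_same[OF subsp_vac] jcur_coset[OF form] by (simp add: resop_sum)
  qed
next
  fix z and \<nu> :: "'a mero" and P u and X :: "'a mero free_alg set"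
  assume "P \<noteq> z \<and> coordinate P u" and X: "X \<in> UEA (van P \<inter> reg z)"
  then interpret iota_setup form P z u using form by unfold_locales auto
  let ?a = "ev z \<nu>"
  obtain t where t: "t \<in> free_on Hz" "X = t +o Jz" using X unfolding UEA_iff by blast
  have Jv: "Jz \<subseteq> vac_ideal (reg z)" "Jz \<subseteq> uea_ideal (van P)"
    by (rule uea_vac uea_mono, simp)+
  have "eps P u z ?a (X + uea_ideal (van P)) + iota form P u z ?a X + vac_ideal UNIV =
      (gen (eps_elt u z ?a) * t + iop form u z ?a t) +o vac_ideal UNIV"
    unfolding t(2) iota_coset[OF t(1)] eps_def coset_plus(3)[OF subsp_uea subsp_0[OF subsp_uea] Jv(2)]
      uea_lmul[OF free_on_gen[OF eps_elt_van[OF u zP]]]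
      coset_plus(2)[OF subsp_uea subsp_0[OF subsp_uea] Jv(2)]
      coset_plus(3)[OF subsp_vac subsp_0[OF subsp_uea] uea_sub_vac] ..
  also have "\<dots> = resop form z (elem (pol z) ?a) t +o vac_ideal UNIV"
    by (rule coset_eqI[OF subsp_vac eqm_sym[OF subsp_vac resop_pol[OF t(1)]]])
  finally show "jcur form ?a z (X + vac_ideal (reg z)) =
      eps P u z ?a (X + uea_ideal (van P)) + iota form P u z ?a X + vac_ideal UNIV"
    unfolding t(2) coset_plus(3)[OF subsp_vac subsp_0[OF subsp_uea] Jv(1)] jcur_coset[OF form] ..
qed

section \<open>Covariance\<close>

text \<open>The one point at which \<open>coord z\<close> is infinite and takes its dummy
  value.\<close>

fun dummy :: "proj_line \<Rightarrow> proj_line" where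
  "dummy (Fin a) = Infty"
| "dummy Infty = Fin 0"

lemma chart_coord: "p \<noteq> dummy z \<Longrightarrow> chart z (coord z p) = p"
  by (cases z; cases p) auto

lemma coord_chart: "coord z (chart z h) = h"
  by (cases z) auto

lemma dummy_neq: "z \<noteq> dummy z"
  by (cases z) auto

definition loc :: "(proj_line \<Rightarrow> proj_line) \<Rightarrow> proj_line \<Rightarrow> complex \<Rightarrow> complex" where
  "loc s p h = coord (s p) (s (chart p h))"

definition jac :: "(proj_line \<Rightarrow> proj_line) \<Rightarrow> proj_line \<Rightarrow> complex" where
  "jac s p = deriv (loc s p) 0"

lemma loc_0 [simp]: "loc s p 0 = 0"
  by (cases "s p") (auto simp: loc_def)

lemma K_transport_jac: "bij g \<Longrightarrow> K_transport g z = jac (inv g) (g z)"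
  by (simp add: K_transport_def jac_def loc_def[abs_def] diff_def bij_is_inj)

context
  fixes s :: "proj_line \<Rightarrow> proj_line"
  assumes holo: "holo_map s" and inj: "inj s"
begin

lemma loc_analytic: "loc s p analytic_on {0}"
  using holo unfolding holo_map_def loc_def[abs_def] by blast

text \<open>As \<open>s\<close> is injective, at most one point goes to the dummy point of the chart
  at \<open>s p\<close>, and \<open>p\<close> itself does not. Near \<open>p\<close> the local
  expression \<open>loc\<close> therefore represents \<open>s\<close> faithfully.\<close>

lemma loc_chart: "eventually (\<lambda>h. chart (s p) (loc s p h) = s (chart p h)) (nhds 0)"
proof -
  have "finite (s -` {dummy (s p)})" by (rule finite_vimageI[OF _ inj]) simp
  then have "eventually (\<lambda>h. chart p h \<notin> s -` {dummy (s p)}) (at 0)"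
    by (rule eventually_chart_notin)
  then have "eventually (\<lambda>h. s (chart p h) \<noteq> dummy (s p)) (at 0)" by simp
  then have "eventually (\<lambda>h. s (chart p h) \<noteq> dummy (s p)) (nhds 0)"
    using dummy_neq[of "s p"] by (auto simp: eventually_at_filter elim!: eventually_mono)
  then show ?thesis by eventually_elim (simp add: loc_def chart_coord)
qed

lemma comp_loc: "eventually (\<lambda>h. f (chart (s p) (loc s p h)) = f (s (chart p h))) (nhds 0)"
  using loc_chart[of p] by eventually_elim simp

lemma meromorphic_fun_comp: assumes "meromorphic_fun f" shows "meromorphic_fun (\<lambda>p. f (s p))"
  unfolding meromorphic_fun_def
proof
  fix p
  have "(\<lambda>h. f (chart (s p) (loc s p h))) meromorphic_on {0}"
    by (rule meromorphic_on_compose[OF assms[unfolded meromorphic_fun_def, rule_format] loc_analytic]) simp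
  also have "?this \<longleftrightarrow> (\<lambda>h. f (s (chart p h))) meromorphic_on {0}"
    by (rule meromorphic_on_cong) (use comp_loc[of f p] in \<open>auto simp: eventually_at_filter elim: eventually_mono\<close>)
  finally show "(\<lambda>h. f (s (chart p h))) meromorphic_on {0}" .
qed

lemma holo_at_comp: assumes "holo_at f (s p)" shows "holo_at (\<lambda>p. f (s p)) p"
proof -
  have "((\<lambda>h. f (chart (s p) h)) \<circ> loc s p) analytic_on {0}"
    by (rule analytic_on_compose[OF loc_analytic]) (use assms in \<open>simp add: holo_at_def\<close>)
  also have "?this \<longleftrightarrow> (\<lambda>h. f (s (chart p h))) analytic_on {0}"
    by (rule analytic_at_cong) (use comp_loc[of f p] in auto)
  finally show ?thesis by (simp add: holo_at_def)
qed

lemma diff_comp: assumes "holo_at f (s p)" shows "diff (\<lambda>p. f (s p)) p = diff f (s p) * jac s p"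
proof -
  have "diff (\<lambda>p. f (s p)) p = deriv (\<lambda>h. f (chart (s p) (loc s p h))) 0"
    unfolding diff_def by (rule deriv_cong_ev) (use comp_loc[of f p] in \<open>auto elim: eventually_mono\<close>)
  also have "\<dots> = deriv ((\<lambda>h. f (chart (s p) h)) \<circ> loc s p) 0" by (simp add: o_def)
  also have "\<dots> = deriv (\<lambda>h. f (chart (s p) h)) (loc s p 0) * deriv (loc s p) 0"
    by (rule deriv_chain)
      (use assms loc_analytic in \<open>auto simp: holo_at_def dest: analytic_on_imp_differentiable_at\<close>)
  finally show ?thesis by (simp add: diff_def jac_def)
qed

end

text \<open>If the derivative vanished, the chain rule applied to \<open>coord p\<close>, factored
  through \<open>s\<close> and its inverse, would give 0 for a derivative that is 1.\<close>

lemma jac_nonzero: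
  assumes "holo_map s" "bij s" "holo_map (inv s)" shows "jac s p \<noteq> 0"
proof
  assume 0: "jac s p = 0"
  let ?f = "\<lambda>q. coord p (inv s q)"
  have inj: "inj s" using assms(2) by (rule bij_is_inj)
  have "holo_at ?f (s p)"
    using assms(3)[unfolded holo_map_def, rule_format, of "s p"] inj by (simp add: holo_at_def)
  then have "diff (\<lambda>p'. ?f (s p')) p = 0" using diff_comp[OF assms(1) inj, of ?f p] 0 by simp
  moreover have "(\<lambda>p'. ?f (s p')) = coord p" using inj by simp
  ultimately show False by (simp add: diff_def coord_chart)
qed

text \<open>Near \<open>w\<close> the pulled back pole is 1/\<open>loc s w h\<close>, which behaves
  like 1/(K h) with K the derivative of \<open>s\<close>. After multiplication by K the two poles
  cancel, and a map without poles is constant.\<close>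

lemma pol_comp:
  assumes "holo_map s" "bij s" "holo_map (inv s)"
  obtains c where "finite {p. jac s w * pol (s w) (s p) \<noteq> pol w p + c}"
proof -
  have inj: "inj s" using assms(2) by (rule bij_is_inj)
  let ?K = "jac s w" and ?f = "\<lambda>p. pol (s w) (s p)"
  have K: "?K \<noteq> 0" by (rule jac_nonzero[OF assms])
  have mf: "meromorphic_fun ?f" by (rule meromorphic_fun_comp[OF assms(1) inj]) simp
  have mKf: "meromorphic_fun (\<lambda>p. ?K * ?f p)" by (rule meromorphic_fun_mult[OF _ mf]) simp
  have m: "meromorphic_fun (\<lambda>p. ?K * ?f p - pol w p)" by (rule meromorphic_fun_diff[OF mKf]) simp
  have "LE z (\<lambda>p. ?K * ?f p - pol w p) $$ n = 0" if "n < 0" for z n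
  proof (cases "z = w")
    case False
    then have "s z \<noteq> s w" using inj by (simp add: inj_eq)
    then have "holo_at ?f z"
      by (intro holo_at_comp[OF assms(1) inj, of "pol (s w)"] holo_at_pol)
    then show ?thesis using False that
      by (intro holo_at_LE(1) holo_at_diff holo_at_mult holo_at_pol) auto
  next
    case True
    let ?F = "LE w (\<lambda>p. ?K * ?f p - pol w p)"
    \<comment> \<open>The pole is at most simple, so it suffices that h times the difference tends
      to K / K - 1 = 0; multiplication by \<open>fls_X\<close> raises the order by one.\<close>
    have "(\<lambda>h. h * (?K * ?f (chart w h) - pol w (chart w h))) has_laurent_expansion fls_X * ?F"
      by (intro has_laurent_expansion_mult LE_expansion[OF m] has_laurent_expansion_fps_X)
    moreover have "((\<lambda>h. h * (?K * ?f (chart w h) - pol w (chart w h))) \<longlongrightarrow> 0) (at 0)"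
    proof -
      have "(loc s w has_field_derivative ?K) (at 0)"
        unfolding jac_def using loc_analytic[OF assms(1) inj, of w]
        by (intro DERIV_deriv_iff_field_differentiable[THEN iffD2] analytic_on_imp_differentiable_at) auto
      then have "((\<lambda>h. loc s w h / h) \<longlongrightarrow> ?K) (at 0)" by (simp add: DERIV_def)
      then have "((\<lambda>h. ?K / (loc s w h / h) - 1) \<longlongrightarrow> ?K / ?K - 1) (at 0)"
        by (intro tendsto_intros K)
      then have "((\<lambda>h. ?K / (loc s w h / h) - 1) \<longlongrightarrow> 0) (at 0)" using K by simp
      then show ?thesis
      proof (rule Lim_transform_eventually)
        have "eventually (\<lambda>h. pol (s w) (chart (s w) (loc s w h)) = ?f (chart w h)) (at 0)"
          using comp_loc[OF assms(1) inj, of "pol (s w)" w] by (auto simp: eventually_at_filter elim: eventually_mono)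
        moreover have "eventually (\<lambda>h::complex. h \<noteq> 0) (at 0)" by (auto simp: eventually_at_filter)
        ultimately show "eventually (\<lambda>h. ?K / (loc s w h / h) - 1 = h * (?K * ?f (chart w h) - pol w (chart w h))) (at 0)"
        proof eventually_elim
          case (elim h)
          then have "?f (chart w h) = inverse (loc s w h)" by (simp add: pol_chart)
          then show ?case using elim(2) by (simp add: pol_chart right_diff_distrib divide_inverse)
        qed
      qed
    qed
    ultimately have "fls_X * ?F = 0 \<or> fls_subdegree (fls_X * ?F) > 0"
      using tendsto_0_subdegree_iff_0 by blast
    then show ?thesis using that True fls_eq0_below_subdegree[of n ?F] by (cases "?F = 0") auto
  qed
  then obtain c where "finite {p. ?K * ?f p - pol w p \<noteq> c}"
    by (rule regular_imp_constant[OF m])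
  then have "finite {p. ?K * ?f p \<noteq> pol w p + c}" by (simp add: diff_eq_eq add.commute)
  then show ?thesis by (rule that)
qed

section \<open>Transport as pullback along the inverse\<close>

definition tr :: "(proj_line \<Rightarrow> proj_line) \<Rightarrow> 'g::complex_lie_algebra mero \<Rightarrow> 'g mero" where
  "tr s \<nu> = abs_mero (\<lambda>p. rep_mero \<nu> (s p))"

lemma transport_tr: "transport g = tr (inv g)"
  by (rule ext) (simp add: transport_def tr_def)

context
  fixes s :: "proj_line \<Rightarrow> proj_line"
  assumes holo: "holo_map s" and bij: "bij s" and holo': "holo_map (inv s)"
begin

lemmas inj = bij_is_inj[OF bij]

lemma tr_sum:
  assumes f: "\<And>i. i \<in> I \<Longrightarrow> meromorphic_fun (f i)"
  shows "tr s (\<Sum>i\<in>I. elem (f i) (x i)) = (\<Sum>i\<in>I. elem (\<lambda>p. f i (s p)) (x i))"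
proof -
  let ?\<nu> = "\<Sum>i\<in>I. elem (f i) (x i)"
  have m: "meromorphic_map (\<lambda>p. \<Sum>i\<in>I. f i p *\<^sub>C x i)"
    by (intro meromorphic_map_sum meromorphic_map_elem f)
  have f': "meromorphic_fun (\<lambda>p. f i (s p))" if "i \<in> I" for i
    by (rule meromorphic_fun_comp[OF holo inj f[OF that]])
  have m': "meromorphic_map (\<lambda>p. \<Sum>i\<in>I. f i (s p) *\<^sub>C x i)"
    by (intro meromorphic_map_sum meromorphic_map_elem f')
  have "?\<nu> = abs_mero (\<lambda>p. \<Sum>i\<in>I. f i p *\<^sub>C x i)" using f by (simp add: abs_mero_elems)
  then have "finite {p. rep_mero ?\<nu> p \<noteq> (\<Sum>i\<in>I. f i p *\<^sub>C x i)}"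
    using m by (simp add: rep_abs_mero)
  \<comment> \<open>Injectivity of \<open>s\<close> keeps the exceptional set of the representative
    finite under pullback.\<close>
  then have "finite (s -` {p. rep_mero ?\<nu> p \<noteq> (\<Sum>i\<in>I. f i p *\<^sub>C x i)})"
    by (rule finite_vimageI[OF _ inj])
  then have fin: "finite {p. (\<Sum>i\<in>I. f i (s p) *\<^sub>C x i) \<noteq> rep_mero ?\<nu> (s p)}"
    by (rule rev_finite_subset) auto
  have "abs_mero (\<lambda>p. rep_mero ?\<nu> (s p)) = abs_mero (\<lambda>p. \<Sum>i\<in>I. f i (s p) *\<^sub>C x i)"
  proof (rule abs_mero_eqI[OF _ m'])
    obtain n :: nat and h y where "\<And>i. i < n \<Longrightarrow> meromorphic_fun (h i)"
      "finite {p. (\<Sum>i\<in>I. f i (s p) *\<^sub>C x i) \<noteq> (\<Sum>i<n. h i p *\<^sub>C y i)}"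
      by (rule meromorphic_mapE[OF m']) blast
    note h = this
    have "finite {p. rep_mero ?\<nu> (s p) \<noteq> (\<Sum>i<n. h i p *\<^sub>C y i)}"
      by (rule finite_subset[OF _ finite_UnI[OF fin h(2)]]) auto
    with h(1) show "meromorphic_map (\<lambda>p. rep_mero ?\<nu> (s p))"
      unfolding meromorphic_map_def by blast
    show "finite {p. rep_mero ?\<nu> (s p) \<noteq> (\<Sum>i\<in>I. f i (s p) *\<^sub>C x i)}"
      using fin by (rule rev_finite_subset) auto
  qed
  also have "\<dots> = (\<Sum>i\<in>I. elem (\<lambda>p. f i (s p)) (x i))" by (rule abs_mero_elems[OF f'])
  finally show ?thesis by (simp add: tr_def)
qed

lemma tr_elem: "meromorphic_fun f \<Longrightarrow> tr s (elem f a) = elem (\<lambda>p. f (s p)) a"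
  using tr_sum[of "{0::nat}" "\<lambda>_. f" "\<lambda>_. a"] by simp

lemma tr_add: "tr s (\<nu> + \<mu>) = tr s \<nu> + tr s \<mu>"
proof -
  obtain k :: nat and f x where 1: "\<And>i. i < k \<Longrightarrow> meromorphic_fun (f i)" "\<nu> = (\<Sum>i<k. elem (f i) (x i))"
    by (rule mero_expand[of \<nu>]) blast
  obtain m :: nat and g y where 2: "\<And>i. i < m \<Longrightarrow> meromorphic_fun (g i)" "\<mu> = (\<Sum>i<m. elem (g i) (y i))"
    by (rule mero_expand[of \<mu>]) blast
  have "\<nu> + \<mu> = (\<Sum>i\<in>{..<k} <+> {..<m}. elem (case_sum f g i) (case_sum x y i))"
    by (simp add: sum.Plus 1(2) 2(2))
  also have "tr s \<dots> = (\<Sum>i\<in>{..<k} <+> {..<m}. elem (\<lambda>p. case_sum f g i (s p)) (case_sum x y i))"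
    by (rule tr_sum) (use 1 2 in auto)
  also have "\<dots> = tr s \<nu> + tr s \<mu>"
    unfolding 1(2) 2(2) using 1(1) 2(1) by (subst (1 2) tr_sum) (auto simp: sum.Plus)
  finally show ?thesis .
qed

lemma tr_scale: "tr s (c *\<^sub>C \<nu>) = c *\<^sub>C tr s \<nu>"
proof (induction \<nu> rule: mero_induct)
  case (ele f a)
  then show ?case using meromorphic_fun_comp[OF holo inj ele] by (simp add: elem_scale tr_elem)
qed (simp add: cscale_add_right tr_add)

lemma tr_lie: "tr s (lie \<nu> \<mu>) = lie (tr s \<nu>) (tr s \<mu>)"
proof (induction \<nu> rule: mero_induct)
  case (ele f a)
  show ?case
  proof (induction \<mu> rule: mero_induct)
    case (ele g b)
    note c = meromorphic_fun_comp[OF holo inj]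
    show ?case using \<open>meromorphic_fun f\<close> ele c[OF \<open>meromorphic_fun f\<close>] c[OF ele]
      by (simp add: elem_lie tr_elem meromorphic_fun_mult)
  qed (simp add: lie_add_right tr_add)
qed (simp add: lie_add_left tr_add)

lemma tr_const: "tr s (const a) = const a"
  by (simp add: const_elem tr_elem)

lemma tr_reg:
  assumes "\<alpha> \<in> reg (s w)"
  shows "tr s \<alpha> \<in> reg w \<and> ev w (tr s \<alpha>) = ev (s w) \<alpha> \<and> dev w (tr s \<alpha>) = jac s w *\<^sub>C dev (s w) \<alpha>"
  using assms
proof (induction rule: reg_induct)
  case (ele f a)
  have c: "meromorphic_fun (\<lambda>p. f (s p))" "holo_at (\<lambda>p. f (s p)) w"
    by (rule meromorphic_fun_comp[OF holo inj ele(1)], rule holo_at_comp[OF holo inj ele(2)])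
  show ?case
    using ele c diff_comp[OF holo inj ele(2)]
    by (simp add: tr_elem elem_reg ev_elem dev_elem cscale_cscale mult.commute)
next
  case (add \<nu> \<mu>)
  then show ?case by (simp add: tr_add reg_add ev_add dev_add cscale_add_right)
qed

text \<open>Pullback is a homomorphism of Lie algebras that fixes constant maps, so it preserves
  both the relators and the balancing relations.\<close>

lemma free_map_vac:
  assumes "r \<in> vac_ideal UNIV" shows "free_map (tr s) r \<in> vac_ideal UNIV"
proof -
  let ?F = "free_map (tr s)"
  have uea: "?F r \<in> uea_ideal UNIV" if "r \<in> uea_ideal UNIV" for r :: "'a::complex_lie_algebra mero free_alg"
    using that
  proof (induction rule: uea_ideal.induct)
    case (rel_add \<alpha> \<beta>)
    then show ?case
      using uea_ideal.rel_add[of "tr s \<alpha>" UNIV "tr s \<beta>"] by (simp add: free_map_diff free_map_gen tr_add)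
  next
    case (rel_scale \<alpha> c)
    then show ?case
      using uea_ideal.rel_scale[of "tr s \<alpha>" UNIV c]
      by (simp add: free_map_diff free_map_mult free_map_scal free_map_gen tr_scale)
  next
    case (rel_lie \<alpha> \<beta>)
    then show ?case
      using uea_ideal.rel_lie[of "tr s \<alpha>" UNIV "tr s \<beta>"]
      by (simp add: free_map_diff free_map_mult free_map_gen tr_lie)
  next
    case zero
    show ?case by (simp add: free_map_0 uea_ideal.zero)
  next
    case (add s t)
    then show ?case by (simp add: free_map_add uea_ideal.add)
  next
    case (mult s r t)
    then show ?case by (simp add: free_map_mult uea_ideal.mult)
  qed
  have const: "?F a = a" if "a \<in> free_on (range const)" for a :: "'a mero free_alg"
    using that
  proof (induction rule: free_on_induct)
    case (add s t)
    then show ?case by (simp add: free_map_add)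
  next
    case (word c w)
    then have "map (tr s) w = w" by (induction w) (auto simp: tr_const)
    then show ?case by (simp add: free_map_wext wext_word)
  qed
  show ?thesis
    using assms
  proof (induction rule: vac_ideal.induct)
    case (uea r)
    then show ?case by (intro vac_ideal.uea) (rule \<open>\<And>r. r \<in> uea_ideal UNIV \<Longrightarrow> ?F r \<in> uea_ideal UNIV\<close>)
  next
    case (balance t a)
    then show ?case
      using vac_ideal.balance[of "?F t" UNIV a]
      by (simp add: free_map_diff free_map_mult free_map_scal const)
  next
    case (add s t)
    then show ?case by (simp add: free_map_add vac_ideal.add)
  qed
qed

lemma free_map_eqm: "eqm (vac_ideal UNIV) t t' \<Longrightarrow> eqm (vac_ideal UNIV) (free_map (tr s) t) (free_map (tr s) t')"
  using free_map_vac[of "t - t'"] by (simp add: eqm_def free_map_diff)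

text \<open>By \<open>pol_comp\<close> the two maps differ by a constant map, and constants kill the
  vacuum. This is covariance of the current on the vacuum vector.\<close>

lemma gen_pol_tr:
  "eqm (vac_ideal UNIV) (scal (jac s w) * gen (tr s (elem (pol (s w)) a))) (gen (elem (pol w) a))"
proof -
  obtain c where c: "finite {p. jac s w * pol (s w) (s p) \<noteq> pol w p + c}"
    by (rule pol_comp[OF holo bij holo'])
  have m: "meromorphic_fun (\<lambda>p. pol (s w) (s p))" by (rule meromorphic_fun_comp[OF holo inj]) simp
  have "jac s w *\<^sub>C tr s (elem (pol (s w)) a) = elem (\<lambda>p. jac s w * pol (s w) (s p)) a"
    by (simp add: tr_elem elem_scale[OF m] elem_scale_left)
  also have "\<dots> = elem (\<lambda>p. pol w p - (- c)) a"
    by (rule elem_cong) (use c in \<open>auto intro!: meromorphic_fun_mult m meromorphic_fun_add\<close>)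
  also have "\<dots> = elem (pol w) a + const (c *\<^sub>C a)" by (simp only: elem_pol_shift minus_minus)
  finally have *: "jac s w *\<^sub>C tr s (elem (pol (s w)) a) = elem (pol w) a + const (c *\<^sub>C a)" .
  have "eqm (vac_ideal UNIV) (gen (elem (pol w) a + const (c *\<^sub>C a))) (gen (elem (pol w) a) + gen (const (c *\<^sub>C a)))"
    by (rule eqm_vacI[OF gen_add[of _ UNIV]]) auto
  then have 1: "eqm (vac_ideal UNIV) (gen (elem (pol w) a + const (c *\<^sub>C a))) (gen (elem (pol w) a))"
    by (rule eqm_add_ideal[OF subsp_vac _ gen_const_vac])
  have "eqm (vac_ideal UNIV) (gen (jac s w *\<^sub>C tr s (elem (pol (s w)) a))) (scal (jac s w) * gen (tr s (elem (pol (s w)) a)))"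
    by (rule eqm_vacI[OF gen_scale[of _ UNIV]]) auto
  then show ?thesis using 1 unfolding * by (rule eqm_trans[OF subsp_vac eqm_sym[OF subsp_vac]])
qed

end

text \<open>The bracket of the simple pole with \<alpha> may be replaced by the simple pole with
  coefficient [a, \<alpha>(z)], the remainder being regular. The commutation rule then involves only
  \<alpha>(z) and d\<alpha>(z), whose behaviour under pullback is known.\<close>

lemma resop_pol_gen:
  assumes form: "invariant_form form" and \<alpha>: "\<alpha> \<in> reg z" and t: "t \<in> free_on (reg z)"
  shows "eqm (vac_ideal UNIV) (resop form z (elem (pol z) a) (gen \<alpha> * t))
    (gen \<alpha> * resop form z (elem (pol z) a) t - scal (form a (dev z \<alpha>)) * t
      + resop form z (elem (pol z) (lie a (ev z \<alpha>))) t)"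
proof -
  let ?b = "lie a (ev z \<alpha>)" and ?N = "vac_ideal UNIV"
  let ?c = "lie (elem (pol z) a) \<alpha> - elem (pol z) ?b"
  have split: "lie (elem (pol z) a) \<alpha> = elem (pol z) ?b + ?c" by simp
  have r: "eqm ?N (resop form z (lie (elem (pol z) a) \<alpha>) t) (resop form z (elem (pol z) ?b) t)"
    by (subst split, rule eqm_add_ideal[OF subsp_vac resop_add[OF form]])
      (intro resop_reg[OF form] lie_pol_reg \<alpha> t)
  show ?thesis
    unfolding resop_gen om_pol[OF form \<alpha>]
    by (rule eqm_add[OF subsp_vac eqm_refl[OF subsp_vac] r])
qed

text \<open>Under pullback the value of a letter is unchanged and its differential is multiplied by
  the derivative of \<open>s\<close>. Every term of the commutation rule thus acquires the same
  factor as the value on the vacuum.\<close>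

lemma resop_covariant:
  assumes form: "invariant_form form" and s: "holo_map s" "bij s" "holo_map (inv s)"
    and t: "t \<in> free_on (reg (s w))"
  shows "eqm (vac_ideal UNIV) (resop form w (elem (pol w) a) (free_map (tr s) t))
    (scal (jac s w) * free_map (tr s) (resop form (s w) (elem (pol (s w)) a) t))"
proof -
  let ?N = "vac_ideal UNIV :: 'a mero free_alg set" and ?F = "free_map (tr s)" and ?K = "scal (jac s w)"
  let ?R = "\<lambda>a. resop form w (elem (pol w) a)" and ?R' = "\<lambda>a. resop form (s w) (elem (pol (s w)) a)"
  have wd: "eqm ?N (?R a (?F (gens v))) (?K * ?F (?R' a (gens v)))" if "set v \<subseteq> reg (s w)" for v a
    using that
  proof (induction v arbitrary: a)
    case Nil
    have "?R a (?F (gens [])) = gen (elem (pol w) a)"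
      using pp_polk[of 1 w a] free_map_scal[of "tr s :: 'a mero \<Rightarrow> 'a mero" 1] by (simp add: resop_1)
    moreover have "?R' a (gens []) = gen (elem (pol (s w)) a)"
      using pp_polk[of 1 "s w" a] by (simp add: resop_1)
    ultimately show ?case
      using eqm_sym[OF subsp_vac gen_pol_tr[OF s, of w a]] by (simp add: free_map_gen)
  next
    case (Cons \<alpha> v)
    let ?b = "lie a (ev (s w) \<alpha>)"
    have \<alpha>: "\<alpha> \<in> reg (s w)" and v: "set v \<subseteq> reg (s w)" using Cons.prems by auto
    have tr: "tr s \<alpha> \<in> reg w" "ev w (tr s \<alpha>) = ev (s w) \<alpha>" "dev w (tr s \<alpha>) = jac s w *\<^sub>C dev (s w) \<alpha>"
      using tr_reg[OF s \<alpha>] by auto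
    have Fv: "?F (gens v) \<in> free_on (reg w)"
      unfolding free_map_wext wext_gens using v tr_reg[OF s] by (intro free_on_gens) auto
    have "eqm ?N (?R a (gen (tr s \<alpha>) * ?F (gens v)))
        (gen (tr s \<alpha>) * ?R a (?F (gens v)) - scal (jac s w * form a (dev (s w) \<alpha>)) * ?F (gens v) + ?R ?b (?F (gens v)))"
      using resop_pol_gen[OF form tr(1) Fv, of a] by (simp add: tr form_scale_right[OF form])
    note r1 = this
    have r2: "eqm ?N
        (gen (tr s \<alpha>) * ?R a (?F (gens v)) - scal (jac s w * form a (dev (s w) \<alpha>)) * ?F (gens v) + ?R ?b (?F (gens v)))
        (gen (tr s \<alpha>) * (?K * ?F (?R' a (gens v))) - scal (jac s w * form a (dev (s w) \<alpha>)) * ?F (gens v)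
          + ?K * ?F (?R' ?b (gens v)))"
      by (rule eqm_add[OF subsp_vac eqm_diff[OF subsp_vac eqm_lmult[OF left_stable_vac _ Cons.IH[OF v]]
              eqm_refl[OF subsp_vac]] Cons.IH[OF v]]) simp
    have r3: "gen (tr s \<alpha>) * (?K * ?F (?R' a (gens v))) - scal (jac s w * form a (dev (s w) \<alpha>)) * ?F (gens v)
          + ?K * ?F (?R' ?b (gens v)) =
        ?K * ?F (gen \<alpha> * ?R' a (gens v) - scal (form a (dev (s w) \<alpha>)) * gens v + ?R' ?b (gens v))"
      by (simp only: free_map_add free_map_diff free_map_mult free_map_gen free_map_scal
          mult_scal_left[of "gen (tr s \<alpha>)"] scal_mult mult.assoc distrib_left right_diff_distrib)
    have r4: "eqm ?N (?K * ?F (gen \<alpha> * ?R' a (gens v) - scal (form a (dev (s w) \<alpha>)) * gens v + ?R' ?b (gens v)))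
        (?K * ?F (?R' a (gen \<alpha> * gens v)))"
      by (rule eqm_scal[OF subsp_vac free_map_eqm[OF s eqm_sym[OF subsp_vac
              resop_pol_gen[OF form \<alpha> free_on_gens[OF v]]]]])
    show ?case
      unfolding gens_Cons free_map_mult[of "tr s" "gen \<alpha>" "gens v"] free_map_gen
      by (rule eqm_trans[OF subsp_vac eqm_trans[OF subsp_vac r1 r2[unfolded r3]] r4])
  qed
  show ?thesis
    using t
  proof (induction rule: free_on_induct)
    case (add x y)
    then show ?case
      using eqm_add[OF subsp_vac add] by (simp add: free_map_add resop_sum distrib_left)
  next
    case (word c v)
    show ?case
      using eqm_scal[OF subsp_vac wd[OF word], of c a]
      by (simp add: free_map_mult free_map_scal resop_scal scal_mult_left mult.commute)
  qed
qed

lemma covariant_jcur: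
  assumes form: "invariant_form form" shows "covariant (jcur form)"
  unfolding covariant_def
proof (intro ballI allI)
  fix g z a and X :: "'a mero free_alg set" assume g: "g \<in> Aut" and X: "X \<in> Vac (reg z)"
  define s where "s = inv g"
  let ?N = "vac_ideal UNIV :: 'a mero free_alg set"
  have bij: "bij g" using g by (simp add: Aut_def)
  then have s: "holo_map s" "bij s" "holo_map (inv s)"
    using g by (simp_all add: Aut_def s_def bij_imp_bij_inv inv_inv_eq)
  have sz: "s (g z) = z" using bij by (simp add: s_def bij_is_inj)
  have K: "K_transport g z = jac s (g z)" by (simp add: K_transport_jac bij s_def)
  obtain t where t: "t \<in> free_on (reg z)" "X = t +o vac_ideal (reg z)" using X unfolding Vac_iff by blast
  let ?F = "free_map (tr s)"
  have F: "vac_transport g Y = ?F ` Y" for Y :: "'a mero free_alg set"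
    by (simp add: vac_transport_def transport_tr s_def)
  have VN: "r \<in> ?N" if "r \<in> vac_ideal (reg z)" for r using that vac_mono[of "reg z" UNIV] by auto
  have "jcur form a (g z) (?F ` X) = (\<lambda>t. resop form (g z) (elem (pol (g z)) a) (?F t)) ` (t +o vac_ideal (reg z)) + ?N"
    unfolding jcur_def t(2) image_image ..
  also have "\<dots> = resop form (g z) (elem (pol (g z)) a) (?F t) +o ?N"
    by (rule image_coset_plus)
      (simp_all add: subsp_0 free_map_add resop_sum resop_vac[OF form free_map_vac[OF s VN]])
  also have "\<dots> = (scal (jac s (g z)) * ?F (resop form z (elem (pol z) a) t)) +o ?N"
    using resop_covariant[OF form s, of t "g z" a] t(1) by (intro coset_eqI subsp_vac) (simp add: sz)
  also have "\<dots> = (\<lambda>t. scal (jac s (g z)) * ?F t) ` (resop form z (elem (pol z) a) t +o ?N) + ?N"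
    by (rule image_coset_plus[symmetric])
      (auto simp: subsp_0 free_map_add distrib_left intro!: subsp_scal free_map_vac[OF s])
  also have "\<dots> = lmul ?N (scal (jac s (g z))) (?F ` jcur form a z X)"
  proof -
    have "(\<lambda>x. c * ?F x) ` Y = c *o ?F ` Y" for c :: "'a mero free_alg" and Y
      by (auto simp: elt_set_times_def)
    then show ?thesis unfolding t(2) jcur_coset[OF form] lmul_def by (rule arg_cong)
  qed
  finally show "jcur form a (g z) (vac_transport g X) =
       lmul ?N (scal (K_transport g z)) (vac_transport g (jcur form a z X))"
    unfolding F K .
qed

section \<open>Rational families\<close>

lemma no_pole_append: "no_pole_at s (R @ R') \<longleftrightarrow> no_pole_at s R \<and> no_pole_at s R'"
  by (simp only: no_pole_at_def set_append ball_Un)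

lemma family_at_Nil: "family_at u s [] = 0"
  and family_at_append: "family_at u s (R @ R') = family_at u s R + family_at u s R'"
  and family_at_single: "family_at u s [(c, d, l)] =
    scal (poly c s / poly d s) * prod_list (map (\<lambda>l. gen (letter_at u s l)) l)"
  by (simp_all add: family_at_def)

fun family_mult :: "complex poly \<times> complex poly \<times> 'g letter_family list \<Rightarrow>
    complex poly \<times> complex poly \<times> 'g letter_family list \<Rightarrow>
    complex poly \<times> complex poly \<times> 'g letter_family list" where
  "family_mult (c, d, l) (c', d', l') = (c * c', d * d', l @ l')"

lemma family_at_family_mult: "family_at u s [family_mult x y] = family_at u s [x] * family_at u s [y]"
proof (cases x; cases y)
  fix c d l c' d' l' assume *: "x = (c, d, l)" "y = (c', d', l')"
  define A where "A = prod_list (map (\<lambda>l. gen (letter_at u s l)) l)"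
  define B where "B = prod_list (map (\<lambda>l. gen (letter_at u s l)) l')"
  define a where "a = poly c s / poly d s"
  define b where "b = poly c' s / poly d' s"
  have "scal (a * b) * (A * B) = scal a * A * (scal b * B)"
    by (metis mult.assoc mult_scal_left scal_mult)
  then show ?thesis using * by (simp add: family_at_def A_def B_def a_def b_def)
qed

lemma family_at_Cons: "family_at u s (x # R) = family_at u s [x] + family_at u s R"
  using family_at_append[of u s "[x]" R] by simp

lemma family_at_map_mult: "family_at u s (map (family_mult x) R) = family_at u s [x] * family_at u s R"
proof (induction R)
  case (Cons y R)
  show ?case
    unfolding list.map family_at_Cons[of u s "family_mult x y"] family_at_Cons[of u s y R] Cons
      family_at_family_mult by (simp add: distrib_left)
qed (simp add: family_at_Nil)

lemma family_at_concat_mult: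
  "family_at u s (concat (map (\<lambda>x. map (family_mult x) R') R)) = family_at u s R * family_at u s R'"
proof (induction R)
  case (Cons x R)
  then show ?case
    by (simp add: family_at_append family_at_map_mult family_at_Cons[of u s x R] distrib_right)
qed (simp add: family_at_Nil)

lemma no_pole_family_mult:
  assumes "no_pole_at s R" "no_pole_at s R'"
  shows "no_pole_at s (concat (map (\<lambda>x. map (family_mult x) R') R))"
proof -
  have "case family_mult x y of (c, d, l) \<Rightarrow> poly d s \<noteq> 0 \<and> (\<forall>(p, q, a)\<in>set l. poly q [:s:] \<noteq> 0)"
    if "x \<in> set R" "y \<in> set R'" for x y
    using assms that unfolding no_pole_at_def by (cases x; cases y) fastforce
  then show ?thesis unfolding no_pole_at_def by auto
qed

text \<open>Equality is demanded in the free algebra, not modulo relations, and on a full disc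
  including its centre, so that the value of the family at \<open>s1\<close> is determined by
  evaluating F there.\<close>

definition ratfam :: "proj_line \<Rightarrow> (proj_line \<Rightarrow> complex) \<Rightarrow> complex \<Rightarrow>
    (complex \<Rightarrow> 'g::complex_lie_algebra mero free_alg) \<Rightarrow> bool" where
  "ratfam P u s1 F \<longleftrightarrow> (\<exists>R. no_pole_at s1 R \<and>
     (\<exists>\<delta>>0. \<forall>s. dist s s1 < \<delta> \<longrightarrow> family_at u s R = F s \<and> F s \<in> free_on (van P)))"

lemma ratfamI:
  assumes "no_pole_at s1 R" "\<delta> > 0"
    "\<And>s. dist s s1 < \<delta> \<Longrightarrow> family_at u s R = F s" "\<And>s. dist s s1 < \<delta> \<Longrightarrow> F s \<in> free_on (van P)"
  shows "ratfam P u s1 F"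
  unfolding ratfam_def using assms by blast

lemma ratfamE:
  assumes "ratfam P u s1 F"
  obtains R \<delta> where "no_pole_at s1 R" "\<delta> > 0"
    "\<And>s. dist s s1 < \<delta> \<Longrightarrow> family_at u s R = F s" "\<And>s. dist s s1 < \<delta> \<Longrightarrow> F s \<in> free_on (van P)"
  using assms unfolding ratfam_def by blast

lemma ratfam_free: "ratfam P u s1 F \<Longrightarrow> F s1 \<in> free_on (van P)"
  by (erule ratfamE) simp

lemma ratfam_add:
  assumes "ratfam P u s1 F" "ratfam P u s1 G" shows "ratfam P u s1 (\<lambda>s. F s + G s)"
proof -
  obtain R \<delta> where 1: "no_pole_at s1 R" "\<delta> > 0"
    "\<And>s. dist s s1 < \<delta> \<Longrightarrow> family_at u s R = F s" "\<And>s. dist s s1 < \<delta> \<Longrightarrow> F s \<in> free_on (van P)"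
    by (rule ratfamE[OF assms(1)]) blast
  obtain R' \<delta>' where 2: "no_pole_at s1 R'" "\<delta>' > 0"
    "\<And>s. dist s s1 < \<delta>' \<Longrightarrow> family_at u s R' = G s" "\<And>s. dist s s1 < \<delta>' \<Longrightarrow> G s \<in> free_on (van P)"
    by (rule ratfamE[OF assms(2)]) blast
  show ?thesis
    by (rule ratfamI[of _ "R @ R'" "min \<delta> \<delta>'"])
      (use 1 2 in \<open>auto simp: no_pole_append family_at_append intro: free_on_add\<close>)
qed

lemma ratfam_mult:
  assumes "ratfam P u s1 F" "ratfam P u s1 G" shows "ratfam P u s1 (\<lambda>s. F s * G s)"
proof -
  obtain R \<delta> where 1: "no_pole_at s1 R" "\<delta> > 0"
    "\<And>s. dist s s1 < \<delta> \<Longrightarrow> family_at u s R = F s" "\<And>s. dist s s1 < \<delta> \<Longrightarrow> F s \<in> free_on (van P)"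
    by (rule ratfamE[OF assms(1)]) blast
  obtain R' \<delta>' where 2: "no_pole_at s1 R'" "\<delta>' > 0"
    "\<And>s. dist s s1 < \<delta>' \<Longrightarrow> family_at u s R' = G s" "\<And>s. dist s s1 < \<delta>' \<Longrightarrow> G s \<in> free_on (van P)"
    by (rule ratfamE[OF assms(2)]) blast
  show ?thesis
    by (rule ratfamI[of _ "concat (map (\<lambda>x. map (family_mult x) R') R)" "min \<delta> \<delta>'"])
      (use 1 2 in \<open>auto simp: no_pole_family_mult family_at_concat_mult intro: free_on_mult\<close>)
qed

lemma ratfam_scal_rational:
  assumes "poly d s1 \<noteq> 0" shows "ratfam P u s1 (\<lambda>s. scal (poly c s / poly d s))"
  by (rule ratfamI[of _ "[(c, d, [])]" 1]) (use assms in \<open>auto simp: no_pole_at_def family_at_single\<close>)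

lemma ratfam_scal: "ratfam P u s1 (\<lambda>s. scal c)"
  using ratfam_scal_rational[of "[:1:]" s1 P u "[:c:]"] by simp

lemma ratfam_0: "ratfam P u s1 (\<lambda>s. 0)"
  and ratfam_1: "ratfam P u s1 (\<lambda>s. 1)"
  using ratfam_scal[of P u s1 0] ratfam_scal[of P u s1 1] by simp_all

lemma ratfam_sum: "(\<And>i. i \<in> I \<Longrightarrow> ratfam P u s1 (F i)) \<Longrightarrow> ratfam P u s1 (\<lambda>s. \<Sum>i\<in>I. F i s)"
  by (induction I rule: infinite_finite_induct) (auto intro: ratfam_add ratfam_0)

lemma ratfam_inverse_power: "s1 \<noteq> \<sigma> \<Longrightarrow> ratfam P u s1 (\<lambda>s. scal (c * inverse (s - \<sigma>) ^ k))"
  using ratfam_scal_rational[of "[:-\<sigma>, 1:] ^ k" s1 P u "[:c:]"]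
  by (simp add: poly_power divide_inverse power_inverse)

lemma ratfam_letter:
  assumes "poly q [:s1:] \<noteq> 0"
    and "\<And>s. elem (\<lambda>t. poly (poly p [:s:]) (u t) / poly (poly q [:s:]) (u t)) x \<in> van P"
  shows "ratfam P u s1 (\<lambda>s. gen (elem (\<lambda>t. poly (poly p [:s:]) (u t) / poly (poly q [:s:]) (u t)) x))"
  by (rule ratfamI[of _ "[([:1:], [:1:], [(p, q, x)])]" 1])
    (use assms in \<open>auto simp: no_pole_at_def family_at_single elem_def intro: free_on_gen\<close>)

text \<open>An algebraic derivative: the increment of F is (s - s1) times another rational family G,
  exactly in the free algebra, and D is the value of G at \<open>s1\<close>. The family G, and not
  only D, is used in the limits.\<close>

definition dfam :: "proj_line \<Rightarrow> (proj_line \<Rightarrow> complex) \<Rightarrow> complex \<Rightarrow>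
    (complex \<Rightarrow> 'g::complex_lie_algebra mero free_alg) \<Rightarrow> 'g mero free_alg \<Rightarrow> bool" where
  "dfam P u s1 F D \<longleftrightarrow> ratfam P u s1 F \<and> (\<exists>G. ratfam P u s1 G \<and> G s1 = D \<and>
     (\<exists>\<delta>>0. \<forall>s. dist s s1 < \<delta> \<longrightarrow> F s = F s1 + scal (s - s1) * G s))"

lemma dfamI:
  assumes "ratfam P u s1 F" "ratfam P u s1 G" "G s1 = D" "\<delta> > 0"
    "\<And>s. dist s s1 < \<delta> \<Longrightarrow> F s = F s1 + scal (s - s1) * G s"
  shows "dfam P u s1 F D"
  unfolding dfam_def using assms by blast

lemma dfamE:
  assumes "dfam P u s1 F D"
  obtains G \<delta> where "ratfam P u s1 F" "ratfam P u s1 G" "G s1 = D" "\<delta> > 0"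
    "\<And>s. dist s s1 < \<delta> \<Longrightarrow> F s = F s1 + scal (s - s1) * G s"
  using assms unfolding dfam_def by blast

lemma dfam_const: "ratfam P u s1 (\<lambda>s. t) \<Longrightarrow> dfam P u s1 (\<lambda>s. t) 0"
  by (rule dfamI[OF _ ratfam_0 refl, of _ _ _ _ 1]) auto

lemma dfam_add:
  assumes "dfam P u s1 F D" "dfam P u s1 F' D'" shows "dfam P u s1 (\<lambda>s. F s + F' s) (D + D')"
proof -
  obtain G \<delta> where 1: "ratfam P u s1 F" "ratfam P u s1 G" "G s1 = D" "\<delta> > 0"
    "\<And>s. dist s s1 < \<delta> \<Longrightarrow> F s = F s1 + scal (s - s1) * G s" by (rule dfamE[OF assms(1)]) blast
  obtain G' \<delta>' where 2: "ratfam P u s1 F'" "ratfam P u s1 G'" "G' s1 = D'" "\<delta>' > 0"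
    "\<And>s. dist s s1 < \<delta>' \<Longrightarrow> F' s = F' s1 + scal (s - s1) * G' s" by (rule dfamE[OF assms(2)]) blast
  show ?thesis
  proof (rule dfamI[of _ _ _ _ "\<lambda>s. G s + G' s" _ "min \<delta> \<delta>'"])
    fix s assume "dist s s1 < min \<delta> \<delta>'"
    then have "F s = F s1 + scal (s - s1) * G s" "F' s = F' s1 + scal (s - s1) * G' s"
      using 1(5) 2(5) by auto
    then have "F s + F' s = (F s1 + scal (s - s1) * G s) + (F' s1 + scal (s - s1) * G' s)" by (rule arg_cong2)
    then show "F s + F' s = F s1 + F' s1 + scal (s - s1) * (G s + G' s)" by (simp add: algebra_simps)
  qed (use 1 2 in \<open>auto intro: ratfam_add\<close>)
qed

lemma dfam_mult_const:
  assumes "dfam P u s1 F D" "ratfam P u s1 (\<lambda>s. t)"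
  shows "dfam P u s1 (\<lambda>s. t * F s) (t * D)" "dfam P u s1 (\<lambda>s. F s * t) (D * t)"
proof -
  obtain G \<delta> where 1: "ratfam P u s1 F" "ratfam P u s1 G" "G s1 = D" "\<delta> > 0"
    "\<And>s. dist s s1 < \<delta> \<Longrightarrow> F s = F s1 + scal (s - s1) * G s" by (rule dfamE[OF assms(1)]) blast
  show "dfam P u s1 (\<lambda>s. t * F s) (t * D)"
  proof (rule dfamI[of _ _ _ _ "\<lambda>s. t * G s" _ \<delta>])
    fix s assume "dist s s1 < \<delta>"
    then have "t * F s = t * (F s1 + scal (s - s1) * G s)" using 1(5) by metis
    then show "t * F s = t * F s1 + scal (s - s1) * (t * G s)" by (simp add: distrib_left mult_scal_left[of t])
  qed (use 1 assms(2) in \<open>auto intro: ratfam_mult\<close>)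
  show "dfam P u s1 (\<lambda>s. F s * t) (D * t)"
  proof (rule dfamI[of _ _ _ _ "\<lambda>s. G s * t" _ \<delta>])
    fix s assume "dist s s1 < \<delta>"
    then have "F s * t = (F s1 + scal (s - s1) * G s) * t" using 1(5) by metis
    then show "F s * t = F s1 * t + scal (s - s1) * (G s * t)" by (simp add: distrib_right mult.assoc)
  qed (use 1 assms(2) in \<open>auto intro: ratfam_mult\<close>)
qed

lemma dfam_sum: "(\<And>i. i \<in> I \<Longrightarrow> dfam P u s1 (F i) (D i)) \<Longrightarrow> dfam P u s1 (\<lambda>s. \<Sum>i\<in>I. F i s) (\<Sum>i\<in>I. D i)"
  by (induction I rule: infinite_finite_induct) (auto intro: dfam_add dfam_const ratfam_0)

text \<open>The geometric sum for a difference of k-th powers, combined with y - y1 = -(s - s1) y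
  y1. The product y y1 adds one factor of each kind to every summand, whence the exponents
  \<open>k - i\<close> and \<open>Suc i\<close>.\<close>

lemma inverse_diff_dd:
  fixes s s1 \<sigma> :: complex
  assumes "s \<noteq> \<sigma>" "s1 \<noteq> \<sigma>"
  shows "inverse (s - \<sigma>) ^ k - inverse (s1 - \<sigma>) ^ k =
    (s - s1) * - (\<Sum>i<k. inverse (s1 - \<sigma>) ^ (k - i) * inverse (s - \<sigma>) ^ Suc i)"
proof -
  let ?y = "inverse (s - \<sigma>)" and ?y1 = "inverse (s1 - \<sigma>)"
  have 1: "?y - ?y1 = - ((s - s1) * (?y * ?y1))"
    using assms by (simp add: divide_simps)
  have "?y ^ k - ?y1 ^ k = (?y - ?y1) * (\<Sum>i<k. ?y1 ^ (k - Suc i) * ?y ^ i)"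
    by (rule power_diff_sumr2)
  also have "\<dots> = - ((s - s1) * (\<Sum>i<k. (?y * ?y1) * (?y1 ^ (k - Suc i) * ?y ^ i)))"
    unfolding 1 by (simp add: sum_distrib_left sum_negf mult.assoc)
  also have "(\<Sum>i<k. (?y * ?y1) * (?y1 ^ (k - Suc i) * ?y ^ i)) = (\<Sum>i<k. ?y1 ^ (k - i) * ?y ^ Suc i)"
  proof (rule sum.cong)
    fix i assume "i \<in> {..<k}"
    then have "?y1 ^ (k - i) = ?y1 * ?y1 ^ (k - Suc i)"
      by (simp flip: power_Suc add: Suc_diff_Suc)
    then show "(?y * ?y1) * (?y1 ^ (k - Suc i) * ?y ^ i) = ?y1 ^ (k - i) * ?y ^ Suc i" by simp
  qed simp
  finally show ?thesis by simp
qed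

lemma dfam_inverse_power:
  assumes "s1 \<noteq> \<sigma>"
  shows "dfam P u s1 (\<lambda>s. scal (c * inverse (s - \<sigma>) ^ k)) (scal (- (c * of_nat k * inverse (s1 - \<sigma>) ^ Suc k)))"
\<comment> \<open>The radius keeps s away from the pole \<sigma>. At s = s1 all k summands coincide,
  which produces the factor k of the derivative.\<close>
proof (rule dfamI[of _ _ _ _ "\<lambda>s. \<Sum>i<k. scal ((- c * inverse (s1 - \<sigma>) ^ (k - i)) * inverse (s - \<sigma>) ^ Suc i)" _ "dist \<sigma> s1"])
  have "(\<Sum>i<k. (- c * inverse (s1 - \<sigma>) ^ (k - i)) * inverse (s1 - \<sigma>) ^ Suc i) = (\<Sum>i<k. - c * inverse (s1 - \<sigma>) ^ Suc k)"
    by (intro sum.cong refl) (simp add: mult.assoc flip: power_add power_Suc del: power_inverse)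
  then show "(\<Sum>i<k. scal ((- c * inverse (s1 - \<sigma>) ^ (k - i)) * inverse (s1 - \<sigma>) ^ Suc i)) =
      scal (- (c * of_nat k * inverse (s1 - \<sigma>) ^ Suc k))"
    by (simp only: scal_sum[symmetric]) (simp add: mult.assoc mult.left_commute[of c])
  show "ratfam P u s1 (\<lambda>s. \<Sum>i<k. scal ((- c * inverse (s1 - \<sigma>) ^ (k - i)) * inverse (s - \<sigma>) ^ Suc i))"
    by (rule ratfam_sum) (rule ratfam_inverse_power[OF assms])
  show "ratfam P u s1 (\<lambda>s. scal (c * inverse (s - \<sigma>) ^ k))"
    by (rule ratfam_inverse_power[OF assms])
  fix s assume "dist s s1 < dist \<sigma> s1"
  then have "s \<noteq> \<sigma>" by auto
  have "c * inverse (s - \<sigma>) ^ k - c * inverse (s1 - \<sigma>) ^ k =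
      (s - s1) * (\<Sum>i<k. (- c * inverse (s1 - \<sigma>) ^ (k - i)) * inverse (s - \<sigma>) ^ Suc i)"
    using arg_cong[OF inverse_diff_dd[OF \<open>s \<noteq> \<sigma>\<close> assms, of k], of "\<lambda>x. c * x"]
    by (simp add: right_diff_distrib sum_distrib_left sum_negf mult.assoc mult.left_commute)
  then have "c * inverse (s - \<sigma>) ^ k = c * inverse (s1 - \<sigma>) ^ k +
      (s - s1) * (\<Sum>i<k. (- c * inverse (s1 - \<sigma>) ^ (k - i)) * inverse (s - \<sigma>) ^ Suc i)"
    by (simp add: diff_eq_eq add.commute)
  then show "scal (c * inverse (s - \<sigma>) ^ k) = scal (c * inverse (s1 - \<sigma>) ^ k) + scal (s - s1) *
      (\<Sum>i<k. scal ((- c * inverse (s1 - \<sigma>) ^ (k - i)) * inverse (s - \<sigma>) ^ Suc i))"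
    by (simp only: scal_add scal_mult scal_sum)
qed (use assms in simp)

lemma dfam_scal_mult:
  fixes F :: "complex \<Rightarrow> 'g::complex_lie_algebra mero free_alg"
  assumes "dfam P u s1 (\<lambda>s. scal (c s) :: 'g mero free_alg) (scal c')" "dfam P u s1 F D"
  shows "dfam P u s1 (\<lambda>s. scal (c s) * F s) (scal c' * F s1 + scal (c s1) * D)"
proof -
  obtain C :: "complex \<Rightarrow> 'g mero free_alg" and \<delta>'
    where 2: "ratfam P u s1 (\<lambda>s. scal (c s) :: 'g mero free_alg)" "ratfam P u s1 C" "C s1 = scal c'" "\<delta>' > 0"
    "\<And>s. dist s s1 < \<delta>' \<Longrightarrow> (scal (c s) :: 'g mero free_alg) = scal (c s1) + scal (s - s1) * C s"
    by (rule dfamE[OF assms(1)]) blast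
  obtain G \<delta> where 1: "ratfam P u s1 F" "ratfam P u s1 G" "G s1 = D" "\<delta> > 0"
    "\<And>s. dist s s1 < \<delta> \<Longrightarrow> F s = F s1 + scal (s - s1) * G s" by (rule dfamE[OF assms(2)]) blast
  show ?thesis
  proof (rule dfamI[of _ _ _ _ "\<lambda>s. C s * F s + scal (c s1) * G s" _ "min \<delta> \<delta>'"])
    fix s assume "dist s s1 < min \<delta> \<delta>'"
    then have *: "scal (c s) = scal (c s1) + scal (s - s1) * C s" "F s = F s1 + scal (s - s1) * G s"
      using 1(5)[of s] 2(5)[of s] by simp_all
    have "scal (c s) * F s = (scal (c s1) + scal (s - s1) * C s) * F s" by (rule arg_cong[OF *(1)])
    also have "\<dots> = scal (c s1) * (F s1 + scal (s - s1) * G s) + scal (s - s1) * (C s * F s)"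
      unfolding *(2)[symmetric] by (simp add: distrib_right mult.assoc)
    also have "\<dots> = scal (c s1) * F s1 + scal (s - s1) * (C s * F s + scal (c s1) * G s)"
      by (simp add: distrib_left mult_scal_left[of "scal (c s1)" "s - s1"] add.assoc add.commute add.left_commute)
    finally show "scal (c s) * F s = scal (c s1) * F s1 + scal (s - s1) * (C s * F s + scal (c s1) * G s)" .
  qed (use 1(1-4) 2(1-4) in \<open>auto intro!: ratfam_add ratfam_mult ratfam_scal\<close>)
qed

section \<open>Explicit form of \<open>\<iota>\<close> on words of simple fractions\<close>

definition rlet :: "(proj_line \<Rightarrow> complex) \<Rightarrow> complex \<Rightarrow> nat \<Rightarrow> 'g \<Rightarrow> 'g::complex_lie_algebra mero" where
  "rlet u \<sigma> k x = elem (\<lambda>p. inverse (u p - \<sigma>) ^ k) x"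

type_synonym 'g simple = "complex \<times> nat \<times> 'g"

text \<open>The condition \<open>s \<noteq> \<sigma>\<close> makes the simple fraction regular at
  the point with coordinate s, and \<open>0 < k\<close> makes it vanish at the pole of the
  coordinate.\<close>

fun valid :: "complex \<Rightarrow> 'g simple \<Rightarrow> bool" where
  "valid s (\<sigma>, k, x) \<longleftrightarrow> s \<noteq> \<sigma> \<and> 0 < k"

fun simple_elt :: "(proj_line \<Rightarrow> complex) \<Rightarrow> 'g simple \<Rightarrow> 'g::complex_lie_algebra mero" where
  "simple_elt u (\<sigma>, k, x) = rlet u \<sigma> k x"

definition gl :: "(proj_line \<Rightarrow> complex) \<Rightarrow> 'g::complex_lie_algebra simple list \<Rightarrow> 'g mero free_alg" where
  "gl u w = gens (map (simple_elt u) w)"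

lemma gl_Nil [simp]: "gl u [] = 1"
  and gl_Cons: "gl u (l # w) = gen (simple_elt u l) * gl u w"
  by (simp_all add: gl_def gens_Cons)

text \<open>The contribution of the letter \<alpha> = x/(u - \<sigma>)^k to its commutator with
  \<iota>, divided by du. The sum is the divided difference left by the two \<epsilon> terms; the
  scalar is -(a, d\<alpha>), its sign absorbed by differentiating a negative power.\<close>

fun eio :: "('g \<Rightarrow> 'g \<Rightarrow> complex) \<Rightarrow> (proj_line \<Rightarrow> complex) \<Rightarrow> complex \<Rightarrow> 'g \<Rightarrow> 'g simple \<Rightarrow>
    'g::complex_lie_algebra mero free_alg" where
  "eio form u s a (\<sigma>, k, x) =
     (\<Sum>i<k. scal (1 * inverse (s - \<sigma>) ^ (k - i)) * gen (rlet u \<sigma> (Suc i) (lie a x)))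
     + scal ((of_nat k * form a x) * inverse (s - \<sigma>) ^ Suc k)"

text \<open>\<open>io s w a\<close> is the value of \<open>\<iota>\<^sup>a(z) / du\<close> on the word \<open>w\<close>, where \<open>s = u z\<close>, and \<open>dio s w a\<close> is its
  derivative with respect to \<open>s\<close>. All coefficients have the shape \<open>c * inverse (s - \<sigma>) ^ k\<close>, even for \<open>c = 1\<close>.\<close>

fun io :: "('g \<Rightarrow> 'g \<Rightarrow> complex) \<Rightarrow> (proj_line \<Rightarrow> complex) \<Rightarrow> complex \<Rightarrow> 'g simple list \<Rightarrow> 'g \<Rightarrow>
    'g::complex_lie_algebra mero free_alg" where
  "io form u s [] a = 0"
| "io form u s ((\<sigma>, k, x) # w) a = gen (rlet u \<sigma> k x) * io form u s w a
     + eio form u s a (\<sigma>, k, x) * gl u w + scal (1 * inverse (s - \<sigma>) ^ k) * io form u s w (lie a x)"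

fun deio :: "('g \<Rightarrow> 'g \<Rightarrow> complex) \<Rightarrow> (proj_line \<Rightarrow> complex) \<Rightarrow> complex \<Rightarrow> 'g \<Rightarrow> 'g simple \<Rightarrow>
    'g::complex_lie_algebra mero free_alg" where
  "deio form u s a (\<sigma>, k, x) =
     (\<Sum>i<k. scal (- (1 * of_nat (k - i) * inverse (s - \<sigma>) ^ Suc (k - i))) * gen (rlet u \<sigma> (Suc i) (lie a x)))
     + scal (- ((of_nat k * form a x) * of_nat (Suc k) * inverse (s - \<sigma>) ^ Suc (Suc k)))"

fun dio :: "('g \<Rightarrow> 'g \<Rightarrow> complex) \<Rightarrow> (proj_line \<Rightarrow> complex) \<Rightarrow> complex \<Rightarrow> 'g simple list \<Rightarrow> 'g \<Rightarrow>
    'g::complex_lie_algebra mero free_alg" where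
  "dio form u s [] a = 0"
| "dio form u s ((\<sigma>, k, x) # w) a = gen (rlet u \<sigma> k x) * dio form u s w a
     + deio form u s a (\<sigma>, k, x) * gl u w
     + (scal (- (1 * of_nat k * inverse (s - \<sigma>) ^ Suc k)) * io form u s w (lie a x)
        + scal (1 * inverse (s - \<sigma>) ^ k) * dio form u s w (lie a x))"

lemma gen_linear_sum:
  assumes "finite I" "0 \<in> H" "\<And>\<alpha> \<beta>. \<alpha> \<in> H \<Longrightarrow> \<beta> \<in> H \<Longrightarrow> \<alpha> + \<beta> \<in> H"
    "\<And>c \<alpha>. \<alpha> \<in> H \<Longrightarrow> c *\<^sub>C \<alpha> \<in> H" "\<And>i. i \<in> I \<Longrightarrow> f i \<in> H"
  shows "(\<Sum>i\<in>I. c i *\<^sub>C f i) \<in> H \<and>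
    eqm (uea_ideal H) (gen (\<Sum>i\<in>I. c i *\<^sub>C f i)) (\<Sum>i\<in>I. scal (c i) * gen (f i))"
  using assms(1,5)
proof (induction I rule: finite_induct)
  case empty
  show ?case using assms(2) gen_zero[of H] by (simp add: eqm_def)
next
  case (insert i I)
  then have *: "(\<Sum>i\<in>I. c i *\<^sub>C f i) \<in> H" "c i *\<^sub>C f i \<in> H"
    "eqm (uea_ideal H) (gen (\<Sum>i\<in>I. c i *\<^sub>C f i)) (\<Sum>i\<in>I. scal (c i) * gen (f i))"
    using assms(4) by auto
  have "eqm (uea_ideal H) (gen (c i *\<^sub>C f i + (\<Sum>i\<in>I. c i *\<^sub>C f i)))
      (gen (c i *\<^sub>C f i) + gen (\<Sum>i\<in>I. c i *\<^sub>C f i))"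
    by (rule gen_add[OF *(2,1)])
  moreover have "eqm (uea_ideal H) (gen (c i *\<^sub>C f i) + gen (\<Sum>i\<in>I. c i *\<^sub>C f i))
      (scal (c i) * gen (f i) + (\<Sum>i\<in>I. scal (c i) * gen (f i)))"
    using insert by (intro eqm_add[OF subsp_uea] gen_scale *(3)) auto
  ultimately show ?case
    using insert * assms(3) eqm_trans[OF subsp_uea] by auto
qed

locale coord_setup =
  fixes form :: "'g::complex_lie_algebra \<Rightarrow> 'g \<Rightarrow> complex" and P :: proj_line and u
  assumes form: "invariant_form form" and u: "coordinate P u"
begin

lemma iota_setup: "z \<noteq> P \<Longrightarrow> iota_setup form P z u"
  by unfold_locales (auto simp: form u)

lemma mer_inverse: "meromorphic_fun (\<lambda>p. inverse (u p - \<sigma>) ^ k)"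
  using coordinate_meromorphic[OF u]
  by (intro meromorphic_fun_power meromorphic_fun_inverse meromorphic_fun_diff) auto

lemma point_exists: obtains y where "y \<noteq> P" "u y = \<sigma>"
proof -
  obtain c b where *: "c \<noteq> 0" "\<And>p. p \<noteq> P \<Longrightarrow> u p = c * pol P p + b" by (rule coordinateE[OF u]) blast
  obtain y where "y \<noteq> P" "pol P y = (\<sigma> - b) / c" by (rule pol_surj)
  then show ?thesis using * that[of y] by simp
qed

lemma finite_level: "finite {p. u p = \<sigma> \<or> p = P}"
proof -
  obtain y where y: "y \<noteq> P" "u y = \<sigma>" by (rule point_exists)
  have "{p. u p = \<sigma> \<or> p = P} \<subseteq> {P, y}"
  proof
    fix p assume "p \<in> {p. u p = \<sigma> \<or> p = P}"
    then show "p \<in> {P, y}" using coordinate_inj[OF u _ y(1), of p] y(2) by (cases "p = P") auto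
  qed
  then show ?thesis by (rule finite_subset) simp
qed

text \<open>The value of \<open>u\<close> at its pole is a dummy. Written with \<open>pol y\<close>,
  the same map is visibly holomorphic at \<open>P\<close> and, for positive k, zero there.\<close>

lemma rlet_pol:
  assumes "y \<noteq> P"
  shows "rlet u (u y) k x = elem (\<lambda>p. (inverse (diff u y) * (pol y p - pol y P)) ^ k) x"
  unfolding rlet_def
proof (rule elem_cong[OF mer_inverse])
  have *: "inverse (u p - u y) = inverse (diff u y) * (pol y p - pol y P)" if "p \<noteq> y" "p \<noteq> P" for p
    unfolding coordinate_eps[OF u assms that, symmetric]
    using coordinate_diff_nonzero[OF u assms] by (simp add: divide_inverse)
  show "finite {p. inverse (u p - u y) ^ k \<noteq> (inverse (diff u y) * (pol y p - pol y P)) ^ k}"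
  proof (rule finite_subset)
    show "{p. inverse (u p - u y) ^ k \<noteq> (inverse (diff u y) * (pol y p - pol y P)) ^ k} \<subseteq> {y, P}"
    proof
      fix p assume "p \<in> {p. inverse (u p - u y) ^ k \<noteq> (inverse (diff u y) * (pol y p - pol y P)) ^ k}"
      then show "p \<in> {y, P}" using *[of p] by (cases "p = y \<or> p = P") auto
    qed
  qed simp
qed (intro meromorphic_fun_power meromorphic_fun_mult meromorphic_fun_diff meromorphic_fun_const meromorphic_fun_pol)

lemma rlet_van: assumes "k > 0" shows "rlet u \<sigma> k x \<in> van P"
proof -
  obtain y where y: "y \<noteq> P" "u y = \<sigma>" by (rule point_exists)
  have "elem (\<lambda>p. (inverse (diff u y) * (pol y p - pol y P)) ^ k) x \<in> van P"
  proof (rule elem_van)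
    show "meromorphic_fun (\<lambda>p. (inverse (diff u y) * (pol y p - pol y P)) ^ k)"
      by (intro meromorphic_fun_power meromorphic_fun_mult meromorphic_fun_diff meromorphic_fun_const meromorphic_fun_pol)
    show "holo_at (\<lambda>p. (inverse (diff u y) * (pol y p - pol y P)) ^ k) P"
      using y(1) by (intro holo_at_power holo_at_mult holo_at_diff holo_at_const holo_at_pol) auto
  qed (use assms in simp)
  then show ?thesis using rlet_pol[OF y(1), of k x] unfolding y(2) by simp
qed

lemma holo_inverse:
  assumes "z \<noteq> P" "u z \<noteq> \<sigma>" shows "holo_at (\<lambda>p. inverse (u p - \<sigma>) ^ k) z"
proof -
  have "holo_at (\<lambda>p. 1 / (u p - \<sigma>)) z"
    using assms coordinate_holo[OF u assms(1)] by (intro holo_at_divide holo_at_diff) auto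
  then show ?thesis by (intro holo_at_power) (simp add: divide_inverse)
qed

lemma diff_inverse:
  assumes "z \<noteq> P" "u z \<noteq> \<sigma>"
  shows "diff (\<lambda>p. inverse (u p - \<sigma>) ^ k) z = - (of_nat k * inverse (u z - \<sigma>) ^ Suc k * diff u z)"
proof -
  have "(\<lambda>h. u (chart z h)) field_differentiable at 0"
    using coordinate_holo[OF u assms(1)] by (simp add: holo_at_def analytic_on_imp_differentiable_at)
  then have d: "((\<lambda>h. u (chart z h)) has_field_derivative diff u z) (at 0)"
    by (simp add: diff_def DERIV_deriv_iff_field_differentiable)
  have "((\<lambda>h. inverse (u (chart z h) - \<sigma>) ^ k) has_field_derivative
      of_nat k * (- (inverse (u z - \<sigma>) * diff u z * inverse (u z - \<sigma>))) * inverse (u z - \<sigma>) ^ (k - 1)) (at 0)"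
    by (rule derivative_eq_intros d refl | use assms in simp)+
  then have "diff (\<lambda>p. inverse (u p - \<sigma>) ^ k) z =
      of_nat k * (- (inverse (u z - \<sigma>) * diff u z * inverse (u z - \<sigma>))) * inverse (u z - \<sigma>) ^ (k - 1)"
    unfolding diff_def[of "\<lambda>p. inverse (u p - \<sigma>) ^ k"] by (rule DERIV_imp_deriv)
  then show ?thesis by (cases k) (simp_all add: mult_ac)
qed

lemma rlet_at:
  assumes "z \<noteq> P" "u z \<noteq> \<sigma>"
  shows "rlet u \<sigma> k x \<in> reg z" "ev z (rlet u \<sigma> k x) = inverse (u z - \<sigma>) ^ k *\<^sub>C x"
    "dev z (rlet u \<sigma> k x) = (- (of_nat k * inverse (u z - \<sigma>) ^ Suc k * diff u z)) *\<^sub>C x"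
  unfolding rlet_def using holo_inverse[OF assms] mer_inverse diff_inverse[OF assms]
  by (simp_all add: elem_reg ev_elem dev_elem)

lemma valid_simple: "z \<noteq> P \<Longrightarrow> valid (u z) l \<Longrightarrow> simple_elt u l \<in> van P \<inter> reg z"
  by (cases l) (auto simp: rlet_van rlet_at)

lemma gl_free: "z \<noteq> P \<Longrightarrow> list_all (valid (u z)) w \<Longrightarrow> gl u w \<in> free_on (van P \<inter> reg z)"
  unfolding gl_def list_all_iff by (rule free_on_gens, unfold set_map) (use valid_simple in blast)

text \<open>The two \<epsilon> terms combine to the difference of y^k and (u - \<sigma>)^(-k), with
  y = 1/(u(z) - \<sigma>), times du/(u - u(z)). The divided difference cancels this pole at
  \<open>z\<close> and leaves simple fractions at \<sigma>.\<close>

lemma celt_rlet: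
  assumes z: "z \<noteq> P" and \<sigma>: "u z \<noteq> \<sigma>"
  shows "celt u z a (rlet u \<sigma> k x) =
    (\<Sum>i<k. (diff u z * inverse (u z - \<sigma>) ^ (k - i)) *\<^sub>C rlet u \<sigma> (Suc i) (lie a x))"
proof -
  let ?f = "\<lambda>p. diff u z / (u p - u z)" and ?X = "\<lambda>p. inverse (u p - \<sigma>)" and ?y = "inverse (u z - \<sigma>)"
  have mf: "meromorphic_fun ?f"
    using coordinate_meromorphic[OF u] by (intro meromorphic_fun_divide meromorphic_fun_diff) auto
  have eps: "eps_elt u z b = elem ?f b" for b by (simp add: eps_elt_def elem_def)
  have "celt u z a (rlet u \<sigma> k x) = - elem (\<lambda>p. ?f p * ?X p ^ k) (lie a x) + elem ?f (?y ^ k *\<^sub>C lie a x)"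
    unfolding celt_def rlet_at(2)[OF z \<sigma>] eps lie_cscale_right
    by (simp add: rlet_def elem_lie[OF mf mer_inverse])
  also have "elem ?f (?y ^ k *\<^sub>C lie a x) = elem (\<lambda>p. ?y ^ k * ?f p) (lie a x)"
    by (rule elem_scale_left[symmetric])
  also have "- elem (\<lambda>p. ?f p * ?X p ^ k) (lie a x) + elem (\<lambda>p. ?y ^ k * ?f p) (lie a x) =
      elem (\<lambda>p. ?y ^ k * ?f p - ?f p * ?X p ^ k) (lie a x)"
    using elem_diff_left[OF meromorphic_fun_mult[OF meromorphic_fun_const[of "?y ^ k"] mf]
        meromorphic_fun_mult[OF mf mer_inverse[of \<sigma> k]], of "lie a x"] by simp
  also have "\<dots> = elem (\<lambda>p. \<Sum>i<k. (diff u z * ?y ^ (k - i)) * ?X p ^ Suc i) (lie a x)"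
  proof (rule elem_cong)
    have "?y ^ k * ?f p - ?f p * ?X p ^ k = (\<Sum>i<k. (diff u z * ?y ^ (k - i)) * ?X p ^ Suc i)"
      if p: "u p \<noteq> \<sigma>" "u p \<noteq> u z" for p
    proof -
      have "?y ^ k * ?f p - ?f p * ?X p ^ k = - (?f p * (?X p ^ k - ?y ^ k))" by (simp add: algebra_simps)
      also have "\<dots> = ?f p * (u p - u z) * (\<Sum>i<k. ?y ^ (k - i) * ?X p ^ Suc i)"
        unfolding inverse_diff_dd[OF p(1) \<sigma>] by simp
      also have "?f p * (u p - u z) = diff u z" using p(2) by simp
      finally show ?thesis by (simp add: sum_distrib_left mult.assoc)
    qed
    then have "{p. ?y ^ k * ?f p - ?f p * ?X p ^ k \<noteq> (\<Sum>i<k. (diff u z * ?y ^ (k - i)) * ?X p ^ Suc i)}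
        \<subseteq> {p. u p = \<sigma> \<or> p = P} \<union> {p. u p = u z \<or> p = P}" by blast
    then show "finite {p. ?y ^ k * ?f p - ?f p * ?X p ^ k \<noteq> (\<Sum>i<k. (diff u z * ?y ^ (k - i)) * ?X p ^ Suc i)}"
      by (rule finite_subset[OF _ finite_UnI[OF finite_level finite_level]])
    show "meromorphic_fun (\<lambda>p. \<Sum>i<k. (diff u z * ?y ^ (k - i)) * ?X p ^ Suc i)"
      by (intro meromorphic_fun_sum meromorphic_fun_mult[OF meromorphic_fun_const mer_inverse])
    show "meromorphic_fun (\<lambda>p. ?y ^ k * ?f p - ?f p * ?X p ^ k)"
      by (intro meromorphic_fun_diff meromorphic_fun_mult[OF meromorphic_fun_const mf] meromorphic_fun_mult[OF mf mer_inverse])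
  qed
  also have "\<dots> = (\<Sum>i<k. elem (\<lambda>p. (diff u z * ?y ^ (k - i)) * ?X p ^ Suc i) (lie a x))"
    by (intro elem_sum_left meromorphic_fun_mult[OF meromorphic_fun_const mer_inverse])
  also have "\<dots> = (\<Sum>i<k. (diff u z * ?y ^ (k - i)) *\<^sub>C rlet u \<sigma> (Suc i) (lie a x))"
    unfolding rlet_def elem_scale_left elem_scale[OF mer_inverse] ..
  finally show ?thesis .
qed

lemma gen_celt:
  assumes z: "z \<noteq> P" and \<sigma>: "u z \<noteq> \<sigma>"
  shows "eqm (uea_ideal (van P \<inter> reg z))
    (gen (celt u z a (rlet u \<sigma> k x)) - scal (form a (dev z (rlet u \<sigma> k x))))
    (scal (diff u z) * eio form u (u z) a (\<sigma>, k, x))"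
proof -
  let ?H = "van P \<inter> reg z"
  have "eqm (uea_ideal ?H) (gen (celt u z a (rlet u \<sigma> k x)))
      (\<Sum>i<k. scal (diff u z * inverse (u z - \<sigma>) ^ (k - i)) * gen (rlet u \<sigma> (Suc i) (lie a x)))"
    unfolding celt_rlet[OF z \<sigma>]
    by (rule conjunct2[OF gen_linear_sum]) (auto simp: van_add reg_add van_scale reg_scale rlet_van rlet_at z \<sigma>)
  from eqm_diff[OF subsp_uea this eqm_refl[OF subsp_uea, of ?H "scal (form a (dev z (rlet u \<sigma> k x)))"]]
  show ?thesis
    unfolding rlet_at(3)[OF z \<sigma>] form_scale_right[OF form] eio.simps
    by (simp add: distrib_left sum_distrib_left scal_mult mult.assoc scal_minus[symmetric])
      (simp add: scal_minus scal_mult[symmetric] mult_ac)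
qed

lemma io_iop:
  assumes z: "z \<noteq> P" and w: "list_all (valid (u z)) w"
  shows "eqm (uea_ideal (van P \<inter> reg z)) (iop form u z a (gl u w)) (scal (diff u z) * io form u (u z) w a)"
  using w
proof (induction w arbitrary: a)
  case Nil
  show ?case by (simp add: iop_1 eqm_refl)
next
  case (Cons l w)
  interpret iota_setup form P z u by (rule iota_setup[OF z])
  obtain \<sigma> k x where l: "l = (\<sigma>, k, x)" by (cases l)
  have \<sigma>: "u z \<noteq> \<sigma>" "k > 0" and w: "list_all (valid (u z)) w" using Cons.prems by (auto simp: l)
  let ?l = "rlet u \<sigma> k x" and ?y = "inverse (u z - \<sigma>)" and ?d = "scal (diff u z)"
  have l_Hz: "?l \<in> Hz" using valid_simple[OF z, of l] Cons.prems by (simp add: l)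
  have wf: "gl u w \<in> free_on Hz" by (rule gl_free[OF z w])
  have 1: "eqm Jz (gen ?l * iop form u z a (gl u w)) (gen ?l * (?d * io form u (u z) w a))"
    by (rule eqm_lmult[OF left_stable_uea free_on_gen[OF l_Hz] Cons.IH[OF w]])
  have 2: "eqm Jz ((gen (celt u z a ?l) - scal (form a (dev z ?l))) * gl u w) ((?d * eio form u (u z) a (\<sigma>, k, x)) * gl u w)"
    by (rule eqm_rmult_uea[OF gen_celt[OF z \<sigma>(1)] wf])
  have "eqm Jz (iop form u z (lie a (ev z ?l)) (gl u w)) (scal (?y ^ k) * iop form u z (lie a x) (gl u w))"
    unfolding rlet_at(2)[OF z \<sigma>(1)] lie_cscale_right by (rule iop_scale_left[OF wf])
  moreover have "eqm Jz (scal (?y ^ k) * iop form u z (lie a x) (gl u w)) (scal (?y ^ k) * (?d * io form u (u z) w (lie a x)))"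
    by (rule eqm_scal[OF subsp_uea Cons.IH[OF w]])
  ultimately have 3: "eqm Jz (iop form u z (lie a (ev z ?l)) (gl u w)) (scal (?y ^ k) * (?d * io form u (u z) w (lie a x)))"
    by (rule eqm_trans[OF subsp_uea])
  have eq: "?d * io form u (u z) (l # w) a = gen ?l * (?d * io form u (u z) w a)
      + (?d * eio form u (u z) a (\<sigma>, k, x)) * gl u w + scal (?y ^ k) * (?d * io form u (u z) w (lie a x))"
    unfolding l io.simps distrib_left mult.assoc mult_scal_left[of "gen ?l"] mult_1_left
      mult_scal_left[of "scal (?y ^ k)" "diff u z"] ..
  show ?case
    unfolding gl_Cons iop_gen eq unfolding l simple_elt.simps
    by (rule eqm_add[OF subsp_uea eqm_add[OF subsp_uea 1 2] 3])
qed

lemma ratfam_rlet: "k > 0 \<Longrightarrow> ratfam P u s1 (\<lambda>s. gen (rlet u \<sigma> k x))"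
  using ratfam_letter[of "[:[:-\<sigma>, 1:] ^ k:]" s1 "[:1:]" u x P] rlet_van[of k \<sigma> x]
  by (simp add: rlet_def poly_power divide_inverse power_inverse)

lemma ratfam_eps: "ratfam P u s1 (\<lambda>s. gen (rlet u s 1 x))"
  using ratfam_letter[of "[:[:0, 1:], [:-1:]:]" s1 "[:1:]" u x P] rlet_van[of 1 _ x]
  by (simp add: rlet_def divide_inverse)

lemma ratfam_gl: "list_all (valid s1) w \<Longrightarrow> ratfam P u s1 (\<lambda>s. gl u w)"
proof (induction w)
  case (Cons l w)
  then show ?case by (cases l) (auto simp: gl_Cons intro!: ratfam_mult ratfam_rlet)
qed (simp add: ratfam_1)

lemma dfam_eio:
  assumes "s1 \<noteq> \<sigma>"
  shows "dfam P u s1 (\<lambda>s. eio form u s a (\<sigma>, k, x)) (deio form u s1 a (\<sigma>, k, x))"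
  unfolding eio.simps deio.simps
  by (intro dfam_add dfam_sum dfam_mult_const(2) dfam_inverse_power assms ratfam_rlet) simp

lemma dfam_io: "list_all (valid s1) w \<Longrightarrow> dfam P u s1 (\<lambda>s. io form u s w a) (dio form u s1 w a)"
proof (induction w arbitrary: a)
  case Nil
  show ?case by (simp add: dfam_const ratfam_0)
next
  case (Cons l w)
  obtain \<sigma> k x where l: "l = (\<sigma>, k, x)" by (cases l)
  have \<sigma>: "s1 \<noteq> \<sigma>" "k > 0" and w: "list_all (valid s1) w" using Cons.prems by (auto simp: l)
  show ?case
    unfolding l io.simps dio.simps
    by (intro dfam_add dfam_mult_const(1)[OF Cons.IH[OF w] ratfam_rlet[OF \<sigma>(2)]]
        dfam_mult_const(2)[OF dfam_eio[OF \<sigma>(1)] ratfam_gl[OF w]]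
        dfam_scal_mult[OF dfam_inverse_power[OF \<sigma>(1)] Cons.IH[OF w]])
qed

end

text \<open>With V = 1/(u - s), X = 1/(u - \<sigma>) and y = 1/(s - \<sigma>), this is the expansion
  of V^2 X^m into partial fractions, the s-derivative of that of V X^m. The setting of commutative
  rings serves both functions and Laurent series.\<close>

lemma fraction_identity:
  fixes V X y :: "'a::comm_ring_1"
  assumes VX: "V * X = y * (V - X)"
  shows "V ^ 2 * X ^ m = y ^ m * V ^ 2 - of_nat m * y ^ Suc m * V
    + (\<Sum>i<m. (of_nat (m - i) * y ^ Suc (m - i)) * X ^ Suc i)"
proof (induction m)
  case (Suc m)
  have "V ^ 2 * X ^ Suc m = X * (V ^ 2 * X ^ m)" by simp
  also have "\<dots> = y ^ m * V * (V * X) - of_nat m * y ^ Suc m * (V * X)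
      + (\<Sum>i<m. (of_nat (m - i) * y ^ Suc (m - i)) * X ^ Suc (Suc i))"
    unfolding Suc by (simp add: algebra_simps power2_eq_square sum_distrib_left)
  also have "y ^ m * V * (V * X) - of_nat m * y ^ Suc m * (V * X) =
      y ^ m * V * (y * V - y * X) - of_nat m * y ^ Suc m * (y * V - y * X)"
    by (simp only: VX right_diff_distrib)
  also have "\<dots> = y ^ Suc m * V ^ 2 - of_nat m * y ^ Suc (Suc m) * V + of_nat m * y ^ Suc (Suc m) * X
      - y ^ Suc m * (V * X)"
    by (simp add: algebra_simps power2_eq_square)
  also have "y ^ Suc m * (V * X) = y ^ Suc (Suc m) * V - y ^ Suc (Suc m) * X"
    unfolding VX by (simp add: algebra_simps)
  also have "y ^ Suc m * V ^ 2 - of_nat m * y ^ Suc (Suc m) * V + of_nat m * y ^ Suc (Suc m) * X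
      - (y ^ Suc (Suc m) * V - y ^ Suc (Suc m) * X)
      + (\<Sum>i<m. (of_nat (m - i) * y ^ Suc (m - i)) * X ^ Suc (Suc i)) =
      y ^ Suc m * V ^ 2 - of_nat (Suc m) * y ^ Suc (Suc m) * V
      + (of_nat (Suc m) * y ^ Suc (Suc m) * X + (\<Sum>i<m. (of_nat (m - i) * y ^ Suc (m - i)) * X ^ Suc (Suc i)))"
    by (simp add: algebra_simps)
  also have "of_nat (Suc m) * y ^ Suc (Suc m) * X + (\<Sum>i<m. (of_nat (m - i) * y ^ Suc (m - i)) * X ^ Suc (Suc i)) =
      (\<Sum>i<Suc m. (of_nat (Suc m - i) * y ^ Suc (Suc m - i)) * X ^ Suc i)"
    unfolding sum.lessThan_Suc_shift by simp
  finally show ?case .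
qed simp

context coord_setup
begin

lemma VX: "u p \<noteq> s \<Longrightarrow> u p \<noteq> \<sigma> \<Longrightarrow> s \<noteq> \<sigma> \<Longrightarrow>
    inverse (u p - s) * inverse (u p - \<sigma>) = inverse (s - \<sigma>) * (inverse (u p - s) - inverse (u p - \<sigma>))"
  by (simp add: divide_simps)

lemma lie_rlet: "lie (rlet u \<sigma> k a) (rlet u \<tau> m b) =
    elem (\<lambda>p. inverse (u p - \<sigma>) ^ k * inverse (u p - \<tau>) ^ m) (lie a b)"
  unfolding rlet_def by (rule elem_lie[OF mer_inverse mer_inverse])

text \<open>A double pole is the s-derivative of a simple one, so the coefficients are the
  derivatives of those for a simple pole. The three kinds of terms are a double pole, a simple pole,
  and a remainder regular at the point with coordinate s.\<close>

lemma lie_rlet2: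
  assumes s: "s \<noteq> \<sigma>"
  shows "lie (rlet u s 2 a) (rlet u \<sigma> k x) =
    inverse (s - \<sigma>) ^ k *\<^sub>C rlet u s 2 (lie a x)
    + (- (of_nat k * inverse (s - \<sigma>) ^ Suc k)) *\<^sub>C rlet u s 1 (lie a x)
    + (\<Sum>i<k. (of_nat (k - i) * inverse (s - \<sigma>) ^ Suc (k - i)) *\<^sub>C rlet u \<sigma> (Suc i) (lie a x))"
proof -
  let ?V = "\<lambda>p. inverse (u p - s)" and ?X = "\<lambda>p. inverse (u p - \<sigma>)" and ?y = "inverse (s - \<sigma>)"
  let ?f = "\<lambda>p. ?y ^ k * ?V p ^ 2" and ?g = "\<lambda>p. (- (of_nat k * ?y ^ Suc k)) * ?V p ^ 1"
    and ?h = "\<lambda>p. \<Sum>i<k. (of_nat (k - i) * ?y ^ Suc (k - i)) * ?X p ^ Suc i"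
  have m: "meromorphic_fun ?f" "meromorphic_fun ?g" "meromorphic_fun ?h"
    by (intro meromorphic_fun_sum meromorphic_fun_mult[OF meromorphic_fun_const mer_inverse])+
  have "lie (rlet u s 2 a) (rlet u \<sigma> k x) = elem (\<lambda>p. ?V p ^ 2 * ?X p ^ k) (lie a x)"
    by (rule lie_rlet)
  also have "\<dots> = elem (\<lambda>p. (?f p + ?g p) + ?h p) (lie a x)"
  proof (rule elem_cong)
    have *: "?V p ^ 2 * ?X p ^ k = (?f p + ?g p) + ?h p" if "u p \<noteq> s" "u p \<noteq> \<sigma>" for p
      using fraction_identity[OF VX[OF that s], of k] by simp
    have "{p. ?V p ^ 2 * ?X p ^ k \<noteq> (?f p + ?g p) + ?h p} \<subseteq> {p. u p = s \<or> p = P} \<union> {p. u p = \<sigma> \<or> p = P}"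
      using * by blast
    then show "finite {p. ?V p ^ 2 * ?X p ^ k \<noteq> (?f p + ?g p) + ?h p}"
      by (rule finite_subset[OF _ finite_UnI[OF finite_level finite_level]])
  qed (intro meromorphic_fun_mult[OF mer_inverse mer_inverse] meromorphic_fun_add m)+
  also have "\<dots> = elem ?f (lie a x) + elem ?g (lie a x) + elem ?h (lie a x)"
    using elem_add_left[OF meromorphic_fun_add[OF m(1,2)] m(3), of "lie a x"] elem_add_left[OF m(1,2), of "lie a x"]
    by simp
  also have "elem ?f (lie a x) = ?y ^ k *\<^sub>C rlet u s 2 (lie a x)"
    unfolding rlet_def elem_scale_left elem_scale[OF mer_inverse] ..
  also have "elem ?g (lie a x) = (- (of_nat k * ?y ^ Suc k)) *\<^sub>C rlet u s 1 (lie a x)"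
    unfolding rlet_def elem_scale_left elem_scale[OF mer_inverse] ..
  also have "elem ?h (lie a x) = (\<Sum>i<k. elem (\<lambda>p. (of_nat (k - i) * ?y ^ Suc (k - i)) * ?X p ^ Suc i) (lie a x))"
    by (intro elem_sum_left meromorphic_fun_mult[OF meromorphic_fun_const mer_inverse])
  also have "\<dots> = (\<Sum>i<k. (of_nat (k - i) * ?y ^ Suc (k - i)) *\<^sub>C rlet u \<sigma> (Suc i) (lie a x))"
    unfolding rlet_def elem_scale_left elem_scale[OF mer_inverse] ..
  finally show ?thesis .
qed

lemma mer_inverse1: "meromorphic_fun (\<lambda>p. inverse (u p - \<sigma>))"
  using mer_inverse[of \<sigma> 1] by simp

lemma LE_inverse_deriv:
  "fls_deriv (LE z (\<lambda>p. inverse (u p - \<sigma>))) = - (LE z (\<lambda>p. inverse (u p - \<sigma>)) ^ 2 * fls_deriv (LE z u))"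
proof -
  let ?X = "LE z (\<lambda>p. inverse (u p - \<sigma>))" and ?U = "LE z u"
  have mu: "meromorphic_fun u" by (rule coordinate_meromorphic[OF u])
  have md: "meromorphic_fun (\<lambda>p. u p - \<sigma>)" by (rule meromorphic_fun_diff[OF mu]) simp
  have "LE z (\<lambda>p. inverse (u p - \<sigma>) * (u p - \<sigma>)) = LE z (\<lambda>p. 1)"
    by (rule LE_cong, rule finite_subset[OF _ finite_level[of \<sigma>]])
      (auto, metis left_inverse right_minus_eq)
  then have X1: "?X * (?U - fls_const \<sigma>) = 1"
    by (simp add: LE_mult mer_inverse1 md LE_diff mu LE_const)
  then have "fls_deriv (?X * (?U - fls_const \<sigma>)) = 0" by simp
  then have "fls_deriv ?X * (?U - fls_const \<sigma>) + ?X * fls_deriv ?U = 0" by (simp add: algebra_simps)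
  then have "(fls_deriv ?X * (?U - fls_const \<sigma>) + ?X * fls_deriv ?U) * ?X = 0" by simp
  then have "fls_deriv ?X * (?X * (?U - fls_const \<sigma>)) + ?X ^ 2 * fls_deriv ?U = 0"
    by (simp add: algebra_simps power2_eq_square)
  then show ?thesis unfolding X1 by (simp add: add_eq_0_iff)
qed

text \<open>The residue of du/(u - u(z)) at \<open>z\<close>; the expansion of 1/(u - u(z)) is read
  off from its form in \<open>pol z\<close>.\<close>

lemma LE_inverse_residue:
  assumes z: "z \<noteq> P"
  shows "(LE z (\<lambda>p. inverse (u p - u z)) * fls_deriv (LE z u)) $$ (-1) = 1"
proof -
  let ?d = "diff u z" and ?U = "LE z u"
  have hU: "\<And>n. n < 0 \<Longrightarrow> ?U $$ n = 0" "?U $$ 1 = ?d"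
    using holo_at_LE[OF coordinate_holo[OF u z]] by auto
  have "LE z (\<lambda>p. inverse (u p - u z)) = LE z (\<lambda>p. inverse ?d * (pol z p - pol z P))"
  proof (rule LE_cong, rule finite_subset)
    show "{p. inverse (u p - u z) \<noteq> inverse ?d * (pol z p - pol z P)} \<subseteq> {z, P}"
    proof
      fix p assume *: "p \<in> {p. inverse (u p - u z) \<noteq> inverse ?d * (pol z p - pol z P)}"
      show "p \<in> {z, P}"
      proof (rule ccontr)
        assume "p \<notin> {z, P}"
        then have "diff u z / (u p - u z) = pol z p - pol z P" by (intro coordinate_eps[OF u z]) auto
        then have "inverse (u p - u z) = inverse ?d * (pol z p - pol z P)"
          using coordinate_diff_nonzero[OF u z] by (simp add: divide_inverse flip: \<open>_ = pol z p - pol z P\<close>)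
        then show False using * by simp
      qed
    qed
  qed simp
  also have "\<dots> = fls_const (inverse ?d) * (fls_X_inv - fls_const (pol z P))"
    by (simp add: LE_cmult LE_diff meromorphic_fun_diff LE_pol_same LE_const)
  finally have "LE z (\<lambda>p. inverse (u p - u z)) * fls_deriv ?U =
      fls_const (inverse ?d) * (fls_X_inv * fls_deriv ?U - fls_const (pol z P) * fls_deriv ?U)"
    by (simp only: left_diff_distrib mult.assoc)
  then show ?thesis
    using hU coordinate_diff_nonzero[OF u z] by (simp add: fls_X_inv_times_conv_shift)
qed

text \<open>The differential form is -k V^2 X^(k+1) du. In its partial fractions V^2 du = -dV is
  exact, the powers of X are regular at \<open>z\<close>, and V du has residue 1 with coefficient
  -(k+1) y^(k+2). Up to sign the result is the derivative of the scalar in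
  \<open>eio\<close>.\<close>

lemma om_rlet2:
  assumes z: "z \<noteq> P" and \<sigma>: "u z \<noteq> \<sigma>"
  shows "om form z (rlet u (u z) 2 a) (rlet u \<sigma> k x) =
    of_nat k * form a x * of_nat (Suc k) * inverse (u z - \<sigma>) ^ Suc (Suc k)"
proof -
  let ?V = "LE z (\<lambda>p. inverse (u p - u z))" and ?X = "LE z (\<lambda>p. inverse (u p - \<sigma>))"
    and ?y = "fls_const (inverse (u z - \<sigma>))" and ?U' = "fls_deriv (LE z u)"
  have "LE z (\<lambda>p. inverse (u p - u z) * inverse (u p - \<sigma>)) =
      LE z (\<lambda>p. inverse (u z - \<sigma>) * (inverse (u p - u z) - inverse (u p - \<sigma>)))"
    by (rule LE_cong, rule finite_subset[OF _ finite_UnI[OF finite_level[of "u z"] finite_level[of \<sigma>]]])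
      (use VX[OF _ _ \<sigma>] in blast)
  then have VX: "?V * ?X = ?y * (?V - ?X)"
    by (simp add: LE_mult LE_const LE_diff mer_inverse1 meromorphic_fun_diff)
  have holo: "(?X ^ Suc i * ?U') $$ (-1) = 0" for i
  proof -
    have "LE z (\<lambda>p. inverse (u p - \<sigma>) ^ Suc i) $$ n = 0" if "n < 0" for n
      by (rule holo_at_LE(1)[OF holo_inverse[OF z \<sigma>] that])
    then have 1: "\<And>n. n < 0 \<Longrightarrow> (?X ^ Suc i) $$ n = 0" using LE_power[OF mer_inverse1] by metis
    have 2: "?U' $$ n = 0" if "n < 0" for n
    proof (cases "n = -1")
      case False
      then show ?thesis using that holo_at_LE(1)[OF coordinate_holo[OF u z], of "n + 1"] by simp
    qed simp
    have "fls_subdegree (?X ^ Suc i) \<ge> 0" "fls_subdegree ?U' \<ge> 0"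
      using 1 2 by (auto intro!: fls_subdegree_ge0I)
    then show ?thesis by (intro fls_times_nth_eq0) simp
  qed
  have "LE z (\<lambda>p. inverse (u p - u z) ^ 2) * fls_deriv (LE z (\<lambda>p. inverse (u p - \<sigma>) ^ k)) =
      of_nat k * (- (?V ^ 2 * ?X ^ Suc k * ?U'))"
  proof (cases k)
    case 0
    then show ?thesis by (simp add: LE_const)
  next
    case (Suc j)
    have "fls_deriv (?X ^ k) = of_nat k * ?X ^ j * fls_deriv ?X" unfolding fls_deriv_power Suc by simp
    then show ?thesis
      unfolding LE_power[OF mer_inverse1] LE_inverse_deriv
      by (simp only: Suc power2_eq_square power_Suc mult_minus_left mult_minus_right mult_ac)
  qed
  also have "?V ^ 2 * ?X ^ Suc k * ?U' = ?y ^ Suc k * (?V ^ 2 * ?U') - of_nat (Suc k) * ?y ^ Suc (Suc k) * (?V * ?U')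
      + (\<Sum>i<Suc k. (of_nat (Suc k - i) * ?y ^ Suc (Suc k - i)) * (?X ^ Suc i * ?U'))"
    unfolding fraction_identity[OF VX, of "Suc k"] by (simp add: algebra_simps sum_distrib_left)
  also have "?V ^ 2 * ?U' = - fls_deriv ?V" unfolding LE_inverse_deriv by simp
  finally have *: "LE z (\<lambda>p. inverse (u p - u z) ^ 2) * fls_deriv (LE z (\<lambda>p. inverse (u p - \<sigma>) ^ k)) =
     of_nat k * - (?y ^ Suc k * - fls_deriv ?V - of_nat (Suc k) * ?y ^ Suc (Suc k) * (?V * ?U')
      + (\<Sum>i<Suc k. (of_nat (Suc k - i) * ?y ^ Suc (Suc k - i)) * (?X ^ Suc i * ?U')))" .
  have c: "(of_nat n :: complex fls) = fls_const (of_nat n)" for n by (simp add: fls_of_nat)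
  have p: "?y ^ n = fls_const (inverse (u z - \<sigma>) ^ n)" for n by (simp add: fls_const_power)
  have "(LE z (\<lambda>p. inverse (u p - u z) ^ 2) * fls_deriv (LE z (\<lambda>p. inverse (u p - \<sigma>) ^ k))) $$ (-1) =
      of_nat k * (of_nat (Suc k) * inverse (u z - \<sigma>) ^ Suc (Suc k))"
    unfolding * c p fls_const_mult_const
    by (simp only: fls_mult_const_nth fls_uminus_nth fls_plus_nth fls_minus_nth fls_nth_sum holo
        LE_inverse_residue[OF z] mult.assoc) (simp add: fls_deriv_nth)
  then show ?thesis
    unfolding rlet_def om_elem[OF form mer_inverse mer_inverse] by (simp add: mult_ac)
qed

end

context coord_setup
begin

lemma eps_rlet: "eps_elt u z a = diff u z *\<^sub>C rlet u (u z) 1 a"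
proof -
  have "eps_elt u z a = elem (\<lambda>p. diff u z * inverse (u p - u z) ^ 1) a"
    by (simp add: eps_elt_def elem_def divide_inverse)
  then show ?thesis unfolding elem_scale_left rlet_def elem_scale[OF mer_inverse] .
qed

lemma resop_rlet1:
  assumes z: "z \<noteq> P" and t: "t \<in> free_on (van P \<inter> reg z)"
  shows "eqm (vac_ideal UNIV) (resop form z (rlet u (u z) 1 a) t)
    (gen (rlet u (u z) 1 a) * t + scal (inverse (diff u z)) * iop form u z a t)"
proof -
  interpret iota_setup form P z u by (rule iota_setup[OF z])
  let ?N = "vac_ideal UNIV :: 'g mero free_alg set" and ?r = "rlet u (u z) 1 a" and ?d = "diff u z"
  have d: "?d \<noteq> 0" by (rule coordinate_diff_nonzero[OF u z])
  have 1: "eqm ?N (scal ?d * resop form z ?r t) (resop form z (eps_elt u z a) t)"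
    unfolding eps_rlet by (rule eqm_sym[OF subsp_vac resop_scale[OF form]])
  have 2: "eqm ?N (gen (eps_elt u z a) * t) (scal ?d * gen ?r * t)"
    unfolding eps_rlet by (rule eqm_N_mult[OF gen_scale]) simp
  have "eqm ?N (scal ?d * resop form z ?r t) (scal ?d * gen ?r * t + iop form u z a t)"
    by (rule eqm_trans[OF subsp_vac eqm_trans[OF subsp_vac 1 resop_eps[OF t]]
          eqm_add[OF subsp_vac 2 eqm_refl[OF subsp_vac]]])
  then have "eqm ?N (scal (inverse ?d) * (scal ?d * resop form z ?r t))
      (scal (inverse ?d) * (scal ?d * gen ?r * t + iop form u z a t))"
    by (rule eqm_scal[OF subsp_vac])
  then show ?thesis using d by (simp add: scal_mult_left distrib_left mult.assoc)
qed

text \<open>Squaring a multiple of \<open>pol z\<close> minus its value at \<open>P\<close> gives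
  the principal part and a constant, and constants kill the vacuum.\<close>

lemma pp_rlet2:
  assumes z: "z \<noteq> P"
  shows "eqm (vac_ideal UNIV) (gen (pp z (rlet u (u z) 2 a))) (gen (rlet u (u z) 2 a))"
proof -
  let ?c = "inverse (diff u z)" and ?k = "pol z P"
  let ?x = "(?c ^ 2) *\<^sub>C a" and ?y = "(- (2 * ?c ^ 2 * ?k)) *\<^sub>C a" and ?w = "(?c ^ 2 * ?k ^ 2) *\<^sub>C a"
  have m: "meromorphic_fun (\<lambda>p. e * polk z j p)" for e j by (intro meromorphic_fun_mult) auto
  have "rlet u (u z) 2 a = elem (\<lambda>p. (?c * (pol z p - ?k)) ^ 2) a" by (rule rlet_pol[OF z])
  also have "(\<lambda>p. (?c * (pol z p - ?k)) ^ 2) =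
      (\<lambda>p. (?c ^ 2 * polk z 2 p + (- (2 * ?c ^ 2 * ?k)) * polk z 1 p) + (?c ^ 2 * ?k ^ 2) * 1)"
    by (rule ext) (simp add: power2_eq_square algebra_simps)
  also have "elem \<dots> a = elem (\<lambda>p. ?c ^ 2 * polk z 2 p + (- (2 * ?c ^ 2 * ?k)) * polk z 1 p) a
      + elem (\<lambda>p. (?c ^ 2 * ?k ^ 2) * 1) a"
    by (rule elem_add_left) (intro meromorphic_fun_add m, simp)
  also have "elem (\<lambda>p. ?c ^ 2 * polk z 2 p + (- (2 * ?c ^ 2 * ?k)) * polk z 1 p) a =
      elem (\<lambda>p. ?c ^ 2 * polk z 2 p) a + elem (\<lambda>p. (- (2 * ?c ^ 2 * ?k)) * polk z 1 p) a"
    by (rule elem_add_left[OF m m])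
  finally have r: "rlet u (u z) 2 a = elem (polk z 2) ?x + elem (polk z 1) ?y + const ?w"
    unfolding elem_scale_left const_elem[symmetric] .
  have pp: "pp z (rlet u (u z) 2 a) = elem (polk z 2) ?x + elem (polk z 1) ?y"
    unfolding r pp_add by (simp only: pp_polk pp_reg[OF const_reg] zero_less_numeral zero_less_one add_0_right)
  have "eqm (vac_ideal UNIV) (gen (rlet u (u z) 2 a)) (gen (pp z (rlet u (u z) 2 a)) + gen (const ?w))"
    unfolding pp unfolding r by (rule eqm_vacI[OF gen_add[of _ UNIV]]) auto
  then show ?thesis
    by (rule eqm_sym[OF subsp_vac eqm_add_ideal[OF subsp_vac _ gen_const_vac]])
qed

text \<open>The s-derivative of \<open>resop_rlet1\<close>: the residue operator of a double pole is
  the derivative of the current. In the induction, the bracket with a letter gives a double pole,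
  covered by the induction hypothesis, a simple pole, whose operator is given by \<open>io\<close>,
  and a regular remainder that kills the word.\<close>

lemma resop_rlet2:
  assumes z: "z \<noteq> P" and w: "list_all (valid (u z)) w"
  shows "eqm (vac_ideal UNIV) (resop form z (rlet u (u z) 2 a) (gl u w))
    (gen (rlet u (u z) 2 a) * gl u w + dio form u (u z) w a)"
  using w
proof (induction w arbitrary: a)
  case Nil
  show ?case using pp_rlet2[OF z] by (simp add: resop_1)
next
  case (Cons l w)
  interpret iota_setup form P z u by (rule iota_setup[OF z])
  obtain \<sigma> k x where l: "l = (\<sigma>, k, x)" by (cases l)
  have \<sigma>: "u z \<noteq> \<sigma>" "k > 0" and w: "list_all (valid (u z)) w" using Cons.prems by (auto simp: l)
  let ?N = "vac_ideal UNIV :: 'g mero free_alg set" and ?U = "uea_ideal UNIV :: 'g mero free_alg set"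
  let ?s = "u z" and ?b = "lie a x" and ?l = "rlet u \<sigma> k x"
  let ?y = "inverse (?s - \<sigma>)" and ?W = "gl u w" and ?d = "scal (inverse (diff u z))"
  define B2 where "B2 b = rlet u ?s 2 b" for b :: 'g
  define B1 where "B1 b = rlet u ?s 1 b" for b :: 'g
  define r where "r = (\<Sum>i<k. (of_nat (k - i) * ?y ^ Suc (k - i)) *\<^sub>C rlet u \<sigma> (Suc i) ?b)"
  define gr where "gr = (\<Sum>i<k. scal (of_nat (k - i) * ?y ^ Suc (k - i)) * gen (rlet u \<sigma> (Suc i) ?b))"
  define c1 where "c1 = - (of_nat k * ?y ^ Suc k)"
  define c2 where "c2 = ?y ^ k"
  define o2 where "o2 = (of_nat k * form a x) * of_nat (Suc k) * ?y ^ Suc (Suc k)"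
  note add = eqm_add[OF subsp_vac] and trans = eqm_trans[OF subsp_vac] and refl = eqm_refl[OF subsp_vac]
  have wf: "?W \<in> free_on Hz" by (rule gl_free[OF z w])
  have split: "lie (B2 a) ?l = c2 *\<^sub>C B2 ?b + c1 *\<^sub>C B1 ?b + r"
    unfolding B2_def B1_def r_def c1_def c2_def by (rule lie_rlet2[OF \<sigma>(1)])
  have rr: "r \<in> Hz \<and> eqm Jz (gen r) gr"
    unfolding r_def gr_def
    by (rule gen_linear_sum) (auto simp: van_add reg_add van_scale reg_scale rlet_van rlet_at z \<sigma>)
  have om: "om form z (B2 a) ?l = o2" unfolding B2_def o2_def om_rlet2[OF z \<sigma>(1)] by simp
  have dl: "deio form u ?s a (\<sigma>, k, x) = - gr - scal o2"
    unfolding deio.simps gr_def o2_def by (simp add: scal_minus sum_negf)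
  have IHio: "eqm ?N (?d * iop form u z ?b ?W) (io form u ?s w ?b)"
  proof -
    have "eqm ?N (?d * iop form u z ?b ?W) (?d * (scal (diff u z) * io form u ?s w ?b))"
      by (rule eqm_scal[OF subsp_vac eqm_vacI[OF io_iop[OF z w]]])
    then show ?thesis using coordinate_diff_nonzero[OF u z] by (simp add: scal_mult_left)
  qed
  have B1: "eqm ?N (resop form z (B1 ?b) ?W) (gen (B1 ?b) * ?W + io form u ?s w ?b)"
    unfolding B1_def by (rule trans[OF resop_rlet1[OF z wf] add[OF refl IHio]])
  have lie: "eqm ?N (resop form z (lie (B2 a) ?l) ?W)
      (scal c2 * (gen (B2 ?b) * ?W + dio form u ?s w ?b) + scal c1 * (gen (B1 ?b) * ?W + io form u ?s w ?b))"
  proof -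
    have 1: "eqm ?N (resop form z (lie (B2 a) ?l) ?W) (resop form z (c2 *\<^sub>C B2 ?b + c1 *\<^sub>C B1 ?b) ?W)"
      unfolding split
      by (rule eqm_add_ideal[OF subsp_vac resop_add[OF form] resop_reg[OF form _ free_reg[OF wf]]]) (use rr in blast)
    have 2: "eqm ?N (resop form z (c2 *\<^sub>C B2 ?b) ?W) (scal c2 * (gen (B2 ?b) * ?W + dio form u ?s w ?b))"
      using Cons.IH[OF w, of ?b] unfolding B2_def[symmetric]
      by (rule trans[OF resop_scale[OF form] eqm_scal[OF subsp_vac]])
    have 3: "eqm ?N (resop form z (c1 *\<^sub>C B1 ?b) ?W) (scal c1 * (gen (B1 ?b) * ?W + io form u ?s w ?b))"
      by (rule trans[OF resop_scale[OF form] eqm_scal[OF subsp_vac B1]])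
    show ?thesis by (rule trans[OF 1 trans[OF resop_add[OF form] add[OF 2 3]]])
  qed
  have IH: "eqm ?N (gen ?l * resop form z (B2 a) ?W) (gen ?l * (gen (B2 a) * ?W + dio form u ?s w a))"
    unfolding B2_def by (rule eqm_lmult[OF left_stable_vac _ Cons.IH[OF w]]) simp
  have lhs: "eqm ?N (resop form z (B2 a) (gen ?l * ?W))
      (gen ?l * (gen (B2 a) * ?W + dio form u ?s w a) - scal o2 * ?W
       + (scal c2 * (gen (B2 ?b) * ?W + dio form u ?s w ?b) + scal c1 * (gen (B1 ?b) * ?W + io form u ?s w ?b)))"
    unfolding resop_gen om by (rule add[OF eqm_diff[OF subsp_vac IH refl] lie])
  \<comment> \<open>The regular remainder, dropped in the bracket above, reappears when the double
    pole is brought to the front of the word; this is the origin of the sum in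
    \<open>deio\<close>.\<close>
  have comm: "eqm ?N ((gen (B2 a) * gen ?l - gen ?l * gen (B2 a)) * ?W)
      ((scal c2 * gen (B2 ?b) + scal c1 * gen (B1 ?b) + gr) * ?W)"
  proof (rule eqm_N_mult)
    have g: "eqm ?U (gen (lie (B2 a) ?l)) (gen (c2 *\<^sub>C B2 ?b) + gen (c1 *\<^sub>C B1 ?b) + gen r)"
      unfolding split
      by (rule eqm_trans[OF subsp_uea gen_add eqm_add[OF subsp_uea gen_add eqm_refl[OF subsp_uea]]]) auto
    have g': "eqm ?U (gen (c2 *\<^sub>C B2 ?b) + gen (c1 *\<^sub>C B1 ?b) + gen r)
        (scal c2 * gen (B2 ?b) + scal c1 * gen (B1 ?b) + gr)"
      using rr eqm_mono[OF uea_mono[of Hz UNIV]]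
      by (intro eqm_add[OF subsp_uea] gen_scale) auto
    show "eqm ?U (gen (B2 a) * gen ?l - gen ?l * gen (B2 a)) (scal c2 * gen (B2 ?b) + scal c1 * gen (B1 ?b) + gr)"
      by (rule eqm_trans[OF subsp_uea gen_lie eqm_trans[OF subsp_uea g g']]) auto
  qed
  have dio: "dio form u ?s (l # w) a = gen ?l * dio form u ?s w a + (- gr - scal o2) * ?W
      + (scal c1 * io form u ?s w ?b + scal c2 * dio form u ?s w ?b)"
    unfolding l dio.simps dl c1_def c2_def by simp
  have "gen ?l * (gen (B2 a) * ?W + dio form u ?s w a) - scal o2 * ?W
       + (scal c2 * (gen (B2 ?b) * ?W + dio form u ?s w ?b) + scal c1 * (gen (B1 ?b) * ?W + io form u ?s w ?b))
       - (gen (B2 a) * (gen ?l * ?W) + dio form u ?s (l # w) a) =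
     - ((gen (B2 a) * gen ?l - gen ?l * gen (B2 a)) * ?W - (scal c2 * gen (B2 ?b) + scal c1 * gen (B1 ?b) + gr) * ?W)"
    unfolding dio by (simp add: algebra_simps)
  also have "\<dots> \<in> ?N" using comm by (simp only: eqm_def subsp_minus[OF subsp_vac])
  finally have "eqm ?N (gen ?l * (gen (B2 a) * ?W + dio form u ?s w a) - scal o2 * ?W
       + (scal c2 * (gen (B2 ?b) * ?W + dio form u ?s w ?b) + scal c1 * (gen (B1 ?b) * ?W + io form u ?s w ?b)))
       (gen (B2 a) * (gen ?l * ?W) + dio form u ?s (l # w) a)"
    by (simp only: eqm_def)
  from trans[OF lhs this] show ?case unfolding gl_Cons unfolding l simple_elt.simps B2_def .
qed


subsection \<open>Spanning by words of simple fractions\<close>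

definition simple_sum :: "complex \<Rightarrow> 'g mero \<Rightarrow> bool" where
  "simple_sum s \<nu> \<longleftrightarrow> (\<exists>c ls. list_all (valid s) ls \<and> \<nu> = const c + sum_list (map (simple_elt u) ls))"

lemma simple_sum_add: assumes "simple_sum s \<nu>" "simple_sum s \<mu>" shows "simple_sum s (\<nu> + \<mu>)"
proof -
  obtain c ls d ms where "list_all (valid s) ls" "\<nu> = const c + sum_list (map (simple_elt u) ls)"
    "list_all (valid s) ms" "\<mu> = const d + sum_list (map (simple_elt u) ms)"
    using assms unfolding simple_sum_def by (elim exE conjE)
  then show ?thesis
    unfolding simple_sum_def
    by (intro exI[of _ "c + d"] exI[of _ "ls @ ms"])
      (simp add: const_elem elem_add_right add.assoc add.left_commute)
qed

lemma simple_sum_const: "simple_sum s (const c)"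
  unfolding simple_sum_def by (intro exI[of _ c] exI[of _ "[]"]) simp

lemma simple_sum_rlet: "s \<noteq> \<sigma> \<Longrightarrow> simple_sum s (rlet u \<sigma> k x)"
proof (cases k)
  case 0
  have "rlet u \<sigma> 0 x = const x" by (simp add: rlet_def const_elem)
  then show ?thesis using 0 simple_sum_const by simp
next
  case (Suc j)
  assume "s \<noteq> \<sigma>"
  then show ?thesis
    unfolding simple_sum_def
    by (intro exI[of _ 0] exI[of _ "[(\<sigma>, k, x)]"]) (simp add: Suc const_elem)
qed

lemma simple_sum_sum: "(\<And>i. i \<in> I \<Longrightarrow> simple_sum s (f i)) \<Longrightarrow> simple_sum s (sum f I)"
  using simple_sum_const[of s 0]
  by (induction I rule: infinite_finite_induct) (auto simp: const_elem intro: simple_sum_add)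

lemma simple_sum_polk:
  assumes y: "y \<noteq> P" and s: "s \<noteq> u y" shows "simple_sum s (elem (polk y k) a)"
proof -
  let ?d = "diff u y" and ?X = "\<lambda>p. inverse (u p - u y)"
  let ?c = "\<lambda>j. of_nat (k choose j) * ?d ^ j * pol y P ^ (k - j)"
  have "elem (polk y k) a = elem (\<lambda>p. \<Sum>j\<le>k. ?c j * ?X p ^ j) a"
  proof (rule elem_cong)
    have "polk y k p = (\<Sum>j\<le>k. ?c j * ?X p ^ j)" if "p \<noteq> y" "p \<noteq> P" for p
    proof -
      have "pol y p = ?d * ?X p + pol y P"
        using coordinate_eps[OF u y that] by (simp add: divide_inverse)
      then have "polk y k p = (?d * ?X p + pol y P) ^ k" by simp
      also have "\<dots> = (\<Sum>j\<le>k. of_nat (k choose j) * (?d * ?X p) ^ j * pol y P ^ (k - j))"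
        by (rule binomial_ring)
      finally show ?thesis by (simp add: power_mult_distrib mult_ac)
    qed
    then have "{p. polk y k p \<noteq> (\<Sum>j\<le>k. ?c j * ?X p ^ j)} \<subseteq> {y, P}" by blast
    then show "finite {p. polk y k p \<noteq> (\<Sum>j\<le>k. ?c j * ?X p ^ j)}" by (rule finite_subset) simp
  qed (simp, intro meromorphic_fun_sum meromorphic_fun_mult[OF meromorphic_fun_const mer_inverse])
  also have "\<dots> = (\<Sum>j\<le>k. elem (\<lambda>p. ?c j * ?X p ^ j) a)"
    by (intro elem_sum_left meromorphic_fun_mult[OF meromorphic_fun_const mer_inverse])
  also have "\<dots> = (\<Sum>j\<le>k. rlet u (u y) j (?c j *\<^sub>C a))"
    unfolding rlet_def elem_scale_left ..
  also have "simple_sum s \<dots>"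
    by (intro simple_sum_sum simple_sum_rlet s)
  finally show ?thesis .
qed

text \<open>Regularity removes the terms at \<open>z\<close> and \<open>P\<close> from the partial
  fractions, and each remaining power of \<open>pol y\<close> is expanded binomially in 1/(u -
  u(y)). All simple fractions vanish at \<open>P\<close>, and so does the map, which forces the
  constant to be zero.\<close>

lemma simple_span:
  fixes \<nu> :: "'g mero"
  assumes z: "z \<noteq> P" and \<nu>: "\<nu> \<in> van P \<inter> reg z"
  obtains ls where "list_all (valid (u z)) ls" "\<nu> = sum_list (map (simple_elt u) ls)"
proof -
  obtain c S M where "finite S" and *: "\<nu> = const c + (\<Sum>y\<in>S. \<Sum>k=1..M. elem (polk y k) (lc y (- int k) \<nu>))"
    by (rule mero_partial_fractions[of \<nu>])
  have "simple_sum (u z) (elem (polk y k) (lc y (- int k) \<nu>))" if "k \<in> {1..M}" for y k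
  proof (cases "y = P \<or> y = z")
    case True
    moreover have "\<nu> \<in> reg P" "\<nu> \<in> reg z" using \<nu> by (auto intro: van_reg)
    ultimately have "lc y (- int k) \<nu> = 0" using that by (auto intro: lc_reg)
    then show ?thesis using simple_sum_const[of _ 0] by (simp add: const_elem)
  next
    case False
    then have "u z \<noteq> u y" using coordinate_inj[OF u z, of y] by auto
    then show ?thesis using False by (intro simple_sum_polk) auto
  qed
  then have "simple_sum (u z) (const c + (\<Sum>y\<in>S. \<Sum>k=1..M. elem (polk y k) (lc y (- int k) \<nu>)))"
    by (intro simple_sum_add simple_sum_const simple_sum_sum)
  then have "simple_sum (u z) \<nu>" using * by simp
  then obtain c' ls where ls: "list_all (valid (u z)) ls" and \<nu>': "\<nu> = const c' + sum_list (map (simple_elt u) ls)"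
    unfolding simple_sum_def by (elim exE conjE)
  have "sum_list (map (simple_elt u) ls) \<in> van P"
    using ls valid_simple[OF z] by (induction ls) (auto intro: van_add)
  then have "ev P (const c' + sum_list (map (simple_elt u) ls)) = c'"
    by (simp add: ev_add van_reg van_ev)
  then have "c' = 0" using \<nu> van_ev[of \<nu> P] \<nu>' by simp
  then have "\<nu> = sum_list (map (simple_elt u) ls)" using \<nu>' by (simp add: const_elem)
  with ls show ?thesis by (rule that)
qed

text \<open>To regard \<iota> on a vector as a function of z, one representative must be fixed while
  z moves. A formal combination of words of simple fractions is such a representative for all z off
  the poles of its letters.\<close>

type_synonym 'h combo = "(complex \<times> 'h simple list) list"

definition comb :: "'g combo \<Rightarrow> 'g mero free_alg" where
  "comb ls = sum_list (map (\<lambda>(c, w). scal c * gl u w) ls)"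

definition valid_combo :: "complex \<Rightarrow> 'g combo \<Rightarrow> bool" where
  "valid_combo s ls \<longleftrightarrow> list_all (\<lambda>(c, w). list_all (valid s) w) ls"

lemma comb_Nil [simp]: "comb [] = 0"
  and comb_Cons: "comb ((c, w) # ls) = scal c * gl u w + comb ls"
  and comb_append: "comb (ls @ ms) = comb ls + comb ms"
  by (simp_all add: comb_def)

lemma valid_combo_simps [simp]: "valid_combo s []"
  "valid_combo s ((c, w) # ls) \<longleftrightarrow> list_all (valid s) w \<and> valid_combo s ls"
  "valid_combo s (ls @ ms) \<longleftrightarrow> valid_combo s ls \<and> valid_combo s ms"
  by (simp_all add: valid_combo_def)

definition cons_combo :: "'g simple \<Rightarrow> 'g combo \<Rightarrow> 'g combo" where
  "cons_combo l ls = map (\<lambda>(c, w). (c, l # w)) ls"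

lemma comb_cons: "comb (cons_combo l ls) = gen (simple_elt u l) * comb ls"
  unfolding cons_combo_def by (induction ls) (auto simp: comb_Cons gl_Cons distrib_left mult_scal_left)

lemma valid_cons: "valid s l \<Longrightarrow> valid_combo s ls \<Longrightarrow> valid_combo s (cons_combo l ls)"
  unfolding cons_combo_def valid_combo_def by (auto simp: list_all_iff)

lemma comb_scal: "comb (map (\<lambda>(c, w). (d * c, w)) ls) = scal d * comb ls"
  by (induction ls) (auto simp: comb_Cons distrib_left scal_mult_left)

lemma valid_scal: "valid_combo s (map (\<lambda>(c, w). (d * c, w)) ls) \<longleftrightarrow> valid_combo s ls"
  unfolding valid_combo_def by (auto simp: list_all_iff)

lemma comb_free: "z \<noteq> P \<Longrightarrow> valid_combo (u z) ls \<Longrightarrow> comb ls \<in> free_on (van P \<inter> reg z)"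
  by (induction ls) (auto simp: comb_Cons intro!: free_on_add free_on_mult gl_free)

lemma combo_exists:
  assumes z: "z \<noteq> P" and t: "t \<in> free_on (van P \<inter> reg z)"
  obtains ls where "valid_combo (u z) ls" "eqm (uea_ideal (van P \<inter> reg z)) t (comb ls)"
proof -
  let ?H = "van P \<inter> reg z :: 'g mero set"
  let ?J = "uea_ideal ?H"
  let ?ok = "\<lambda>t. \<exists>ls. valid_combo (u z) ls \<and> eqm ?J t (comb ls)"
  have ok_add: "?ok (s + t)" if s: "?ok s" and t: "?ok t" for s t
  proof -
    obtain ls where "valid_combo (u z) ls" "eqm ?J s (comb ls)" using s by (elim exE conjE)
    moreover obtain ms where "valid_combo (u z) ms" "eqm ?J t (comb ms)" using t by (elim exE conjE)
    ultimately show ?thesis by (intro exI[of _ "ls @ ms"]) (simp add: comb_append eqm_add)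
  qed
  have ok_eqm: "?ok s" if st: "eqm ?J s t" and t: "?ok t" for s t
  proof -
    obtain ls where "valid_combo (u z) ls" "eqm ?J t (comb ls)" using t by (elim exE conjE)
    then show ?thesis using eqm_trans[OF subsp_uea st] by (intro exI[of _ ls]) simp
  qed
  have ok_gen: "?ok (gen (simple_elt u l) * t)" if l: "valid (u z) l" and t: "?ok t" for l t
  proof -
    obtain ls where "valid_combo (u z) ls" "eqm ?J t (comb ls)" using t by (elim exE conjE)
    then show ?thesis using l
      by (intro exI[of _ "cons_combo l ls"])
        (simp add: valid_cons comb_cons eqm_lmult[OF left_stable_uea free_on_gen[OF valid_simple[OF z l]]])
  qed
  have ok_sum: "?ok (gen (sum_list (map (simple_elt u) ls)) * t)"
    if "list_all (valid (u z)) ls" "?ok t" and tf: "t \<in> free_on ?H" for ls t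
    using that(1)
  proof (induction ls)
    case Nil
    have "eqm ?J (gen 0 * t) 0"
      using uea_rmult[OF gen_zero[of ?H] tf] by (simp add: eqm_def)
    moreover have "?ok 0" by (intro exI[of _ "[]"]) (simp add: eqm_refl)
    ultimately show ?case using ok_eqm by simp
  next
    case (Cons l ls)
    have "valid (u z) l" using Cons.prems by simp
    then have l: "simple_elt u l \<in> ?H" by (rule valid_simple[OF z])
    have s: "sum_list (map (simple_elt u) ls) \<in> ?H"
    proof -
      have "list_all (valid (u z)) ls" using Cons.prems by simp
      then show ?thesis using valid_simple[OF z] by (induction ls) (auto intro: van_add reg_add)
    qed
    have "eqm ?J (gen (simple_elt u l + sum_list (map (simple_elt u) ls)) * t)
        ((gen (simple_elt u l) + gen (sum_list (map (simple_elt u) ls))) * t)"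
      by (rule eqm_rmult_uea[OF gen_add[OF l s] tf])
    moreover have "?ok ((gen (simple_elt u l) + gen (sum_list (map (simple_elt u) ls))) * t)"
      unfolding distrib_right using Cons \<open>?ok t\<close> by (intro ok_add ok_gen) auto
    ultimately show ?case using ok_eqm by simp
  qed
  have ok_word: "?ok (gens w)" if "set w \<subseteq> ?H" for w
    using that
  proof (induction w)
    case Nil
    show ?case by (intro exI[of _ "[(1, [])]"]) (simp add: comb_Cons eqm_refl)
  next
    case (Cons \<alpha> w)
    then have "\<alpha> \<in> ?H" by simp
    then obtain ls where ls: "list_all (valid (u z)) ls" "\<alpha> = sum_list (map (simple_elt u) ls)"
      by (rule simple_span[OF z])
    have "?ok (gens w)" "gens w \<in> free_on ?H" using Cons by (auto intro: free_on_gens)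
    then show ?case unfolding gens_Cons ls(2) by (rule ok_sum[OF ls(1)])
  qed
  have "?ok t"
    using t
  proof (induction rule: free_on_induct)
    case (word c w)
    obtain ls where "valid_combo (u z) ls" "eqm ?J (gens w) (comb ls)" using ok_word[OF word] by (elim exE conjE)
    then show ?case
      by (intro exI[of _ "map (\<lambda>(d, w). (c * d, w)) ls"]) (simp add: valid_scal comb_scal eqm_scal)
  qed (rule ok_add)
  then show ?thesis using that by (elim exE conjE)
qed

definition Io :: "complex \<Rightarrow> 'g combo \<Rightarrow> 'g \<Rightarrow> 'g mero free_alg" where
  "Io s ls a = sum_list (map (\<lambda>(c, w). scal c * io form u s w a) ls)"

definition Dio :: "complex \<Rightarrow> 'g combo \<Rightarrow> 'g \<Rightarrow> 'g mero free_alg" where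
  "Dio s ls a = sum_list (map (\<lambda>(c, w). scal c * dio form u s w a) ls)"

lemma Io_simps: "Io s [] a = 0" "Io s ((c, w) # ls) a = scal c * io form u s w a + Io s ls a"
  and Dio_simps: "Dio s [] a = 0" "Dio s ((c, w) # ls) a = scal c * dio form u s w a + Dio s ls a"
  by (simp_all add: Io_def Dio_def)

lemma Io_iop:
  assumes z: "z \<noteq> P" and "valid_combo (u z) ls"
  shows "eqm (uea_ideal (van P \<inter> reg z)) (iop form u z a (comb ls)) (scal (diff u z) * Io (u z) ls a)"
  using assms(2)
proof (induction ls)
  case (Cons x ls)
  obtain c w where x: "x = (c, w)" by (cases x)
  have "eqm (uea_ideal (van P \<inter> reg z)) (scal c * iop form u z a (gl u w)) (scal c * (scal (diff u z) * io form u (u z) w a))"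
    using Cons.prems by (intro eqm_scal[OF subsp_uea] io_iop[OF z]) (simp add: x)
  from eqm_add[OF subsp_uea this Cons.IH] show ?case
    using Cons.prems
    by (simp add: x comb_Cons Io_simps iop_add iop_scal distrib_left scal_mult_left mult.commute)
qed (simp add: iop_0 Io_simps eqm_refl)

lemma dfam_Io: "valid_combo s1 ls \<Longrightarrow> dfam P u s1 (\<lambda>s. Io s ls a) (Dio s1 ls a)"
proof (induction ls)
  case Nil
  show ?case by (simp add: Io_simps Dio_simps dfam_const ratfam_0)
next
  case (Cons x ls)
  obtain c w where x: "x = (c, w)" by (cases x)
  show ?case
    unfolding x Io_simps Dio_simps
    using Cons by (intro dfam_add dfam_mult_const(1)[OF dfam_io ratfam_scal]) (auto simp: x)
qed

lemma resop_Dio: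
  assumes z: "z \<noteq> P" and "valid_combo (u z) ls"
  shows "eqm (vac_ideal UNIV) (resop form z (rlet u (u z) 2 a) (comb ls))
    (gen (rlet u (u z) 2 a) * comb ls + Dio (u z) ls a)"
  using assms(2)
proof (induction ls)
  case (Cons x ls)
  obtain c w where x: "x = (c, w)" by (cases x)
  have "eqm (vac_ideal UNIV) (scal c * resop form z (rlet u (u z) 2 a) (gl u w))
      (scal c * (gen (rlet u (u z) 2 a) * gl u w + dio form u (u z) w a))"
    using Cons.prems by (intro eqm_scal[OF subsp_vac] resop_rlet2[OF z]) (simp add: x)
  from eqm_add[OF subsp_vac this Cons.IH] show ?case
    using Cons.prems
    by (simp add: x comb_Cons Dio_simps resop_sum resop_scal distrib_left mult_scal_left add_ac)
qed (simp add: resop_0 Dio_simps eqm_refl)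

end

section \<open>The limit\<close>

text \<open>By \<open>coordinate_eps\<close> the product is -du(z1) du(z)/(u(z1) - u(z))^2 for a
  coordinate with pole at \<open>P\<close>. This bidifferential is invariant under projective
  changes of coordinate.\<close>

lemma pol_product:
  assumes "z \<noteq> z1" "z \<noteq> P" "z \<noteq> Q" "z1 \<noteq> P" "z1 \<noteq> Q"
  shows "(pol z1 z - pol z1 P) * (pol z z1 - pol z P) = (pol z1 z - pol z1 Q) * (pol z z1 - pol z Q)"
proof -
  \<comment> \<open>The common value, independent of \<open>P\<close>: minus the bidifferential in
    the local coordinates of the two points, which equals 1 as soon as one of them is
    \<open>Infty\<close>.\<close>
  have "(pol z1 z - pol z1 P) * (pol z z1 - pol z P) =
      (case (z, z1) of (Fin a, Fin b) \<Rightarrow> - inverse ((a - b) ^ 2) | _ \<Rightarrow> 1)"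
    if "z \<noteq> P" "z1 \<noteq> P" for P
  proof (cases z; cases z1; cases P)
    fix a b c assume *: "z = Fin a" "z1 = Fin b" "P = Fin c"
    then have "a \<noteq> b" "a \<noteq> c" "b \<noteq> c" using assms(1) that by auto
    then show ?thesis
      unfolding * by (simp add: divide_simps power2_eq_square)
  next
    fix a b assume *: "z = Fin a" "z1 = Fin b" "P = Infty"
    then have "a \<noteq> b" using assms(1) by auto
    then show ?thesis
      unfolding * by (simp add: divide_simps power2_eq_square)
  qed (use assms that in \<open>auto simp: divide_simps\<close>)
  then show ?thesis using assms by metis
qed

text \<open>The bidifferential does not change, whereas du/(u - u(z1)) changes by a correction
  regular at \<open>z1\<close>. The quotient by du(z) of that correction has the value \<kappa> /
  \<open>diff u z1\<close> there.\<close>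

lemma coordinate_change:
  assumes u: "coordinate P u" and w: "coordinate Q w"
    and z: "z \<noteq> z1" "z \<noteq> P" "z \<noteq> Q" "z1 \<noteq> P" "z1 \<noteq> Q"
  defines "\<kappa> \<equiv> pol z1 P - pol z1 Q"
  shows "diff w z1 * diff w z / (w z1 - w z)\<^sup>2 = diff u z1 * diff u z / (u z1 - u z)\<^sup>2"
    and "1 / (w z - w z1) * diff w z =
      diff u z * (1 / (u z - u z1) - \<kappa> / (diff u z1 + \<kappa> * (u z - u z1)))"
proof -
  have ne: "u z \<noteq> u z1" "w z \<noteq> w z1"
    using coordinate_inj[OF u, of z z1] coordinate_inj[OF w, of z z1] z by auto
  define p p' q q' where "p = pol z1 z - pol z1 P" and "p' = pol z z1 - pol z P"
    and "q = pol z1 z - pol z1 Q" and "q' = pol z z1 - pol z Q"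
  have pq: "p * p' = q * q'" unfolding p_def p'_def q_def q'_def using z by (rule pol_product)
  have U: "diff u z1 = p * (u z - u z1)" "diff u z = - p' * (u z - u z1)"
    using coordinate_eps[OF u z(4) z(1) z(2)] coordinate_eps[OF u z(2) z(1)[symmetric] z(4)] ne
    by (auto simp: p_def p'_def divide_simps) (simp add: algebra_simps)
  have W: "diff w z1 = q * (w z - w z1)" "diff w z = - q' * (w z - w z1)"
    using coordinate_eps[OF w z(5) z(1) z(3)] coordinate_eps[OF w z(3) z(1)[symmetric] z(5)] ne
    by (auto simp: q_def q'_def divide_simps) (simp add: algebra_simps)
  have nz: "p \<noteq> 0" "q \<noteq> 0"
    using coordinate_diff_nonzero[OF u z(4)] coordinate_diff_nonzero[OF w z(5)] U W by auto
  \<comment> \<open>The same pole at \<open>z1\<close>, normalised to vanish at \<open>P\<close> or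
    at \<open>Q\<close>, differs by \<kappa>; the invariant product then determines q' from p, p'
    and q.\<close>
  have "\<kappa> = q - p" unfolding \<kappa>_def p_def q_def by simp
  then have k: "diff u z1 + \<kappa> * (u z - u z1) = q * (u z - u z1)"
    unfolding U(1) by (simp add: left_diff_distrib)
  have sq: "a * y * (- b * y) / (- y)\<^sup>2 = - (a * b)" if "y \<noteq> 0" for a b y :: complex
    using that by (simp add: power2_eq_square)
  have "diff u z1 * diff u z / (u z1 - u z)\<^sup>2 = - (p * p')"
    unfolding U using sq[of "u z - u z1" p p'] ne by simp
  moreover have "diff w z1 * diff w z / (w z1 - w z)\<^sup>2 = - (q * q')"
    unfolding W using sq[of "w z - w z1" q q'] ne by simp
  ultimately show "diff w z1 * diff w z / (w z1 - w z)\<^sup>2 = diff u z1 * diff u z / (u z1 - u z)\<^sup>2"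
    using pq by simp
  have "1 / (w z - w z1) * diff w z = - q'" unfolding W using ne by simp
  also have "\<dots> = - (p * p' / q)" using pq nz by simp
  also have "\<dots> = diff u z * (1 / (u z - u z1) - \<kappa> / (diff u z1 + \<kappa> * (u z - u z1)))"
    unfolding k unfolding U(2) \<open>\<kappa> = q - p\<close> using ne nz by (simp add: divide_simps) (simp add: algebra_simps)?
  finally show "1 / (w z - w z1) * diff w z =
      diff u z * (1 / (u z - u z1) - \<kappa> / (diff u z1 + \<kappa> * (u z - u z1)))" .
qed

lemma om_const:
  assumes form: "invariant_form form" shows "om form z (const b) \<alpha> = 0"
proof -
  have "lc z n (const b) = 0" if "n \<noteq> 0" for n
    using that by (simp add: const_elem lc_elem LE_const)
  then have "of_int n * form (lc z (- n) (const b)) (lc z n \<alpha>) = 0" for n :: int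
    by (cases "n = 0") (auto simp: form_zero[OF form])
  then show ?thesis unfolding om_def[OF form] by (simp only: Sum_any.neutral)
qed

lemma tends_toI:
  assumes "ratfam P u (u z1) F" "\<delta> > 0"
    and "\<And>z. z \<noteq> P \<Longrightarrow> z \<noteq> z1 \<Longrightarrow> dist (u z) (u z1) < \<delta> \<Longrightarrow> E z (F (u z) +o uea_ideal (van P))"
  shows "tends_to P u z1 E (F (u z1) +o uea_ideal (van P))"
proof -
  obtain R \<delta>' where R: "no_pole_at (u z1) R" "\<delta>' > 0"
    "\<And>s. dist s (u z1) < \<delta>' \<Longrightarrow> family_at u s R = F s"
    "\<And>s. dist s (u z1) < \<delta>' \<Longrightarrow> F s \<in> free_on (van P)"
    by (rule ratfamE[OF assms(1)]) blast
  show ?thesis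
    unfolding tends_to_def Let_def
  proof (intro exI[of _ R] exI[of _ "min \<delta> \<delta>'"] conjI allI impI)
    fix z assume "z \<noteq> P \<and> z \<noteq> z1 \<and> dist (u z) (u z1) < min \<delta> \<delta>'"
    then show "family_at u (u z) R \<in> free_on (van P)" "E z (family_at u (u z) R +o uea_ideal (van P))"
      using R(3,4)[of "u z"] assms(3)[of z] by auto
  qed (use R(1,2) R(3,4)[of "u z1"] assms(2) in auto)
qed

text \<open>The parameter is frozen by replacing every polynomial in s by the constant polynomial of
  its value at \<open>s1\<close>. This is needed for the current of [v2, v1], which stays at z1
  while z2 moves.\<close>

lemma ratfam_const_at:
  assumes "ratfam P u s1 F" shows "ratfam P u s1 (\<lambda>s. F s1)"
proof -
  obtain R \<delta> where R: "no_pole_at s1 R" "\<delta> > 0"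
    "\<And>s. dist s s1 < \<delta> \<Longrightarrow> family_at u s R = F s" "\<And>s. dist s s1 < \<delta> \<Longrightarrow> F s \<in> free_on (van P)"
    by (rule ratfamE[OF assms]) blast
  define h where "h = (\<lambda>(p :: complex poly poly, q :: complex poly poly, x :: 'a). ([:poly p [:s1:]:], [:poly q [:s1:]:], x))"
  define H where "H = (\<lambda>(c, d, ls). ([:poly c s1:], [:poly d s1:], map h ls))"
  have h: "letter_at u s (h l) = letter_at u s1 l" for s l
    by (cases l) (simp add: h_def)
  have "family_at u s (map H R) = family_at u s1 R" for s
    unfolding family_at_def map_map
    by (rule arg_cong[of _ _ sum_list], rule map_cong[OF refl])
      (auto simp: H_def comp_def h)
  moreover have "no_pole_at s1 (map H R)"
    using R(1) by (fastforce simp: no_pole_at_def H_def h_def)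
  ultimately show ?thesis
    using R(2) R(3,4)[of s1] by (intro ratfamI[of _ "map H R" 1]) auto
qed

text \<open>The cancellation of singular terms, with r = s - s1 and y its inverse. On the right the
  terms with y^2 and with y(e + i1) are removed by the subtraction, r y = 1 lets the divided
  difference g survive, and k carries the change of coordinate.\<close>

lemma product_algebra:
  assumes "r * y = 1"
  shows "scal (d1 * dz) * (a1 + a2 + a3 + g + scal k * (e + i1)) =
    scal d1 * (scal dz * (a1 + (a2 + (scal y * e + scal (f * y\<^sup>2) * t) + scal y * (i1 + scal r * g) + a3)))
    - scal (f * (d1 * dz * y\<^sup>2)) * t - scal (dz * (y - k)) * (scal d1 * (e + i1))"
proof -
  have *: "d1 * (dz * (r * y)) = d1 * dz" using assms by simp
  then show ?thesis
    by (simp add: distrib_left scal_mult_left right_diff_distrib left_diff_distrib scal_diff mult_ac *)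
qed

context coord_setup
begin

abbreviation ehat :: "complex \<Rightarrow> 'g \<Rightarrow> 'g mero free_alg" where
  "ehat s a \<equiv> gen (rlet u s 1 a)"

lemma Io_append: "Io s (ls @ ms) a = Io s ls a + Io s ms a"
  by (simp add: Io_def)

lemma Io_cons: "Io s (cons_combo (\<sigma>, k, x) ls) a = gen (rlet u \<sigma> k x) * Io s ls a
    + eio form u s a (\<sigma>, k, x) * comb ls + scal (inverse (s - \<sigma>) ^ k) * Io s ls (lie a x)"
proof (induction ls)
  case (Cons y ls)
  obtain c w where y: "y = (c, w)" by (cases y)
  have "Io s (cons_combo (\<sigma>, k, x) (y # ls)) a =
      scal c * io form u s ((\<sigma>, k, x) # w) a + Io s (cons_combo (\<sigma>, k, x) ls) a"
    by (simp add: y cons_combo_def Io_simps del: io.simps)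
  then show ?case
    unfolding Cons io.simps y Io_simps comb_Cons
    by (simp add: distrib_left mult_scal_left[of "gen _" c] mult_scal_left[of "eio _ _ _ _ _" c]
        scal_mult_left mult.commute[of c] add_ac mult.assoc del: eio.simps)
qed (simp add: cons_combo_def Io_simps)

lemma eventually_valid_combo:
  assumes "valid_combo s1 ls" obtains \<delta> where "\<delta> > 0" "\<And>s. dist s s1 < \<delta> \<Longrightarrow> valid_combo s ls"
proof -
  have v: "eventually (\<lambda>s. valid s l) (nhds s1)" if "valid s1 l" for l :: "'g simple"
  proof (cases l)
    case (fields \<sigma> k x)
    then have "eventually (\<lambda>s. s \<noteq> \<sigma>) (nhds s1)" using that by (intro t1_space_nhds) auto
    then show ?thesis using that fields by (auto elim: eventually_mono)
  qed
  have w: "eventually (\<lambda>s. list_all (valid s) w) (nhds s1)" if "list_all (valid s1) w" for w :: "'g simple list"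
    using that by (induction w) (auto intro: eventually_conj v)
  have "eventually (\<lambda>s. valid_combo s ls) (nhds s1)"
    using assms
  proof (induction ls)
    case (Cons x ls)
    obtain c v where x: "x = (c, v)" by (cases x)
    show ?case using Cons by (auto simp: x intro: eventually_conj w)
  qed simp
  then show ?thesis using that unfolding eventually_nhds_metric by blast
qed

lemma resop_comb:
  assumes z: "z \<noteq> P" and ls: "valid_combo (u z) ls"
  shows "eqm (vac_ideal UNIV) (resop form z (eps_elt u z a) (comb ls))
    (scal (diff u z) * (ehat (u z) a * comb ls + Io (u z) ls a))"
proof -
  interpret iota_setup form P z u by (rule iota_setup[OF z])
  let ?N = "vac_ideal UNIV :: 'g mero free_alg set"
  have "eqm ?N (gen (eps_elt u z a) * comb ls) (scal (diff u z) * ehat (u z) a * comb ls)"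
    unfolding eps_rlet by (rule eqm_N_mult[OF gen_scale]) simp
  from eqm_trans[OF subsp_vac resop_eps[OF comb_free[OF z ls]]
      eqm_add[OF subsp_vac this eqm_vacI[OF Io_iop[OF z ls]]]]
  show ?thesis by (simp add: distrib_left mult.assoc)
qed

lemma resop_pol_comb:
  assumes z: "z \<noteq> P" and ls: "valid_combo (u z) ls"
  shows "eqm (vac_ideal UNIV) (resop form z (elem (pol z) a) (comb ls))
    (scal (diff u z) * (ehat (u z) a * comb ls + Io (u z) ls a))"
proof -
  interpret iota_setup form P z u by (rule iota_setup[OF z])
  show ?thesis
    by (rule eqm_trans[OF subsp_vac resop_pol_eps[OF free_reg[OF comb_free[OF z ls]]] resop_comb[OF z ls]])
qed

text \<open>V dV is half of d(V^2), and an exact form has no residue.\<close>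

lemma om_rlet1:
  assumes z: "z \<noteq> P" shows "om form z (rlet u s 1 a) (rlet u s 1 b) = 0"
proof -
  let ?V = "LE z (\<lambda>p. inverse (u p - s))"
  have "fls_deriv (?V ^ 2) = of_nat 2 * (?V * fls_deriv ?V)"
    by (simp add: power2_eq_square)
  then have "2 * (?V * fls_deriv ?V) $$ (-1) = fls_deriv (?V ^ 2) $$ (-1)"
    by (simp add: fls_of_nat numeral_2_eq_2)
  also have "\<dots> = 0" by simp
  finally show ?thesis
    using om_elem[OF form mer_inverse1 mer_inverse1, of z s a s b] by (simp add: rlet_def)
qed

lemma ratfam_comb: "valid_combo s1 ls \<Longrightarrow> ratfam P u s1 (\<lambda>s. comb ls)"
proof (induction ls)
  case (Cons x ls)
  obtain c w where x: "x = (c, w)" by (cases x)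
  show ?case using Cons unfolding x comb_Cons by (intro ratfam_add ratfam_mult ratfam_scal ratfam_gl) auto
qed (simp add: ratfam_0)

lemma lie_eps_rlet: "lie (eps_elt u z a) (rlet u (u z) 1 b) = diff u z *\<^sub>C rlet u (u z) 2 (lie a b)"
  unfolding eps_rlet lie_cscale_left lie_rlet by (simp add: rlet_def power2_eq_square)

lemma gen_rlet2:
  "eqm (vac_ideal UNIV) (gen (rlet u s 2 (lie a b)) * t) (ehat s a * (ehat s b * t) - ehat s b * (ehat s a * t))"
proof -
  have "lie (rlet u s 1 a) (rlet u s 1 b) = rlet u s 2 (lie a b)"
    unfolding lie_rlet by (simp add: rlet_def power2_eq_square)
  then have "eqm (uea_ideal UNIV) (ehat s a * ehat s b - ehat s b * ehat s a) (gen (rlet u s 2 (lie a b)))"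
    using gen_lie[of "rlet u s 1 a" UNIV "rlet u s 1 b"] by simp
  then have "eqm (vac_ideal UNIV) (ehat s a * ehat s b * t - ehat s b * ehat s a * t) (gen (rlet u s 2 (lie a b)) * t)"
    unfolding left_diff_distrib[symmetric] by (rule eqm_vacI[OF eqm_rmult_uea]) simp
  then show ?thesis unfolding mult.assoc by (rule eqm_sym[OF subsp_vac])
qed

text \<open>The operator of a constant kills \<open>comb ls\<close> and \<open>comb ms\<close>,
  which are regular at \<open>z\<close>. Only its bracket with the one singular letter survives, a
  simple pole with coefficient [a, b], and the operator of that pole is the current.\<close>

lemma resop_const_comb:
  assumes z: "z \<noteq> P" and ls: "valid_combo (u z) ls" and ms: "valid_combo (u z) ms"
  shows "eqm (vac_ideal UNIV)
    (resop form z (const a) (scal (diff u z) * (ehat (u z) b * comb ls + comb ms)))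
    (scal (diff u z) * (ehat (u z) (lie a b) * comb ls + Io (u z) ls (lie a b)))"
proof -
  interpret iota_setup form P z u by (rule iota_setup[OF z])
  let ?N = "vac_ideal UNIV :: 'g mero free_alg set" and ?t = "comb ls" and ?e = "rlet u (u z) 1 b"
  let ?A = "resop form z (const a)" and ?r = "rlet u (u z) 1 (lie a b)"
  note fr = free_reg[OF comb_free[OF z]]
  have t: "?A ?t \<in> ?N" "?A (comb ms) \<in> ?N"
    by (rule resop_reg[OF form const_reg fr[OF ls]], rule resop_reg[OF form const_reg fr[OF ms]])
  have lie: "lie (const a) ?e = ?r"
    unfolding const_elem rlet_def by (simp add: elem_lie mer_inverse1)
  have 1: "?A (scal (diff u z) * (gen ?e * ?t + comb ms)) =
      scal (diff u z) * resop form z ?r ?t + scal (diff u z) * (gen ?e * ?A ?t + ?A (comb ms))"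
    unfolding resop_scal resop_sum resop_gen om_const[OF form] lie by (simp add: distrib_left)
  have 2: "scal (diff u z) * (gen ?e * ?A ?t + ?A (comb ms)) \<in> ?N"
    by (intro subsp_scal[OF subsp_vac] subsp_add[OF subsp_vac] vac_lmult[OF form] t)
  have 3: "eqm ?N (?A (scal (diff u z) * (gen ?e * ?t + comb ms))) (scal (diff u z) * resop form z ?r ?t)"
    unfolding eqm_def 1 using 2 by simp
  have 4: "eqm ?N (scal (diff u z) * resop form z ?r ?t) (resop form z (eps_elt u z (lie a b)) ?t)"
    unfolding eps_rlet by (rule eqm_sym[OF subsp_vac resop_scale[OF form]])
  show ?thesis
    by (rule eqm_trans[OF subsp_vac 3 eqm_trans[OF subsp_vac 4 resop_comb[OF z ls]]])
qed

text \<open>The coefficient of \<open>du\<^sup>2\<close> in the right hand side of the limit formula.\<close>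

definition lim_value :: "complex \<Rightarrow> 'g combo \<Rightarrow> 'g combo \<Rightarrow> 'g \<Rightarrow> 'g \<Rightarrow> 'g mero free_alg" where
  "lim_value s ls ms a b = ehat s a * (ehat s b * comb ls + comb ms) + ehat s b * Io s ls a
     + Io s ms a + Dio s ls (lie a b)"

text \<open>Passing the singular letter costs no residue, by exactness, but gives a double pole with
  coefficient [a, b], the source of the derivative. Its letter is the commutator of the two
  \<epsilon> elements and exchanges their order, so that \<epsilon> of a ends up in front.\<close>

lemma resop_eps_comb:
  assumes z: "z \<noteq> P" and ls: "valid_combo (u z) ls" and ms: "valid_combo (u z) ms"
  shows "eqm (vac_ideal UNIV)
    (resop form z (eps_elt u z a) (scal (diff u z) * (ehat (u z) b * comb ls + comb ms)))
    (scal ((diff u z)\<^sup>2) * lim_value (u z) ls ms a b)"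
proof -
  interpret iota_setup form P z u by (rule iota_setup[OF z])
  let ?N = "vac_ideal UNIV :: 'g mero free_alg set" and ?t = "comb ls" and ?s = "u z" and ?d = "scal (diff u z)"
  let ?A = "resop form z (eps_elt u z a)" and ?b = "lie a b"
  note add = eqm_add[OF subsp_vac] and trans = eqm_trans[OF subsp_vac] and refl = eqm_refl[OF subsp_vac]
  have om: "om form z (eps_elt u z a) (rlet u ?s 1 b) = 0"
    unfolding eps_rlet om_scale_left[OF form] om_rlet1[OF z] by simp
  have 1: "eqm ?N (ehat ?s b * ?A ?t) (ehat ?s b * (?d * (ehat ?s a * ?t + Io ?s ls a)))"
    by (rule eqm_lmult[OF left_stable_vac _ resop_comb[OF z ls]]) simp
  have 2: "eqm ?N (resop form z (diff u z *\<^sub>C rlet u ?s 2 ?b) ?t)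
      (?d * ((ehat ?s a * (ehat ?s b * ?t) - ehat ?s b * (ehat ?s a * ?t)) + Dio ?s ls ?b))"
    by (rule trans[OF resop_scale[OF form] eqm_scal[OF subsp_vac trans[OF resop_Dio[OF z ls] add[OF gen_rlet2 refl]]]])
  have eq: "?A (gen (rlet u ?s 1 b) * ?t + comb ms) =
      ehat ?s b * ?A ?t + resop form z (diff u z *\<^sub>C rlet u ?s 2 ?b) ?t + ?A (comb ms)"
    unfolding resop_sum resop_gen om lie_eps_rlet by simp
  have 3: "eqm ?N (?A (gen (rlet u ?s 1 b) * ?t + comb ms))
      (ehat ?s b * (?d * (ehat ?s a * ?t + Io ?s ls a))
       + ?d * ((ehat ?s a * (ehat ?s b * ?t) - ehat ?s b * (ehat ?s a * ?t)) + Dio ?s ls ?b)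
       + ?d * (ehat ?s a * comb ms + Io ?s ms a))"
    unfolding eq by (rule add[OF add[OF 1 2] resop_comb[OF z ms]])
  have 4: "ehat ?s b * (?d * (ehat ?s a * ?t + Io ?s ls a))
       + ?d * ((ehat ?s a * (ehat ?s b * ?t) - ehat ?s b * (ehat ?s a * ?t)) + Dio ?s ls ?b)
       + ?d * (ehat ?s a * comb ms + Io ?s ms a) = ?d * lim_value ?s ls ms a b"
    unfolding lim_value_def mult_scal_left[of "ehat ?s b"]
    by (simp add: distrib_left right_diff_distrib)
  have "eqm ?N (?d * ?A (gen (rlet u ?s 1 b) * ?t + comb ms)) (?d * (?d * lim_value ?s ls ms a b))"
    using eqm_scal[OF subsp_vac 3] unfolding 4 .
  then show ?thesis unfolding resop_scal power2_eq_square scal_mult mult.assoc .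
qed

end

context coord_setup
begin

text \<open>Here \<open>u\<close> is the coordinate in which the limit is calculated, while
  \<open>w\<close> occurs in the subtracted terms; for equal poles \<kappa> is zero. The limit is
  the value at \<open>s1\<close> of an explicit rational family.\<close>

lemma product_limit:
  assumes w: "coordinate Q w" and z1: "z1 \<noteq> P" "z1 \<noteq> Q"
    and ls: "valid_combo (u z1) ls" and ms: "valid_combo (u z1) ms"
    and t: "eqm (vac_ideal UNIV) t (comb ls)"
    and Io: "eqm (vac_ideal UNIV) (Io (u z1) ls v1) (comb ms)"
  defines "\<kappa> \<equiv> pol z1 P - pol z1 Q"
  shows "current_product_limit form (jcur form) w v2 v1 z1 (t +o vac_ideal (reg z1)) P u
    ((lim_value (u z1) ls ms v2 v1 + scal (\<kappa> / diff u z1)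
        * (ehat (u z1) (lie v2 v1) * comb ls + Io (u z1) ls (lie v2 v1))) +o uea_ideal (van P))"
proof -
  let ?N = "vac_ideal UNIV :: 'g mero free_alg set" and ?J = "uea_ideal (van P :: 'g mero set)"
  define s1 where "s1 = u z1"
  define d1 where "d1 = diff u z1"
  define b where "b = lie v2 v1"
  \<comment> \<open>Up to the factor \<open>scal d1\<close>, the first current applied to the
    vector: the letter v1/(u - s1) in front of \<open>ls\<close>, and \<open>ms\<close> for the
    \<iota> part. Near s1 the combination is valid for s different from s1, where the second current
    acts.\<close>
  define C where "C = cons_combo (s1, 1, v1) ls @ ms"
  define T where "T = scal d1 * comb C"
  define Jb where "Jb = ehat s1 b * comb ls + Io s1 ls b"
  have d1: "d1 \<noteq> 0" unfolding d1_def by (rule coordinate_diff_nonzero[OF u z1(1)])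
  note ls' = ls[folded s1_def] and ms' = ms[folded s1_def]
  obtain G \<delta>G where G: "ratfam P u s1 (\<lambda>s. Io s ls b)" "ratfam P u s1 G" "G s1 = Dio s1 ls b" "\<delta>G > 0"
    "\<And>s. dist s s1 < \<delta>G \<Longrightarrow> Io s ls b = Io s1 ls b + scal (s - s1) * G s"
    by (rule dfamE[OF dfam_Io[OF ls', of b]]) blast
  have Io_fam: "ratfam P u s1 (\<lambda>s. Io s ks a)" if "valid_combo s1 ks" for ks a
    by (rule dfamE[OF dfam_Io[OF that, of a]])
  have ehat1: "ratfam P u s1 (\<lambda>s. ehat s1 a)" for a by (rule ratfam_rlet) simp
  have C: "comb C = ehat s1 v1 * comb ls + comb ms" by (simp add: C_def comb_append comb_cons)
  have C_fam: "ratfam P u s1 (\<lambda>s. comb C)"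
    unfolding C by (intro ratfam_add ratfam_mult ehat1 ratfam_comb ls' ms')
  have Jb_fam: "ratfam P u s1 (\<lambda>s. Jb)"
    unfolding Jb_def
    by (intro ratfam_add ratfam_mult ehat1 ratfam_comb ls' ratfam_const_at[OF Io_fam])
  \<comment> \<open>The correction from \<open>coordinate_change\<close>. It is regular at s1, and
    its value \<kappa> / d1 is the coefficient of the extra current in the limit.\<close>
  define k where "k = (\<lambda>s. \<kappa> / (d1 + \<kappa> * (s - s1)))"
  have k_fam: "ratfam P u s1 (\<lambda>s. scal (k s) :: 'g mero free_alg)"
  proof -
    have *: "poly [:d1 - \<kappa> * s1, \<kappa>:] s = d1 + \<kappa> * (s - s1)" "poly [:\<kappa>:] s = \<kappa>" for s
      by (simp_all add: algebra_simps)
    have "poly [:d1 - \<kappa> * s1, \<kappa>:] s1 \<noteq> 0" unfolding * using d1 by simp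
    from ratfam_scal_rational[OF this, of P u "[:\<kappa>:]", unfolded *] show ?thesis unfolding k_def .
  qed
  \<comment> \<open>What remains of the product when the singular terms have cancelled; each summand
    is regular at s1. G is the divided difference of \<iota> for [v2, v1], with the derivative as
    its value at s1.\<close>
  define F where "F = (\<lambda>s. ehat s v2 * comb C + ehat s1 v1 * Io s ls v2 + Io s ms v2 + G s + scal (k s) * Jb)"
  have F_fam: "ratfam P u s1 F"
    unfolding F_def
    by (intro ratfam_add ratfam_mult ratfam_eps ehat1 Io_fam ls' ms' C_fam Jb_fam k_fam G(2))
  have Fs1: "F s1 = lim_value s1 ls ms v2 v1 + scal (\<kappa> / d1) * Jb"
    unfolding F_def lim_value_def C G(3) b_def[symmetric] by (simp add: k_def)
  obtain \<delta>1 where \<delta>1: "\<delta>1 > 0" "\<And>s. dist s s1 < \<delta>1 \<Longrightarrow> valid_combo s ls"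
    by (rule eventually_valid_combo[OF ls']) blast
  obtain \<delta>2 where \<delta>2: "\<delta>2 > 0" "\<And>s. dist s s1 < \<delta>2 \<Longrightarrow> valid_combo s ms"
    by (rule eventually_valid_combo[OF ms']) blast
  \<comment> \<open>Keeps \<open>z\<close> away from \<open>Q\<close>, where \<open>w\<close> has
    its pole; if \<open>Q = P\<close> that point is excluded anyway and the radius is a
    default.\<close>
  define \<delta>Q where "\<delta>Q = (if Q = P then 1 else dist (u Q) s1)"
  have "u Q \<noteq> s1" if "Q \<noteq> P"
    using coordinate_inj[OF u that z1(1)] z1(2) by (auto simp: s1_def)
  then have \<delta>Q: "\<delta>Q > 0" by (simp add: \<delta>Q_def)
  define \<delta> where "\<delta> = min (min \<delta>G \<delta>1) (min \<delta>2 \<delta>Q)"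
  interpret Z1: iota_setup form P z1 u by (rule iota_setup[OF z1(1)])
  have jX: "jcur form a z1 (t +o vac_ideal (reg z1)) = (scal d1 * (ehat s1 a * comb ls + Io s1 ls a)) +o ?N" for a
    unfolding jcur_coset[OF form] s1_def d1_def
    by (rule coset_eqI[OF subsp_vac eqm_trans[OF subsp_vac resop_eqm[OF form t] resop_pol_comb[OF z1(1) ls]]])
  show ?thesis
    unfolding current_product_limit_def s1_def[symmetric] d1_def[symmetric] b_def[symmetric]
      Jb_def[symmetric] Fs1[symmetric] unfolding s1_def d1_def
  proof (rule tends_toI[where \<delta> = \<delta> and F = F])
    show "ratfam P u (u z1) F" using F_fam unfolding s1_def .
    show "\<delta> > 0" using G(4) \<delta>1(1) \<delta>2(1) \<delta>Q by (simp add: \<delta>_def)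
  next
    fix z assume zP: "z \<noteq> P" and zz: "z \<noteq> z1" and "dist (u z) (u z1) < \<delta>"
    then have dist: "dist (u z) s1 < \<delta>G" "dist (u z) s1 < \<delta>1" "dist (u z) s1 < \<delta>2" "dist (u z) s1 < \<delta>Q"
      by (simp_all add: \<delta>_def s1_def)
    then have zQ: "z \<noteq> Q" using zP by (auto simp: \<delta>Q_def split: if_splits)
    define s dz y where "s = u z" and "dz = diff u z" and "y = inverse (s - s1)"
    have ss: "s \<noteq> s1" using coordinate_inj[OF u zP z1(1)] zz by (auto simp: s_def s1_def)
    have y: "(s - s1) * y = 1" using ss by (simp add: y_def)
    have vC: "valid_combo s C"
      using \<delta>1(2)[OF dist(2)] \<delta>2(2)[OF dist(3)] ss valid_cons[of s "(s1, 1, v1)" ls]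
      by (simp add: C_def s_def)
    have Tf: "T \<in> free_on (reg z)"
      unfolding T_def using comb_free[OF zP, of C] vC
      by (intro free_on_mult free_on_scal free_reg) (simp add: s_def)
    have T1: "jcur form v1 z1 (t +o vac_ideal (reg z1)) = T +o ?N"
      unfolding jX T_def C
      by (rule coset_eqI[OF subsp_vac eqm_scal[OF subsp_vac eqm_add[OF subsp_vac eqm_refl[OF subsp_vac]]]])
        (use Io in \<open>simp_all add: s1_def\<close>)
    have T2: "jcur form v2 z (T +o vac_ideal (reg z)) =
        (scal d1 * (scal dz * (ehat s v2 * comb C + Io s C v2))) +o ?N"
      unfolding jcur_coset[OF form] T_def resop_scal s_def dz_def
      by (rule coset_eqI[OF subsp_vac eqm_scal[OF subsp_vac resop_pol_comb[OF zP]]])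
        (use vC in \<open>simp add: s_def\<close>)
    \<comment> \<open>The singular letter gives the form with y^2 and the bracket terms with y. In
      the latter, \<open>Io s ls b\<close> is replaced by its value at s1 plus (s - s1) times G,
      which separates the singular part from the derivative.\<close>
    have IoC: "Io s C v2 = ehat s1 v1 * Io s ls v2
        + (scal y * ehat s1 b + scal (form v2 v1 * y\<^sup>2)) * comb ls + scal y * (Io s1 ls b + scal (s - s1) * G s)
        + Io s ms v2"
      unfolding C_def Io_append Io_cons b_def[symmetric] G(5)[OF dist(1), folded s_def, symmetric]
      by (simp add: y_def b_def power2_eq_square)
    have form12: "form v1 v2 * diff w z1 * diff w z / (w z1 - w z)\<^sup>2 = form v2 v1 * (d1 * dz * y\<^sup>2)"
      and coeff: "1 / (w z - w z1) * diff w z = dz * (y - k s)"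
    proof -
      note cc = coordinate_change[OF u w zz zP zQ z1]
      have "(u z1 - u z)\<^sup>2 = (s - s1)\<^sup>2" by (simp add: s_def s1_def power2_commute)
      then have "diff u z1 * diff u z / (u z1 - u z)\<^sup>2 = d1 * dz * y\<^sup>2"
        by (simp add: d1_def dz_def y_def divide_inverse power_inverse)
      moreover have "form v1 v2 * diff w z1 * diff w z / (w z1 - w z)\<^sup>2 =
          form v2 v1 * (diff w z1 * diff w z / (w z1 - w z)\<^sup>2)"
        by (simp add: form_sym[OF form, of v1])
      ultimately show "form v1 v2 * diff w z1 * diff w z / (w z1 - w z)\<^sup>2 = form v2 v1 * (d1 * dz * y\<^sup>2)"
        using cc(1) by simp
      show "1 / (w z - w z1) * diff w z = dz * (y - k s)"
        unfolding cc(2) by (simp add: dz_def y_def k_def \<kappa>_def s_def s1_def d1_def divide_inverse)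
    qed
    have "scal (d1 * dz) * F s = scal d1 * (scal dz * (ehat s v2 * comb C + Io s C v2))
        - scal (form v2 v1 * (d1 * dz * y\<^sup>2)) * comb ls - scal (dz * (y - k s)) * (scal d1 * Jb)"
      unfolding F_def Jb_def product_algebra[OF y, of d1 dz _ _ _ _ "k s" _ _ "form v2 v1" "comb ls"] IoC
      by (simp add: distrib_right mult.assoc add.assoc)
    then have eqm: "eqm ?N (scal (d1 * dz) * F s)
        (scal d1 * (scal dz * (ehat s v2 * comb C + Io s C v2))
        - scal (form v2 v1 * (d1 * dz * y\<^sup>2)) * t - scal (dz * (y - k s)) * (scal d1 * Jb))"
      using eqm_diff[OF subsp_vac eqm_diff[OF subsp_vac eqm_refl[OF subsp_vac] eqm_scal[OF subsp_vac eqm_sym[OF subsp_vac t]]]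
          eqm_refl[OF subsp_vac]] by metis
    note lm = lmul_scal_coset[OF subsp_vac subsp_vac vac_mono[OF subset_UNIV]]
      lmul_scal_coset[OF subsp_vac subsp_vac order.refl]
    have FN: "F (u z) +o ?J + ?N = F s +o ?N"
      unfolding s_def by (rule coset_plus(3)[OF subsp_vac subsp_0[OF subsp_uea] uea_sub_vac])
    show "current_product form (jcur form) w v2 v1 z1 (t +o vac_ideal (reg z1)) z
        (lmul ?N (scal (diff u z1 * diff u z)) (F (u z) +o ?J + ?N))"
      unfolding current_product_def Let_def
    proof (intro bexI[of _ "T +o vac_ideal (reg z)"] conjI)
      show "T +o vac_ideal (reg z) \<in> Vac (reg z)" unfolding Vac_iff using Tf by blast
      show "T +o vac_ideal (reg z) + ?N = jcur form v1 z1 (t +o vac_ideal (reg z1))"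
        unfolding T1 by (rule coset_plus(3)[OF subsp_vac subsp_0[OF subsp_vac] vac_mono]) simp
      show "lmul ?N (scal (diff u z1 * diff u z)) (F (u z) +o ?J + ?N) =
          jcur form v2 z (T +o vac_ideal (reg z))
          \<ominus> lmul ?N (scal (form v1 v2 * diff w z1 * diff w z / (w z1 - w z)\<^sup>2)) (t +o vac_ideal (reg z1))
          \<ominus> lmul ?N (scal (1 / (w z - w z1) * diff w z)) (jcur form (lie v2 v1) z1 (t +o vac_ideal (reg z1)))"
        unfolding FN T2 jX form12 coeff lm coset_diff_coset[OF subsp_vac] b_def[symmetric] Jb_def[symmetric]
          d1_def[symmetric] dz_def[symmetric]
        by (rule coset_eqI[OF subsp_vac eqm])
    qed
  qed
qed

text \<open>The same \<open>comb ls\<close> represents the vector at z1 and its preimages at all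
  nearby points. The difference quotient is thus formed on one fixed representative, where it is the
  divided difference from \<open>dfam_Io\<close>.\<close>

lemma iota_deriv_Dio:
  assumes z1: "z1 \<noteq> P" and ls: "valid_combo (u z1) ls" and t: "t \<in> free_on (van P \<inter> reg z1)"
    "eqm (uea_ideal (van P \<inter> reg z1)) t (comb ls)"
  shows "iota_deriv form P u z1 b (t +o uea_ideal (van P \<inter> reg z1)) (Dio (u z1) ls b +o uea_ideal (van P))"
proof -
  let ?J = "uea_ideal (van P :: 'g mero set)"
  interpret Z1: iota_setup form P z1 u by (rule iota_setup[OF z1])
  define s1 where "s1 = u z1"
  obtain G \<delta>G where G: "ratfam P u s1 (\<lambda>s. Io s ls b)" "ratfam P u s1 G" "G s1 = Dio s1 ls b" "\<delta>G > 0"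
    "\<And>s. dist s s1 < \<delta>G \<Longrightarrow> Io s ls b = Io s1 ls b + scal (s - s1) * G s"
    by (rule dfamE[OF dfam_Io[OF ls[folded s1_def], of b]]) blast
  obtain \<delta>1 where \<delta>1: "\<delta>1 > 0" "\<And>s. dist s s1 < \<delta>1 \<Longrightarrow> valid_combo s ls"
    by (rule eventually_valid_combo[OF ls[folded s1_def]]) blast
  have sub: "uea_ideal (van P \<inter> reg z) \<subseteq> ?J" for z by (rule uea_mono) simp
  have iota: "lmul ?J (scal (1 / diff u z)) (iota form P u z b (comb ls +o uea_ideal (van P \<inter> reg z))) =
      Io (u z) ls b +o ?J" if z: "z \<noteq> P" and v: "valid_combo (u z) ls" for z
  proof -
    interpret iota_setup form P z u by (rule iota_setup[OF z])
    have "eqm ?J (scal (1 / diff u z) * iop form u z b (comb ls)) (scal (1 / diff u z) * (scal (diff u z) * Io (u z) ls b))"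
      by (rule eqm_scal[OF subsp_uea eqm_mono[OF sub Io_iop[OF z v]]])
    then show ?thesis
      unfolding iota_coset[OF comb_free[OF z v]] lmul_scal_coset[OF subsp_uea subsp_uea sub]
      using coordinate_diff_nonzero[OF u z] by (intro coset_eqI[OF subsp_uea]) (simp add: scal_mult_left)
  qed
  have X: "t +o uea_ideal (van P \<inter> reg z1) = comb ls +o uea_ideal (van P \<inter> reg z1)"
    by (rule coset_eqI[OF subsp_uea t(2)])
  show ?thesis
    unfolding iota_deriv_def Let_def X G(3)[unfolded s1_def, symmetric]
  proof (rule tends_toI[where \<delta> = "min \<delta>G \<delta>1" and F = G])
    show "ratfam P u (u z1) G" using G(2) unfolding s1_def .
    show "min \<delta>G \<delta>1 > 0" using G(4) \<delta>1(1) by simp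
  next
    fix z assume zP: "z \<noteq> P" and zz: "z \<noteq> z1" and "dist (u z) (u z1) < min \<delta>G \<delta>1"
    then have dist: "dist (u z) s1 < \<delta>G" "dist (u z) s1 < \<delta>1" by (simp_all add: s1_def)
    note v = \<delta>1(2)[OF dist(2)]
    have ss: "u z - u z1 \<noteq> 0" using coordinate_inj[OF u zP z1] zz by auto
    let ?X' = "comb ls +o uea_ideal (van P \<inter> reg z)"
    show "\<exists>X'\<in>UEA (van P \<inter> reg z). X' + ?J = comb ls +o uea_ideal (van P \<inter> reg z1) + ?J \<and>
        G (u z) +o ?J = lmul ?J (scal (1 / (u z - u z1)))
          (lmul ?J (scal (1 / diff u z)) (iota form P u z b X') \<ominus>
           lmul ?J (scal (1 / diff u z1)) (iota form P u z1 b (comb ls +o uea_ideal (van P \<inter> reg z1))))"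
    proof (intro bexI[of _ ?X'] conjI)
      show "?X' \<in> UEA (van P \<inter> reg z)" unfolding UEA_iff using comb_free[OF zP v] by blast
      show "?X' + ?J = comb ls +o uea_ideal (van P \<inter> reg z1) + ?J"
        unfolding coset_plus(3)[OF subsp_uea subsp_0[OF subsp_uea] sub] ..
      have "scal (1 / (u z - u z1)) * (Io (u z) ls b - Io (u z1) ls b) = G (u z)"
        using G(5)[OF dist(1)] ss by (simp add: s1_def scal_mult_left)
      then show "G (u z) +o ?J = lmul ?J (scal (1 / (u z - u z1)))
          (lmul ?J (scal (1 / diff u z)) (iota form P u z b ?X') \<ominus>
           lmul ?J (scal (1 / diff u z1)) (iota form P u z1 b (comb ls +o uea_ideal (van P \<inter> reg z1))))"
        unfolding iota[OF zP v] iota[OF z1 ls] coset_diff_coset[OF subsp_uea]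
          lmul_scal_coset[OF subsp_uea subsp_uea order.refl] by simp
    qed
  qed
qed

lemma limit_formula_value:
  assumes z1: "z1 \<noteq> P" and ls: "valid_combo (u z1) ls" and ms: "valid_combo (u z1) ms"
    and t: "t \<in> free_on (van P \<inter> reg z1)" "eqm (uea_ideal (van P \<inter> reg z1)) t (comb ls)"
    and Io: "eqm (uea_ideal (van P \<inter> reg z1)) (Io (u z1) ls v1) (comb ms)"
  shows "limit_formula form P u v2 v1 z1 (t +o uea_ideal (van P \<inter> reg z1)) (Dio (u z1) ls (lie v2 v1) +o uea_ideal (van P))
    = (scal ((diff u z1)\<^sup>2) * lim_value (u z1) ls ms v2 v1) +o uea_ideal (van P)"
proof -
  interpret iota_setup form P z1 u by (rule iota_setup[OF z1])
  let ?J = "uea_ideal (van P :: 'g mero set)" and ?d = "scal (diff u z1)" and ?s = "u z1" and ?t0 = "comb ls"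
  have sub: "Jz \<subseteq> ?J" by (rule uea_mono) simp
  note trans = eqm_trans[OF subsp_uea] and refl = eqm_refl[OF subsp_uea] and scal = eqm_scal[OF subsp_uea]
  have i1: "eqm Jz (iop form u z1 v1 t) (?d * comb ms)"
    by (rule trans[OF iop_eqm[OF t(2)] trans[OF Io_iop[OF z1 ls] scal[OF Io]]])
  have i2: "eqm Jz (iop form u z1 v2 t) (?d * Io ?s ls v2)"
    by (rule trans[OF iop_eqm[OF t(2)] Io_iop[OF z1 ls]])
  have "eqm Jz (iop form u z1 v2 (iop form u z1 v1 t)) (?d * (?d * Io ?s ms v2))"
    using trans[OF iop_eqm[OF i1] _] scal[OF Io_iop[OF z1 ms]] unfolding iop_scal .
  then have ii: "eqm ?J (iop form u z1 v2 (iop form u z1 v1 t)) (?d * (?d * Io ?s ms v2))"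
    by (rule eqm_mono[OF sub])
  have E: "eqm ?J (gen (eps_elt u z1 a) * x) (?d * ehat ?s a * y)" if "eqm ?J x y" "y \<in> free_on (van P)" for a x y
  proof -
    have "eqm ?J (gen (eps_elt u z1 a)) (?d * ehat ?s a)"
      unfolding eps_rlet by (rule gen_scale) (simp add: rlet_van)
    then show ?thesis
      by (intro trans[OF eqm_lmult[OF left_stable_uea free_on_gen[OF eps_elt_van[OF u z1]] that(1)] eqm_rmult_uea] that(2))
  qed
  have free: "x \<in> free_on (van P)" if "x \<in> free_on Hz" for x
    using that by (rule free_on_mono[rotated]) simp
  have e1: "eqm ?J (gen (eps_elt u z1 v1) * t) (?d * ehat ?s v1 * ?t0)"
    by (rule E[OF eqm_mono[OF sub t(2)] free[OF comb_free[OF z1 ls]]])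
  have e2: "eqm ?J (gen (eps_elt u z1 v2) * (gen (eps_elt u z1 v1) * t)) (?d * ehat ?s v2 * (?d * ehat ?s v1 * ?t0))"
    by (rule E[OF e1]) (intro free_on_mult free_on_scal free_on_gen rlet_van free comb_free z1 ls, simp)
  have e3: "eqm ?J (gen (eps_elt u z1 v2) * iop form u z1 v1 t) (?d * ehat ?s v2 * (?d * comb ms))"
    by (rule E[OF eqm_mono[OF sub i1]]) (intro free_on_mult free_on_scal free comb_free z1 ms)
  have IoF: "Io ?s ls v2 \<in> free_on (van P)"
    by (rule dfamE[OF dfam_Io[OF ls, of v2]]) (rule ratfam_free)
  have e4: "eqm ?J (gen (eps_elt u z1 v1) * iop form u z1 v2 t) (?d * ehat ?s v1 * (?d * Io ?s ls v2))"
    by (rule E[OF eqm_mono[OF sub i2]]) (intro free_on_mult free_on_scal IoF)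
  have "eqm ?J (iop form u z1 v2 (iop form u z1 v1 t) + gen (eps_elt u z1 v2) * (gen (eps_elt u z1 v1) * t)
      + gen (eps_elt u z1 v2) * iop form u z1 v1 t + gen (eps_elt u z1 v1) * iop form u z1 v2 t
      + scal ((diff u z1)\<^sup>2) * Dio ?s ls (lie v2 v1))
    (?d * (?d * Io ?s ms v2) + ?d * ehat ?s v2 * (?d * ehat ?s v1 * ?t0)
      + ?d * ehat ?s v2 * (?d * comb ms) + ?d * ehat ?s v1 * (?d * Io ?s ls v2)
      + scal ((diff u z1)\<^sup>2) * Dio ?s ls (lie v2 v1))"
    by (intro eqm_add[OF subsp_uea] ii e2 e3 e4 refl)
  also have "?d * (?d * Io ?s ms v2) + ?d * ehat ?s v2 * (?d * ehat ?s v1 * ?t0)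
      + ?d * ehat ?s v2 * (?d * comb ms) + ?d * ehat ?s v1 * (?d * Io ?s ls v2)
      + scal ((diff u z1)\<^sup>2) * Dio ?s ls (lie v2 v1) = scal ((diff u z1)\<^sup>2) * lim_value ?s ls ms v2 v1"
    unfolding lim_value_def
    by (simp add: mult.assoc mult_scal_left[of "gen _" "diff u z1"] scal_mult_left distrib_left power2_eq_square add_ac)
  finally have eqm: "eqm ?J (iop form u z1 v2 (iop form u z1 v1 t) + gen (eps_elt u z1 v2) * (gen (eps_elt u z1 v1) * t)
      + gen (eps_elt u z1 v2) * iop form u z1 v1 t + gen (eps_elt u z1 v1) * iop form u z1 v2 t
      + scal ((diff u z1)\<^sup>2) * Dio ?s ls (lie v2 v1)) (scal ((diff u z1)\<^sup>2) * lim_value ?s ls ms v2 v1)" .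
  note cp = coset_plus[OF subsp_uea subsp_0[OF subsp_uea] sub]
  show ?thesis
    unfolding limit_formula_def Let_def iota_coset[OF t(1)] iota_coset[OF iop_free[OF t(1)]] eps_def cp
      uea_lmul[OF free_on_gen[OF eps_elt_van[OF u z1]]] uea_lmul[OF free_on_scal] coset_plus_same[OF subsp_uea]
    by (rule coset_eqI[OF subsp_uea eqm])
qed

text \<open>The right side mentions neither \<open>P\<close> nor \<open>u\<close>, but only
  \<open>Q\<close>, the pole of the coordinate in the subtracted terms: the added constant
  normalises the simple pole to vanish there. Two points at infinity are compared by using this with
  the same \<open>Q\<close>.\<close>

lemma lim_value_resop:
  assumes Q: "z1 \<noteq> Q" and z1: "z1 \<noteq> P" and ls: "valid_combo (u z1) ls" and ms: "valid_combo (u z1) ms"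
    and t: "eqm (vac_ideal UNIV) t (comb ls)"
    and Io: "eqm (vac_ideal UNIV) (Io (u z1) ls v1) (comb ms)"
  defines "\<kappa> \<equiv> pol z1 P - pol z1 Q"
  shows "eqm (vac_ideal UNIV)
    (scal ((diff u z1)\<^sup>2) * (lim_value (u z1) ls ms v2 v1 + scal (\<kappa> / diff u z1)
        * (ehat (u z1) (lie v2 v1) * comb ls + Io (u z1) ls (lie v2 v1))))
    (resop form z1 (elem (pol z1) v2 + const (- pol z1 Q *\<^sub>C v2)) (resop form z1 (elem (pol z1) v1) t))"
proof -
  interpret iota_setup form P z1 u by (rule iota_setup[OF z1])
  let ?N = "vac_ideal UNIV :: 'g mero free_alg set"
  define T where "T = scal (diff u z1) * (ehat (u z1) v1 * comb ls + comb ms)"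
  note trans = eqm_trans[OF subsp_vac]
  have T: "eqm ?N (resop form z1 (elem (pol z1) v1) t) T"
    unfolding T_def
    by (rule trans[OF resop_eqm[OF form t] trans[OF resop_pol_comb[OF z1 ls]
          eqm_scal[OF subsp_vac eqm_add[OF subsp_vac eqm_refl[OF subsp_vac] Io]]]])
  have "(- pol z1 Q) *\<^sub>C v2 = - pol z1 P *\<^sub>C v2 + \<kappa> *\<^sub>C v2"
    unfolding \<kappa>_def cscale_add_left[symmetric] by simp
  then have "const (- pol z1 Q *\<^sub>C v2) = const (- pol z1 P *\<^sub>C v2) + \<kappa> *\<^sub>C const v2"
    by (simp only: const_elem elem_add_right elem_scale meromorphic_fun_const)
  then have split: "elem (pol z1) v2 + const (- pol z1 Q *\<^sub>C v2) = eps_elt u z1 v2 + \<kappa> *\<^sub>C const v2"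
    unfolding eps_elt_const[OF u z1] by simp
  have 1: "eqm ?N (resop form z1 (\<kappa> *\<^sub>C const v2) T)
      (scal \<kappa> * (scal (diff u z1) * (ehat (u z1) (lie v2 v1) * comb ls + Io (u z1) ls (lie v2 v1))))"
    unfolding T_def
    by (rule trans[OF resop_scale[OF form] eqm_scal[OF subsp_vac resop_const_comb[OF z1 ls ms]]])
  have 2: "eqm ?N (resop form z1 (eps_elt u z1 v2) T) (scal ((diff u z1)\<^sup>2) * lim_value (u z1) ls ms v2 v1)"
    unfolding T_def by (rule resop_eps_comb[OF z1 ls ms])
  have "(diff u z1)\<^sup>2 * (\<kappa> / diff u z1) = \<kappa> * diff u z1"
    using coordinate_diff_nonzero[OF u z1] by (simp add: power2_eq_square)
  then have 3: "scal ((diff u z1)\<^sup>2) * (lim_value (u z1) ls ms v2 v1 + scal (\<kappa> / diff u z1)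
        * (ehat (u z1) (lie v2 v1) * comb ls + Io (u z1) ls (lie v2 v1))) =
      scal ((diff u z1)\<^sup>2) * lim_value (u z1) ls ms v2 v1
      + scal \<kappa> * (scal (diff u z1) * (ehat (u z1) (lie v2 v1) * comb ls + Io (u z1) ls (lie v2 v1)))"
    by (simp only: distrib_left[of "scal ((diff u z1)\<^sup>2)"] scal_mult_left)
  show ?thesis
    unfolding split 3
    by (rule eqm_sym[OF subsp_vac trans[OF resop_eqm[OF form T] trans[OF resop_add[OF form] eqm_add[OF subsp_vac 2 1]]]])
qed

text \<open>The second current also acts on the \<iota> part of the first, so that part must in turn
  be available, modulo the relations, as a combination \<open>ms\<close> of words.\<close>

lemma combos_exist:
  assumes z1: "z1 \<noteq> P" and t: "t \<in> free_on (van P \<inter> reg z1)"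
  obtains ls ms where "valid_combo (u z1) ls" "valid_combo (u z1) ms"
    "eqm (uea_ideal (van P \<inter> reg z1)) t (comb ls)"
    "eqm (uea_ideal (van P \<inter> reg z1)) (Io (u z1) ls a) (comb ms)"
proof -
  interpret iota_setup form P z1 u by (rule iota_setup[OF z1])
  obtain ls where ls: "valid_combo (u z1) ls" "eqm Jz t (comb ls)" by (rule combo_exists[OF z1 t])
  let ?d = "inverse (diff u z1)"
  have "scal ?d * iop form u z1 a (comb ls) \<in> free_on Hz"
    by (intro free_on_mult free_on_scal iop_free comb_free z1 ls)
  then obtain ms where ms: "valid_combo (u z1) ms" "eqm Jz (scal ?d * iop form u z1 a (comb ls)) (comb ms)"
    by (rule combo_exists[OF z1])
  have "eqm Jz (scal ?d * iop form u z1 a (comb ls)) (scal ?d * (scal (diff u z1) * Io (u z1) ls a))"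
    by (rule eqm_scal[OF subsp_uea Io_iop[OF z1 ls(1)]])
  then have "eqm Jz (scal ?d * iop form u z1 a (comb ls)) (Io (u z1) ls a)"
    using coordinate_diff_nonzero[OF u z1] by (simp add: scal_mult_left)
  then have "eqm Jz (Io (u z1) ls a) (comb ms)"
    by (rule eqm_trans[OF subsp_uea eqm_sym[OF subsp_uea] ms(2)])
  with ls ms(1) show ?thesis by (intro that)
qed

end

theorem theorem11p7:
  fixes form :: "'g::complex_lie_algebra \<Rightarrow> 'g \<Rightarrow> complex"
  assumes "invariant_form form"
  shows "\<exists>j. current_field form j \<and> covariant j \<and>
    (\<forall>v\<^sub>1 v\<^sub>2 z\<^sub>1 P u. \<forall>X \<in> UEA (van P \<inter> reg z\<^sub>1). P \<noteq> z\<^sub>1 \<and> coordinate P u \<longrightarrow>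
       (\<exists>D. iota_deriv form P u z\<^sub>1 (lie v\<^sub>2 v\<^sub>1) X D \<and>
         (let N = vac_ideal UNIV;
              X' = X + vac_ideal (reg z\<^sub>1);
              rhs = limit_formula form P u v\<^sub>2 v\<^sub>1 z\<^sub>1 X D
          in (\<exists>L. current_product_limit form j u v\<^sub>2 v\<^sub>1 z\<^sub>1 X' P u L \<and>
                lmul (uea_ideal (van P)) (scal ((diff u z\<^sub>1)\<^sup>2)) L = rhs) \<and>
             (\<forall>Q w. \<forall>Y \<in> UEA (van Q \<inter> reg z\<^sub>1).
                Q \<noteq> z\<^sub>1 \<and> coordinate Q w \<and> Y + vac_ideal (reg z\<^sub>1) = X' \<longrightarrow>
                (\<exists>L. current_product_limit form j u v\<^sub>2 v\<^sub>1 z\<^sub>1 X' Q w L \<and>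
                   lmul N (scal ((diff w z\<^sub>1)\<^sup>2)) (L + N) = rhs + N)))))"
proof (intro exI[of _ "jcur form"] conjI allI ballI impI)
  show "current_field form (jcur form)" "covariant (jcur form)"
    by (rule current_field_jcur[OF assms], rule covariant_jcur[OF assms])
next
  fix v1 v2 :: 'g and z1 P u and X :: "'g mero free_alg set"
  assume X: "X \<in> UEA (van P \<inter> reg z1)" and "P \<noteq> z1 \<and> coordinate P u"
  then have z1: "z1 \<noteq> P" and u: "coordinate P u" by auto
  interpret coord_setup form P u using assms u by unfold_locales
  let ?N = "vac_ideal UNIV :: 'g mero free_alg set" and ?J = "uea_ideal (van P :: 'g mero set)"
  let ?X' = "X + vac_ideal (reg z1)" and ?b = "lie v2 v1"
  obtain t where t: "t \<in> free_on (van P \<inter> reg z1)" "X = t +o uea_ideal (van P \<inter> reg z1)"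
    using X unfolding UEA_iff by blast
  obtain ls ms where ls: "valid_combo (u z1) ls" and ms: "valid_combo (u z1) ms"
    and eq: "eqm (uea_ideal (van P \<inter> reg z1)) t (comb ls)"
    "eqm (uea_ideal (van P \<inter> reg z1)) (Io (u z1) ls v1) (comb ms)"
    by (rule combos_exist[OF z1 t(1)])
  define D where "D = Dio (u z1) ls ?b +o ?J"
  define V where "V = scal ((diff u z1)\<^sup>2) * lim_value (u z1) ls ms v2 v1"
  have X': "t +o uea_ideal (van Q \<inter> reg z1) + vac_ideal (reg z1) = t +o vac_ideal (reg z1)"
    for t :: "'g mero free_alg" and Q
    by (rule coset_plus(3)[OF subsp_vac subsp_0[OF subsp_uea] uea_vac]) simp
  have rhs: "limit_formula form P u v2 v1 z1 X D = V +o ?J"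
    unfolding D_def V_def t(2) by (rule limit_formula_value[OF z1 ls ms t(1) eq])
  \<comment> \<open>Here the coordinate in the subtracted terms is the one of the calculation, so
    \<kappa> is zero and the correction disappears.\<close>
  have lim: "current_product_limit form (jcur form) u v2 v1 z1 ?X' P u (lim_value (u z1) ls ms v2 v1 +o ?J)"
    using product_limit[OF u z1 z1 ls ms eqm_vacI[OF eq(1)] eqm_vacI[OF eq(2)], of v2] unfolding t(2) X' by simp
  have res: "eqm ?N V (resop form z1 (elem (pol z1) v2 + const (- pol z1 P *\<^sub>C v2)) (resop form z1 (elem (pol z1) v1) t))"
    unfolding V_def using lim_value_resop[OF z1 z1 ls ms eqm_vacI[OF eq(1)] eqm_vacI[OF eq(2)], of v2] by simp
  have indep: "\<exists>L. current_product_limit form (jcur form) u v2 v1 z1 ?X' Q w L \<and>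
      lmul ?N (scal ((diff w z1)\<^sup>2)) (L + ?N) = (V +o ?J) + ?N"
    if Y: "Y \<in> UEA (van Q \<inter> reg z1)" and Q: "Q \<noteq> z1 \<and> coordinate Q w \<and> Y + vac_ideal (reg z1) = ?X'" for Q w Y
  proof -
    have zQ: "z1 \<noteq> Q" and w: "coordinate Q w" using Q by auto
    interpret W: coord_setup form Q w using assms w by unfold_locales
    obtain t' where t': "t' \<in> free_on (van Q \<inter> reg z1)" "Y = t' +o uea_ideal (van Q \<inter> reg z1)"
      using Y unfolding UEA_iff by blast
    obtain ls' ms' where ls': "W.valid_combo (w z1) ls'" and ms': "W.valid_combo (w z1) ms'"
      and eq': "eqm (uea_ideal (van Q \<inter> reg z1)) t' (W.comb ls')"
      "eqm (uea_ideal (van Q \<inter> reg z1)) (W.Io (w z1) ls' v1) (W.comb ms')"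
      by (rule W.combos_exist[OF zQ t'(1)])
    have XY: "t' +o vac_ideal (reg z1) = t +o vac_ideal (reg z1)"
      using Q unfolding t(2) t'(2) X' by blast
    then have tt: "eqm ?N t' t" by (intro eqm_mono[OF vac_mono[OF subset_UNIV]]) (simp add: coset_eq_iff)
    \<comment> \<open>The limit is now calculated with \<open>w\<close>, while the subtracted terms
      keep \<open>u\<close> with pole at \<open>P\<close>; hence the order of the difference in the
      correction.\<close>
    let ?L = "W.lim_value (w z1) ls' ms' v2 v1 + scal ((pol z1 Q - pol z1 P) / diff w z1)
        * (W.ehat (w z1) ?b * W.comb ls' + W.Io (w z1) ls' ?b)"
    have "current_product_limit form (jcur form) u v2 v1 z1 ?X' Q w (?L +o uea_ideal (van Q))"
      using W.product_limit[OF u zQ z1 ls' ms' eqm_vacI[OF eq'(1)] eqm_vacI[OF eq'(2)], of v2]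
      unfolding XY t(2) X' .
    \<comment> \<open>Both sides are the operator of the simple pole normalised at \<open>P\<close>,
      applied to the first current. The representatives \<open>t\<close> and \<open>t'\<close> may
      be exchanged because they agree in the vacuum module.\<close>
    moreover have "eqm ?N (scal ((diff w z1)\<^sup>2) * ?L) V"
      by (rule eqm_trans[OF subsp_vac W.lim_value_resop[OF z1 zQ ls' ms' eqm_vacI[OF eq'(1)] eqm_vacI[OF eq'(2)]]
            eqm_trans[OF subsp_vac resop_eqm[OF assms resop_eqm[OF assms tt]] eqm_sym[OF subsp_vac res]]])
    then have "lmul ?N (scal ((diff w z1)\<^sup>2)) (?L +o uea_ideal (van Q) + ?N) = (V +o ?J) + ?N"
      unfolding coset_plus(3)[OF subsp_vac subsp_0[OF subsp_uea] uea_sub_vac]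
        lmul_scal_coset[OF subsp_vac subsp_vac order.refl] by (rule coset_eqI[OF subsp_vac])
    ultimately show ?thesis by blast
  qed
  have "iota_deriv form P u z1 ?b X D"
    unfolding D_def t(2) by (rule iota_deriv_Dio[OF z1 ls t(1) eq(1)])
  moreover have "lmul ?J (scal ((diff u z1)\<^sup>2)) (lim_value (u z1) ls ms v2 v1 +o ?J) = V +o ?J"
    unfolding V_def by (rule uea_lmul) simp
  ultimately show "\<exists>D. iota_deriv form P u z1 ?b X D \<and>
         (let N = vac_ideal UNIV;
              X' = X + vac_ideal (reg z1);
              rhs = limit_formula form P u v2 v1 z1 X D
          in (\<exists>L. current_product_limit form (jcur form) u v2 v1 z1 X' P u L \<and>
                lmul (uea_ideal (van P)) (scal ((diff u z1)\<^sup>2)) L = rhs) \<and>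
             (\<forall>Q w. \<forall>Y \<in> UEA (van Q \<inter> reg z1).
                Q \<noteq> z1 \<and> coordinate Q w \<and> Y + vac_ideal (reg z1) = X' \<longrightarrow>
                (\<exists>L. current_product_limit form (jcur form) u v2 v1 z1 X' Q w L \<and>
                   lmul N (scal ((diff w z1)\<^sup>2)) (L + N) = rhs + N)))"
    unfolding Let_def using lim indep unfolding rhs[symmetric] by blast
qed

end
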